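(* Let $T$ be a Calderón–Zygmund operator in $\mathbb{R}^d$ with parameter $\alpha$. Then $T$ can be represented as \[ T=C\int_\Omega\ \sum_{m,n\in\mathbb{Z}_+}2^{-(m+n)\alpha/2}\,\mathbb{S}^\omega_{m,n}\,d\mathbf{P}(\omega), \] where, for each $\omega\in\Omega$ and $m,n\in\mathbb{Z}_+=\{0,1,2,\dots\}$, $\mathbb{S}^\omega_{m,n}$ is a dyadic shift with parameters $m,n$ in the lattice $\mathcal{D}_\omega$; the shifts with parameters $(0,1)$ and $(1,0)$ can be generalized dyadic shifts, and all other shifts are regular (non-generalized) ones. The constant $C$ depends only on the dimension $d$ and the parameters of $T$ (the norm $\|T\|_{L^2\to L^2}$, the smoothness $\alpha$, and the constant $C_{\mathrm{cz}}$ in the Calderón–Zygmund estimates).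
   Context: The representation is understood in the weak sense, as an equality of bilinear forms $\langle Tf,g\rangle$ for $f,g\in C_0^\infty(\mathbb{R}^d)$. A Calderón–Zygmund operator in $\mathbb{R}^d$ (with parameters $C_{\mathrm{cz}}$, $\alpha>0$) is an integral operator bounded in $L^2(\mathbb{R}^d)$ with kernel $K$ satisfying $|K(x,y)|\le C_{\mathrm{cz}}|x-y|^{-d}$ for $x\neq y$, and $|K(x,y)-K(x',y)|+|K(y,x)-K(y,x')|\le C_{\mathrm{cz}}|x-x'|^\alpha|x-y|^{-d-\alpha}$ whenever $|x-x'|<|x-y|/2$. Random lattices: $\mathcal{D}^0=\bigcup_k\mathcal{D}^0_k$, $\mathcal{D}^0_k=\{2^k([0,1)^d+m):m\in\mathbb{Z}^d\}$. $\Omega=(\{0,1\}^d)^{\mathbb{Z}}$ with $\mathbf{P}$ the product of uniform probability measures on $\{0,1\}^d$. For $I\in\mathcal{D}^0_k$, $I\dot+\omega=I+\sum_{j<k}\omega_j2^j$, and $\mathcal{D}_\omega=\{I\dot+\omega:I\in\mathcal{D}^0\}$. Given a dyadic lattice $\mathcal{D}$, a generalized Haar function for $Q\in\mathcal{D}$ is a function supported on $Q$ and constant on each of the $2^d$ dyadic children of $Q$; a Haar function for $Q$ is a generalized Haar function with integral zero. An elementary (generalized) dyadic shift with parameters $m,n\in\mathbb{Z}_+$ is an operator \[ \mathbb{S}f=\sum_{Q\in\mathcal{D}}\ \sum_{\substack{Q',Q''\in\mathcal{D},\ Q',Q''\subset Q\\ \ell(Q')=2^{-m}\ell(Q),\ \ell(Q'')=2^{-n}\ell(Q)}}|Q|^{-1}(f,h_{Q'}^{Q''})\,h_{Q''}^{Q'},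 \] where $h_{Q'}^{Q''}$, $h_{Q''}^{Q'}$ are (generalized) Haar functions for $Q'$, $Q''$ respectively with $\|h_{Q'}^{Q''}\|_\infty\|h_{Q''}^{Q'}\|_\infty\le1$. A dyadic shift with parameters $m,n$ is a sum of at most $(2^d)^2$ elementary dyadic shifts with parameters $m,n$; it is a generalized dyadic shift if some or all of these elementary shifts are allowed to be generalized. *)

theory Defs
  imports "HOL-Probability.Probability"
begin

section \<open>Square-integrable functions and test functions\<close>

text \<open>
  Elements of $L^2(\mathbb{R}^d)$ are represented by Borel functions \<open>real^'n \<Rightarrow> complex\<close>, with
  \<open>d = CARD('n)\<close>; an operator on $L^2$ is a map between such functions of which only the values on
  square-integrable functions, up to equality almost everywhere, are relevant.
\<close>

type_synonym 'n fn = "real^'n \<Rightarrow> complex"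
type_synonym 'n oper = "'n fn \<Rightarrow> 'n fn"

definition square_integrable :: "('n::finite) fn \<Rightarrow> bool" where
  "square_integrable f \<longleftrightarrow>
     f \<in> borel_measurable lborel \<and> integrable lborel (\<lambda>x. (cmod (f x))\<^sup>2)"

definition L2_norm :: "('n::finite) fn \<Rightarrow> real" where
  "L2_norm f = sqrt (LINT x|lborel. (cmod (f x))\<^sup>2)"

definition pairing :: "('n::finite) fn \<Rightarrow> 'n fn \<Rightarrow> complex" where
  "pairing f g = (LINT x|lborel. f x * g x)"

definition L2_bounded_operator :: "('n::finite) oper \<Rightarrow> bool" where
  "L2_bounded_operator T \<longleftrightarrow>
     (\<forall>f. square_integrable f \<longrightarrow> square_integrable (T f)) \<and>
     (\<forall>f g. square_integrable f \<longrightarrow> square_integrable g \<longrightarrow>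
        (AE x in lborel. T (\<lambda>y. f y + g y) x = T f x + T g x)) \<and>
     (\<forall>c f. square_integrable f \<longrightarrow>
        (AE x in lborel. T (\<lambda>y. c * f y) x = c * T f x)) \<and>
     (\<exists>B. \<forall>f. square_integrable f \<longrightarrow> L2_norm (T f) \<le> B * L2_norm f)"

definition L2_opnorm :: "('n::finite) oper \<Rightarrow> real" where
  "L2_opnorm T = (SUP f\<in>{f. square_integrable f \<and> L2_norm f \<le> 1}. L2_norm (T f))"

definition supp :: "('n::finite) fn \<Rightarrow> (real^'n) set" where
  "supp f = closure {x. f x \<noteq> 0}"

primrec times_cont_diff :: "nat \<Rightarrow> ('n::finite) fn \<Rightarrow> bool" where
  "times_cont_diff 0 f \<longleftrightarrow> continuous_on UNIV f"
| "times_cont_diff (Suc k) f \<longleftrightarrow>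
     f differentiable_on UNIV \<and>
     (\<forall>v. times_cont_diff k (\<lambda>x. frechet_derivative f (at x) v))"

definition test_function :: "('n::finite) fn \<Rightarrow> bool" where
  "test_function f \<longleftrightarrow> (\<forall>k. times_cont_diff k f) \<and> compact (supp f)"


section \<open>Calderon-Zygmund operators\<close>

definition cz_kernel :: "real \<Rightarrow> real \<Rightarrow> (real^'n \<Rightarrow> real^'n \<Rightarrow> complex) \<Rightarrow> bool" where
  "cz_kernel Ccz \<alpha> K \<longleftrightarrow>
     (\<forall>x y. x \<noteq> y \<longrightarrow> cmod (K x y) \<le> Ccz * norm (x - y) powr (- real CARD('n))) \<and>
     (\<forall>x x' y. norm (x - x') < norm (x - y) / 2 \<longrightarrow>
        cmod (K x y - K x' y) + cmod (K y x - K y x')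
          \<le> Ccz * norm (x - x') powr \<alpha> * norm (x - y) powr (- real CARD('n) - \<alpha>))"

text \<open>
  That \<open>T\<close> is an integral operator with the (singular) kernel \<open>K\<close> means, as usual, that \<open>T f\<close> is
  given by the integral off the support of \<open>f\<close>. Values of \<open>K\<close> on the diagonal are irrelevant.
\<close>

definition has_kernel :: "('n::finite) oper \<Rightarrow> (real^'n \<Rightarrow> real^'n \<Rightarrow> complex) \<Rightarrow> bool" where
  "has_kernel T K \<longleftrightarrow>
     (\<forall>f. square_integrable f \<longrightarrow> compact (supp f) \<longrightarrow>
        (AE x in lborel. x \<notin> supp f \<longrightarrow> T f x = (LINT y|lborel. K x y * f y)))"

definition cz_operator :: "real \<Rightarrow> real \<Rightarrow> ('n::finite) oper \<Rightarrow> bool" where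
  "cz_operator Ccz \<alpha> T \<longleftrightarrow>
     \<alpha> > 0 \<and> L2_bounded_operator T \<and> (\<exists>K. cz_kernel Ccz \<alpha> K \<and> has_kernel T K)"


section \<open>Random dyadic lattices\<close>

text \<open>
  A lattice is given by its generations: \<open>D k\<close> is the set of its cubes of side length $2^k$.
\<close>

type_synonym 'n lattice = "int \<Rightarrow> (real^'n) set set"

definition std_lattice :: "('n::finite) lattice" where
  "std_lattice k =
     {(\<lambda>x. (2 powi k) *\<^sub>R (x + m)) ` {x. \<forall>i. 0 \<le> x $ i \<and> x $ i < 1} | m. \<forall>i. m $ i \<in> \<int>}"

definition zero_one_vectors :: "(real^'n::finite) set" where
  "zero_one_vectors = {v. \<forall>i. v $ i \<in> {0, 1}}"

definition omega_measure :: "(int \<Rightarrow> real^'n::finite) measure" where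
  "omega_measure = PiM UNIV (\<lambda>j. uniform_count_measure zero_one_vectors)"

definition shifted_lattice :: "(int \<Rightarrow> real^'n) \<Rightarrow> ('n::finite) lattice" where
  "shifted_lattice \<omega> k =
     (\<lambda>I. (\<lambda>x. x + (\<Sum>\<^sub>\<infinity>j\<in>{..<k}. (2 powi j) *\<^sub>R \<omega> j)) ` I) ` std_lattice k"


section \<open>Haar functions and dyadic shifts\<close>

definition children :: "('n::finite) lattice \<Rightarrow> (real^'n) set \<Rightarrow> (real^'n) set set" where
  "children D Q = {R. \<exists>k. Q \<in> D k \<and> R \<in> D (k - 1) \<and> R \<subseteq> Q}"

definition generalized_haar :: "('n::finite) lattice \<Rightarrow> (real^'n) set \<Rightarrow> 'n fn \<Rightarrow> bool" where
  "generalized_haar D Q h \<longleftrightarrow>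
     (\<forall>x. x \<notin> Q \<longrightarrow> h x = 0) \<and> (\<forall>R\<in>children D Q. h constant_on R)"

definition haar :: "('n::finite) lattice \<Rightarrow> (real^'n) set \<Rightarrow> 'n fn \<Rightarrow> bool" where
  "haar D Q h \<longleftrightarrow> generalized_haar D Q h \<and> (LINT x|lborel. h x) = 0"

definition sup_norm :: "('n::finite) fn \<Rightarrow> real" where
  "sup_norm h = (SUP x. cmod (h x))"

definition shift_triples ::
  "('n::finite) lattice \<Rightarrow> nat \<Rightarrow> nat \<Rightarrow> ((real^'n) set \<times> (real^'n) set \<times> (real^'n) set) set" where
  "shift_triples D m n =
     {(Q, Q', Q''). Q' \<subseteq> Q \<and> Q'' \<subseteq> Q \<and>
        (\<exists>k. Q \<in> D k \<and> Q' \<in> D (k - int m) \<and> Q'' \<in> D (k - int n))}"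

text \<open>
  The families \<open>u Q' Q''\<close> and \<open>v Q' Q''\<close> stand for $h_{Q'}^{Q''}$ and $h_{Q''}^{Q'}$. They are two
  separate families: for $m = n$ the notation must not be read as forcing, say,
  $h_{Q'}^{Q''} = h_{Q''}^{Q'}$ when $Q' = Q''$. The series defining
  \<open>S f\<close> is required to converge unconditionally in $L^2$ for every $f \in L^2$; this is automatic
  for Haar functions, but not for generalized ones. The flag \<open>gen\<close> says whether generalized Haar functions are allowed.
\<close>

definition elementary_shift ::
  "bool \<Rightarrow> ('n::finite) lattice \<Rightarrow> nat \<Rightarrow> nat \<Rightarrow> 'n oper \<Rightarrow> bool" where
  "elementary_shift gen D m n S \<longleftrightarrow>
     (\<exists>u v :: (real^'n) set \<Rightarrow> (real^'n) set \<Rightarrow> 'n fn.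
        (\<forall>(Q, Q', Q'')\<in>shift_triples D m n.
           (if gen then generalized_haar D Q' (u Q' Q'') \<and> generalized_haar D Q'' (v Q' Q'')
            else haar D Q' (u Q' Q'') \<and> haar D Q'' (v Q' Q'')) \<and>
           sup_norm (u Q' Q'') * sup_norm (v Q' Q'') \<le> 1) \<and>
        (\<forall>f. square_integrable f \<longrightarrow>
           square_integrable (S f) \<and>
           ((\<lambda>F. L2_norm (\<lambda>x. S f x -
               (\<Sum>(Q, Q', Q'')\<in>F.
                  complex_of_real (1 / measure lborel Q) * pairing f (u Q' Q'') * v Q' Q'' x)))
             \<longlongrightarrow> 0) (finite_subsets_at_top (shift_triples D m n))))"

definition dyadic_shift ::
  "bool \<Rightarrow> ('n::finite) lattice \<Rightarrow> nat \<Rightarrow> nat \<Rightarrow> 'n oper \<Rightarrow> bool" where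
  "dyadic_shift gen D m n S \<longleftrightarrow>
     (\<exists>(N::nat) (E :: nat \<Rightarrow> 'n oper). N \<le> (2 ^ CARD('n))\<^sup>2 \<and>
        (\<forall>i<N. elementary_shift gen D m n (E i)) \<and>
        (\<forall>f. square_integrable f \<longrightarrow>
           square_integrable (S f) \<and> (AE x in lborel. S f x = (\<Sum>i<N. E i f x))))"

definition shift_series_term ::
  "real \<Rightarrow> (nat \<Rightarrow> nat \<Rightarrow> ('n::finite) oper) \<Rightarrow> 'n fn \<Rightarrow> 'n fn \<Rightarrow> nat \<times> nat \<Rightarrow> complex" where
  "shift_series_term \<alpha> S f g =
     (\<lambda>(m, n). complex_of_real (2 powr (- (real (m + n) * \<alpha> / 2))) * pairing (S m n f) g)"

end

theory Submission
  imports Defs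
begin

text \<open>
  Let $E_k$ be the averaging operator over the cubes of side $2^k$ of the random lattice and
  $D_k = E_{k-1} - E_k$. The form $B(f,g) = (Tf,g)$ is the telescoping sum over $k$ of
  $B(E_{k-1}f, E_{k-1}g) - B(E_kf, E_kg) = B(E_kf, D_kg) + B(D_kf, E_kg) + B(D_kf, D_kg)$,
  and each of the three terms is a sum over pairs of cubes $I, J$ of generation $k$. Instead of
  discarding bad cubes, a pair at distance about $2^{k+r}$ is multiplied by a weight which depends
  on the lattice only through its digit $k+r-1$ and its cubes of lower generations, has
  conditional expectation $1$ given the digits below $k+r-1$, and vanishes unless $I$ and $J$ have
  the same ancestor of generation $k+r$. The weights do not change the expectation.

  In $B(E_kf, D_kg) = \sum_J \sum_I F_I B(1_I, D_Jg)$, with $F_I$ the average of $f$ over $I$, write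
  $F_I = (F_I - F_J) + F_J$. In the weighted first part $F_I - F_J$ telescopes along the chains of
  ancestors of $I$ and of $J$, which meet; this yields shifts of complexity $(m,n)$, $m < n$, with
  coefficients of size $2^{-n\alpha}$ by the kernel estimates. The second part is a paraproduct with
  $T1$, a generalized shift of complexity $(0,1)$, which is bounded by the Carleson embedding
  theorem. The term $B(D_kf, E_kg)$ is treated in the same way with $B$ transposed, and
  $B(D_kf, D_kg)$ gives the shifts with $m = n$.

  All series converge because a family of vectors $x_t$ with $\sum_t |(x_t, g)| \le A \|g\|$ is
  unconditionally summable in $L^2$.
\<close>

text \<open>The cubes of generation k and their children see only the digits below k. The digits are
  independent, so a factor that tests a higher digit can be inserted under the expectation. After
  the volumes are balanced, the kernel decay leaves \<open>2 powr (- \<alpha> * max m n)\<close>,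
  and since \<open>max m n\<close> is at least \<open>(m + n) / 2\<close>, this gives the exponent
  \<alpha>/2 of the statement. Only differences of averages are weighted; the paraproduct needs the
  unweighted sum over all I to produce T1. Hence the decomposition holds at each scale only in
  expectation, and the sums over scales, over complexities and over lattices have to be
  interchanged; bounds that are uniform in the lattice and geometric in \<open>max m n\<close> allow
  this. The shifts are picked by choice, lattice by lattice, and need not depend measurably on the
  lattice: what is integrated is a scalar series that equals an explicit measurable one. The centred
  indicators of children replace a Haar basis, so that all pairings are continuous in the corners of
  cubes and no basis has to be fixed.\<close>

section \<open>Square-integrable functions: the bilinear pairing, completeness and unconditional
  convergence\<close>

lemma square_integrableD:
  assumes "square_integrable f"
  shows "f \<in> borel_measurable borel" "integrable lborel (\<lambda>x. (cmod (f x))\<^sup>2)"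
  using assms by (auto simp: square_integrable_def)

lemma integrable_pairing:
  assumes "square_integrable f" "square_integrable g"
  shows "integrable lborel (\<lambda>x. f x * g x)" "integrable lborel (\<lambda>x. cmod (f x) * cmod (g x))"
proof -
  note [measurable] = square_integrableD(1)[OF assms(1)] square_integrableD(1)[OF assms(2)]
  have *: "integrable lborel (\<lambda>x. (cmod (f x))\<^sup>2 + (cmod (g x))\<^sup>2)"
    using assms by (auto simp: square_integrable_def)
  have le: "a * b \<le> a\<^sup>2 + b\<^sup>2" for a b :: real
  proof -
    have "0 \<le> a\<^sup>2 + b\<^sup>2" "2 * (a * b) \<le> a\<^sup>2 + b\<^sup>2"
      using sum_squares_bound[of a b] by auto
    thus ?thesis by linarith
  qed
  show "integrable lborel (\<lambda>x. f x * g x)"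
    by (rule Bochner_Integration.integrable_bound[OF *]) (auto simp: norm_mult le)
  show "integrable lborel (\<lambda>x. cmod (f x) * cmod (g x))"
    by (rule Bochner_Integration.integrable_bound[OF *]) (auto simp: abs_mult le)
qed

lemma square_integrable_add:
  assumes "square_integrable f" "square_integrable g"
  shows "square_integrable (\<lambda>x. f x + g x)"
proof -
  note [measurable] = square_integrableD(1)[OF assms(1)] square_integrableD(1)[OF assms(2)]
  have *: "integrable lborel (\<lambda>x. 2 * ((cmod (f x))\<^sup>2 + (cmod (g x))\<^sup>2))"
    using assms by (auto simp: square_integrable_def)
  have le: "(cmod (a + b))\<^sup>2 \<le> 2 * ((cmod a)\<^sup>2 + (cmod b)\<^sup>2)" for a b :: complex
  proof -
    have "(cmod (a + b))\<^sup>2 \<le> (cmod a + cmod b)\<^sup>2"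
      by (intro power_mono norm_triangle_ineq) auto
    thus ?thesis using sum_squares_bound[of "cmod a" "cmod b"] by (simp add: power2_sum)
  qed
  have "integrable lborel (\<lambda>x. (cmod (f x + g x))\<^sup>2)"
    using le by (intro Bochner_Integration.integrable_bound[OF *]) (auto simp del: distrib_left_numeral)
  thus ?thesis by (auto simp: square_integrable_def)
qed

lemma square_integrable_scale:
  assumes "square_integrable f"
  shows "square_integrable (\<lambda>x. c * f x)"
  using assms by (auto simp: square_integrable_def norm_mult power_mult_distrib)

lemma square_integrable_zero [simp]: "square_integrable (\<lambda>x. 0)"
  by (auto simp: square_integrable_def)

lemma square_integrable_diff:
  assumes "square_integrable f" "square_integrable g"
  shows "square_integrable (\<lambda>x. f x - g x)"
  using square_integrable_add[OF assms(1) square_integrable_scale[OF assms(2), of "-1"]] by simp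

lemma square_integrable_cnj:
  assumes "square_integrable f" shows "square_integrable (\<lambda>x. cnj (f x))"
proof -
  have "continuous_on UNIV cnj" by (intro continuous_intros)
  hence "(\<lambda>x. cnj (f x)) \<in> borel_measurable borel"
    using borel_measurable_continuous_on square_integrableD(1)[OF assms] by blast
  thus ?thesis using assms by (auto simp: square_integrable_def)
qed

lemma square_integrable_sum:
  assumes "\<And>t. t \<in> F \<Longrightarrow> square_integrable (X t)"
  shows "square_integrable (\<lambda>x. \<Sum>t\<in>F. X t x)"
  using assms by (induction F rule: infinite_finite_induct) (auto intro: square_integrable_add)

lemma L2_norm_nonneg [simp]: "L2_norm f \<ge> 0"
  by (simp add: L2_norm_def)

lemma L2_norm_power2: "(L2_norm f)\<^sup>2 = (LINT x|lborel. (cmod (f x))\<^sup>2)"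
  by (simp add: L2_norm_def)

lemma L2_norm_zero [simp]: "L2_norm (\<lambda>x. 0) = 0"
  by (simp add: L2_norm_def)

text \<open>The integral of the square of \<open>t * u - v\<close> is a nonnegative quadratic in
  \<open>t\<close>; its minimum at \<open>W / U\<close> gives the claim, and if \<open>U = 0\<close>
  the quadratic is affine and forces \<open>W = 0\<close>.\<close>

lemma Cauchy_Schwarz_integral:
  fixes u v :: "'a \<Rightarrow> real"
  assumes u: "integrable M (\<lambda>x. (u x)\<^sup>2)" and v: "integrable M (\<lambda>x. (v x)\<^sup>2)"
    and uv: "integrable M (\<lambda>x. u x * v x)"
  shows "(LINT x|M. u x * v x) \<le> sqrt (LINT x|M. (u x)\<^sup>2) * sqrt (LINT x|M. (v x)\<^sup>2)"
proof -
  define U V W where "U = (LINT x|M. (u x)\<^sup>2)" and "V = (LINT x|M. (v x)\<^sup>2)"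
    and "W = (LINT x|M. u x * v x)"
  have UV: "U \<ge> 0" "V \<ge> 0" by (auto simp: U_def V_def)
  have quad: "0 \<le> t\<^sup>2 * U - 2 * t * W + V" for t
  proof -
    have "0 \<le> (LINT x|M. (t * u x - v x)\<^sup>2)" by simp
    also have "\<dots> = (LINT x|M. t\<^sup>2 * (u x)\<^sup>2 - 2 * t * (u x * v x) + (v x)\<^sup>2)"
      by (intro Bochner_Integration.integral_cong) (auto simp: power2_eq_square algebra_simps)
    also have "\<dots> = t\<^sup>2 * U - 2 * t * W + V"
      using u v uv by (simp add: U_def V_def W_def)
    finally show ?thesis .
  qed
  have "W\<^sup>2 \<le> U * V"
  proof (cases "U = 0")
    case True
    have "W = 0"
    proof (rule ccontr)
      assume "W \<noteq> 0"
      \<comment> \<open>The argument \<open>(V + 1) / (2 * W)\<close> is chosen so that the affine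
        function takes the value -1.\<close>
      have "0 \<le> - 2 * ((V + 1) / (2 * W)) * W + V"
        using quad[of "(V+1)/(2*W)"] unfolding True by (simp only: mult_zero_right minus_mult_left[symmetric] diff_conv_add_uminus add_0)
      moreover have "- 2 * ((V + 1) / (2 * W)) * W = - V - 1" using \<open>W \<noteq> 0\<close> by (simp add: field_simps)
      ultimately show False by linarith
    qed
    thus ?thesis using UV by simp
  next
    case False
    hence "U > 0" using UV by simp
    have "0 \<le> (W/U)\<^sup>2 * U - 2 * (W/U) * W + V" by (rule quad)
    also have "\<dots> = V - W\<^sup>2 / U" using False by (simp add: power2_eq_square field_simps)
    finally show ?thesis using \<open>U > 0\<close> by (simp add: field_simps)
  qed
  hence "\<bar>W\<bar> \<le> sqrt (U * V)" by (metis real_sqrt_abs real_sqrt_le_iff)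
  thus ?thesis unfolding U_def V_def W_def by (simp add: real_sqrt_mult)
qed

lemma pairing_abs_bound:
  assumes "square_integrable f" "square_integrable g"
  shows "(LINT x|lborel. cmod (f x) * cmod (g x)) \<le> L2_norm f * L2_norm g"
  unfolding L2_norm_def
  by (rule Cauchy_Schwarz_integral)
     (use assms integrable_pairing in \<open>auto simp: square_integrable_def\<close>)

lemma pairing_bound:
  assumes "square_integrable f" "square_integrable g"
  shows "cmod (pairing f g) \<le> L2_norm f * L2_norm g"
proof -
  have "cmod (pairing f g) \<le> (LINT x|lborel. cmod (f x * g x))"
    unfolding pairing_def by (rule integral_norm_bound)
  also have "\<dots> \<le> L2_norm f * L2_norm g"
    using pairing_abs_bound[OF assms] by (simp add: norm_mult)
  finally show ?thesis .
qed

lemma pairing_commute: "pairing f g = pairing g f"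
  by (simp add: pairing_def mult.commute)

lemma pairing_add_left:
  assumes "square_integrable f" "square_integrable f'" "square_integrable g"
  shows "pairing (\<lambda>x. f x + f' x) g = pairing f g + pairing f' g"
  unfolding pairing_def distrib_right
  by (intro Bochner_Integration.integral_add integrable_pairing assms)

lemma pairing_diff_left:
  assumes "square_integrable f" "square_integrable f'" "square_integrable g"
  shows "pairing (\<lambda>x. f x - f' x) g = pairing f g - pairing f' g"
  unfolding pairing_def left_diff_distrib
  by (intro Bochner_Integration.integral_diff integrable_pairing assms)

lemma pairing_scale_left: "pairing (\<lambda>x. c * f x) g = c * pairing f g"
  unfolding pairing_def by (simp add: mult.assoc)

lemma pairing_zero_left [simp]: "pairing (\<lambda>x. 0) g = 0"
  by (simp add: pairing_def)

lemma pairing_sum_left: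
  assumes "\<And>t. t \<in> F \<Longrightarrow> square_integrable (X t)" "square_integrable g"
  shows "pairing (\<lambda>x. \<Sum>t\<in>F. X t x) g = (\<Sum>t\<in>F. pairing (X t) g)"
  using assms
  by (induction F rule: infinite_finite_induct)
     (auto simp: pairing_add_left square_integrable_sum)

lemma pairing_add_right:
  assumes "square_integrable f" "square_integrable g" "square_integrable g'"
  shows "pairing f (\<lambda>x. g x + g' x) = pairing f g + pairing f g'"
  using pairing_add_left[OF assms(2,3,1)] by (simp add: pairing_commute)

lemma pairing_diff_right:
  assumes "square_integrable f" "square_integrable g" "square_integrable g'"
  shows "pairing f (\<lambda>x. g x - g' x) = pairing f g - pairing f g'"
  using pairing_diff_left[OF assms(2,3,1)] by (simp add: pairing_commute)

lemma pairing_scale_right: "pairing f (\<lambda>x. c * g x) = c * pairing f g"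
  using pairing_scale_left[of c g f] by (simp add: pairing_commute)

lemma pairing_sum_right:
  assumes "\<And>t. t \<in> F \<Longrightarrow> square_integrable (X t)" "square_integrable g"
  shows "pairing g (\<lambda>x. \<Sum>t\<in>F. X t x) = (\<Sum>t\<in>F. pairing g (X t))"
  using pairing_sum_left[OF assms] by (simp add: pairing_commute)

lemma L2_norm_cnj [simp]: "L2_norm (\<lambda>x. cnj (f x)) = L2_norm f"
  by (simp add: L2_norm_def)

lemma L2_norm_scale: "L2_norm (\<lambda>x. c * f x) = cmod c * L2_norm f"
  by (simp add: L2_norm_def norm_mult power_mult_distrib real_sqrt_mult)

lemma pairing_cnj_self: "pairing f (\<lambda>x. cnj (f x)) = complex_of_real ((L2_norm f)\<^sup>2)"
  unfolding pairing_def L2_norm_power2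
  by (subst integral_complex_of_real[symmetric]) (simp add: complex_norm_square[symmetric] of_real_power[symmetric] del: of_real_power)

lemma L2_norm_triangle:
  assumes f: "square_integrable f" and g: "square_integrable g"
  shows "L2_norm (\<lambda>x. f x + g x) \<le> L2_norm f + L2_norm g"
proof -
  note [measurable] = square_integrableD(1)[OF f] square_integrableD(1)[OF g]
  have i: "integrable lborel (\<lambda>x. (cmod (f x))\<^sup>2)" "integrable lborel (\<lambda>x. (cmod (g x))\<^sup>2)"
      "integrable lborel (\<lambda>x. cmod (f x) * cmod (g x))"
      "integrable lborel (\<lambda>x. (cmod (f x + g x))\<^sup>2)"
    using f g square_integrable_add[OF f g] integrable_pairing[OF f g]
    by (auto simp: square_integrable_def)
  have "(L2_norm (\<lambda>x. f x + g x))\<^sup>2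
      \<le> (LINT x|lborel. (cmod (f x))\<^sup>2 + 2 * (cmod (f x) * cmod (g x)) + (cmod (g x))\<^sup>2)"
    unfolding L2_norm_power2
  proof (rule integral_mono)
    fix x
    have "(cmod (f x + g x))\<^sup>2 \<le> (cmod (f x) + cmod (g x))\<^sup>2"
      by (intro power_mono norm_triangle_ineq) auto
    thus "(cmod (f x + g x))\<^sup>2 \<le> (cmod (f x))\<^sup>2 + 2 * (cmod (f x) * cmod (g x)) + (cmod (g x))\<^sup>2"
      by (simp add: power2_sum)
  qed (use i in auto)
  also have "\<dots> = (L2_norm f)\<^sup>2 + 2 * (LINT x|lborel. cmod (f x) * cmod (g x)) + (L2_norm g)\<^sup>2"
    using i by (simp add: L2_norm_power2)
  also have "\<dots> \<le> (L2_norm f + L2_norm g)\<^sup>2"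
    using pairing_abs_bound[OF f g] by (simp add: power2_sum)
  finally show ?thesis by (rule power2_le_imp_le) simp
qed

lemma L2_norm_minus_commute: "L2_norm (\<lambda>x. f x - g x) = L2_norm (\<lambda>x. g x - f x)"
  by (simp add: L2_norm_def norm_minus_commute)

lemma L2_norm_triangle_diff:
  assumes "square_integrable f" "square_integrable g" "square_integrable h"
  shows "L2_norm (\<lambda>x. f x - h x) \<le> L2_norm (\<lambda>x. f x - g x) + L2_norm (\<lambda>x. g x - h x)"
  using L2_norm_triangle[of "\<lambda>x. f x - g x" "\<lambda>x. g x - h x"] assms
  by (simp add: square_integrable_diff)

lemma L2_norm_parallelogram:
  assumes f: "square_integrable f" and g: "square_integrable g"
  shows "(L2_norm (\<lambda>x. f x + g x))\<^sup>2 + (L2_norm (\<lambda>x. f x - g x))\<^sup>2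
           = 2 * (L2_norm f)\<^sup>2 + 2 * (L2_norm g)\<^sup>2"
proof -
  have i: "integrable lborel (\<lambda>x. (cmod (f x))\<^sup>2)" "integrable lborel (\<lambda>x. (cmod (g x))\<^sup>2)"
      "integrable lborel (\<lambda>x. (cmod (f x + g x))\<^sup>2)" "integrable lborel (\<lambda>x. (cmod (f x - g x))\<^sup>2)"
    using f g square_integrable_add[OF f g] square_integrable_diff[OF f g]
    by (auto simp: square_integrable_def)
  have eq: "(cmod (a + b))\<^sup>2 + (cmod (a - b))\<^sup>2 = 2 * (cmod a)\<^sup>2 + 2 * (cmod b)\<^sup>2" for a b
    unfolding cmod_power2 by (simp add: power2_eq_square algebra_simps)
  have "(L2_norm (\<lambda>x. f x + g x))\<^sup>2 + (L2_norm (\<lambda>x. f x - g x))\<^sup>2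
     = (LINT x|lborel. (cmod (f x + g x))\<^sup>2 + (cmod (f x - g x))\<^sup>2)"
    using i by (simp add: L2_norm_power2)
  also have "\<dots> = (LINT x|lborel. 2 * (cmod (f x))\<^sup>2 + 2 * (cmod (g x))\<^sup>2)"
    by (simp add: eq)
  also have "\<dots> = 2 * (L2_norm f)\<^sup>2 + 2 * (L2_norm g)\<^sup>2"
    using i by (simp add: L2_norm_power2)
  finally show ?thesis .
qed

text \<open>Riesz-Fischer for functions instead of classes. The sums of the absolute increments have
  bounded norm, so monotone convergence makes the series finite almost everywhere, and Fatou's lemma
  carries the rate over to the limit. \<open>lim\<close> yields a Borel function that is defined
  also at the points of divergence.\<close>

lemma L2_complete:
  fixes h :: "nat \<Rightarrow> ('n::finite) fn"
  assumes h: "\<And>n. square_integrable (h n)"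
    and close: "\<And>n. L2_norm (\<lambda>x. h (Suc n) x - h n x) \<le> (1/2)^n"
  obtains s where "square_integrable s" "\<And>n. L2_norm (\<lambda>x. s x - h n x) \<le> 2 * (1/2)^n"
proof -
  note [measurable] = square_integrableD(1)[OF h]
  \<comment> \<open>The subtracted term makes the geometric bound exact, so that the induction
    closes; it is dropped afterwards.\<close>
  have far: "L2_norm (\<lambda>x. h (n + m) x - h n x) \<le> 2 * (1/2)^n - 2 * (1/2)^(n+m)" for n m
  proof (induction m)
    case (Suc m)
    have "L2_norm (\<lambda>x. h (n + Suc m) x - h n x)
        \<le> L2_norm (\<lambda>x. h (Suc (n + m)) x - h (n+m) x) + L2_norm (\<lambda>x. h (n+m) x - h n x)"
      using L2_norm_triangle_diff[OF h h h] by simp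
    also have "\<dots> \<le> (1/2)^(n+m) + (2 * (1/2)^n - 2 * (1/2)^(n+m))"
      using close[of "n+m"] Suc by simp
    finally show ?case by simp
  qed simp
  define G where "G N x = (\<Sum>n<N. cmod (h (Suc n) x - h n x))" for N x
  have [measurable]: "G N \<in> borel_measurable borel" for N unfolding G_def by measurable
  have Gsq: "square_integrable (\<lambda>x. complex_of_real (G N x)) \<and>
      L2_norm (\<lambda>x. complex_of_real (G N x)) \<le> 2" for N
  proof -
    have d: "square_integrable (\<lambda>x. complex_of_real (cmod (h (Suc n) x - h n x)))" for n
      using square_integrable_diff[OF h[of "Suc n"] h[of n]] by (auto simp: square_integrable_def)
    have dn: "L2_norm (\<lambda>x. complex_of_real (cmod (h (Suc n) x - h n x))) \<le> (1/2)^n" for n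
      using close[of n] by (simp add: L2_norm_def)
    have "square_integrable (\<lambda>x. complex_of_real (G N x)) \<and>
      L2_norm (\<lambda>x. complex_of_real (G N x)) \<le> 2 - 2 * (1/2)^N"
    proof (induction N)
      case 0 thus ?case by (simp add: G_def)
    next
      case (Suc N)
      have eq: "(\<lambda>x. complex_of_real (G (Suc N) x))
          = (\<lambda>x. complex_of_real (G N x) + complex_of_real (cmod (h (Suc N) x - h N x)))"
        by (simp add: G_def)
      have "L2_norm (\<lambda>x. complex_of_real (G (Suc N) x)) \<le> (2 - 2 * (1/2)^N) + (1/2)^N"
        unfolding eq
        by (rule order_trans[OF L2_norm_triangle[OF _ d[of N]] add_mono[OF _ dn[of N]]]) (use Suc in auto)
      thus ?case using square_integrable_add[OF _ d[of N]] Suc unfolding eq by simp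
    qed
    moreover have "2 - 2 * (1/2::real)^N \<le> 2" by simp
    ultimately show ?thesis by (meson order_trans)
  qed
  have fin: "AE x in lborel. (SUP N. ennreal ((G N x)\<^sup>2)) \<noteq> \<infinity>"
  proof -
    have G0: "G N x \<ge> 0" for N x by (simp add: G_def sum_nonneg)
    have "incseq (\<lambda>N x. ennreal ((G N x)\<^sup>2))"
      by (intro monoI le_funI ennreal_leI power_mono G0) (auto simp: G_def intro!: sum_mono2)
    hence "(\<integral>\<^sup>+x. (SUP N. ennreal ((G N x)\<^sup>2)) \<partial>lborel) = (SUP N. (\<integral>\<^sup>+x. ennreal ((G N x)\<^sup>2) \<partial>lborel))"
      by (intro nn_integral_monotone_convergence_SUP) auto
    also have "\<dots> \<le> ennreal 4"
    proof (rule SUP_least)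
      fix N
      have "(\<integral>\<^sup>+x. ennreal ((G N x)\<^sup>2) \<partial>lborel) = ennreal ((L2_norm (\<lambda>x. complex_of_real (G N x)))\<^sup>2)"
        unfolding L2_norm_power2 using Gsq[of N]
        by (subst nn_integral_eq_integral[symmetric]) (auto simp: square_integrable_def)
      also have "\<dots> \<le> ennreal (2\<^sup>2)"
        using Gsq[of N] by (intro ennreal_leI power_mono) auto
      finally show "(\<integral>\<^sup>+x. ennreal ((G N x)\<^sup>2) \<partial>lborel) \<le> ennreal 4" by simp
    qed
    finally have "(\<integral>\<^sup>+x. (SUP N. ennreal ((G N x)\<^sup>2)) \<partial>lborel) \<noteq> \<infinity>"
      by (auto simp: top_unique)
    thus ?thesis by (intro nn_integral_noteq_infinite) auto
  qed
  have conv: "AE x in lborel. (\<lambda>n. h n x) \<longlonglongrightarrow> lim (\<lambda>n. h n x)"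
    using fin
  proof eventually_elim
    case (elim x)
    have "summable (\<lambda>n. cmod (h (Suc n) x - h n x))"
    proof (rule bounded_imp_summable)
      fix N
      define S where "S = (SUP N. ennreal ((G N x)\<^sup>2))"
      have "ennreal ((G (Suc N) x)\<^sup>2) \<le> S" unfolding S_def by (rule SUP_upper) simp
      also have "S = ennreal (enn2real S)" 
        using elim unfolding S_def by (subst ennreal_enn2real) (auto simp only: less_top infinity_ennreal_def)
      finally have "(G (Suc N) x)\<^sup>2 \<le> enn2real S" by (subst (asm) ennreal_le_iff) auto
      hence "G (Suc N) x \<le> sqrt (enn2real (SUP N. ennreal ((G N x)\<^sup>2)))"
        unfolding S_def by (rule real_le_rsqrt)
      thus "(\<Sum>n\<le>N. cmod (h (Suc n) x - h n x)) \<le> sqrt (enn2real (SUP N. ennreal ((G N x)\<^sup>2)))"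
        by (simp add: G_def lessThan_Suc_atMost)
    qed simp
    hence "summable (\<lambda>n. h (Suc n) x - h n x)" by (rule summable_norm_cancel)
    hence "convergent (\<lambda>n. \<Sum>k<n. h (Suc k) x - h k x)" by (simp add: summable_iff_convergent)
    hence "convergent (\<lambda>n. h n x - h 0 x)"
      by (simp only: sum_lessThan_telescope[of "\<lambda>n. h n x"])
    hence "convergent (\<lambda>n. (h n x - h 0 x) + h 0 x)" by (intro convergent_add convergent_const)
    hence "convergent (\<lambda>n. h n x)" by simp
    thus ?case by (simp only: convergent_LIMSEQ_iff)
  qed
  define s where "s x = lim (\<lambda>n. h n x)" for x
  have [measurable]: "s \<in> borel_measurable borel" unfolding s_def by measurable
  have nn: "(\<integral>\<^sup>+x. ennreal ((cmod (s x - h n x))\<^sup>2) \<partial>lborel) \<le> ennreal ((2 * (1/2)^n)\<^sup>2)" for n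
  proof -
    have "(\<integral>\<^sup>+x. ennreal ((cmod (s x - h n x))\<^sup>2) \<partial>lborel)
        = (\<integral>\<^sup>+x. liminf (\<lambda>m. ennreal ((cmod (h (n + m) x - h n x))\<^sup>2)) \<partial>lborel)"
      using conv
    proof (intro nn_integral_cong_AE, eventually_elim)
      case (elim x)
      have "(\<lambda>m. h (n + m) x) \<longlonglongrightarrow> s x"
        using LIMSEQ_ignore_initial_segment[OF elim(2), of n] by (simp add: s_def add.commute)
      hence "(\<lambda>m. ennreal ((cmod (h (n + m) x - h n x))\<^sup>2)) \<longlonglongrightarrow> ennreal ((cmod (s x - h n x))\<^sup>2)"
        by (intro tendsto_intros)
      thus ?case by (intro lim_imp_Liminf[symmetric]) auto
    qed
    also have "\<dots> \<le> liminf (\<lambda>m. \<integral>\<^sup>+x. ennreal ((cmod (h (n + m) x - h n x))\<^sup>2) \<partial>lborel)"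
      by (rule nn_integral_liminf) measurable
    also have "\<dots> \<le> liminf (\<lambda>m. ennreal ((2 * (1/2)^n)\<^sup>2))"
    proof (rule Liminf_mono, rule always_eventually, rule allI)
      fix m
      have "(\<integral>\<^sup>+x. ennreal ((cmod (h (n + m) x - h n x))\<^sup>2) \<partial>lborel)
          = ennreal ((L2_norm (\<lambda>x. h (n+m) x - h n x))\<^sup>2)"
        unfolding L2_norm_power2 using square_integrable_diff[OF h[of "n+m"] h[of n]]
        by (intro nn_integral_eq_integral) (auto simp: square_integrable_def)
      also have "\<dots> \<le> ennreal ((2 * (1/2)^n)\<^sup>2)"
      proof (intro ennreal_leI power_mono)
        have "0 \<le> 2 * (1/2::real)^(n+m)" by simp
        thus "L2_norm (\<lambda>x. h (n+m) x - h n x) \<le> 2 * (1/2)^n"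
          using far[of n m] by linarith
      qed auto
      finally show "(\<integral>\<^sup>+x. ennreal ((cmod (h (n + m) x - h n x))\<^sup>2) \<partial>lborel) \<le> ennreal ((2 * (1/2)^n)\<^sup>2)" .
    qed
    also have "\<dots> = ennreal ((2 * (1/2)^n)\<^sup>2)" by (simp add: Liminf_const)
    finally show ?thesis .
  qed
  have sqd: "square_integrable (\<lambda>x. s x - h n x)" for n
    unfolding square_integrable_def
    using nn[of n] by (auto intro!: integrableI_bounded le_less_trans[OF nn[of n]])
  have "square_integrable (\<lambda>x. (s x - h 0 x) + h 0 x)" by (intro square_integrable_add sqd h)
  hence "square_integrable s" by simp
  moreover have "L2_norm (\<lambda>x. s x - h n x) \<le> 2 * (1/2)^n" for n
  proof -
    have "ennreal ((L2_norm (\<lambda>x. s x - h n x))\<^sup>2) \<le> ennreal ((2 * (1/2)^n)\<^sup>2)"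
      unfolding L2_norm_power2 using nn[of n] sqd[of n]
      by (subst nn_integral_eq_integral[symmetric]) (auto simp: square_integrable_def)
    hence "(L2_norm (\<lambda>x. s x - h n x))\<^sup>2 \<le> (2 * (1/2)^n)\<^sup>2" by (subst (asm) ennreal_le_iff) auto
    thus ?thesis by (rule power2_le_imp_le) auto
  qed
  ultimately show ?thesis using that by blast
qed

text \<open>An orthogonality-free criterion: if the sums diverged, blocks of norm \<open>\<ge> \<epsilon>\<close> could be added with
  signs chosen by the parallelogram law, so that the signed sums would be unbounded in norm.\<close>

lemma L2_unconditional_convergence:
  fixes X :: "'t \<Rightarrow> ('n::finite) fn"
  assumes X: "\<And>t. t \<in> I \<Longrightarrow> square_integrable (X t)"
    and bd: "\<And>F g. finite F \<Longrightarrow> F \<subseteq> I \<Longrightarrow> square_integrable g \<Longrightarrow>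
               (\<Sum>t\<in>F. cmod (pairing (X t) g)) \<le> A * L2_norm g"
  obtains s where "square_integrable s"
    "((\<lambda>F. L2_norm (\<lambda>x. s x - (\<Sum>t\<in>F. X t x))) \<longlongrightarrow> 0) (finite_subsets_at_top I)"
proof -
  have sqF: "square_integrable (\<lambda>x. \<Sum>t\<in>F. c t * X t x)" if "F \<subseteq> I" for F and c :: "'t \<Rightarrow> complex"
    using that X by (intro square_integrable_sum square_integrable_scale) auto
  have sqF1: "square_integrable (\<lambda>x. \<Sum>t\<in>F. X t x)" if "F \<subseteq> I" for F
    using sqF[OF that, of "\<lambda>_. 1"] by simp
  \<comment> \<open>Pairing the signed sum with its own conjugate turns the weak bound into a norm
    bound that does not depend on the unimodular coefficients.\<close>
  have signed: "L2_norm (\<lambda>x. \<Sum>t\<in>F. c t * X t x) \<le> \<bar>A\<bar>"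
    if F: "finite F" "F \<subseteq> I" and c: "\<And>t. cmod (c t) = 1" for F and c :: "'t \<Rightarrow> complex"
  proof -
    define h where "h = (\<lambda>x. \<Sum>t\<in>F. c t * X t x)"
    have hsq: "square_integrable h" unfolding h_def by (rule sqF[OF F(2)])
    have "(L2_norm h)\<^sup>2 = cmod (pairing h (\<lambda>x. cnj (h x)))" by (simp add: pairing_cnj_self norm_power)
    also have "pairing h (\<lambda>x. cnj (h x)) = (\<Sum>t\<in>F. c t * pairing (X t) (\<lambda>x. cnj (h x)))"
      unfolding h_def
      by (subst pairing_sum_left)
         (use F X square_integrable_cnj[OF hsq] in
           \<open>auto simp: pairing_scale_left h_def intro!: square_integrable_scale\<close>)
    also have "cmod \<dots> \<le> (\<Sum>t\<in>F. cmod (pairing (X t) (\<lambda>x. cnj (h x))))"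
      by (rule order_trans[OF norm_sum]) (simp add: norm_mult c)
    also have "\<dots> \<le> A * L2_norm h"
      using bd[OF F square_integrable_cnj[OF hsq]] by simp
    also have "\<dots> \<le> \<bar>A\<bar> * L2_norm h" by (intro mult_right_mono) auto
    finally have "L2_norm h * L2_norm h \<le> \<bar>A\<bar> * L2_norm h" by (simp add: power2_eq_square)
    thus ?thesis unfolding h_def[symmetric]
      using L2_norm_nonneg[of h] by (cases "L2_norm h = 0") (auto simp: mult_le_cancel_right)
  qed
  have tails: "\<exists>F0. finite F0 \<and> F0 \<subseteq> I \<and> (\<forall>F. finite F \<longrightarrow> F \<subseteq> I - F0 \<longrightarrow>
      L2_norm (\<lambda>x. \<Sum>t\<in>F. X t x) < e)" if "e > 0" for e
  proof (rule ccontr)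
    assume "\<not> ?thesis"
    hence ex: "\<exists>F. finite F \<and> F \<subseteq> I - F0 \<and> L2_norm (\<lambda>x. \<Sum>t\<in>F. X t x) \<ge> e"
      if "finite F0" "F0 \<subseteq> I" for F0 using that by (meson not_le)
    \<comment> \<open>Each block raises the squared norm by \<open>e\<^sup>2\<close>, which
      contradicts \<open>signed\<close> after more than \<open>A\<^sup>2 / e\<^sup>2\<close>
      blocks.\<close>
    have blocks: "\<exists>G (c :: 't \<Rightarrow> complex). finite G \<and> G \<subseteq> I \<and> (\<forall>t. cmod (c t) = 1) \<and>
        real N * e\<^sup>2 \<le> (L2_norm (\<lambda>x. \<Sum>t\<in>G. c t * X t x))\<^sup>2" for N
    proof (induction N)
      case 0 show ?case by (intro exI[of _ "{}"] exI[of _ "\<lambda>_. 1"]) auto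
    next
      case (Suc N)
      then obtain G and c :: "'t \<Rightarrow> complex" where G: "finite G" "G \<subseteq> I" "\<And>t. cmod (c t) = 1"
        "real N * e\<^sup>2 \<le> (L2_norm (\<lambda>x. \<Sum>t\<in>G. c t * X t x))\<^sup>2" by blast
      obtain F where F: "finite F" "F \<subseteq> I - G" "L2_norm (\<lambda>x. \<Sum>t\<in>F. X t x) \<ge> e"
        using ex[OF G(1,2)] by blast
      define h where "h = (\<lambda>x. \<Sum>t\<in>G. c t * X t x)"
      define k where "k = (\<lambda>x. \<Sum>t\<in>F. X t x)"
      have hk: "square_integrable h" "square_integrable k"
        unfolding h_def k_def using sqF[OF G(2)] sqF1[of F] F(2) by auto
      have e2: "e\<^sup>2 \<le> (L2_norm k)\<^sup>2" using F(3) \<open>e > 0\<close> by (intro power_mono) (auto simp: k_def)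
      have comb: "(\<lambda>x. \<Sum>t\<in>G \<union> F. (if t \<in> F then z else c t) * X t x) = (\<lambda>x. h x + z * k x)" for z
      proof
        fix x
        have "(\<Sum>t\<in>G \<union> F. (if t \<in> F then z else c t) * X t x)
           = (\<Sum>t\<in>G. (if t \<in> F then z else c t) * X t x) + (\<Sum>t\<in>F. (if t \<in> F then z else c t) * X t x)"
          using F G by (intro sum.union_disjoint) auto
        also have "(\<Sum>t\<in>G. (if t \<in> F then z else c t) * X t x) = h x"
          unfolding h_def using F(2) by (intro sum.cong) auto
        also have "(\<Sum>t\<in>F. (if t \<in> F then z else c t) * X t x) = z * k x"
          unfolding k_def by (simp add: sum_distrib_left)
        finally show "(\<Sum>t\<in>G \<union> F. (if t \<in> F then z else c t) * X t x) = h x + z * k x" .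
      qed
      have "(L2_norm h)\<^sup>2 + (L2_norm k)\<^sup>2 \<le> (L2_norm (\<lambda>x. h x + 1 * k x))\<^sup>2 \<or>
            (L2_norm h)\<^sup>2 + (L2_norm k)\<^sup>2 \<le> (L2_norm (\<lambda>x. h x + (-1) * k x))\<^sup>2"
        using L2_norm_parallelogram[OF hk] by (simp) linarith
      then obtain z :: complex where z: "cmod z = 1"
        "(L2_norm h)\<^sup>2 + (L2_norm k)\<^sup>2 \<le> (L2_norm (\<lambda>x. h x + z * k x))\<^sup>2"
      proof
        assume a: "(L2_norm h)\<^sup>2 + (L2_norm k)\<^sup>2 \<le> (L2_norm (\<lambda>x. h x + 1 * k x))\<^sup>2"
        show ?thesis by (rule that[OF _ a]) simp
      next
        assume a: "(L2_norm h)\<^sup>2 + (L2_norm k)\<^sup>2 \<le> (L2_norm (\<lambda>x. h x + (-1) * k x))\<^sup>2"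
        show ?thesis by (rule that[OF _ a]) simp
      qed
      have "real (Suc N) * e\<^sup>2 \<le> (L2_norm h)\<^sup>2 + (L2_norm k)\<^sup>2"
        using G(4) e2 by (simp add: algebra_simps h_def)
      with z(2) show ?case
        by (intro exI[of _ "G \<union> F"] exI[of _ "\<lambda>t. if t \<in> F then z else c t"])
           (use F G z(1) in \<open>auto simp: comb\<close>)
    qed
    obtain G and c :: "'t \<Rightarrow> complex" where G: "finite G" "G \<subseteq> I" "\<And>t. cmod (c t) = 1"
      "real (nat \<lceil>A\<^sup>2 / e\<^sup>2\<rceil> + 1) * e\<^sup>2 \<le> (L2_norm (\<lambda>x. \<Sum>t\<in>G. c t * X t x))\<^sup>2"
      using blocks[of "nat \<lceil>A\<^sup>2 / e\<^sup>2\<rceil> + 1"] by (elim exE conjE) blast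
    have "(L2_norm (\<lambda>x. \<Sum>t\<in>G. c t * X t x))\<^sup>2 \<le> \<bar>A\<bar>\<^sup>2"
      using signed[of G c] G by (intro power_mono) auto
    hence le: "real (nat \<lceil>A\<^sup>2 / e\<^sup>2\<rceil> + 1) * e\<^sup>2 \<le> A\<^sup>2" using G(4) by simp
    have "A\<^sup>2 / e\<^sup>2 < real (nat \<lceil>A\<^sup>2 / e\<^sup>2\<rceil> + 1)" by linarith
    hence "A\<^sup>2 < real (nat \<lceil>A\<^sup>2 / e\<^sup>2\<rceil> + 1) * e\<^sup>2" using \<open>e > 0\<close> by (simp add: field_simps)
    with le show False by linarith
  qed
  have "\<forall>n. \<exists>F0. finite F0 \<and> F0 \<subseteq> I \<and> (\<forall>F. finite F \<longrightarrow> F \<subseteq> I - F0 \<longrightarrow>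
      L2_norm (\<lambda>x. \<Sum>t\<in>F. X t x) < (1/2)^n)" by (intro allI tails) simp
  then obtain F0 where F0: "\<And>n. finite (F0 n)" "\<And>n. F0 n \<subseteq> I"
    "\<And>n F. finite F \<Longrightarrow> F \<subseteq> I - F0 n \<Longrightarrow> L2_norm (\<lambda>x. \<Sum>t\<in>F. X t x) < (1/2)^n"
    by metis
  \<comment> \<open>Unions make the sets nested, so that any larger finite sum differs from the one
    over \<open>H n\<close> by a sum outside \<open>F0 n\<close>.\<close>
  define H where "H n = (\<Union>m\<le>n. F0 m)" for n
  have H: "finite (H n)" "H n \<subseteq> I" "F0 n \<subseteq> H n" "H n \<subseteq> H (Suc n)" for n
    using F0 by (auto simp: H_def le_Suc_eq)
  have step: "L2_norm (\<lambda>x. (\<Sum>t\<in>F. X t x) - (\<Sum>t\<in>H n. X t x)) \<le> (1/2)^n"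
    if "finite F" "H n \<subseteq> F" "F \<subseteq> I" for F n
  proof -
    have "(\<lambda>x. (\<Sum>t\<in>F. X t x) - (\<Sum>t\<in>H n. X t x)) = (\<lambda>x. \<Sum>t\<in>F - H n. X t x)"
      using that by (simp add: sum_diff)
    moreover have "F - H n \<subseteq> I - F0 n" using that H(3)[of n] by blast
    ultimately show ?thesis using F0(3)[of "F - H n" n] that by (simp add: less_imp_le)
  qed
  obtain s where s: "square_integrable s"
    "\<And>n. L2_norm (\<lambda>x. s x - (\<Sum>t\<in>H n. X t x)) \<le> 2 * (1/2)^n"
    by (rule L2_complete[of "\<lambda>n x. \<Sum>t\<in>H n. X t x"]) (use H sqF1 step in auto)
  have "((\<lambda>F. L2_norm (\<lambda>x. s x - (\<Sum>t\<in>F. X t x))) \<longlongrightarrow> 0) (finite_subsets_at_top I)"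
  proof (rule tendstoI)
    fix e :: real assume "e > 0"
    then obtain n where n: "(1/2)^n < e / 3"
      using real_arch_pow_inv[of "e/3" "1/2"] by auto
    have "eventually (\<lambda>F. finite F \<and> H n \<subseteq> F \<and> F \<subseteq> I) (finite_subsets_at_top I)"
      unfolding eventually_finite_subsets_at_top using H by (intro exI[of _ "H n"]) auto
    thus "eventually (\<lambda>F. dist (L2_norm (\<lambda>x. s x - (\<Sum>t\<in>F. X t x))) 0 < e) (finite_subsets_at_top I)"
    proof eventually_elim
      case (elim F)
      have "L2_norm (\<lambda>x. s x - (\<Sum>t\<in>F. X t x))
          \<le> L2_norm (\<lambda>x. s x - (\<Sum>t\<in>H n. X t x)) + L2_norm (\<lambda>x. (\<Sum>t\<in>H n. X t x) - (\<Sum>t\<in>F. X t x))"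
        by (intro L2_norm_triangle_diff s sqF1 H) (use elim in auto)
      also have "\<dots> \<le> 2 * (1/2)^n + (1/2)^n"
        by (intro add_mono s) (use step[of F n] elim in \<open>auto simp: L2_norm_minus_commute\<close>)
      also have "\<dots> < e" using n by simp
      finally show ?case by simp
    qed
  qed
  with s(1) show ?thesis using that by blast
qed

text \<open>Fixes the form in which shifts are used later: their action is known only through
  unconditionally convergent series of pairings.\<close>

lemma L2_limit_pairing_has_sum:
  fixes X :: "'t \<Rightarrow> ('n::finite) fn"
  assumes X: "\<And>t. t \<in> I \<Longrightarrow> square_integrable (X t)" and s: "square_integrable s"
    and lim: "((\<lambda>F. L2_norm (\<lambda>x. s x - (\<Sum>t\<in>F. X t x))) \<longlongrightarrow> 0) (finite_subsets_at_top I)"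
    and g: "square_integrable g"
  shows "((\<lambda>t. pairing (X t) g) has_sum pairing s g) I"
  unfolding has_sum_def
proof (rule Lim_null_comparison[where g = "\<lambda>F. L2_norm (\<lambda>x. s x - (\<Sum>t\<in>F. X t x)) * L2_norm g",
        THEN Lim_null[THEN iffD2]])
  show "((\<lambda>F. L2_norm (\<lambda>x. s x - (\<Sum>t\<in>F. X t x)) * L2_norm g) \<longlongrightarrow> 0) (finite_subsets_at_top I)"
    using tendsto_mult_right[OF lim, of "L2_norm g"] by simp
  have "eventually (\<lambda>F. finite F \<and> F \<subseteq> I) (finite_subsets_at_top I)"
    by (auto simp: eventually_finite_subsets_at_top)
  thus "eventually (\<lambda>F. norm ((\<Sum>t\<in>F. pairing (X t) g) - pairing s g)
      \<le> L2_norm (\<lambda>x. s x - (\<Sum>t\<in>F. X t x)) * L2_norm g) (finite_subsets_at_top I)"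
  proof eventually_elim
    case (elim F)
    have XF: "square_integrable (\<lambda>x. \<Sum>t\<in>F. X t x)" using X elim by (intro square_integrable_sum) auto
    have "(\<Sum>t\<in>F. pairing (X t) g) = pairing (\<lambda>x. \<Sum>t\<in>F. X t x) g"
      using X elim g by (intro pairing_sum_left[symmetric]) auto
    hence "norm ((\<Sum>t\<in>F. pairing (X t) g) - pairing s g) = cmod (pairing (\<lambda>x. s x - (\<Sum>t\<in>F. X t x)) g)"
      by (simp add: pairing_diff_left s XF g norm_minus_commute)
    also have "\<dots> \<le> L2_norm (\<lambda>x. s x - (\<Sum>t\<in>F. X t x)) * L2_norm g"
      by (intro pairing_bound square_integrable_diff s XF g)
    finally show ?case .
  qed
qed

section \<open>Dyadic cubes addressed by generation and integer index\<close>

type_synonym 'n digits = "int \<Rightarrow> real^'n"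
type_synonym 'n coeffs = "int \<Rightarrow> int^'n \<Rightarrow> int^'n \<Rightarrow> int^'n \<Rightarrow> int^'n \<Rightarrow> complex"

text \<open>The corner ranges over all points, so that a quantity attached to a random cube is a
  continuous function of the corner composed with the random \<open>corner\<close>.\<close>

definition qube :: "int \<Rightarrow> real^'n \<Rightarrow> (real^'n::finite) set" where
  "qube k y = {x. \<forall>c. y $ c \<le> x $ c \<and> x $ c < y $ c + 2 powi k}"

definition rv :: "int^'n \<Rightarrow> real^'n::finite" where
  "rv i = (\<chi> c. of_int (i $ c))"

definition off :: "'n digits \<Rightarrow> int \<Rightarrow> real^'n::finite" where
  "off \<omega> k = (\<Sum>\<^sub>\<infinity>j\<in>{..<k}. (2 powi j) *\<^sub>R \<omega> j)"

definition corner :: "'n digits \<Rightarrow> int \<Rightarrow> int^'n \<Rightarrow> real^'n::finite" where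
  "corner \<omega> k i = (2 powi k) *\<^sub>R rv i + off \<omega> k"

definition cub :: "'n digits \<Rightarrow> int \<Rightarrow> int^'n \<Rightarrow> (real^'n::finite) set" where
  "cub \<omega> k i = qube k (corner \<omega> k i)"

text \<open>The index of the cube of generation \<open>k\<close> that contains \<open>x\<close>;
  geometric relations between cubes become integer arithmetic through it.\<close>

definition pidx :: "'n digits \<Rightarrow> int \<Rightarrow> real^'n \<Rightarrow> int^'n::finite" where
  "pidx \<omega> k x = (\<chi> c. \<lfloor>(x $ c - off \<omega> k $ c) / 2 powi k\<rfloor>)"

definition dg :: "'n digits \<Rightarrow> int \<Rightarrow> int^'n::finite" where
  "dg \<omega> k = (\<chi> c. \<lfloor>\<omega> k $ c\<rfloor>)"

text \<open>
  The origin of generation \<open>k + 1\<close> is that of generation \<open>k\<close> shifted by \<open>2 powi k\<close> times the digit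
  \<open>dg \<omega> k\<close>, whence the correction of the index before halving.
\<close>

definition par :: "'n digits \<Rightarrow> int \<Rightarrow> int^'n \<Rightarrow> int^'n::finite" where
  "par \<omega> k i = (\<chi> c. (i $ c - dg \<omega> k $ c) div 2)"

primrec anc :: "'n digits \<Rightarrow> int \<Rightarrow> nat \<Rightarrow> int^'n \<Rightarrow> int^'n::finite" where
  "anc \<omega> k 0 i = i"
| "anc \<omega> k (Suc r) i = par \<omega> (k + int r) (anc \<omega> k r i)"

definition bits :: "(int^'n::finite) set" where
  "bits = {v. \<forall>c. v $ c \<in> {0, 1}}"

text \<open>The inverse branches of \<open>par\<close> at generation \<open>k - 1\<close>: doubling
  undoes the halving, and adding the digit undoes the shift of the origin.\<close>

definition chl :: "'n digits \<Rightarrow> int \<Rightarrow> int^'n \<Rightarrow> int^'n \<Rightarrow> int^'n::finite" where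
  "chl \<omega> k i \<theta> = (\<chi> c. 2 * i $ c + dg \<omega> (k - 1) $ c + \<theta> $ c)"

definition valid :: "('n::finite) digits \<Rightarrow> bool" where
  "valid \<omega> \<longleftrightarrow> (\<forall>k c. \<omega> k $ c \<in> {0, 1})"

abbreviation ind :: "(real^'n::finite) set \<Rightarrow> 'n fn" where
  "ind A \<equiv> indicator A"

lemma validD: "valid \<omega> \<Longrightarrow> \<omega> k $ c = real_of_int (dg \<omega> k $ c)"
  by (auto simp: valid_def dg_def) (metis floor_one floor_zero of_int_0 of_int_1 insertE singletonD)

lemma powi_diff_1: "(2::real) powi (k - 1) = 2 powi k / 2"
  by (simp add: power_int_diff)

lemma powi_add_nat: "(2::real) powi (k + int n) = 2 powi k * 2 ^ n"
  by (simp add: power_int_add)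

lemma powi_sub: "(2::real) powi (k - 1 - int n) = 2 powi k * (1/2) ^ Suc n"
proof -
  have "(2::real) powi (k - 1 - int n) = 2 powi (k - int (Suc n))" by (simp add: algebra_simps)
  also have "\<dots> = 2 powi k / 2 ^ Suc n" by (subst power_int_diff) (simp_all del: power_Suc of_nat_Suc)
  finally show ?thesis by (simp add: power_one_over field_simps)
qed

lemma powi_pos [simp]: "0 < (2::real) powi k" by simp

subsection \<open>The offset\<close>

text \<open>Runs through the generations below \<open>k\<close> downwards, which turns the unordered
  sum of the offset into a series.\<close>

lemma bij_lessThan: "bij_betw (\<lambda>n. k - 1 - int n) UNIV {..<k}"
  by (rule bij_betwI[where g = "\<lambda>j. nat (k - 1 - j)"]) auto

lemma off_summable:
  assumes "valid \<omega>"
  shows "(\<lambda>j. (2 powi j) *\<^sub>R \<omega> j) summable_on {..<k}"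
    and "(\<lambda>n. (2 powi (k - 1 - int n)) *\<^sub>R \<omega> (k - 1 - int n)) sums off \<omega> k"
proof -
  have nrm: "norm (\<omega> j) \<le> real CARD('a)" for j
  proof -
    have "norm (\<omega> j) \<le> (\<Sum>c\<in>UNIV. \<bar>\<omega> j $ c\<bar>)" by (rule norm_le_l1_cart)
    also have "\<dots> \<le> (\<Sum>c\<in>(UNIV::'a set). 1)"
    proof (rule sum_mono)
      fix c show "\<bar>\<omega> j $ c\<bar> \<le> 1"
        using assms unfolding valid_def by (metis abs_0 abs_1 insertE order_refl singletonD zero_le_one)
    qed
    finally show ?thesis by simp
  qed
  have pw: "(2::real) powi (k - 1 - int n) = 2 powi (k-1) * (1/2)^n" for n
    unfolding powi_sub powi_diff_1 by simp
  have "summable (\<lambda>n. norm ((2 powi (k - 1 - int n)) *\<^sub>R \<omega> (k - 1 - int n)))"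
  proof (rule summable_comparison_test)
    show "\<exists>N. \<forall>n\<ge>N. norm (norm ((2 powi (k - 1 - int n)) *\<^sub>R \<omega> (k - 1 - int n)))
        \<le> 2 powi (k-1) * real CARD('a) * (1/2)^n"
      using nrm by (auto simp: pw mult_ac intro!: exI[of _ 0] mult_mono)
    show "summable (\<lambda>n. 2 powi (k-1) * real CARD('a) * (1/2)^n)"
      by (intro summable_mult summable_geometric) simp
  qed
  hence s: "(\<lambda>n. (2 powi (k - 1 - int n)) *\<^sub>R \<omega> (k - 1 - int n)) summable_on UNIV"
    by (rule norm_summable_imp_summable_on)
  thus 1: "(\<lambda>j. (2 powi j) *\<^sub>R \<omega> j) summable_on {..<k}"
    using summable_on_reindex_bij_betw[OF bij_lessThan[of k], of "\<lambda>j. (2 powi j) *\<^sub>R \<omega> j"] by simp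
  have "off \<omega> k = (\<Sum>\<^sub>\<infinity>n\<in>UNIV. (2 powi (k - 1 - int n)) *\<^sub>R \<omega> (k - 1 - int n))"
    unfolding off_def
    using infsum_reindex_bij_betw[OF bij_lessThan[of k], of "\<lambda>j. (2 powi j) *\<^sub>R \<omega> j"] by simp
  with has_sum_infsum[OF s] show "(\<lambda>n. (2 powi (k - 1 - int n)) *\<^sub>R \<omega> (k - 1 - int n)) sums off \<omega> k"
    by (simp add: has_sum_imp_sums)
qed

lemma off_step:
  assumes "valid \<omega>"
  shows "off \<omega> (k + 1) = off \<omega> k + (2 powi k) *\<^sub>R \<omega> k"
proof -
  have "{..<k+1} = insert k {..<k}" by auto
  thus ?thesis unfolding off_def using off_summable(1)[OF assms, of k]
    by (simp add: infsum_insert add.commute)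
qed

text \<open>Comparison with the geometric series of the \<open>2 powi (k - 1 - int n)\<close>, whose
  sum is \<open>2 powi k\<close>. The upper bound is attained when all digits below \<open>k\<close>
  are 1.\<close>

lemma off_bounds:
  assumes "valid \<omega>"
  shows "0 \<le> off \<omega> k $ c" "off \<omega> k $ c \<le> 2 powi k"
proof -
  have s: "(\<lambda>n. ((2 powi (k - 1 - int n)) *\<^sub>R \<omega> (k - 1 - int n)) $ c) sums (off \<omega> k $ c)"
    using bounded_linear.sums[OF bounded_linear_vec_nth off_summable(2)[OF assms]] by simp
  have t: "(\<lambda>n. 2 powi (k - 1 - int n)) sums ((2::real) powi k)"
    unfolding powi_sub using sums_mult[OF power_half_series, of "2 powi k"] by simp
  have w: "0 \<le> \<omega> j $ c \<and> \<omega> j $ c \<le> 1" for j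
    using assms unfolding valid_def by (metis insertE order_refl singletonD zero_le_one)
  show "0 \<le> off \<omega> k $ c"
    by (rule sums_le[OF _ sums_zero s]) (use w in simp)
  show "off \<omega> k $ c \<le> 2 powi k"
    by (rule sums_le[OF _ s t]) (use w in \<open>simp add: mult_left_le\<close>)
qed

subsection \<open>Cubes, parents and children\<close>

text \<open>Half-open cubes tile the space, so membership is a system of floor equations.
  Disjointness and inclusion of cubes are later read off from equality of indices.\<close>

lemma mem_cub_iff: "x \<in> cub \<omega> k i \<longleftrightarrow> pidx \<omega> k x = i"
proof -
  have "(corner \<omega> k i $ c \<le> x $ c \<and> x $ c < corner \<omega> k i $ c + 2 powi k) \<longleftrightarrow> pidx \<omega> k x $ c = i $ c" for c
  proof -
    have "(pidx \<omega> k x $ c = i $ c) \<longleftrightarrow> of_int (i $ c) \<le> (x $ c - off \<omega> k $ c) / 2 powi k \<and>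
         (x $ c - off \<omega> k $ c) / 2 powi k < of_int (i $ c) + 1"
      by (simp add: pidx_def floor_eq_iff)
    also have "\<dots> \<longleftrightarrow> of_int (i $ c) * 2 powi k \<le> (x $ c - off \<omega> k $ c) \<and>
         (x $ c - off \<omega> k $ c) < (of_int (i $ c) + 1) * 2 powi k"
      by (simp add: pos_le_divide_eq pos_divide_less_eq)
    also have "\<dots> \<longleftrightarrow> (corner \<omega> k i $ c \<le> x $ c \<and> x $ c < corner \<omega> k i $ c + 2 powi k)"
      by (auto simp: corner_def rv_def algebra_simps)
    finally show ?thesis by simp
  qed
  thus ?thesis by (simp add: cub_def qube_def vec_eq_iff)
qed

lemma corner_mem: "corner \<omega> k i \<in> cub \<omega> k i"
  by (simp add: cub_def qube_def)

lemma pidx_corner [simp]: "pidx \<omega> k (corner \<omega> k i) = i"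
  using corner_mem mem_cub_iff by blast

lemma cub_inj: "cub \<omega> k i = cub \<omega> k j \<longleftrightarrow> i = j"
  by (metis corner_mem mem_cub_iff)

text \<open>Passing to the next generation subtracts the digit from the rescaled coordinate and
  halves it. The floor commutes with subtracting an integer, and it turns halving into
  \<open>div 2\<close>.\<close>

lemma pidx_par:
  assumes "valid \<omega>"
  shows "pidx \<omega> (k + 1) x = par \<omega> k (pidx \<omega> k x)"
proof -
  have "\<lfloor>(x $ c - off \<omega> (k+1) $ c) / 2 powi (k+1)\<rfloor>
      = (\<lfloor>(x $ c - off \<omega> k $ c) / 2 powi k\<rfloor> - dg \<omega> k $ c) div 2" for c
  proof -
    define t where "t = (x $ c - off \<omega> k $ c) / 2 powi k"
    have "(x $ c - off \<omega> (k+1) $ c) / 2 powi (k+1) = (t - real_of_int (dg \<omega> k $ c)) / 2"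
      unfolding off_step[OF assms] t_def using validD[OF assms, of k c]
      by (simp add: power_int_add field_simps)
    also have "\<lfloor>\<dots>\<rfloor> = \<lfloor>t - real_of_int (dg \<omega> k $ c)\<rfloor> div 2"
      using floor_divide_real_eq_div[of 2 "t - real_of_int (dg \<omega> k $ c)"] by simp
    also have "\<lfloor>t - real_of_int (dg \<omega> k $ c)\<rfloor> = \<lfloor>t\<rfloor> - dg \<omega> k $ c" by simp
    finally show ?thesis unfolding t_def .
  qed
  thus ?thesis by (simp add: pidx_def par_def vec_eq_iff)
qed

lemma pidx_anc:
  assumes "valid \<omega>"
  shows "pidx \<omega> (k + int r) x = anc \<omega> k r (pidx \<omega> k x)"
proof (induction r)
  case (Suc r)
  have "pidx \<omega> (k + int (Suc r)) x = pidx \<omega> ((k + int r) + 1) x" by (simp add: algebra_simps)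
  thus ?case by (simp add: pidx_par[OF assms] Suc)
qed simp

lemma anc_add: "anc \<omega> k (r + s) i = anc \<omega> (k + int r) s (anc \<omega> k r i)"
  by (induction s) (auto simp: add.assoc)

lemma anc_Suc2: "anc \<omega> k (Suc r) i = anc \<omega> (k + 1) r (par \<omega> k i)"
  using anc_add[of \<omega> k 1 r i] by simp

text \<open>Inclusion is decided at one point, the corner, since each point lies in only one cube of
  each generation.\<close>

lemma cub_subset_iff:
  assumes "valid \<omega>"
  shows "cub \<omega> k i \<subseteq> cub \<omega> (k + int r) j \<longleftrightarrow> anc \<omega> k r i = j"
proof
  assume "cub \<omega> k i \<subseteq> cub \<omega> (k + int r) j"
  hence "corner \<omega> k i \<in> cub \<omega> (k + int r) j" using corner_mem by blast
  thus "anc \<omega> k r i = j" by (simp add: mem_cub_iff pidx_anc[OF assms])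
next
  assume "anc \<omega> k r i = j"
  thus "cub \<omega> k i \<subseteq> cub \<omega> (k + int r) j" by (auto simp: mem_cub_iff pidx_anc[OF assms])
qed

lemma finite_bits [simp]: "finite (bits :: (int^'n::finite) set)"
  and card_bits: "card (bits :: (int^'n::finite) set) = 2 ^ CARD('n)"
proof -
  have b: "bij_betw (\<lambda>v::int^'n. \<lambda>c. v $ c) bits (Pi\<^sub>E UNIV (\<lambda>_. {0,1}))"
    by (rule bij_betwI[where g = "\<lambda>f. \<chi> c. f c"]) (auto simp: bits_def PiE_def Pi_def)
  thus "finite (bits :: (int^'n::finite) set)"
    using bij_betw_finite by (metis finite_PiE finite.emptyI finite.insertI finite)
  show "card (bits :: (int^'n::finite) set) = 2 ^ CARD('n)"
    using bij_betw_same_card[OF b] by (simp add: card_PiE numeral_2_eq_2)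
qed

lemma bits_nonempty [simp]: "bits \<noteq> {}"
  using card_bits by (metis card.empty power_not_zero zero_neq_numeral)

lemma par_chl:
  assumes "\<theta> \<in> bits"
  shows "par \<omega> (k - 1) (chl \<omega> k i \<theta>) = i"
proof -
  have *: "(2 * a + b + t - b) div 2 = a" if "t \<in> {0, 1}" for a b t :: int
    using that by auto
  show ?thesis
    using assms by (simp add: par_def chl_def bits_def vec_eq_iff *[simplified])
qed

lemma chl_inj: "chl \<omega> k i \<theta> = chl \<omega> k i' \<theta>' \<Longrightarrow> i = i' \<Longrightarrow> \<theta> = \<theta>'"
  by (auto simp: chl_def vec_eq_iff)

lemma chl_ex:
  assumes "par \<omega> (k - 1) j = i"
  shows "\<exists>\<theta>\<in>bits. j = chl \<omega> k i \<theta>"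
proof
  let ?t = "\<chi> c. (j $ c - dg \<omega> (k-1) $ c) mod 2"
  show "?t \<in> bits" unfolding bits_def by (auto simp: not_mod_2_eq_0_eq_1)
  show "j = chl \<omega> k i ?t"
    unfolding assms[symmetric] by (simp add: chl_def par_def vec_eq_iff)
qed

lemma par_eq_iff: "par \<omega> (k - 1) j = i \<longleftrightarrow> (\<exists>\<theta>\<in>bits. j = chl \<omega> k i \<theta>)"
  using chl_ex par_chl by blast

lemma corner_chl:
  assumes "valid \<omega>"
  shows "corner \<omega> (k - 1) (chl \<omega> k i \<theta>) = corner \<omega> k i + (2 powi (k - 1)) *\<^sub>R rv \<theta>"
  using off_step[OF assms, of "k - 1"] validD[OF assms, of "k-1"]
  by (simp add: corner_def vec_eq_iff rv_def chl_def powi_diff_1 field_simps)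

lemma mem_cub_chl_iff:
  assumes "valid \<omega>"
  shows "x \<in> cub \<omega> k i \<longleftrightarrow> (\<exists>\<theta>\<in>bits. x \<in> cub \<omega> (k - 1) (chl \<omega> k i \<theta>))"
  using pidx_par[OF assms, of "k - 1" x] par_eq_iff[of \<omega> k "pidx \<omega> (k-1) x" i]
  by (auto simp: mem_cub_iff)

lemma desc_finite_card:
  fixes q :: "int^'n::finite"
  shows "finite {j. anc \<omega> k n j = q} \<and> card {j. anc \<omega> k n j = q} \<le> 2 ^ (CARD('n) * n)"
proof (induction n arbitrary: q)
  case 0
  have "{j. j = q} = {q}" by auto
  thus ?case by simp
next
  case (Suc n)
  have eq: "{j. anc \<omega> k (Suc n) j = q} = (\<Union>\<theta>\<in>bits. {j. anc \<omega> k n j = chl \<omega> (k + int n + 1) q \<theta>})"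
    using par_eq_iff[of \<omega> "k + int n + 1" _ q] by auto
  have "card {j. anc \<omega> k (Suc n) j = q} \<le> (\<Sum>\<theta>\<in>(bits::(int^'n) set). card {j. anc \<omega> k n j = chl \<omega> (k + int n + 1) q \<theta>})"
    unfolding eq by (rule card_UN_le) simp
  also have "\<dots> \<le> (\<Sum>\<theta>\<in>(bits::(int^'n) set). 2 ^ (CARD('n) * n))"
    using Suc by (intro sum_mono) auto
  also have "\<dots> = 2 ^ (CARD('n) * Suc n)" by (simp add: card_bits power_add)
  finally show ?case unfolding eq using Suc by auto
qed

text \<open>The bridge from the lattices of the statement to indices: a vector with integer
  coordinates is \<open>rv i\<close>, and the shift is \<open>off\<close>.\<close>

lemma range_cub: "valid \<omega> \<Longrightarrow> shifted_lattice \<omega> k = range (cub \<omega> k)"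
proof -
  have img: "(\<lambda>x. x + off \<omega> k) ` ((\<lambda>x. (2 powi k) *\<^sub>R (x + rv i)) ` {x. \<forall>c. 0 \<le> x $ c \<and> x $ c < 1}) = cub \<omega> k i" (is "?L = _") for i
  proof (rule set_eqI)
    fix z
    have "z \<in> ?L \<longleftrightarrow> (\<exists>x. z = (2 powi k) *\<^sub>R (x + rv i) + off \<omega> k \<and> (\<forall>c. 0 \<le> x $ c \<and> x $ c < 1))" by auto
    also have "\<dots> \<longleftrightarrow> (\<forall>c. 0 \<le> ((z $ c - off \<omega> k $ c) / 2 powi k - rv i $ c) \<and> ((z $ c - off \<omega> k $ c) / 2 powi k - rv i $ c) < 1)"
    proof
      assume "\<exists>x. z = (2 powi k) *\<^sub>R (x + rv i) + off \<omega> k \<and> (\<forall>c. 0 \<le> x $ c \<and> x $ c < 1)"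
      thus "\<forall>c. 0 \<le> ((z $ c - off \<omega> k $ c) / 2 powi k - rv i $ c) \<and> ((z $ c - off \<omega> k $ c) / 2 powi k - rv i $ c) < 1"
        by (auto simp: field_simps)
    next
      assume *: "\<forall>c. 0 \<le> ((z $ c - off \<omega> k $ c) / 2 powi k - rv i $ c) \<and> ((z $ c - off \<omega> k $ c) / 2 powi k - rv i $ c) < 1"
      show "\<exists>x. z = (2 powi k) *\<^sub>R (x + rv i) + off \<omega> k \<and> (\<forall>c. 0 \<le> x $ c \<and> x $ c < 1)"
        by (rule exI[of _ "\<chi> c. (z $ c - off \<omega> k $ c) / 2 powi k - rv i $ c"])
           (use * in \<open>auto simp: vec_eq_iff field_simps\<close>)
    qed
    also have "\<dots> \<longleftrightarrow> z \<in> cub \<omega> k i"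
      by (auto simp: mem_cub_iff pidx_def vec_eq_iff floor_eq_iff rv_def algebra_simps)
    finally show "z \<in> ?L \<longleftrightarrow> z \<in> cub \<omega> k i" .
  qed
  have ints: "{m::real^'a. \<forall>i. m $ i \<in> \<int>} = range rv"
  proof (rule set_eqI)
    fix m :: "real^'a"
    show "m \<in> {m. \<forall>i. m $ i \<in> \<int>} \<longleftrightarrow> m \<in> range rv"
    proof
      assume "m \<in> {m. \<forall>i. m $ i \<in> \<int>}"
      hence "m = rv (\<chi> c. \<lfloor>m $ c\<rfloor>)" by (auto simp: rv_def vec_eq_iff elim!: Ints_cases)
      thus "m \<in> range rv" by blast
    qed (auto simp: rv_def)
  qed
  have "std_lattice k = (\<lambda>m::real^'a. (\<lambda>x. (2 powi k) *\<^sub>R (x + m)) ` {x. \<forall>i. 0 \<le> x $ i \<and> x $ i < 1}) ` range rv"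
    unfolding std_lattice_def ints[symmetric] by auto
  thus ?thesis
    unfolding shifted_lattice_def off_def[symmetric] by (simp add: image_image img[unfolded image_image])
qed

subsection \<open>Volumes and indicators\<close>

text \<open>The type argument carries the dimension, so that the volume of a cube of generation
  \<open>k\<close> can be named without naming a cube.\<close>

definition vl :: "'n::finite itself \<Rightarrow> int \<Rightarrow> real" where
  "vl _ k = (2 powi k) ^ CARD('n)"

lemma vl_pos [simp]: "0 < vl TYPE('n::finite) k" by (simp add: vl_def)
lemma vl_nonneg [simp]: "0 \<le> vl TYPE('n::finite) k" by (simp add: vl_def)
lemma vl_nz [simp]: "vl TYPE('n::finite) k \<noteq> 0" by (simp add: vl_def)

lemma vl_add_nat: "vl TYPE('n::finite) (k + int n) = vl TYPE('n) k * 2 ^ (CARD('n) * n)"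
  by (simp add: vl_def powi_add_nat power_mult_distrib power_mult mult.commute)

lemma vl_diff_1: "vl TYPE('n::finite) (k - 1) = vl TYPE('n) k / 2 ^ CARD('n)"
  by (simp add: vl_def powi_diff_1 power_divide)

lemma vl_inj: "vl TYPE('n::finite) k = vl TYPE('n) l \<Longrightarrow> k = l"
proof -
  assume "vl TYPE('n::finite) k = vl TYPE('n) l"
  hence "(2::real) powi k = 2 powi l" unfolding vl_def
    by (rule power_eq_imp_eq_base) auto
  hence "\<not> k < l" "\<not> l < k"
    using power_int_strict_increasing[of k l "2::real"] power_int_strict_increasing[of l k "2::real"] by auto
  thus ?thesis by simp
qed

lemma qube_borel [measurable, simp]: "qube k y \<in> sets borel"
proof -
  have "qube k y = (\<Inter>c. {x. y $ c \<le> x $ c} \<inter> {x. x $ c < y $ c + 2 powi k})"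
    by (auto simp: qube_def)
  also have "\<dots> \<in> sets borel"
    by (intro sets.countable_INT'' sets.Int) (auto intro!: borel_closed borel_open closed_Collect_le open_Collect_less continuous_intros)
  finally show ?thesis .
qed

lemma cub_borel [measurable, simp]: "cub \<omega> k i \<in> sets borel" by (simp add: cub_def)

lemma emeasure_qube: "emeasure lborel (qube k y) = ennreal (vl TYPE('n) k)" for y :: "real^'n::finite"
proof -
  let ?z = "y + (\<chi> c. 2 powi k)"
  have prod: "(\<Prod>b\<in>Basis. (?z - y) \<bullet> b) = vl TYPE('n) k"
  proof -
    have "(\<Prod>b\<in>(Basis::(real^'n) set). (?z - y) \<bullet> b) = (\<Prod>b\<in>(Basis::(real^'n) set). 2 powi k)"
      by (intro prod.cong) (auto simp: Basis_vec_def inner_axis)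
    also have "\<dots> = vl TYPE('n) k" by (simp add: vl_def)
    finally show ?thesis .
  qed
  have le: "y \<bullet> b \<le> ?z \<bullet> b" if "b \<in> Basis" for b
    using that by (auto simp: Basis_vec_def inner_axis)
  have "emeasure lborel (qube k y) \<le> emeasure lborel (cbox y ?z)"
    by (intro emeasure_mono) (auto simp: qube_def mem_box_cart less_imp_le)
  also have "\<dots> = ennreal (vl TYPE('n) k)"
    using emeasure_lborel_cbox[of y ?z] le prod by simp
  finally have 1: "emeasure lborel (qube k y) \<le> ennreal (vl TYPE('n) k)" .
  have "ennreal (vl TYPE('n) k) = emeasure lborel (box y ?z)"
    using emeasure_lborel_box[of y ?z] le prod by simp
  also have "\<dots> \<le> emeasure lborel (qube k y)"
    by (intro emeasure_mono) (auto simp: qube_def mem_box_cart less_imp_le)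
  finally show ?thesis using 1 by (rule antisym[rotated])
qed

lemma measure_qube: "measure lborel (qube k y) = vl TYPE('n) k" for y :: "real^'n::finite"
  by (simp add: measure_def emeasure_qube)

lemma emeasure_cub: "emeasure lborel (cub \<omega> k (i::int^'n::finite)) = ennreal (vl TYPE('n) k)"
  by (simp add: cub_def emeasure_qube)

lemma measure_cub: "measure lborel (cub \<omega> k (i::int^'n::finite)) = vl TYPE('n) k"
  by (simp add: cub_def measure_qube)

text \<open>The volume determines the generation. Hence a cube given as a set determines its
  generation and index, and families over sets can be defined by indices.\<close>

lemma cub_level_inj: "cub \<omega> k i = cub \<omega> l j \<Longrightarrow> k = l \<and> i = j"
  using measure_cub[of \<omega> k i] measure_cub[of \<omega> l j] vl_inj cub_inj by metis

lemma square_integrable_bounded: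
  fixes h :: "('n::finite) fn"
  assumes [measurable]: "h \<in> borel_measurable borel" and A: "A \<in> sets borel" "emeasure lborel A < \<infinity>"
    and h: "\<And>x. x \<notin> A \<Longrightarrow> h x = 0" "\<And>x. cmod (h x) \<le> M"
  shows "square_integrable h" "(L2_norm h)\<^sup>2 \<le> M\<^sup>2 * measure lborel A"
proof -
  have M: "0 \<le> M" using h(2) norm_ge_zero order_trans by blast
  have le: "(cmod (h x))\<^sup>2 \<le> M\<^sup>2 * indicator A x" for x
    using h M by (cases "x \<in> A") (auto intro!: power_mono)
  have iA: "integrable lborel (\<lambda>x. M\<^sup>2 * indicator A x :: real)"
    using A by (intro integrable_mult_right integrable_real_indicator) auto
  have i: "integrable lborel (\<lambda>x. (cmod (h x))\<^sup>2)"
    by (rule Bochner_Integration.integrable_bound[OF iA]) (use le in auto)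
  thus "square_integrable h" by (simp add: square_integrable_def)
  have "(L2_norm h)\<^sup>2 \<le> (LINT x|lborel. M\<^sup>2 * indicator A x)"
    unfolding L2_norm_power2 by (rule integral_mono[OF i iA]) (rule le)
  also have "\<dots> = M\<^sup>2 * measure lborel A" using A by simp
  finally show "(L2_norm h)\<^sup>2 \<le> M\<^sup>2 * measure lborel A" .
qed

lemma square_integrable_ind:
  assumes "A \<in> sets borel" "emeasure lborel A < \<infinity>"
  shows "square_integrable (ind A)" "(L2_norm (ind A))\<^sup>2 = measure lborel A"
proof -
  show "square_integrable (ind A)"
    using assms by (intro square_integrable_bounded(1)[where A = A and M = 1]) (auto simp: indicator_def)
  have "(\<lambda>x. (cmod (ind A x))\<^sup>2) = indicator A" by (auto simp: indicator_def)
  thus "(L2_norm (ind A))\<^sup>2 = measure lborel A" unfolding L2_norm_power2 using assms by simp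
qed

lemma sq_ind_qube [simp]: "square_integrable (ind (qube k y))"
  by (rule square_integrable_ind) (auto simp: emeasure_qube)

lemma sq_ind_cub [simp]: "square_integrable (ind (cub \<omega> k i))"
  by (simp add: cub_def)

text \<open>The indicator of the child \<theta> minus its mean over the cube. These
  \<open>2 ^ CARD('n)\<close> functions add up to zero, but after division by the square root of the
  volume of a child they form a Parseval frame for the Haar functions of the cube.\<close>

definition phi :: "int \<Rightarrow> real^'n \<Rightarrow> int^'n \<Rightarrow> ('n::finite) fn" where
  "phi k y \<theta> x = ind (qube (k - 1) (y + (2 powi (k - 1)) *\<^sub>R rv \<theta>)) x - ind (qube k y) x / 2 ^ CARD('n)"

abbreviation phc :: "'n digits \<Rightarrow> int \<Rightarrow> int^'n \<Rightarrow> int^'n \<Rightarrow> ('n::finite) fn" where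
  "phc \<omega> k i \<theta> \<equiv> phi k (corner \<omega> k i) \<theta>"

lemma phi_sq [simp]: "square_integrable (phi k y \<theta>)"
  unfolding phi_def[abs_def]
  using square_integrable_diff[OF sq_ind_qube square_integrable_scale[OF sq_ind_qube, of "1 / 2 ^ CARD('a)"]]
  by simp

lemma phi_borel [measurable]: "phi k y \<theta> \<in> borel_measurable borel"
  using phi_sq square_integrableD(1) by blast

lemma phc_eq:
  fixes i :: "int^'n::finite"
  assumes "valid \<omega>"
  shows "phc \<omega> k i \<theta> x = ind (cub \<omega> (k-1) (chl \<omega> k i \<theta>)) x - ind (cub \<omega> k i) x / 2 ^ CARD('n)"
  unfolding phi_def cub_def corner_chl[OF assms] ..

lemma child_qube_subset:
  assumes "\<theta> \<in> bits"
  shows "qube (k - 1) (y + (2 powi (k - 1)) *\<^sub>R rv \<theta>) \<subseteq> qube k y"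
proof
  fix x assume x: "x \<in> qube (k - 1) (y + (2 powi (k - 1)) *\<^sub>R rv \<theta>)"
  show "x \<in> qube k y" unfolding qube_def
  proof (intro CollectI allI)
    fix c
    have "\<theta> $ c = 0 \<or> \<theta> $ c = 1" using assms by (auto simp: bits_def)
    thus "y $ c \<le> x $ c \<and> x $ c < y $ c + 2 powi k"
      using x zero_less_power_int[of "2::real" k] by (auto simp: qube_def rv_def powi_diff_1 dest!: spec[of _ c])
  qed
qed

lemma phi_outside: "\<theta> \<in> bits \<Longrightarrow> x \<notin> qube k y \<Longrightarrow> phi k y \<theta> x = 0"
  using child_qube_subset[of \<theta> k y] by (auto simp: phi_def indicator_def)

lemma phi_bound:
  fixes y :: "real^'n::finite"
  assumes that: "\<theta> \<in> bits"
  shows "cmod (phi k y \<theta> x) \<le> 1"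
proof -
  define q where "q = 1 / (2::real) ^ CARD('n)"
  have q: "0 \<le> q" "q \<le> 1" by (auto simp: q_def)
  have eq: "phi k y \<theta> x = complex_of_real (indicator (qube (k - 1) (y + (2 powi (k - 1)) *\<^sub>R rv \<theta>)) x
        - indicator (qube k y) x * q)"
    by (simp add: phi_def indicator_def q_def)
  show ?thesis unfolding eq norm_of_real
    using child_qube_subset[OF that, of k y] q by (auto simp: indicator_def abs_if)
qed

lemma integral_ind: "A \<in> sets borel \<Longrightarrow> (LINT x|lborel. (ind A x :: complex)) = complex_of_real (measure lborel A)"
proof -
  assume "A \<in> sets borel"
  have "(LINT x|lborel. (ind A x :: complex)) = (LINT x|lborel. complex_of_real (indicator A x))"
    by (intro Bochner_Integration.integral_cong) (auto simp: indicator_def)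
  also have "\<dots> = complex_of_real (LINT x|lborel. indicator A x)" by (rule integral_complex_of_real)
  finally show ?thesis using \<open>A \<in> sets borel\<close> by simp
qed

lemma integrable_ind:
  assumes "A \<in> sets borel" "emeasure lborel A < \<infinity>"
  shows "integrable lborel (ind A)"
  using integrable_pairing(1)[OF square_integrable_ind(1)[OF assms] square_integrable_ind(1)[OF assms]]
  by (rule Bochner_Integration.integrable_cong[THEN iffD1, rotated -1]) (auto simp: indicator_def)

lemma phi_integral: "(LINT x|lborel. phi k y \<theta> x) = 0" for y :: "real^'n::finite"
proof -
  have "integrable lborel (ind (qube j z))" for j and z :: "real^'n"
    by (rule integrable_ind) (auto simp: emeasure_qube)
  thus ?thesis unfolding phi_def
    by (simp add: integral_ind measure_qube vl_diff_1)
qed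

subsection \<open>Bounded bilinear forms\<close>

text \<open>With a form in place of an operator the transpose is an exchange of arguments, and the
  pairing itself is an instance with bound 1.\<close>

definition bform :: "real \<Rightarrow> ('n::finite fn \<Rightarrow> 'n fn \<Rightarrow> complex) \<Rightarrow> bool" where
  "bform N B \<longleftrightarrow> N \<ge> 0 \<and>
    (\<forall>f f' g. square_integrable f \<longrightarrow> square_integrable f' \<longrightarrow> square_integrable g \<longrightarrow>
       B (\<lambda>x. f x + f' x) g = B f g + B f' g \<and> B g (\<lambda>x. f x + f' x) = B g f + B g f') \<and>
    (\<forall>c f g. square_integrable f \<longrightarrow> square_integrable g \<longrightarrow>
       B (\<lambda>x. c * f x) g = c * B f g \<and> B g (\<lambda>x. c * f x) = c * B g f) \<and>
    (\<forall>f g. square_integrable f \<longrightarrow> square_integrable g \<longrightarrow> cmod (B f g) \<le> N * L2_norm f * L2_norm g)"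

lemma bform_pairing: "bform 1 pairing"
  unfolding bform_def
  by (auto simp: pairing_add_left pairing_add_right pairing_scale_left pairing_scale_right pairing_bound)

lemma bformD:
  assumes "bform N B"
  shows "N \<ge> 0"
    and "square_integrable f \<Longrightarrow> square_integrable f' \<Longrightarrow> square_integrable g \<Longrightarrow>
       B (\<lambda>x. f x + f' x) g = B f g + B f' g"
    and "square_integrable f \<Longrightarrow> square_integrable g \<Longrightarrow> B (\<lambda>x. c * f x) g = c * B f g"
    and "square_integrable f \<Longrightarrow> square_integrable g \<Longrightarrow> cmod (B f g) \<le> N * L2_norm f * L2_norm g"
  using assms by (auto simp: bform_def)

lemma bform_swap:
  assumes "bform N B" shows "bform N (\<lambda>f g. B g f)"
proof -
  have "cmod (B g f) \<le> N * L2_norm f * L2_norm g" if "square_integrable f" "square_integrable g" for f g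
    using bformD(4)[OF assms that(2,1)] by (simp add: mult_ac)
  thus ?thesis using assms by (auto simp: bform_def)
qed

lemma bform_zero: "bform N B \<Longrightarrow> square_integrable g \<Longrightarrow> B (\<lambda>x. 0) g = 0"
  using bformD(3)[of N B "\<lambda>x. 0" g 0] by simp

lemma bform_diff:
  assumes "bform N B" "square_integrable f" "square_integrable f'" "square_integrable g"
  shows "B (\<lambda>x. f x - f' x) g = B f g - B f' g"
proof -
  have "B (\<lambda>x. f x - f' x) g = B (\<lambda>x. f x + (-1) * f' x) g" by simp
  also have "\<dots> = B f g + B (\<lambda>x. (-1) * f' x) g"
    by (rule bformD(2)[OF assms(1,2) square_integrable_scale[OF assms(3)] assms(4)])
  also have "B (\<lambda>x. (-1) * f' x) g = (-1) * B f' g" by (rule bformD(3)[OF assms(1,3,4)])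
  finally show ?thesis by simp
qed

lemma bform_sum:
  assumes B: "bform N B" and X: "\<And>t. t \<in> F \<Longrightarrow> square_integrable (X t)" and g: "square_integrable g"
  shows "B (\<lambda>x. \<Sum>t\<in>F. c t * X t x) g = (\<Sum>t\<in>F. c t * B (X t) g)"
  using X
proof (induction F rule: infinite_finite_induct)
  case (insert t F)
  have "B (\<lambda>x. \<Sum>t\<in>insert t F. c t * X t x) g = B (\<lambda>x. c t * X t x + (\<Sum>t\<in>F. c t * X t x)) g"
    using insert by simp
  also have "\<dots> = B (\<lambda>x. c t * X t x) g + B (\<lambda>x. \<Sum>t\<in>F. c t * X t x) g"
    using insert g by (intro bformD(2)[OF B] square_integrable_scale square_integrable_sum) auto
  also have "\<dots> = c t * B (X t) g + (\<Sum>t\<in>F. c t * B (X t) g)"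
    using insert g by (simp add: bformD(3)[OF B])
  finally show ?case using insert by simp
qed (use B g in \<open>auto simp: bform_zero\<close>)

lemmas bform_right = bformD(2,3)[OF bform_swap] bform_zero[OF bform_swap] bform_diff[OF bform_swap]
  bform_sum[OF bform_swap]

subsection \<open>Continuity of translations\<close>

lemma AE_coordinate_neq: "AE x in lborel. (x :: real^'n::finite) $ c \<noteq> a"
proof -
  have ax: "axis c (1::real) \<in> (Basis :: (real^'n) set)" by (simp add: axis_in_Basis_iff)
  have eq: "{x :: real^'n. x $ c = a} = {x. x \<bullet> axis c 1 = a}" by (auto simp: inner_axis)
  have "negligible {x :: real^'n. x $ c = a}"
    unfolding eq by (rule negligible_standard_hyperplane[OF ax])
  hence "{x :: real^'n. x $ c = a} \<in> null_sets (completion lborel)"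
    by (simp add: negligible_iff_null_sets)
  moreover have "{x :: real^'n. x $ c = a} \<in> sets lborel"
    by (auto intro!: borel_closed closed_Collect_eq continuous_intros)
  ultimately have "{x :: real^'n. x $ c = a} \<in> null_sets lborel"
    using null_sets_completion_iff by blast
  thus ?thesis by (rule AE_I') auto
qed

text \<open>Off the faces of the limit cube, which are null sets, the indicators converge pointwise.
  As the corners are bounded, all cubes lie in one box, whose indicator dominates.\<close>

lemma ind_qube_continuous:
  fixes y :: "nat \<Rightarrow> real^'n::finite"
  assumes "y \<longlonglongrightarrow> y0"
  shows "(\<lambda>n. L2_norm (\<lambda>x. ind (qube k (y n)) x - ind (qube k y0) x)) \<longlonglongrightarrow> 0"
proof -
  have yc: "(\<lambda>n. y n $ c) \<longlonglongrightarrow> y0 $ c" for c using assms by (rule tendsto_vec_nth)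
  obtain R where R: "\<And>n. norm (y n) \<le> R" using convergent_imp_Bseq[OF convergentI[OF assms]]
    by (auto simp: Bseq_def)
  have R0: "norm y0 \<le> R" using Lim_norm_ubound[OF sequentially_bot assms] R by simp
  define z :: "real^'n" where "z = (\<chi> c. R + 2 powi k)"
  have sub: "qube k v \<subseteq> cbox (-z) z" if "norm v \<le> R" for v
  proof
    fix x assume x: "x \<in> qube k v"
    have "- R - 2 powi k \<le> x $ c \<and> x $ c \<le> R + 2 powi k" for c
    proof -
      have "\<bar>v $ c\<bar> \<le> R" using component_le_norm_cart[of v c] that by linarith
      moreover have "v $ c \<le> x $ c" "x $ c < v $ c + 2 powi k" using x by (auto simp: qube_def)
      moreover have "(0::real) < 2 powi k" by simp
      ultimately show ?thesis by linarith
    qed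
    thus "x \<in> cbox (-z) z" by (auto simp: mem_box_cart z_def)
  qed
  have "(\<lambda>n. LINT x|lborel. (cmod (ind (qube k (y n)) x - ind (qube k y0) x))\<^sup>2)
      \<longlonglongrightarrow> (LINT x|(lborel::(real^'n) measure). 0)"
  proof (rule integral_dominated_convergence[where w = "indicator (cbox (-z) z)"])
    show "AE x in lborel. (\<lambda>n. (cmod (ind (qube k (y n)) x - ind (qube k y0) x))\<^sup>2) \<longlonglongrightarrow> 0"
    proof -
      have "AE x in lborel. \<forall>c. x $ c \<noteq> y0 $ c \<and> x $ c \<noteq> y0 $ c + 2 powi k"
        by (simp add: AE_all_countable AE_coordinate_neq)
      thus ?thesis
      proof eventually_elim
        case (elim x)
        have "eventually (\<lambda>n. (y n $ c \<le> x $ c \<and> x $ c < y n $ c + 2 powi k)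
            = (y0 $ c \<le> x $ c \<and> x $ c < y0 $ c + 2 powi k)) sequentially" for c
        proof -
          have "x $ c < y0 $ c \<or> x $ c > y0 $ c" using elim by (meson linorder_neqE)
          hence "eventually (\<lambda>n. (y n $ c \<le> x $ c) = (y0 $ c \<le> x $ c)) sequentially"
            using order_tendstoD[OF yc[of c], of "x $ c"] by (auto elim!: eventually_mono)
          moreover have c2: "(\<lambda>n. y n $ c + 2 powi k) \<longlonglongrightarrow> y0 $ c + 2 powi k"
            by (intro tendsto_intros yc)
          have "x $ c < y0 $ c + 2 powi k \<or> x $ c > y0 $ c + 2 powi k" using elim by (meson linorder_neqE)
          hence "eventually (\<lambda>n. (x $ c < y n $ c + 2 powi k) = (x $ c < y0 $ c + 2 powi k)) sequentially"
            using order_tendstoD[OF c2, of "x $ c"] by (auto elim!: eventually_mono)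
          ultimately show ?thesis by eventually_elim auto
        qed
        hence "eventually (\<lambda>n. \<forall>c\<in>UNIV. (y n $ c \<le> x $ c \<and> x $ c < y n $ c + 2 powi k)
            = (y0 $ c \<le> x $ c \<and> x $ c < y0 $ c + 2 powi k)) sequentially"
          by (intro eventually_ball_finite) auto
        hence "eventually (\<lambda>n. (cmod (ind (qube k (y n)) x - ind (qube k y0) x))\<^sup>2 = 0) sequentially"
          by eventually_elim (auto simp: qube_def indicator_def)
        thus ?case by (rule tendsto_eventually)
      qed
    qed
    fix n
    show "AE x in lborel. norm ((cmod (ind (qube k (y n)) x - ind (qube k y0) x))\<^sup>2) \<le> indicator (cbox (-z) z) x"
      using sub[OF R[of n]] sub[OF R0] by (auto simp: indicator_def)
  qed (use emeasure_lborel_cbox_finite[of "-z" z] in \<open>auto intro!: integrable_real_indicator\<close>)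
  hence "(\<lambda>n. (L2_norm (\<lambda>x. ind (qube k (y n)) x - ind (qube k y0) x))\<^sup>2) \<longlonglongrightarrow> 0"
    by (simp add: L2_norm_power2)
  hence "(\<lambda>n. sqrt ((L2_norm (\<lambda>x. ind (qube k (y n)) x - ind (qube k y0) x))\<^sup>2)) \<longlonglongrightarrow> sqrt 0"
    by (rule tendsto_real_sqrt)
  thus ?thesis by simp
qed

lemma L2_norm_qube: "L2_norm (ind (qube k y)) = sqrt (vl TYPE('n) k)" for y :: "real^'n::finite"
proof -
  have "(L2_norm (ind (qube k y)))\<^sup>2 = vl TYPE('n) k"
    by (subst square_integrable_ind(2)) (auto simp: emeasure_qube measure_qube)
  thus ?thesis by (metis L2_norm_nonneg real_sqrt_unique)
qed

text \<open>The source of measurability in the lattice: a form on indicators of cubes is continuous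
  in the corners, and the corners are measurable.\<close>

lemma bform_qube_continuous:
  assumes B: "bform N B"
  shows "continuous_on UNIV (\<lambda>p. B (ind (qube k (fst p))) (ind (qube l (snd p))))"
  unfolding continuous_on_sequentially
proof (intro ballI allI impI, unfold o_def)
  fix p0 :: "(real^'a) \<times> (real^'a)" and p
  assume "(\<forall>n. p n \<in> UNIV) \<and> p \<longlonglongrightarrow> p0"
  hence lim: "(\<lambda>n. fst (p n)) \<longlonglongrightarrow> fst p0" "(\<lambda>n. snd (p n)) \<longlonglongrightarrow> snd p0"
    by (auto intro: tendsto_fst tendsto_snd)
  define u where "u n = ind (qube k (fst (p n)))" for n
  define v where "v n = ind (qube l (snd (p n)))" for n
  define u0 where "u0 = ind (qube k (fst p0))"
  define v0 where "v0 = ind (qube l (snd p0))"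
  have sq: "square_integrable (u n)" "square_integrable (v n)" "square_integrable u0" "square_integrable v0" for n
    by (simp_all add: u_def v_def u0_def v0_def)
  have N0: "N \<ge> 0" using bformD(1)[OF B] .
  have "(\<lambda>n. B (u n) (v n) - B u0 v0) \<longlonglongrightarrow> 0"
  proof (rule Lim_null_comparison)
    show "eventually (\<lambda>n. norm (B (u n) (v n) - B u0 v0) \<le>
        N * sqrt (vl TYPE('a) k) * L2_norm (\<lambda>x. v n x - v0 x) + N * L2_norm (\<lambda>x. u n x - u0 x) * sqrt (vl TYPE('a) l)) sequentially"
    proof (rule always_eventually, rule allI)
      fix n
      have "B (u n) (v n) - B u0 v0 = B (u n) (\<lambda>x. v n x - v0 x) + B (\<lambda>x. u n x - u0 x) v0"
        using bform_diff[OF B sq(1)[of n] sq(3,4)] bform_right(4)[OF B sq(2)[of n] sq(4) sq(1)[of n]] by simp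
      hence "norm (B (u n) (v n) - B u0 v0) \<le> cmod (B (u n) (\<lambda>x. v n x - v0 x)) + cmod (B (\<lambda>x. u n x - u0 x) v0)"
        by (simp add: norm_triangle_ineq)
      also have "\<dots> \<le> N * L2_norm (u n) * L2_norm (\<lambda>x. v n x - v0 x) + N * L2_norm (\<lambda>x. u n x - u0 x) * L2_norm v0"
        by (intro add_mono bformD(4)[OF B] sq square_integrable_diff)
      finally show "norm (B (u n) (v n) - B u0 v0) \<le>
        N * sqrt (vl TYPE('a) k) * L2_norm (\<lambda>x. v n x - v0 x) + N * L2_norm (\<lambda>x. u n x - u0 x) * sqrt (vl TYPE('a) l)"
        by (simp add: u_def v0_def L2_norm_qube)
    qed
    have 1: "(\<lambda>n. L2_norm (\<lambda>x. v n x - v0 x)) \<longlonglongrightarrow> 0" "(\<lambda>n. L2_norm (\<lambda>x. u n x - u0 x)) \<longlonglongrightarrow> 0"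
      unfolding u_def v_def u0_def v0_def by (intro ind_qube_continuous lim)+
    show "(\<lambda>n. N * sqrt (vl TYPE('a) k) * L2_norm (\<lambda>x. v n x - v0 x) + N * L2_norm (\<lambda>x. u n x - u0 x) * sqrt (vl TYPE('a) l)) \<longlonglongrightarrow> 0"
      using tendsto_add[OF tendsto_mult_right[OF 1(1), of "N * sqrt (vl TYPE('a) k)"]
         tendsto_mult_left[OF tendsto_mult_right[OF 1(2), of N], of "sqrt (vl TYPE('a) l)"]] by (simp add: mult_ac)
  qed
  thus "(\<lambda>n. B (ind (qube k (fst (p n)))) (ind (qube l (snd (p n))))) \<longlonglongrightarrow> B (ind (qube k (fst p0))) (ind (qube l (snd p0)))"
    unfolding u_def v_def u0_def v0_def by (rule LIM_zero_cancel)
qed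

lemma bform_qube_measurable:
  fixes u v :: "'m \<Rightarrow> real^'n::finite"
  assumes B: "bform N B" and [measurable]: "u \<in> borel_measurable M" "v \<in> borel_measurable M"
  shows "(\<lambda>w. B (ind (qube k (u w))) (ind (qube l (v w)))) \<in> borel_measurable M"
proof -
  have "(\<lambda>p. B (ind (qube k (fst p))) (ind (qube l (snd p)))) \<in> borel_measurable borel"
    by (rule borel_measurable_continuous_onI[OF bform_qube_continuous[OF B]])
  from measurable_compose[OF _ this, of "\<lambda>w. (u w, v w)" M] show ?thesis by simp
qed

lemma bform_qube_measurable_right:
  fixes u :: "'m \<Rightarrow> real^'n::finite"
  assumes B: "bform N B" and f: "square_integrable f" and [measurable]: "u \<in> borel_measurable M"
  shows "(\<lambda>w. B f (ind (qube k (u w)))) \<in> borel_measurable M"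
proof -
  have "continuous_on UNIV (\<lambda>y. B f (ind (qube k y)))"
    unfolding continuous_on_sequentially
  proof (intro ballI allI impI, unfold o_def)
    fix y0 :: "real^'n" and y assume "(\<forall>n. y n \<in> UNIV) \<and> y \<longlonglongrightarrow> y0"
    hence lim: "y \<longlonglongrightarrow> y0" by simp
    have "(\<lambda>n. B f (ind (qube k (y n))) - B f (ind (qube k y0))) \<longlonglongrightarrow> 0"
    proof (rule Lim_null_comparison)
      show "eventually (\<lambda>n. norm (B f (ind (qube k (y n))) - B f (ind (qube k y0)))
          \<le> N * L2_norm f * L2_norm (\<lambda>x. ind (qube k (y n)) x - ind (qube k y0) x)) sequentially"
        using bform_right(4)[OF B sq_ind_qube sq_ind_qube f]
          bformD(4)[OF B f square_integrable_diff[OF sq_ind_qube sq_ind_qube]]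
        by (intro always_eventually allI) metis
      show "(\<lambda>n. N * L2_norm f * L2_norm (\<lambda>x. ind (qube k (y n)) x - ind (qube k y0) x)) \<longlonglongrightarrow> 0"
        using tendsto_mult_right[OF ind_qube_continuous[OF lim, of k], of "N * L2_norm f"] by (simp add: mult_ac)
    qed
    thus "(\<lambda>n. B f (ind (qube k (y n)))) \<longlonglongrightarrow> B f (ind (qube k y0))" by (rule LIM_zero_cancel)
  qed
  hence "(\<lambda>y. B f (ind (qube k y))) \<in> borel_measurable borel"
    by (rule borel_measurable_continuous_onI)
  from measurable_compose[OF _ this, of u M] show ?thesis by simp
qed

subsection \<open>The probability space of lattices\<close>

lemma zero_one_eq: "zero_one_vectors = rv ` (bits :: (int^'n::finite) set)"
proof (rule set_eqI)
  fix v :: "real^'n"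
  show "v \<in> zero_one_vectors \<longleftrightarrow> v \<in> rv ` bits"
  proof
    assume v: "v \<in> zero_one_vectors"
    hence "v = rv (\<chi> c. \<lfloor>v $ c\<rfloor>)" "(\<chi> c. \<lfloor>v $ c\<rfloor>) \<in> bits"
      by (auto simp: zero_one_vectors_def rv_def vec_eq_iff bits_def)
         (metis floor_one floor_zero of_int_0 of_int_1)+
    thus "v \<in> rv ` bits" by blast
  qed (auto simp: zero_one_vectors_def rv_def bits_def)
qed

lemma inj_rv: "inj rv" by (auto intro!: injI simp: rv_def vec_eq_iff)

lemma zov_finite [simp]: "finite (zero_one_vectors :: (real^'n::finite) set)" "(zero_one_vectors :: (real^'n) set) \<noteq> {}"
  and zov_card: "card (zero_one_vectors :: (real^'n) set) = 2 ^ CARD('n)"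
  unfolding zero_one_eq by (auto simp: card_image[OF inj_on_subset[OF inj_rv]] card_bits)

abbreviation digit_measure :: "(real^'n::finite) measure" where
  "digit_measure \<equiv> uniform_count_measure zero_one_vectors"

lemma prob_digit: "prob_space (digit_measure :: (real^'n::finite) measure)"
  by (rule prob_space_uniform_count_measure) auto

lemma prob_omega: "prob_space (omega_measure :: ('n::finite) digits measure)"
  unfolding omega_measure_def by (intro prob_space_PiM prob_digit)

lemma space_omega: "\<omega> \<in> space omega_measure \<longleftrightarrow> valid \<omega>"
  by (auto simp: omega_measure_def space_PiM valid_def PiE_def Pi_def zero_one_vectors_def space_uniform_count_measure)

lemma measurable_digit_count: "(\<lambda>\<omega>. \<omega> l) \<in> measurable omega_measure (count_space (zero_one_vectors :: (real^'n::finite) set))"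
proof -
  have "(\<lambda>\<omega>. \<omega> l) \<in> measurable omega_measure (digit_measure :: (real^'n) measure)"
    unfolding omega_measure_def by (rule measurable_component_singleton) simp
  thus ?thesis by (simp only: measurable_cong_sets[OF refl sets_uniform_count_measure_count_space])
qed

lemma measurable_digit [measurable]: "(\<lambda>\<omega>. \<omega> l) \<in> borel_measurable (omega_measure :: ('n::finite) digits measure)"
  by (rule measurable_compose[OF measurable_digit_count]) simp

lemma measurable_dg [measurable]:
  "(\<lambda>\<omega>. dg \<omega> l) \<in> measurable (omega_measure :: ('n::finite) digits measure) (count_space UNIV)"
  unfolding dg_def
  by (rule measurable_compose[OF measurable_digit_count]) simp

lemma measurable_anc [measurable]:
  "(\<lambda>\<omega>. anc \<omega> k r i) \<in> measurable (omega_measure :: ('n::finite) digits measure) (count_space UNIV)"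
proof (induction r)
  case (Suc r)
  have "(\<lambda>\<omega>. (\<lambda>j \<omega>. \<chi> c. (j $ c - dg \<omega> (k + int r) $ c) div 2) (anc \<omega> k r i) \<omega>)
     \<in> measurable (omega_measure :: 'n digits measure) (count_space UNIV)"
    by (rule measurable_compose_countable[OF _ Suc]) (rule measurable_compose[OF measurable_dg], simp)
  thus ?case by (simp add: par_def)
qed simp

lemma measurable_off [measurable]:
  "(\<lambda>\<omega>. off \<omega> k) \<in> borel_measurable (omega_measure :: ('n::finite) digits measure)"
proof -
  have "(\<lambda>\<omega>. \<Sum>n. (2 powi (k - 1 - int n)) *\<^sub>R \<omega> (k - 1 - int n)) \<in> borel_measurable (omega_measure :: 'n digits measure)"
    by (intro borel_measurable_suminf borel_measurable_scaleR measurable_digit) simp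
  moreover have "off \<omega> k = (\<Sum>n. (2 powi (k - 1 - int n)) *\<^sub>R \<omega> (k - 1 - int n))"
    if "\<omega> \<in> space (omega_measure :: 'n digits measure)" for \<omega>
    using sums_unique[OF off_summable(2)] that by (simp add: space_omega)
  ultimately show ?thesis by (simp cong: measurable_cong)
qed

lemma measurable_corner [measurable]:
  "(\<lambda>\<omega>. corner \<omega> k i) \<in> borel_measurable (omega_measure :: ('n::finite) digits measure)"
  unfolding corner_def by measurable

text \<open>Together with \<open>anc_upd\<close>, the shape in which independence of the digits is
  used: what is built from digits below \<open>l\<close> ignores a change of the digit
  \<open>l\<close>.\<close>

lemma off_upd: "l \<ge> k \<Longrightarrow> off (fun_upd \<omega> l v) k = off \<omega> k"
  unfolding off_def by (rule infsum_cong) auto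

lemma dg_upd: "dg (fun_upd \<omega> l v) k = (if k = l then (\<chi> c. \<lfloor>v $ c\<rfloor>) else dg \<omega> k)"
  by (simp add: dg_def)

lemma anc_upd: "l \<ge> k + int r \<Longrightarrow> anc (fun_upd \<omega> l v) k r i = anc \<omega> k r i"
  by (induction r) (auto simp: par_def dg_upd)

text \<open>The product measure splits off the coordinate \<open>l\<close>. As \<open>h\<close> and
  \<sigma> do not see it, the digit equals \<sigma> with conditional probability
  \<open>1 / 2 ^ CARD('n)\<close>, which the factor in front cancels.\<close>

lemma expect_digit:
  fixes h :: "('n::finite) digits \<Rightarrow> complex"
  assumes h [measurable]: "h \<in> borel_measurable omega_measure"
    and hb: "\<And>\<omega>. valid \<omega> \<Longrightarrow> cmod (h \<omega>) \<le> A"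
    and \<sigma> [measurable]: "\<sigma> \<in> measurable omega_measure (count_space UNIV)"
    and \<sigma>b: "\<And>\<omega>. \<sigma> \<omega> \<in> bits"
    and hu: "\<And>\<omega> v. h (fun_upd \<omega> l v) = h \<omega>" and \<sigma>u: "\<And>\<omega> v. \<sigma> (fun_upd \<omega> l v) = \<sigma> \<omega>"
  shows "(LINT \<omega>|omega_measure. complex_of_real (2 ^ CARD('n) * of_bool (dg \<omega> l = \<sigma> \<omega>)) * h \<omega>) = (LINT \<omega>|omega_measure. h \<omega>)"
proof -
  let ?D = "digit_measure :: (real^'n) measure"
  let ?R = "PiM (UNIV - {l}) (\<lambda>_. ?D)"
  let ?w = "\<lambda>\<omega>. complex_of_real (2 ^ CARD('n) * of_bool (dg \<omega> l = \<sigma> \<omega>))"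
  let ?U = "\<lambda>(x, X). fun_upd X l x"
  interpret D: prob_space ?D by (rule prob_digit)
  interpret R: prob_space ?R by (intro prob_space_PiM prob_digit)
  interpret P: pair_prob_space ?D ?R ..
  interpret O: prob_space "omega_measure :: 'n digits measure" by (rule prob_omega)
  have ins: "insert l (UNIV - {l}) = UNIV" by auto
  have dist: "distr (?D \<Otimes>\<^sub>M ?R) omega_measure ?U = omega_measure"
    using distr_pair_PiM_eq_PiM[of "UNIV - {l}" "\<lambda>_. ?D" l] prob_digit unfolding ins omega_measure_def by blast
  have U [measurable]: "?U \<in> measurable (?D \<Otimes>\<^sub>M ?R) omega_measure"
    unfolding omega_measure_def using measurable_add_dim[of l "UNIV - {l}" "\<lambda>_. ?D"]
    by (simp add: ins case_prod_unfold)
       (rule measurable_fun_upd[where J = "UNIV - {l}"], auto)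
  have main: "(LINT \<omega>|omega_measure. F \<omega>) = (LINT X|?R. LINT x|?D. F (fun_upd X l x))"
    if F [measurable]: "F \<in> borel_measurable omega_measure" and Fb: "\<And>\<omega>. valid \<omega> \<Longrightarrow> cmod (F \<omega>) \<le> K" for F :: "_ \<Rightarrow> complex" and K
  proof -
    have "(LINT \<omega>|omega_measure. F \<omega>) = (LINT \<omega>|distr (?D \<Otimes>\<^sub>M ?R) omega_measure ?U. F \<omega>)"
      by (simp only: dist)
    also have "\<dots> = (LINT p|(?D \<Otimes>\<^sub>M ?R). F (?U p))" by (rule integral_distr[OF U F])
    also have "\<dots> = (LINT p|(?D \<Otimes>\<^sub>M ?R). (case p of (x, X) \<Rightarrow> F (fun_upd X l x)))"
      by (simp add: case_prod_unfold)
    also have "\<dots> = (LINT X|?R. LINT x|?D. F (fun_upd X l x))"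
    proof (rule P.integral_snd[symmetric])
      have "integrable (?D \<Otimes>\<^sub>M ?R) (\<lambda>p. F (?U p))"
      proof (rule P.integrable_const_bound[where B = K])
        show "AE p in ?D \<Otimes>\<^sub>M ?R. cmod (F (?U p)) \<le> K"
          using measurable_space[OF U] by (intro AE_I2 Fb) (simp add: space_omega[symmetric])
      qed measurable
      thus "integrable (?D \<Otimes>\<^sub>M ?R) (case_prod (\<lambda>x X. F (fun_upd X l x)))"
        by (simp add: case_prod_unfold)
    qed
    finally show ?thesis .
  qed
  \<comment> \<open>The integral over the digit alone is a finite average, of which only the summand
    with the digit \<sigma> survives.\<close>
  have inner: "(LINT x|?D. ?w (fun_upd X l x) * h (fun_upd X l x)) = h X" for X
  proof -
    have "(LINT x|?D. ?w (fun_upd X l x) * h (fun_upd X l x))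
       = (\<Sum>x\<in>zero_one_vectors. (1 / real (card (zero_one_vectors::(real^'n) set))) *\<^sub>R (?w (fun_upd X l x) * h (fun_upd X l x)))"
      unfolding uniform_count_measure_def by (rule lebesgue_integral_point_measure_finite) auto
    also have "\<dots> = (\<Sum>x\<in>zero_one_vectors. of_bool ((\<chi> c. \<lfloor>x $ c\<rfloor>) = \<sigma> X) * h X)"
      by (intro sum.cong) (auto simp: hu \<sigma>u zov_card dg_upd scaleR_conv_of_real)
    also have "\<dots> = (\<Sum>v\<in>bits. of_bool (v = \<sigma> X) * h X)"
      unfolding zero_one_eq by (subst sum.reindex) (auto simp: inj_on_subset[OF inj_rv] rv_def)
    also have "\<dots> = h X" using \<sigma>b[of X] by (simp add: of_bool_def if_distrib[of "\<lambda>x. x * _"] cong: if_cong)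
    finally show ?thesis .
  qed
  have "(LINT \<omega>|omega_measure. ?w \<omega> * h \<omega>) = (LINT X|?R. LINT x|?D. ?w (fun_upd X l x) * h (fun_upd X l x))"
  proof (rule main)
    show "(\<lambda>\<omega>. ?w \<omega> * h \<omega>) \<in> borel_measurable omega_measure" by measurable
    fix \<omega> :: "int \<Rightarrow> real^'n" assume v: "valid \<omega>"
    have "cmod (?w \<omega>) \<le> 2 ^ CARD('n)" by (auto simp: norm_mult norm_power)
    thus "cmod (?w \<omega> * h \<omega>) \<le> 2 ^ CARD('n) * A"
      unfolding norm_mult by (intro mult_mono hb v) auto
  qed
  also have "\<dots> = (LINT X|?R. h X)" by (simp only: inner)
  also have "\<dots> = (LINT X|?R. LINT x|?D. h (fun_upd X l x))" by (simp add: hu D.prob_space)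
  also have "\<dots> = (LINT \<omega>|omega_measure. h \<omega>)" by (rule main[symmetric, OF h hb])
  finally show ?thesis .
qed

subsection \<open>Random weights\<close>

text \<open>The number of generations after which cubes with index difference \<delta> can be made
  to share an ancestor: the least \<open>r\<close> brings the ancestors to within one index, and
  \<open>Suc\<close> adds the generation in which the next digit may merge them. Equal cubes also
  have height 1.\<close>

definition hgt :: "int^'n::finite \<Rightarrow> nat" where
  "hgt \<delta> = Suc (LEAST r. \<forall>c. \<bar>\<delta> $ c\<bar> \<le> 2 ^ r)"

text \<open>
  If \<open>p\<close> and \<open>q\<close> differ by at most \<open>1\<close> in every coordinate, then \<open>sg p q\<close> is the only digit that gives
  the cubes with these indices the same parent. So the weight \<open>wt\<close> is \<open>2 ^ CARD('n)\<close> times the indicator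
  of an event of probability \<open>1 / 2 ^ CARD('n)\<close>.
\<close>

definition sg :: "int^'n \<Rightarrow> int^'n \<Rightarrow> int^'n::finite" where
  "sg p q = (\<chi> c. min (p $ c) (q $ c) mod 2)"

definition wt :: "'n digits \<Rightarrow> int \<Rightarrow> int^'n \<Rightarrow> int^'n::finite \<Rightarrow> real" where
  "wt \<omega> k i j = 2 ^ CARD('n) * of_bool (dg \<omega> (k + int (hgt (i - j) - 1))
      = sg (anc \<omega> k (hgt (i - j) - 1) i) (anc \<omega> k (hgt (i - j) - 1) j))"

lemma hgt_ex: "\<exists>r. \<forall>c. \<bar>(\<delta> :: int^'n::finite) $ c\<bar> \<le> 2 ^ r"
proof -
  define m where "m = (MAX c. nat \<bar>\<delta> $ c\<bar>)"
  have "\<bar>\<delta> $ c\<bar> \<le> 2 ^ m" for c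
  proof -
    have "nat \<bar>\<delta> $ c\<bar> \<le> m" unfolding m_def by (rule Max_ge) auto
    moreover have "m < 2 ^ m" by (rule less_exp)
    ultimately have "nat \<bar>\<delta> $ c\<bar> \<le> 2 ^ m" by linarith
    thus ?thesis by (metis nat_le_iff of_nat_numeral of_nat_power)
  qed
  thus ?thesis by blast
qed

lemma hgt_bound: "\<bar>\<delta> $ c\<bar> \<le> 2 ^ (hgt \<delta> - 1)"
  using LeastI_ex[OF hgt_ex[of \<delta>]] by (simp add: hgt_def)

lemma hgt_pos: "0 < hgt \<delta>" by (simp add: hgt_def)

text \<open>Minimality of the exponent; the bound becomes a distance between cubes in
  \<open>cube_sep\<close>.\<close>

lemma hgt_lower: "hgt \<delta> \<noteq> 1 \<Longrightarrow> \<exists>c. 2 ^ (hgt \<delta> - 2) < \<bar>\<delta> $ c\<bar>"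
proof -
  assume h: "hgt \<delta> \<noteq> 1"
  define L where "L = (LEAST r. \<forall>c. \<bar>\<delta> $ c\<bar> \<le> 2 ^ r)"
  have "hgt \<delta> = Suc L" by (simp add: hgt_def L_def)
  hence "L - 1 < L" "hgt \<delta> - 2 = L - 1" using h by auto
  from not_less_Least[OF this(1)[unfolded L_def]] this(2) show ?thesis
    by (auto simp: L_def not_le)
qed

lemma div2_close: "\<bar>p - q\<bar> \<le> 2 * M \<Longrightarrow> \<bar>(p - t) div 2 - (q - t) div 2\<bar> \<le> M" for p q t M :: int
  by presburger

text \<open>Both indices are corrected by the same digit before halving, so a difference of at most
  \<open>2 * M\<close> becomes one of at most \<open>M\<close> in spite of the rounding.\<close>

lemma anc_close: "\<forall>c. \<bar>i $ c - j $ c\<bar> \<le> 2 ^ m \<Longrightarrow> \<bar>anc \<omega> k m i $ c - anc \<omega> k m j $ c\<bar> \<le> 1"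
proof (induction m arbitrary: i j k)
  case (Suc m)
  have "\<forall>c. \<bar>par \<omega> k i $ c - par \<omega> k j $ c\<bar> \<le> 2 ^ m"
    using Suc.prems by (auto simp: par_def intro!: div2_close)
  from Suc.IH[OF this, of "k+1"] show ?case unfolding anc_Suc2 .
qed simp

lemma sg_bits: "sg p q \<in> bits"
  by (auto simp: sg_def bits_def)

text \<open>The digit has the parity of the smaller number, which becomes even after the
  subtraction; the other number exceeds it by at most 1 and has the same half.\<close>

lemma merge_div2: "\<bar>p - q\<bar> \<le> 1 \<Longrightarrow> (p - min p q mod 2) div 2 = (q - min p q mod 2) div 2" for p q :: int
  by presburger

text \<open>What the weight is for: where it does not vanish, the last digit merges two ancestors
  that \<open>anc_close\<close> has brought to within one index.\<close>

lemma wt_merge: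
  assumes "wt \<omega> k i j \<noteq> 0"
  shows "anc \<omega> k (hgt (i - j)) i = anc \<omega> k (hgt (i - j)) j"
proof -
  define m where "m = hgt (i - j) - 1"
  have h: "hgt (i - j) = Suc m" using hgt_pos[of "i - j"] by (simp add: m_def)
  have cl: "\<bar>anc \<omega> k m i $ c - anc \<omega> k m j $ c\<bar> \<le> 1" for c
    by (rule anc_close) (use hgt_bound[of "i - j"] in \<open>simp add: m_def\<close>)
  have "dg \<omega> (k + int m) = sg (anc \<omega> k m i) (anc \<omega> k m j)"
    using assms by (simp add: wt_def h split: if_splits)
  thus ?thesis using merge_div2[OF cl] by (simp add: h par_def sg_def vec_eq_iff)
qed

lemma wt_bounds: "0 \<le> wt \<omega> k i j" "wt \<omega> k i j \<le> 2 ^ CARD('n)" for i j :: "int^'n::finite"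
  by (auto simp: wt_def)

lemma measurable_sg_anc:
  "(\<lambda>\<omega>. sg (anc \<omega> k r i) (anc \<omega> k r j)) \<in> measurable (omega_measure :: ('n::finite) digits measure) (count_space UNIV)"
proof -
  have 1: "(\<lambda>\<omega>. sg p (anc \<omega> k r j)) \<in> measurable (omega_measure :: 'n digits measure) (count_space UNIV)" for p
    by (rule measurable_compose[OF measurable_anc]) simp
  have "(\<lambda>\<omega>. (\<lambda>p \<omega>. sg p (anc \<omega> k r j)) (anc \<omega> k r i) \<omega>)
     \<in> measurable (omega_measure :: 'n digits measure) (count_space UNIV)"
    by (rule measurable_compose_countable[OF _ measurable_anc]) (rule 1)
  thus ?thesis by simp
qed

lemma measurable_wt [measurable]:
  "(\<lambda>\<omega>. wt \<omega> k i j) \<in> borel_measurable (omega_measure :: ('n::finite) digits measure)"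
proof -
  define r where "r = hgt (i - j) - 1"
  have [measurable]: "(\<lambda>\<omega>. sg (anc \<omega> k r i) (anc \<omega> k r j)) \<in> measurable (omega_measure :: 'n digits measure) (count_space UNIV)"
    by (rule measurable_sg_anc)
  show ?thesis unfolding wt_def r_def[symmetric] by measurable
qed

text \<open>The weight compares one digit of generation at least \<open>k\<close> with a value
  computed from ancestors, that is from lower digits, while \<open>h\<close> ignores all digits from
  \<open>k\<close> on.\<close>

lemma expect_wt:
  fixes h :: "('n::finite) digits \<Rightarrow> complex"
  assumes h: "h \<in> borel_measurable omega_measure"
    and hb: "\<And>\<omega>. valid \<omega> \<Longrightarrow> cmod (h \<omega>) \<le> A"
    and hu: "\<And>\<omega> l v. l \<ge> k \<Longrightarrow> h (fun_upd \<omega> l v) = h \<omega>"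
  shows "(LINT \<omega>|omega_measure. complex_of_real (wt \<omega> k i j) * h \<omega>) = (LINT \<omega>|omega_measure. h \<omega>)"
proof -
  define r where "r = hgt (i - j) - 1"
  have m: "(\<lambda>\<omega>. sg (anc \<omega> k r i) (anc \<omega> k r j)) \<in> measurable (omega_measure :: 'n digits measure) (count_space UNIV)"
    by (rule measurable_sg_anc)
  show ?thesis unfolding wt_def r_def[symmetric]
    by (rule expect_digit[OF h hb m]) (auto simp: sg_bits hu anc_upd)
qed

subsection \<open>Expectations of countable sums\<close>

text \<open>A bound for all finite absolute sums that is uniform on the space allows summation and
  integration to be exchanged. The index set is carried to the natural numbers, with zeros off the
  range of \<open>to_nat\<close>.\<close>

lemma expect_infsum:
  fixes \<theta> :: "'i::countable \<Rightarrow> 'a \<Rightarrow> complex"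
  assumes M: "prob_space M" and meas [measurable]: "\<And>i. \<theta> i \<in> borel_measurable M"
    and bd: "\<And>x F. x \<in> space M \<Longrightarrow> finite F \<Longrightarrow> (\<Sum>i\<in>F. cmod (\<theta> i x)) \<le> A"
  shows "integrable M (\<lambda>x. \<Sum>\<^sub>\<infinity>i. \<theta> i x)"
    and "((\<lambda>i. LINT x|M. \<theta> i x) has_sum (LINT x|M. (\<Sum>\<^sub>\<infinity>i. \<theta> i x))) UNIV"
    and "\<And>x. x \<in> space M \<Longrightarrow> (\<lambda>i. cmod (\<theta> i x)) summable_on UNIV"
    and "\<And>x. x \<in> space M \<Longrightarrow> (\<Sum>\<^sub>\<infinity>i. cmod (\<theta> i x)) \<le> A"
proof -
  interpret prob_space M by fact
  show abs: "(\<lambda>i. cmod (\<theta> i x)) summable_on UNIV" if "x \<in> space M" for x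
    by (rule nonneg_bdd_above_summable_on) (use bd[OF that] in \<open>auto intro!: bdd_aboveI\<close>)
  show "(\<Sum>\<^sub>\<infinity>i. cmod (\<theta> i x)) \<le> A" if "x \<in> space M" for x
    by (rule infsum_le_finite_sums[OF abs[OF that]]) (use bd[OF that] in auto)
  have A: "A \<ge> 0" using bd[of _ "{}"] not_empty by auto
  define \<psi> where "\<psi> n x = (if n \<in> range (to_nat :: 'i \<Rightarrow> nat) then \<theta> (from_nat n) x else 0)" for n x
  have [measurable]: "\<psi> n \<in> borel_measurable M" for n unfolding \<psi>_def by simp
  have psi_to: "\<psi> (to_nat i) x = \<theta> i x" for i x by (simp add: \<psi>_def)
  hence psi_fun: "\<psi> (to_nat i) = \<theta> i" for i by blast
  have bdp: "(\<Sum>n<N. cmod (\<psi> n x)) \<le> A" if "x \<in> space M" for N x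
  proof -
    have "(\<Sum>n<N. cmod (\<psi> n x)) = (\<Sum>n\<in>to_nat ` {i::'i. to_nat i < N}. cmod (\<psi> n x))"
      by (rule sum.mono_neutral_right) (auto simp: \<psi>_def)
    also have "\<dots> = (\<Sum>i\<in>{i::'i. to_nat i < N}. cmod (\<theta> i x))"
      by (subst sum.reindex) (auto intro!: inj_on_subset[OF inj_to_nat] simp: psi_to)
    also have "\<dots> \<le> A"
      by (rule bd[OF that]) (rule finite_imageD[OF finite_subset[of _ "{..<N}"]], auto intro!: inj_on_subset[OF inj_to_nat])
    finally show ?thesis .
  qed
  have smx: "summable (\<lambda>n. cmod (\<psi> n x))" if "x \<in> space M" for x
    by (rule bounded_imp_summable[where B = A]) (use bdp[OF that, of "Suc _"] in \<open>auto simp: lessThan_Suc_atMost\<close>)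
  have int: "integrable M (\<psi> n)" for n
  proof (rule integrable_const_bound[where B = A])
    show "AE x in M. cmod (\<psi> n x) \<le> A"
    proof (rule AE_I2)
      fix x assume x: "x \<in> space M"
      show "cmod (\<psi> n x) \<le> A"
        using order_trans[OF member_le_sum[of n "{..<Suc n}" "\<lambda>n. cmod (\<psi> n x)"] bdp[OF x, of "Suc n"]] by simp
    qed
  qed simp
  have ae: "AE x in M. summable (\<lambda>n. norm (\<psi> n x))" using smx by (rule AE_I2)
  have sm: "summable (\<lambda>n. LINT x|M. norm (\<psi> n x))"
  proof (rule bounded_imp_summable[where B = A])
    fix n
    have "(\<Sum>k\<le>n. LINT x|M. norm (\<psi> k x)) = (LINT x|M. (\<Sum>k\<le>n. norm (\<psi> k x)))"
      using int by (intro Bochner_Integration.integral_sum[symmetric]) auto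
    also have "\<dots> \<le> (LINT x|M. A)"
      by (intro integral_mono Bochner_Integration.integrable_sum integrable_norm int)
         (use bdp[of _ "Suc n"] in \<open>auto simp: lessThan_Suc_atMost\<close>)
    also have "\<dots> = A" by (simp add: prob_space)
    finally show "(\<Sum>k\<le>n. LINT x|M. norm (\<psi> k x)) \<le> A" .
  qed (auto intro!: integral_nonneg_AE)
  have eq: "(\<Sum>n. \<psi> n x) = (\<Sum>\<^sub>\<infinity>i. \<theta> i x)" if "x \<in> space M" for x
  proof -
    have "(\<lambda>n. \<psi> n x) summable_on UNIV" by (rule norm_summable_imp_summable_on) (rule smx[OF that])
    hence "(\<Sum>n. \<psi> n x) = (\<Sum>\<^sub>\<infinity>n. \<psi> n x)"
      using has_sum_imp_sums[OF has_sum_infsum] sums_unique by metis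
    also have "\<dots> = (\<Sum>\<^sub>\<infinity>n\<in>range (to_nat :: 'i \<Rightarrow> nat). \<psi> n x)"
      by (rule infsum_cong_neutral) (auto simp: \<psi>_def)
    also have "\<dots> = (\<Sum>\<^sub>\<infinity>i. \<theta> i x)"
      by (subst infsum_reindex) (auto simp: psi_to o_def)
    finally show ?thesis .
  qed
  have "integrable M (\<lambda>x. \<Sum>n. \<psi> n x)" by (rule integrable_suminf[OF int ae sm])
  thus "integrable M (\<lambda>x. \<Sum>\<^sub>\<infinity>i. \<theta> i x)"
    by (rule Bochner_Integration.integrable_cong[THEN iffD1, rotated -1]) (auto simp: eq)
  have inteq: "(\<Sum>n. LINT x|M. \<psi> n x) = (LINT x|M. (\<Sum>\<^sub>\<infinity>i. \<theta> i x))"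
    unfolding integral_suminf[OF int ae sm, symmetric]
    by (rule Bochner_Integration.integral_cong) (auto simp: eq)
  have "summable (\<lambda>n. norm (LINT x|M. \<psi> n x))"
    by (rule summable_comparison_test[OF _ sm]) (auto intro!: exI[of _ 0] integral_norm_bound)
  hence "(\<lambda>n. LINT x|M. \<psi> n x) summable_on UNIV" by (rule norm_summable_imp_summable_on)
  hence "((\<lambda>n. LINT x|M. \<psi> n x) has_sum (LINT x|M. (\<Sum>\<^sub>\<infinity>i. \<theta> i x))) UNIV"
    using has_sum_infsum has_sum_imp_sums sums_unique inteq by metis
  hence "((\<lambda>n. LINT x|M. \<psi> n x) has_sum (LINT x|M. (\<Sum>\<^sub>\<infinity>i. \<theta> i x))) (range (to_nat :: 'i \<Rightarrow> nat))"
    by (rule has_sum_cong_neutral[THEN iffD1, rotated -1]) (auto simp: \<psi>_def)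
  thus "((\<lambda>i. LINT x|M. \<theta> i x) has_sum (LINT x|M. (\<Sum>\<^sub>\<infinity>i. \<theta> i x))) UNIV"
    by (subst (asm) has_sum_reindex) (auto simp: psi_fun o_def)
qed

subsection \<open>Sums over trees of cubes\<close>

definition av :: "'n digits \<Rightarrow> ('n::finite) fn \<Rightarrow> int \<Rightarrow> int^'n \<Rightarrow> complex" where
  "av \<omega> f k i = pairing f (ind (cub \<omega> k i)) / vl TYPE('n) k"

text \<open>The squared norm of the martingale difference of \<open>f\<close> on one cube.\<close>

definition al2 :: "'n digits \<Rightarrow> ('n::finite) fn \<Rightarrow> int \<Rightarrow> int^'n \<Rightarrow> real" where
  "al2 \<omega> f k i = (\<Sum>\<theta>\<in>bits. (cmod (pairing f (phc \<omega> k i \<theta>)))\<^sup>2 / vl TYPE('n) (k - 1))"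

text \<open>A sum over \<open>n\<close> generations of descendants, the cube itself being the first.
  The recursion through the children is the shape in which the Bessel and Carleson estimates are
  proved by induction.\<close>

primrec tsum :: "'n digits \<Rightarrow> (int \<Rightarrow> int^'n::finite \<Rightarrow> real) \<Rightarrow> nat \<Rightarrow> int \<Rightarrow> int^'n \<Rightarrow> real" where
  "tsum \<omega> w 0 = (\<lambda>k i. 0)"
| "tsum \<omega> w (Suc n) = (\<lambda>k i. w k i + (\<Sum>\<theta>\<in>bits. tsum \<omega> w n (k - 1) (chl \<omega> k i \<theta>)))"

definition desc :: "'n digits \<Rightarrow> nat \<Rightarrow> int \<Rightarrow> int^'n \<Rightarrow> (int \<times> (int^'n::finite)) set" where
  "desc \<omega> n k i = {(k - int s, j) | s j. s < n \<and> anc \<omega> (k - int s) s j = i}"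

lemma sum_UN_le:
  fixes w :: "'b \<Rightarrow> real"
  assumes "finite I" "\<And>i. i \<in> I \<Longrightarrow> finite (A i)" "\<And>x. w x \<ge> 0"
  shows "sum w (\<Union>i\<in>I. A i) \<le> (\<Sum>i\<in>I. sum w (A i))"
  using assms(1,2)
proof (induction I rule: finite_induct)
  case (insert i I)
  have "sum w (\<Union>j\<in>insert i I. A j) + sum w (A i \<inter> (\<Union>j\<in>I. A j)) = sum w (A i) + sum w (\<Union>j\<in>I. A j)"
    using insert by (simp add: sum.union_inter)
  moreover have "0 \<le> sum w (A i \<inter> (\<Union>j\<in>I. A j))" by (intro sum_nonneg assms(3))
  ultimately show ?case using insert by simp
qed simp

lemma mem_desc: "(l, j) \<in> desc \<omega> n k i \<longleftrightarrow> (\<exists>s<n. l = k - int s \<and> anc \<omega> l s j = i)"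
  unfolding desc_def by blast

lemma desc_Suc: "desc \<omega> (Suc n) k i = insert (k, i) (\<Union>\<theta>\<in>bits. desc \<omega> n (k - 1) (chl \<omega> k i \<theta>))"
proof -
  have step: "anc \<omega> (k - 1 - int s) (Suc s) j = i \<longleftrightarrow>
      (\<exists>\<theta>\<in>bits. anc \<omega> (k - 1 - int s) s j = chl \<omega> k i \<theta>)" for s j
    using par_eq_iff[of \<omega> k "anc \<omega> (k - 1 - int s) s j" i] by (simp add: algebra_simps)
  have ex: "(\<exists>s<Suc n. P s) \<longleftrightarrow> P 0 \<or> (\<exists>s<n. P (Suc s))" for P :: "nat \<Rightarrow> bool"
    by (metis Suc_less_eq not0_implies_Suc zero_less_Suc)
  have shift: "k - int (Suc s) = k - 1 - int s" for s by simp
  have 1: "(l, j) \<in> desc \<omega> (Suc n) k i \<longleftrightarrow> (l, j) = (k, i) \<or> (\<exists>s<n. l = k - 1 - int s \<and> anc \<omega> l (Suc s) j = i)" for l j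
    unfolding mem_desc ex shift by auto
  have 2: "(\<exists>s<n. l = k - 1 - int s \<and> anc \<omega> l (Suc s) j = i) \<longleftrightarrow>
      (\<exists>\<theta>\<in>bits. (l, j) \<in> desc \<omega> n (k - 1) (chl \<omega> k i \<theta>))" for l j
    unfolding mem_desc using step by blast
  show ?thesis by (rule set_eqI) (use 1 2 in auto)
qed

lemma tsum_ge:
  assumes w: "\<And>k i. w k i \<ge> 0" and F: "finite F" "F \<subseteq> desc \<omega> n k i"
  shows "(\<Sum>(k, i)\<in>F. w k i) \<le> tsum \<omega> w n k i"
  using F
proof (induction n arbitrary: F k i)
  case 0 thus ?case by (simp add: desc_def)
next
  case (Suc n)
  have w': "0 \<le> (case x of (k, i) \<Rightarrow> w k i)" for x using w by (cases x) auto
  let ?D = "\<lambda>\<theta>. F \<inter> desc \<omega> n (k - 1) (chl \<omega> k i \<theta>)"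
  have "(\<Sum>(k, i)\<in>F. w k i) \<le> (\<Sum>(k, i)\<in>insert (k, i) (\<Union>\<theta>\<in>bits. ?D \<theta>). w k i)"
    using Suc.prems w' by (intro sum_mono2) (auto simp: desc_Suc)
  also have "\<dots> \<le> w k i + (\<Sum>(k, i)\<in>(\<Union>\<theta>\<in>bits. ?D \<theta>). w k i)"
    using Suc.prems(1) w by (simp add: sum.insert_if)
  also have "(\<Sum>(k, i)\<in>(\<Union>\<theta>\<in>bits. ?D \<theta>). w k i) \<le> (\<Sum>\<theta>\<in>bits. \<Sum>(k, i)\<in>?D \<theta>. w k i)"
    using Suc.prems(1) w' by (intro sum_UN_le) auto
  also have "\<dots> \<le> (\<Sum>\<theta>\<in>bits. tsum \<omega> w n (k - 1) (chl \<omega> k i \<theta>))"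
    using Suc.prems(1) by (intro sum_mono Suc.IH) auto
  finally show ?case by simp
qed

text \<open>A finite set of cubes lies below finitely many cubes of its coarsest generation, so a
  bound for single trees and one within a single generation suffice.\<close>

lemma tree_bound:
  fixes F :: "(int \<times> (int^'n::finite)) set"
  assumes w: "\<And>k i. w k i \<ge> 0" and F: "finite F"
    and t: "\<And>n k i. tsum \<omega> w n k i \<le> Mf k i"
    and M: "\<And>k A. finite A \<Longrightarrow> (\<Sum>i\<in>A. Mf k i) \<le> M"
  shows "(\<Sum>(k, i)\<in>F. w k i) \<le> M"
proof (cases "F = {}")
  case True
  thus ?thesis using M[of "{}" 0] by simp
next
  case False
  define b where "b = Max (fst ` F)"
  define n where "n = Suc (nat (b - Min (fst ` F)))"
  define A where "A = (\<lambda>(k, i). anc \<omega> k (nat (b - k)) i) ` F"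
  have w': "0 \<le> (case x of (k, i) \<Rightarrow> w k i)" for x using w by (cases x) auto
  have sub: "F \<subseteq> (\<Union>q\<in>A. F \<inter> desc \<omega> n b q)"
  proof
    fix p assume p: "p \<in> F"
    obtain k i where ki: "p = (k, i)" by (cases p)
    have kF: "k \<in> fst ` F" using p ki by force
    have k: "k \<le> b" "Min (fst ` F) \<le> k" using F kF unfolding b_def by auto
    define s where "s = nat (b - k)"
    have ks: "k = b - int s" using k by (simp add: s_def)
    have "s < n" using k by (simp add: s_def n_def)
    hence "(k, i) \<in> desc \<omega> n b (anc \<omega> k s i)"
      unfolding desc_def using ks by auto
    moreover have "anc \<omega> k s i \<in> A" using p ki by (force simp: A_def s_def)
    ultimately show "p \<in> (\<Union>q\<in>A. F \<inter> desc \<omega> n b q)" using p ki by blast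
  qed
  have fA: "finite A" using F by (simp add: A_def)
  have "(\<Sum>(k, i)\<in>F. w k i) \<le> (\<Sum>(k, i)\<in>(\<Union>q\<in>A. F \<inter> desc \<omega> n b q). w k i)"
    using sub F fA w' by (intro sum_mono2) auto
  also have "\<dots> \<le> (\<Sum>q\<in>A. \<Sum>(k, i)\<in>F \<inter> desc \<omega> n b q. w k i)"
    using F fA w' by (intro sum_UN_le) auto
  also have "\<dots> \<le> (\<Sum>q\<in>A. Mf b q)"
    using F by (intro sum_mono order_trans[OF tsum_ge[where w = w] t] w) auto
  also have "\<dots> \<le> M" by (rule M[OF fA])
  finally show ?thesis .
qed

lemma tsum_scale: "tsum \<omega> (\<lambda>k i. c * w k i) n k i = c * tsum \<omega> w n k i"
  by (induction n arbitrary: k i) (auto simp: sum_distrib_left algebra_simps)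

lemma tsum_add: "tsum \<omega> (\<lambda>k i. w k i + w' k i) n k i = tsum \<omega> w n k i + tsum \<omega> w' n k i"
  by (induction n arbitrary: k i) (auto simp: sum.distrib algebra_simps)

lemma tsum_nonneg: "(\<And>k i. w k i \<ge> 0) \<Longrightarrow> tsum \<omega> w n k i \<ge> 0"
  by (induction n arbitrary: k i) (auto intro!: add_nonneg_nonneg sum_nonneg)

subsection \<open>Bessel's inequality\<close>

lemma ind_children:
  assumes "valid \<omega>"
  shows "(indicator (cub \<omega> k i) x :: 'b::{comm_semiring_1}) = (\<Sum>\<theta>\<in>bits. indicator (cub \<omega> (k-1) (chl \<omega> k i \<theta>)) x)"
proof (cases "x \<in> cub \<omega> k i")
  case True
  then obtain t where t: "t \<in> bits" "x \<in> cub \<omega> (k-1) (chl \<omega> k i t)"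
    using mem_cub_chl_iff[OF assms] by blast
  have "(\<Sum>\<theta>\<in>bits. indicator (cub \<omega> (k-1) (chl \<omega> k i \<theta>)) x) = (\<Sum>\<theta>\<in>bits. of_bool (\<theta> = t) :: 'b)"
  proof (intro sum.cong refl)
    fix \<theta>
    show "indicator (cub \<omega> (k-1) (chl \<omega> k i \<theta>)) x = (of_bool (\<theta> = t) :: 'b)"
      using t chl_inj[of \<omega> k i \<theta> i t] by (cases "\<theta> = t") (auto simp: mem_cub_iff indicator_def)
  qed
  also have "\<dots> = 1" using t by (simp add: of_bool_def)
  finally show ?thesis using True by simp
next
  case False
  thus ?thesis using mem_cub_chl_iff[OF assms, of x k i] by (auto simp: indicator_def intro!: sum.neutral[symmetric])
qed

definition mass :: "'n digits \<Rightarrow> (real^'n \<Rightarrow> real) \<Rightarrow> int \<Rightarrow> int^'n::finite \<Rightarrow> real" where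
  "mass \<omega> h k i = (LINT x|lborel. indicator (cub \<omega> k i) x * h x)"

lemma integrable_ind_mult:
  assumes "integrable lborel (h :: real^'n::finite \<Rightarrow> real)"
  shows "integrable lborel (\<lambda>x. indicator (cub \<omega> k i) x * h x)"
  using integrable_mult_indicator[of "cub \<omega> k i" lborel h] assms by simp

lemma mass_children:
  assumes v: "valid \<omega>" and h: "\<And>k i. integrable lborel (\<lambda>x. indicator (cub \<omega> k i) x * h x)"
  shows "mass \<omega> h k i = (\<Sum>\<theta>\<in>bits. mass \<omega> h (k-1) (chl \<omega> k i \<theta>))"
  unfolding mass_def ind_children[OF v, of k i] sum_distrib_right
  by (rule Bochner_Integration.integral_sum) (rule h)

lemma mass_sum_le:
  assumes h: "integrable lborel h" and h0: "\<And>x. h x \<ge> 0" and A: "finite A"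
  shows "(\<Sum>i\<in>A. mass \<omega> h k i) \<le> (LINT x|lborel. h x)"
proof -
  have "(\<Sum>i\<in>A. mass \<omega> h k i) = (LINT x|lborel. (\<Sum>i\<in>A. indicator (cub \<omega> k i) x * h x))"
    unfolding mass_def by (rule Bochner_Integration.integral_sum[symmetric]) (rule integrable_ind_mult[OF h])
  also have "\<dots> \<le> (LINT x|lborel. h x)"
  proof (rule integral_mono)
    fix x
    have "(\<Sum>i\<in>A. indicator (cub \<omega> k i) x * h x) = (\<Sum>i\<in>A. of_bool (i = pidx \<omega> k x) * h x)"
      by (intro sum.cong) (auto simp: indicator_def mem_cub_iff)
    also have "\<dots> \<le> h x" using A h0[of x] by (simp add: of_bool_def if_distrib[of "\<lambda>z. z * _"] cong: if_cong)
    finally show "(\<Sum>i\<in>A. indicator (cub \<omega> k i) x * h x) \<le> h x" .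
  qed (use integrable_ind_mult[OF h] h in auto)
  finally show ?thesis .
qed

lemma abs_av_le:
  fixes f :: "('n::finite) fn"
  assumes f: "square_integrable f"
  shows "cmod (pairing f (ind (cub \<omega> k i))) \<le> mass \<omega> (\<lambda>x. cmod (f x)) k i"
    and "(mass \<omega> (\<lambda>x. cmod (f x)) k i)\<^sup>2 \<le> vl TYPE('n) k * mass \<omega> (\<lambda>x. (cmod (f x))\<^sup>2) k i"
    and "integrable lborel (\<lambda>x. indicator (cub \<omega> k i) x * cmod (f x))"
proof -
  have c: "cmod (indicator A x) = indicator A x" for A and x :: "real^'n" by (simp add: indicator_def)
  show int: "integrable lborel (\<lambda>x. indicator (cub \<omega> k i) x * cmod (f x))"
    using integrable_pairing(2)[OF sq_ind_cub f] by (simp add: c)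
  have "cmod (pairing f (ind (cub \<omega> k i))) \<le> (LINT x|lborel. cmod (f x * ind (cub \<omega> k i) x))"
    unfolding pairing_def by (rule integral_norm_bound)
  thus "cmod (pairing f (ind (cub \<omega> k i))) \<le> mass \<omega> (\<lambda>x. cmod (f x)) k i"
    by (simp add: mass_def norm_mult c mult.commute)
  have isq: "integrable lborel (\<lambda>x. (indicator (cub \<omega> k i) x * cmod (f x))\<^sup>2)"
  proof -
    have "(\<lambda>x. (indicator (cub \<omega> k i) x * cmod (f x))\<^sup>2) = (\<lambda>x. indicator (cub \<omega> k i) x * (cmod (f x))\<^sup>2)"
      by (auto simp: indicator_def)
    thus ?thesis using integrable_ind_mult[OF square_integrableD(2)[OF f], of \<omega> k i] by simp
  qed
  have "mass \<omega> (\<lambda>x. cmod (f x)) k i = (LINT x|lborel. indicator (cub \<omega> k i) x * (indicator (cub \<omega> k i) x * cmod (f x)))"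
    unfolding mass_def by (intro Bochner_Integration.integral_cong) (auto simp: indicator_def)
  also have "\<dots> \<le> sqrt (LINT x|lborel. (indicator (cub \<omega> k i) x)\<^sup>2) * sqrt (LINT x|lborel. (indicator (cub \<omega> k i) x * cmod (f x))\<^sup>2)"
  proof (rule Cauchy_Schwarz_integral[OF _ isq])
    have "integrable lborel (indicator (cub \<omega> k i) :: _ \<Rightarrow> real)"
      by (rule integrable_real_indicator) (auto simp: emeasure_cub)
    moreover have "(\<lambda>x. (indicator (cub \<omega> k i) x :: real)\<^sup>2) = indicator (cub \<omega> k i)"
      by (auto simp: indicator_def)
    ultimately show "integrable lborel (\<lambda>x. (indicator (cub \<omega> k i) x :: real)\<^sup>2)" by simp
    have "(\<lambda>x. indicator (cub \<omega> k i) x * (indicator (cub \<omega> k i) x * cmod (f x))) = (\<lambda>x. indicator (cub \<omega> k i) x * cmod (f x))"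
      by (auto simp: indicator_def)
    thus "integrable lborel (\<lambda>x. indicator (cub \<omega> k i) x * (indicator (cub \<omega> k i) x * cmod (f x)))"
      using int by simp
  qed
  also have "(LINT x|lborel. (indicator (cub \<omega> k i) x :: real)\<^sup>2) = vl TYPE('n) k"
  proof -
    have "(\<lambda>x. (indicator (cub \<omega> k i) x :: real)\<^sup>2) = indicator (cub \<omega> k i)" by (auto simp: indicator_def)
    thus ?thesis by (simp add: measure_cub)
  qed
  also have "(LINT x|lborel. (indicator (cub \<omega> k i) x * cmod (f x))\<^sup>2) = mass \<omega> (\<lambda>x. (cmod (f x))\<^sup>2) k i"
    unfolding mass_def by (intro Bochner_Integration.integral_cong) (auto simp: indicator_def power_mult_distrib)
  finally have le: "mass \<omega> (\<lambda>x. cmod (f x)) k i \<le> sqrt (vl TYPE('n) k) * sqrt (mass \<omega> (\<lambda>x. (cmod (f x))\<^sup>2) k i)" .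
  have m0: "0 \<le> mass \<omega> (\<lambda>x. cmod (f x)) k i" "0 \<le> mass \<omega> (\<lambda>x. (cmod (f x))\<^sup>2) k i"
    unfolding mass_def by (auto intro!: integral_nonneg_AE)
  show "(mass \<omega> (\<lambda>x. cmod (f x)) k i)\<^sup>2 \<le> vl TYPE('n) k * mass \<omega> (\<lambda>x. (cmod (f x))\<^sup>2) k i"
    using power_mono[OF le m0(1), of 2] m0 by (simp add: power_mult_distrib)
qed

lemma pairing_phc:
  fixes f :: "('n::finite) fn"
  assumes "valid \<omega>" "square_integrable f"
  shows "pairing f (phc \<omega> k i \<theta>) = vl TYPE('n) (k-1) * (av \<omega> f (k-1) (chl \<omega> k i \<theta>) - av \<omega> f k i)"
proof -
  have "phc \<omega> k i \<theta> = (\<lambda>x. ind (cub \<omega> (k-1) (chl \<omega> k i \<theta>)) x - (1 / 2 ^ CARD('n)) * ind (cub \<omega> k i) x)"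
    by (rule ext) (simp add: phc_eq[OF assms(1)])
  hence "pairing f (phc \<omega> k i \<theta>) = pairing f (ind (cub \<omega> (k-1) (chl \<omega> k i \<theta>))) - (1 / 2 ^ CARD('n)) * pairing f (ind (cub \<omega> k i))"
    using pairing_diff_right[OF assms(2) sq_ind_cub square_integrable_scale[OF sq_ind_cub]]
    by (simp only: pairing_scale_right)
  thus ?thesis by (simp add: av_def vl_diff_1 right_diff_distrib)
qed

lemma pairing_children:
  assumes "valid \<omega>" "square_integrable f"
  shows "pairing f (ind (cub \<omega> k i)) = (\<Sum>\<theta>\<in>bits. pairing f (ind (cub \<omega> (k-1) (chl \<omega> k i \<theta>))))"
proof -
  have "ind (cub \<omega> k i) = (\<lambda>x. \<Sum>\<theta>\<in>bits. ind (cub \<omega> (k-1) (chl \<omega> k i \<theta>)) x)"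
    by (rule ext) (rule ind_children[OF assms(1)])
  thus ?thesis using assms by (simp add: pairing_sum_right)
qed

lemma av_children:
  fixes f :: "('n::finite) fn"
  assumes "valid \<omega>" "square_integrable f"
  shows "(\<Sum>\<theta>\<in>bits. av \<omega> f (k-1) (chl \<omega> k i \<theta>)) = 2 ^ CARD('n) * av \<omega> f k i"
  unfolding av_def pairing_children[OF assms, of k i] by (simp add: vl_diff_1 sum_divide_distrib sum_distrib_left mult.commute)

lemma al2_nonneg: "al2 \<omega> f k i \<ge> 0"
  unfolding al2_def by (intro sum_nonneg divide_nonneg_nonneg) auto

text \<open>The variance identity: \<open>al2\<close> is the volume-weighted sum of the squared
  deviations of the averages on the children from their mean, which is the average on the
  cube.\<close>

lemma al2_eq:
  fixes f :: "('n::finite) fn"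
  assumes "valid \<omega>" "square_integrable f"
  shows "al2 \<omega> f k i + vl TYPE('n) k * (cmod (av \<omega> f k i))\<^sup>2
    = (\<Sum>\<theta>\<in>bits. vl TYPE('n) (k-1) * (cmod (av \<omega> f (k-1) (chl \<omega> k i \<theta>)))\<^sup>2)"
proof -
  define a where "a = av \<omega> f k i"
  define b where "b \<theta> = av \<omega> f (k-1) (chl \<omega> k i \<theta>)" for \<theta>
  define V where "V = vl TYPE('n) (k-1)"
  have V: "V > 0" by (simp add: V_def)
  have Vk: "vl TYPE('n) k = 2 ^ CARD('n) * V" by (simp add: V_def vl_diff_1)
  have sq: "(cmod (z - a))\<^sup>2 = (cmod z)\<^sup>2 - 2 * Re (z * cnj a) + (cmod a)\<^sup>2" for z
    unfolding cmod_power2 by (simp add: power2_eq_square algebra_simps)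
  have aa: "Re (a * cnj a) = (cmod a)\<^sup>2" by (simp add: complex_mult_cnj cmod_power2)
  have "al2 \<omega> f k i = (\<Sum>\<theta>\<in>bits. V * (cmod (b \<theta> - a))\<^sup>2)"
    unfolding al2_def pairing_phc[OF assms] using V
    by (simp add: norm_mult power_mult_distrib a_def b_def V_def power2_eq_square mult_ac)
  also have "\<dots> = V * (\<Sum>\<theta>\<in>bits. (cmod (b \<theta>))\<^sup>2) - 2 * V * Re ((\<Sum>\<theta>\<in>bits. b \<theta>) * cnj a) + 2 ^ CARD('n) * V * (cmod a)\<^sup>2"
    by (simp add: sq sum.distrib sum_subtractf sum_distrib_left algebra_simps card_bits sum_distrib_right)
  also have "Re ((\<Sum>\<theta>\<in>bits. b \<theta>) * cnj a) = 2 ^ CARD('n) * (cmod a)\<^sup>2"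
  proof -
    have "(\<Sum>\<theta>\<in>bits. b \<theta>) * cnj a = complex_of_real (2 ^ CARD('n)) * (a * cnj a)"
      using av_children[OF assms, of k i] by (simp add: b_def a_def)
    thus ?thesis using aa by (simp only: Re_complex_of_real times_complex.sel Im_complex_of_real mult_zero_left diff_zero)
  qed
  finally show ?thesis unfolding a_def[symmetric] b_def[symmetric] V_def[symmetric] Vk
    by (simp add: sum_distrib_left algebra_simps)
qed

text \<open>The squared average is kept on the left because it is what the next coarser generation
  consumes in the induction.\<close>

lemma bessel_tree:
  fixes f :: "('n::finite) fn"
  assumes v: "valid \<omega>" and f: "square_integrable f"
  shows "tsum \<omega> (al2 \<omega> f) n k i + vl TYPE('n) k * (cmod (av \<omega> f k i))\<^sup>2 \<le> mass \<omega> (\<lambda>x. (cmod (f x))\<^sup>2) k i"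
proof (induction n arbitrary: k i)
  case 0
  have "(cmod (pairing f (ind (cub \<omega> k i))))\<^sup>2 \<le> (mass \<omega> (\<lambda>x. cmod (f x)) k i)\<^sup>2"
    by (intro power_mono abs_av_le f) auto
  also have "\<dots> \<le> vl TYPE('n) k * mass \<omega> (\<lambda>x. (cmod (f x))\<^sup>2) k i" by (rule abs_av_le[OF f])
  finally show ?case
    by (simp add: av_def norm_divide power_divide power2_eq_square[of "vl _ _"] field_simps)
next
  case (Suc n)
  have "tsum \<omega> (al2 \<omega> f) (Suc n) k i + vl TYPE('n) k * (cmod (av \<omega> f k i))\<^sup>2
     = (\<Sum>\<theta>\<in>bits. tsum \<omega> (al2 \<omega> f) n (k-1) (chl \<omega> k i \<theta>) + vl TYPE('n) (k-1) * (cmod (av \<omega> f (k-1) (chl \<omega> k i \<theta>)))\<^sup>2)"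
    using al2_eq[OF v f, of k i] by (simp add: sum.distrib)
  also have "\<dots> \<le> (\<Sum>\<theta>\<in>bits. mass \<omega> (\<lambda>x. (cmod (f x))\<^sup>2) (k-1) (chl \<omega> k i \<theta>))"
    by (intro sum_mono Suc)
  also have "\<dots> = mass \<omega> (\<lambda>x. (cmod (f x))\<^sup>2) k i"
    by (rule mass_children[OF v integrable_ind_mult[OF square_integrableD(2)[OF f]], symmetric])
  finally show ?case .
qed

lemma bessel:
  fixes f :: "('n::finite) fn"
  assumes v: "valid \<omega>" and f: "square_integrable f" and F: "finite F"
  shows "(\<Sum>(k, i)\<in>F. al2 \<omega> f k i) \<le> (L2_norm f)\<^sup>2"
proof (rule tree_bound[where Mf = "mass \<omega> (\<lambda>x. (cmod (f x))\<^sup>2)" and \<omega> = \<omega>])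
  fix n k i
  have "0 \<le> vl TYPE('n) k * (cmod (av \<omega> f k i))\<^sup>2" by simp
  thus "tsum \<omega> (al2 \<omega> f) n k i \<le> mass \<omega> (\<lambda>x. (cmod (f x))\<^sup>2) k i"
    using bessel_tree[OF v f, of n k i] by linarith
next
  fix k and A :: "(int^'n) set" assume "finite A"
  thus "(\<Sum>i\<in>A. mass \<omega> (\<lambda>x. (cmod (f x))\<^sup>2) k i) \<le> (L2_norm f)\<^sup>2"
    unfolding L2_norm_power2 by (intro mass_sum_le square_integrableD(2)[OF f]) auto
qed (auto simp: al2_nonneg F)

text \<open>Bessel's inequality for the functional \<open>B u\<close>, by duality and without
  representing it by a function: the combination \<open>s\<close> tests the functional against its
  own coefficients.\<close>

lemma bessel_functional:
  fixes u :: "('n::finite) fn"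
  assumes v: "valid \<omega>" and B: "bform N B" and u: "square_integrable u" and F: "finite F"
  shows "(\<Sum>(k, i)\<in>F. \<Sum>\<theta>\<in>bits. (cmod (B u (phc \<omega> k i \<theta>)))\<^sup>2 / vl TYPE('n) (k-1)) \<le> (N * L2_norm u)\<^sup>2"
proof -
  let ?P = "F \<times> (bits :: (int^'n) set)"
  define V where "V = (\<lambda>p :: (int \<times> (int^'n)) \<times> (int^'n). vl TYPE('n) (fst (fst p) - 1))"
  define \<Phi> where "\<Phi> = (\<lambda>p :: (int \<times> (int^'n)) \<times> (int^'n). phc \<omega> (fst (fst p)) (snd (fst p)) (snd p))"
  define Z where "Z = (\<Sum>p\<in>?P. (cmod (B u (\<Phi> p)))\<^sup>2 / V p)"
  define c where "c p = cnj (B u (\<Phi> p)) / complex_of_real (V p)" for p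
  define s where "s = (\<lambda>x. \<Sum>p\<in>?P. c p * \<Phi> p x)"
  have V: "V p > 0" for p by (simp add: V_def)
  have N: "N \<ge> 0" using bformD(1)[OF B] .
  have sq: "square_integrable (\<Phi> p)" for p by (simp add: \<Phi>_def)
  have ssq: "square_integrable s" unfolding s_def by (intro square_integrable_sum square_integrable_scale sq)
  have Z0: "Z \<ge> 0" unfolding Z_def using V by (intro sum_nonneg divide_nonneg_pos) auto
  have Bs: "B u s = complex_of_real Z"
    unfolding s_def bform_right(5)[OF B sq u] Z_def of_real_sum
    by (intro sum.cong refl) (simp add: c_def complex_norm_square[symmetric] mult.commute of_real_power[symmetric] del: of_real_power)
  have al: "(\<Sum>p\<in>?P. (cmod (pairing h (\<Phi> p)))\<^sup>2 / V p) \<le> (L2_norm h)\<^sup>2" if "square_integrable h" for h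
  proof -
    have "(\<Sum>p\<in>?P. (cmod (pairing h (\<Phi> p)))\<^sup>2 / V p) = (\<Sum>(k,i)\<in>F. al2 \<omega> h k i)"
      unfolding al2_def \<Phi>_def V_def by (simp add: sum.cartesian_product' case_prod_unfold)
    thus ?thesis using bessel[OF v that F] by simp
  qed
  \<comment> \<open>The dual of Bessel's inequality: a combination of frame vectors is bounded by
    the square sum of its coefficients. It is obtained by pairing \<open>s\<close> with its
    conjugate.\<close>
  have ns: "L2_norm s \<le> sqrt Z"
  proof -
    define h where "h = (\<lambda>x. cnj (s x))"
    have hsq: "square_integrable h" unfolding h_def by (rule square_integrable_cnj[OF ssq])
    have nh: "L2_norm h = L2_norm s" by (simp add: h_def)
    have "(L2_norm s)\<^sup>2 = cmod (pairing s h)" by (simp add: h_def pairing_cnj_self norm_power)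
    also have "pairing s h = (\<Sum>p\<in>?P. c p * pairing (\<Phi> p) h)"
      unfolding s_def by (subst bform_sum[OF bform_pairing]) (auto simp: sq hsq)
    also have "cmod \<dots> \<le> (\<Sum>p\<in>?P. (sqrt (V p) * cmod (c p)) * (cmod (pairing h (\<Phi> p)) / sqrt (V p)))"
      using V by (intro order_trans[OF norm_sum] sum_mono) (auto simp: norm_mult pairing_commute less_imp_neq[THEN not_sym])
    also have "\<dots> \<le> sqrt (\<Sum>p\<in>?P. (sqrt (V p) * cmod (c p))\<^sup>2) * sqrt (\<Sum>p\<in>?P. (cmod (pairing h (\<Phi> p)) / sqrt (V p))\<^sup>2)"
      unfolding real_sqrt_mult[symmetric] by (rule real_le_rsqrt[OF Cauchy_Schwarz_ineq_sum])
    also have "(\<Sum>p\<in>?P. (sqrt (V p) * cmod (c p))\<^sup>2) = Z"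
    proof -
      have sq: "(sqrt v * (b / v))\<^sup>2 = b\<^sup>2 / v" if "v > 0" for v b :: real
        using that by (simp add: power_mult_distrib power_divide power2_eq_square[of v])
      have "cmod (c p) = cmod (B u (\<Phi> p)) / V p" for p using V[of p] by (simp add: c_def norm_divide)
      thus ?thesis unfolding Z_def by (simp only: sq[OF V])
    qed
    also have "(\<Sum>p\<in>?P. (cmod (pairing h (\<Phi> p)) / sqrt (V p))\<^sup>2) = (\<Sum>p\<in>?P. (cmod (pairing h (\<Phi> p)))\<^sup>2 / V p)"
      using V by (intro sum.cong) (auto simp: power_divide less_imp_le)
    also have "sqrt Z * sqrt \<dots> \<le> sqrt Z * L2_norm s"
      using al[OF hsq] Z0 by (intro mult_left_mono real_le_lsqrt) (auto simp: nh intro!: sum_nonneg divide_nonneg_pos V)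
    finally have "L2_norm s * L2_norm s \<le> sqrt Z * L2_norm s" by (simp add: power2_eq_square)
    thus ?thesis using L2_norm_nonneg[of s] Z0 by (cases "L2_norm s = 0") (auto simp: mult_le_cancel_right)
  qed
  have "Z = cmod (B u s)" unfolding Bs using Z0 by simp
  also have "\<dots> \<le> N * L2_norm u * L2_norm s" by (rule bformD(4)[OF B u ssq])
  also have "\<dots> \<le> N * L2_norm u * sqrt Z" using ns N by (intro mult_left_mono) auto
  finally have "sqrt Z * sqrt Z \<le> N * L2_norm u * sqrt Z" using Z0 by simp
  hence "sqrt Z \<le> N * L2_norm u"
    using Z0 N by (cases "Z = 0") (auto simp del: real_sqrt_mult_self simp: mult_le_cancel_right)
  hence "(sqrt Z)\<^sup>2 \<le> (N * L2_norm u)\<^sup>2" using Z0 by (intro power_mono) auto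
  hence "Z \<le> (N * L2_norm u)\<^sup>2" using Z0 by simp
  moreover have "Z = (\<Sum>(k, i)\<in>F. \<Sum>\<theta>\<in>bits. (cmod (B u (phc \<omega> k i \<theta>)))\<^sup>2 / vl TYPE('n) (k-1))"
    unfolding Z_def \<Phi>_def V_def by (simp add: sum.cartesian_product' case_prod_unfold)
  ultimately show ?thesis by simp
qed

subsection \<open>Absolute bounds for shifts\<close>

text \<open>Indices of the triples of a shift; \<open>k\<close> is the generation of the common
  ancestor, which is determined by \<open>i\<close> and therefore not stored.\<close>

definition tri :: "'n digits \<Rightarrow> nat \<Rightarrow> nat \<Rightarrow> (int \<times> (int^'n) \<times> (int^'n::finite)) set" where
  "tri \<omega> m n = {(k, i, j). anc \<omega> (k - int m) m i = anc \<omega> (k - int n) n j}"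

text \<open>Each \<open>i\<close> has at most \<open>2 ^ (CARD('n) * n)\<close> partners
  \<open>j\<close> below the same ancestor, and the denominator pays for them.\<close>

lemma fiber_sum:
  fixes a :: "int \<Rightarrow> int^'n::finite \<Rightarrow> real"
  assumes F: "finite F" "F \<subseteq> tri \<omega> m n" and a: "\<And>k i. a k i \<ge> 0"
    and A: "\<And>G. finite G \<Longrightarrow> (\<Sum>(k, i)\<in>G. a k i) \<le> A"
  shows "(\<Sum>(k, i, j)\<in>F. a (k - int m) i / 2 ^ (CARD('n) * n)) \<le> A"
proof -
  let ?p = "\<lambda>(k, i, j :: int^'n). (k :: int, i :: int^'n)"
  have "(\<Sum>(k, i, j)\<in>F. a (k - int m) i / 2 ^ (CARD('n) * n))
      = (\<Sum>q\<in>?p ` F. \<Sum>x\<in>{x\<in>F. ?p x = q}. (case x of (k, i, j) \<Rightarrow> a (k - int m) i / 2 ^ (CARD('n) * n)))"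
    using F(1) by (rule sum.image_gen)
  also have "\<dots> \<le> (\<Sum>q\<in>?p ` F. a (fst q - int m) (snd q))"
  proof (rule sum_mono)
    fix q assume "q \<in> ?p ` F"
    obtain k i where q: "q = (k, i)" by (cases q)
    let ?J = "{j. anc \<omega> (k - int n) n j = anc \<omega> (k - int m) m i}"
    have sub: "{x\<in>F. ?p x = q} \<subseteq> (\<lambda>j. (k, i, j)) ` ?J"
      using F(2) by (auto simp: q tri_def)
    have J: "finite ?J" "card ?J \<le> 2 ^ (CARD('n) * n)" using desc_finite_card by blast+
    have "card {x\<in>F. ?p x = q} \<le> card ((\<lambda>j. (k, i, j)) ` ?J)"
      using sub J by (intro card_mono) auto
    also have "\<dots> \<le> card ?J" using J by (intro card_image_le)
    finally have c: "card {x\<in>F. ?p x = q} \<le> 2 ^ (CARD('n) * n)" using J by linarith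
    have "(\<Sum>x\<in>{x\<in>F. ?p x = q}. (case x of (k, i, j) \<Rightarrow> a (k - int m) i / 2 ^ (CARD('n) * n)))
        = (\<Sum>x\<in>{x\<in>F. ?p x = q}. a (k - int m) i / 2 ^ (CARD('n) * n))"
      by (rule sum.cong) (auto simp: q)
    also have "\<dots> = real (card {x\<in>F. ?p x = q}) * (a (k - int m) i / 2 ^ (CARD('n) * n))" by simp
    also have "\<dots> \<le> real (2 ^ (CARD('n) * n)) * (a (k - int m) i / 2 ^ (CARD('n) * n))"
      using c a by (intro mult_right_mono) (auto simp del: of_nat_power)
    also have "\<dots> = a (k - int m) i" by simp
    finally show "(\<Sum>x\<in>{x\<in>F. ?p x = q}. (case x of (k, i, j) \<Rightarrow> a (k - int m) i / 2 ^ (CARD('n) * n))) \<le> a (fst q - int m) (snd q)"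
      by (simp add: q)
  qed
  also have "\<dots> = (\<Sum>(k, i)\<in>(\<lambda>q. (fst q - int m, snd q)) ` ?p ` F. a k i)"
    by (subst (2) sum.reindex) (auto intro!: inj_onI simp: prod_eq_iff)
  also have "\<dots> \<le> A" by (rule A) (use F in auto)
  finally show ?thesis .
qed

lemma tri_swap: "(k, i, j) \<in> tri \<omega> m n \<longleftrightarrow> (k, j, i) \<in> tri \<omega> n m"
  by (auto simp: tri_def)

text \<open>Cauchy-Schwarz over triples. The quotient of volumes is the square root of the
  reciprocals of the two partner counts, so that in effect each cube counts once and the bound does
  not depend on the complexity.\<close>

lemma tri_bound:
  fixes a b :: "int \<Rightarrow> int^'n::finite \<Rightarrow> real"
  assumes F: "finite F" "F \<subseteq> tri \<omega> m n" and a: "\<And>k i. a k i \<ge> 0" and b: "\<And>k i. b k i \<ge> 0"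
    and A: "\<And>G. finite G \<Longrightarrow> (\<Sum>(k, i)\<in>G. a k i) \<le> A\<^sup>2" "A \<ge> 0"
    and B: "\<And>G. finite G \<Longrightarrow> (\<Sum>(k, i)\<in>G. b k i) \<le> B\<^sup>2" "B \<ge> 0"
  shows "(\<Sum>(k, i, j)\<in>F. sqrt (vl TYPE('n) (k - int m) * a (k - int m) i) * sqrt (vl TYPE('n) (k - int n) * b (k - int n) j) / vl TYPE('n) k) \<le> A * B"
proof -
  have F': "(\<lambda>(k,i,j). (k,j,i)) ` F \<subseteq> tri \<omega> n m" using F(2) tri_swap by fast
  have vv: "sqrt (vl TYPE('n) (k - int m) * x) * sqrt (vl TYPE('n) (k - int n) * y) / vl TYPE('n) k
      = sqrt (x / 2 ^ (CARD('n) * n)) * sqrt (y / 2 ^ (CARD('n) * m))" for k x y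
  proof -
    have 1: "vl TYPE('n) (k - int m) = vl TYPE('n) k / 2 ^ (CARD('n) * m)" for m
      using vl_add_nat[where 'n = 'n, of "k - int m" m] by simp
    have "sqrt (vl TYPE('n) (k - int m) * x) * sqrt (vl TYPE('n) (k - int n) * y)
       = sqrt ((vl TYPE('n) k)\<^sup>2) * (sqrt (x / 2 ^ (CARD('n) * n)) * sqrt (y / 2 ^ (CARD('n) * m)))"
      unfolding 1 real_sqrt_mult[symmetric] by (simp add: power2_eq_square field_simps)
    thus ?thesis by simp
  qed
  have "(\<Sum>(k, i, j)\<in>F. sqrt (vl TYPE('n) (k - int m) * a (k - int m) i) * sqrt (vl TYPE('n) (k - int n) * b (k - int n) j) / vl TYPE('n) k)
     = (\<Sum>x\<in>F. (case x of (k,i,j) \<Rightarrow> sqrt (a (k - int m) i / 2 ^ (CARD('n) * n))) * (case x of (k,i,j) \<Rightarrow> sqrt (b (k - int n) j / 2 ^ (CARD('n) * m))))"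
    by (intro sum.cong) (auto simp: vv)
  also have "\<dots> \<le> sqrt (\<Sum>x\<in>F. (case x of (k,i,j) \<Rightarrow> sqrt (a (k - int m) i / 2 ^ (CARD('n) * n)))\<^sup>2)
      * sqrt (\<Sum>x\<in>F. (case x of (k,i,j) \<Rightarrow> sqrt (b (k - int n) j / 2 ^ (CARD('n) * m)))\<^sup>2)"
    unfolding real_sqrt_mult[symmetric] by (rule real_le_rsqrt[OF Cauchy_Schwarz_ineq_sum])
  also have "(\<Sum>x\<in>F. (case x of (k,i,j) \<Rightarrow> sqrt (a (k - int m) i / 2 ^ (CARD('n) * n)))\<^sup>2) = (\<Sum>(k,i,j)\<in>F. a (k - int m) i / 2 ^ (CARD('n) * n))"
    by (intro sum.cong) (auto simp: a)
  also have "(\<Sum>x\<in>F. (case x of (k,i,j) \<Rightarrow> sqrt (b (k - int n) j / 2 ^ (CARD('n) * m)))\<^sup>2) = (\<Sum>(k,i,j)\<in>(\<lambda>(k,i,j). (k,j,i)) ` F. b (k - int n) i / 2 ^ (CARD('n) * m))"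
    by (subst sum.reindex) (auto intro!: sum.cong inj_onI simp: b)
  also have "sqrt (\<Sum>(k,i,j)\<in>F. a (k - int m) i / 2 ^ (CARD('n) * n)) * sqrt (\<Sum>(k,i,j)\<in>(\<lambda>(k,i,j). (k,j,i)) ` F. b (k - int n) i / 2 ^ (CARD('n) * m)) \<le> A * B"
  proof (rule mult_mono)
    show "sqrt (\<Sum>(k,i,j)\<in>F. a (k - int m) i / 2 ^ (CARD('n) * n)) \<le> A"
      by (rule real_le_lsqrt) (use fiber_sum[OF F a A(1)] A(2) a in \<open>auto intro!: sum_nonneg\<close>)
    show "sqrt (\<Sum>(k,i,j)\<in>(\<lambda>(k,i,j). (k,j,i)) ` F. b (k - int n) i / 2 ^ (CARD('n) * m)) \<le> B"
      by (rule real_le_lsqrt) (use fiber_sum[OF _ F' b B(1)] F(1) B(2) b in \<open>auto intro!: sum_nonneg\<close>)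
  qed (use A B a b in \<open>auto intro!: real_sqrt_ge_zero sum_nonneg\<close>)
  finally show ?thesis .
qed

lemma pairing_phc_le:
  fixes f :: "('n::finite) fn"
  assumes "\<theta> \<in> bits"
  shows "cmod (pairing f (phc \<omega> k i \<theta>)) \<le> sqrt (vl TYPE('n) k * al2 \<omega> f k i)"
proof (rule real_le_rsqrt)
  have "(cmod (pairing f (phc \<omega> k i \<theta>)))\<^sup>2 / vl TYPE('n) (k-1) \<le> al2 \<omega> f k i"
    unfolding al2_def by (rule member_le_sum[OF assms]) auto
  hence "(cmod (pairing f (phc \<omega> k i \<theta>)))\<^sup>2 \<le> vl TYPE('n) (k-1) * al2 \<omega> f k i"
    by (simp add: pos_divide_le_eq mult.commute)
  also have "\<dots> \<le> vl TYPE('n) k * al2 \<omega> f k i"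
    by (intro mult_right_mono al2_nonneg) (simp add: vl_diff_1 divide_le_eq)
  finally show "(cmod (pairing f (phc \<omega> k i \<theta>)))\<^sup>2 \<le> vl TYPE('n) k * al2 \<omega> f k i" .
qed

subsection \<open>The Carleson embedding\<close>

text \<open>Joint convexity of \<open>a\<^sup>2 / b\<close>, in the form that the induction over
  children with the Bellman function needs.\<close>

lemma sedrakyan:
  fixes a b :: "'t \<Rightarrow> real"
  assumes "finite I" "I \<noteq> {}" "\<And>i. i \<in> I \<Longrightarrow> b i > 0"
  shows "(\<Sum>i\<in>I. a i)\<^sup>2 / (\<Sum>i\<in>I. b i) \<le> (\<Sum>i\<in>I. (a i)\<^sup>2 / b i)"
proof -
  have pos: "(\<Sum>i\<in>I. b i) > 0" using assms by (intro sum_pos) auto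
  have "(\<Sum>i\<in>I. a i)\<^sup>2 = (\<Sum>i\<in>I. (a i / sqrt (b i)) * sqrt (b i))\<^sup>2"
    using assms(3) by (intro arg_cong[where f = "\<lambda>x. x\<^sup>2"] sum.cong) (auto simp: less_imp_neq[THEN not_sym])
  also have "\<dots> \<le> (\<Sum>i\<in>I. (a i / sqrt (b i))\<^sup>2) * (\<Sum>i\<in>I. (sqrt (b i))\<^sup>2)" by (rule Cauchy_Schwarz_ineq_sum)
  also have "\<dots> = (\<Sum>i\<in>I. (a i)\<^sup>2 / b i) * (\<Sum>i\<in>I. b i)"
    using assms(3) by (intro arg_cong2[where f = "(*)"] sum.cong) (auto simp: power_divide less_imp_le)
  finally show ?thesis using pos by (simp add: pos_divide_le_eq)
qed

text \<open>Induction with the Bellman function \<open>4 (F - f\<^sup>2 / (1 + M))\<close>.\<close>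

lemma carleson_tree:
  fixes f :: "('n::finite) fn"
  assumes v: "valid \<omega>" and f: "square_integrable f" and \<mu>: "\<And>k i. \<mu> k i \<ge> 0"
    and car: "\<And>n k i. tsum \<omega> \<mu> n k i \<le> vl TYPE('n) k"
  shows "tsum \<omega> (\<lambda>k i. \<mu> k i * (mass \<omega> (\<lambda>x. cmod (f x)) k i / vl TYPE('n) k)\<^sup>2) n k i
    \<le> 4 * (mass \<omega> (\<lambda>x. (cmod (f x))\<^sup>2) k i - (mass \<omega> (\<lambda>x. cmod (f x)) k i)\<^sup>2 / (vl TYPE('n) k + tsum \<omega> \<mu> n k i))"
proof (induction n arbitrary: k i)
  case 0
  show ?case using abs_av_le(2)[OF f, of \<omega> k i] by (simp add: pos_divide_le_eq mult.commute)
next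
  case (Suc n)
  define a where "a = mass \<omega> (\<lambda>x. cmod (f x)) k i"
  define V where "V = vl TYPE('n) k"
  define c where "c \<theta> = chl \<omega> k i \<theta>" for \<theta>
  define m' where "m' = (\<Sum>\<theta>\<in>bits. tsum \<omega> \<mu> n (k-1) (c \<theta>))"
  define q where "q = \<mu> k i"
  define a' where "a' \<theta> = mass \<omega> (\<lambda>x. cmod (f x)) (k-1) (c \<theta>)" for \<theta>
  define b' where "b' \<theta> = vl TYPE('n) (k-1) + tsum \<omega> \<mu> n (k-1) (c \<theta>)" for \<theta>
  have V: "V > 0" by (simp add: V_def)
  have m'0: "m' \<ge> 0" unfolding m'_def by (intro sum_nonneg tsum_nonneg \<mu>)
  have q0: "q \<ge> 0" by (simp add: q_def \<mu>)
  have mV: "q + m' \<le> V" using car[of "Suc n" k i] by (simp add: q_def m'_def V_def c_def)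
  have b'pos: "b' \<theta> > 0" for \<theta>
    unfolding b'_def by (intro add_pos_nonneg tsum_nonneg \<mu>) auto
  have sb: "(\<Sum>\<theta>\<in>bits. b' \<theta>) = V + m'"
    by (simp add: b'_def sum.distrib m'_def V_def card_bits vl_diff_1)
  have sa: "(\<Sum>\<theta>\<in>bits. a' \<theta>) = a"
    unfolding a_def a'_def c_def by (rule mass_children[OF v abs_av_le(3)[OF f], symmetric])
  have sF: "(\<Sum>\<theta>\<in>bits. mass \<omega> (\<lambda>x. (cmod (f x))\<^sup>2) (k-1) (c \<theta>)) = mass \<omega> (\<lambda>x. (cmod (f x))\<^sup>2) k i"
    unfolding c_def by (rule mass_children[OF v integrable_ind_mult[OF square_integrableD(2)[OF f]], symmetric])
  have "tsum \<omega> (\<lambda>k i. \<mu> k i * (mass \<omega> (\<lambda>x. cmod (f x)) k i / vl TYPE('n) k)\<^sup>2) (Suc n) k i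
     \<le> q * (a / V)\<^sup>2 + (\<Sum>\<theta>\<in>bits. 4 * (mass \<omega> (\<lambda>x. (cmod (f x))\<^sup>2) (k-1) (c \<theta>) - (a' \<theta>)\<^sup>2 / b' \<theta>))"
    using Suc by (auto simp: q_def a_def V_def a'_def b'_def c_def intro!: sum_mono)
  also have "\<dots> = q * (a / V)\<^sup>2 + 4 * (mass \<omega> (\<lambda>x. (cmod (f x))\<^sup>2) k i - (\<Sum>\<theta>\<in>bits. (a' \<theta>)\<^sup>2 / b' \<theta>))"
    by (simp only: sum_distrib_left[symmetric] sum_subtractf sF)
  also have "\<dots> \<le> q * (a / V)\<^sup>2 + 4 * (mass \<omega> (\<lambda>x. (cmod (f x))\<^sup>2) k i - a\<^sup>2 / (V + m'))"
    using sedrakyan[of bits b' a'] b'pos by (simp add: sa sb)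
  also have "\<dots> \<le> 4 * (mass \<omega> (\<lambda>x. (cmod (f x))\<^sup>2) k i - a\<^sup>2 / (V + (q + m')))"
  proof -
    have p: "V + m' > 0" "V + (q + m') > 0" using V m'0 q0 by auto
    \<comment> \<open>Both factors are at most \<open>2 * V\<close> by the Carleson condition; this
      is the origin of the factor 4 in the Bellman function.\<close>
    have le: "(V + m') * (V + (q + m')) \<le> (2 * V) * (2 * V)"
      using V m'0 q0 mV by (intro mult_mono) auto
    have "q * (a / V)\<^sup>2 = 4 * (q * a\<^sup>2) / ((2 * V) * (2 * V))"
      by (simp add: power_divide power2_eq_square)
    also have "\<dots> \<le> 4 * (q * a\<^sup>2) / ((V + m') * (V + (q + m')))"
      using le p q0 V by (intro divide_left_mono mult_pos_pos) auto
    also have "\<dots> = 4 * (a\<^sup>2 / (V + m') - a\<^sup>2 / (V + (q + m')))"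
      using p by (simp add: field_simps)
    finally show ?thesis by simp
  qed
  finally show ?case by (simp add: a_def V_def q_def m'_def c_def)
qed

lemma carleson_embedding:
  fixes f :: "('n::finite) fn"
  assumes v: "valid \<omega>" and f: "square_integrable f" and \<mu>: "\<And>k i. \<mu> k i \<ge> 0"
    and C: "C > 0" and car: "\<And>n k i. tsum \<omega> \<mu> n k i \<le> C * vl TYPE('n) k" and F: "finite F"
  shows "(\<Sum>(k, i)\<in>F. \<mu> k i * (cmod (av \<omega> f k i))\<^sup>2) \<le> 4 * C * (L2_norm f)\<^sup>2"
proof -
  define \<nu> where "\<nu> k i = (1 / C) * \<mu> k i" for k i
  have \<nu>: "\<nu> k i \<ge> 0" for k i using C \<mu> by (simp add: \<nu>_def)
  have car': "tsum \<omega> \<nu> n k i \<le> vl TYPE('n) k" for n k i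
    using car[of n k i] C unfolding \<nu>_def[abs_def] tsum_scale by (simp add: pos_divide_le_eq mult.commute)
  let ?w = "\<lambda>k i. \<nu> k i * (mass \<omega> (\<lambda>x. cmod (f x)) k i / vl TYPE('n) k)\<^sup>2"
  have "(\<Sum>(k, i)\<in>F. ?w k i) \<le> 4 * (L2_norm f)\<^sup>2"
  proof (rule tree_bound[where Mf = "\<lambda>k i. 4 * mass \<omega> (\<lambda>x. (cmod (f x))\<^sup>2) k i" and \<omega> = \<omega>])
    fix n k i
    have "0 \<le> (mass \<omega> (\<lambda>x. cmod (f x)) k i)\<^sup>2 / (vl TYPE('n) k + tsum \<omega> \<nu> n k i)"
      by (intro divide_nonneg_nonneg add_nonneg_nonneg tsum_nonneg \<nu>) auto
    thus "tsum \<omega> ?w n k i \<le> 4 * mass \<omega> (\<lambda>x. (cmod (f x))\<^sup>2) k i"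
      using carleson_tree[OF v f \<nu> car', of n k i] by simp
  next
    fix k and A :: "(int^'n) set" assume "finite A"
    thus "(\<Sum>i\<in>A. 4 * mass \<omega> (\<lambda>x. (cmod (f x))\<^sup>2) k i) \<le> 4 * (L2_norm f)\<^sup>2"
      unfolding L2_norm_power2 sum_distrib_left[symmetric]
      by (intro mult_left_mono mass_sum_le square_integrableD(2)[OF f]) auto
  qed (use \<nu> F in auto)
  hence "C * (\<Sum>(k, i)\<in>F. ?w k i) \<le> C * (4 * (L2_norm f)\<^sup>2)" using C by (intro mult_left_mono) auto
  moreover have "(\<Sum>(k, i)\<in>F. \<mu> k i * (cmod (av \<omega> f k i))\<^sup>2) \<le> C * (\<Sum>(k, i)\<in>F. ?w k i)"
    unfolding sum_distrib_left
  proof (rule sum_mono, clarify)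
    fix k i
    have "cmod (av \<omega> f k i) \<le> mass \<omega> (\<lambda>x. cmod (f x)) k i / vl TYPE('n) k"
      unfolding av_def using abs_av_le(1)[OF f, of \<omega> k i] by (simp add: norm_divide divide_right_mono)
    hence "(cmod (av \<omega> f k i))\<^sup>2 \<le> (mass \<omega> (\<lambda>x. cmod (f x)) k i / vl TYPE('n) k)\<^sup>2"
      by (intro power_mono) auto
    thus "\<mu> k i * (cmod (av \<omega> f k i))\<^sup>2 \<le> C * ?w k i"
      using C \<mu>[of k i] by (simp add: \<nu>_def mult_left_mono)
  qed
  ultimately show ?thesis by (simp only: mult_ac)
qed

subsection \<open>Calderon-Zygmund forms\<close>

text \<open>
  \<open>dec TYPE('n) \<alpha> r\<close> is the decay of the form between a bump and a bump of mean zero on cubes of equal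
  size whose indices differ by about \<open>2 ^ r\<close>.
\<close>

definition dec :: "'n::finite itself \<Rightarrow> real \<Rightarrow> nat \<Rightarrow> real" where
  "dec _ \<alpha> r = 2 powr (- (real r * (real CARD('n) + \<alpha>)))"

lemma dec_pos [simp]: "dec TYPE('n::finite) \<alpha> r > 0" by (simp add: dec_def)

text \<open>One class for indicators of cubes and for the functions \<open>phi\<close>, so that the
  kernel estimate is made only once.\<close>

definition bump :: "int \<Rightarrow> real^'n \<Rightarrow> ('n::finite) fn \<Rightarrow> bool" where
  "bump k y u \<longleftrightarrow> u \<in> borel_measurable borel \<and> (\<forall>x. x \<notin> qube k y \<longrightarrow> u x = 0) \<and> (\<forall>x. cmod (u x) \<le> 1)"

text \<open>Both orders of the arguments are assumed, with the cancellation always on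
  \<open>h\<close>, so that the transposed form is again an instance. The translation
  \<open>X\<close> stands for the offset, which all cubes of one generation share.\<close>

locale cz_form =
  fixes B :: "('n::finite) fn \<Rightarrow> 'n fn \<Rightarrow> complex" and N \<alpha> A :: real
  assumes B: "bform N B" and \<alpha>: "\<alpha> > 0" and A: "A \<ge> 0"
    and decay1: "\<And>k X i j u h. bump k ((2 powi k) *\<^sub>R rv i + X) u \<Longrightarrow> bump k ((2 powi k) *\<^sub>R rv j + X) h \<Longrightarrow>
       (LINT x|lborel. h x) = 0 \<Longrightarrow> cmod (B u h) \<le> A * vl TYPE('n) k * dec TYPE('n) \<alpha> (hgt (i - j))"
    and decay2: "\<And>k X i j u h. bump k ((2 powi k) *\<^sub>R rv i + X) u \<Longrightarrow> bump k ((2 powi k) *\<^sub>R rv j + X) h \<Longrightarrow>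
       (LINT x|lborel. h x) = 0 \<Longrightarrow> cmod (B h u) \<le> A * vl TYPE('n) k * dec TYPE('n) \<alpha> (hgt (i - j))"

lemma cz_form_swap: "cz_form B N \<alpha> A \<Longrightarrow> cz_form (\<lambda>f g. B g f) N \<alpha> A"
  unfolding cz_form_def using bform_swap by blast

lemma bump_sq:
  assumes "bump k y (u :: ('n::finite) fn)"
  shows "square_integrable u" "L2_norm u \<le> sqrt (vl TYPE('n) k)"
proof -
  have b: "u \<in> borel_measurable borel" "\<And>x. x \<notin> qube k y \<Longrightarrow> u x = 0" "\<And>x. cmod (u x) \<le> 1"
    using assms by (auto simp: bump_def)
  have e: "emeasure lborel (qube k y) < \<infinity>" by (simp add: emeasure_qube)
  show "square_integrable u" by (rule square_integrable_bounded(1)[OF b(1) qube_borel e b(2,3)])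
  have "(L2_norm u)\<^sup>2 \<le> 1\<^sup>2 * measure lborel (qube k y)"
    by (rule square_integrable_bounded(2)[OF b(1) qube_borel e b(2,3)])
  thus "L2_norm u \<le> sqrt (vl TYPE('n) k)" by (intro real_le_rsqrt) (simp add: measure_qube)
qed

lemma bump_integrable:
  assumes u: "bump k y (u :: ('n::finite) fn)"
  shows "integrable lborel u"
proof -
  have "integrable lborel (\<lambda>x. u x * ind (qube k y) x)"
    by (rule integrable_pairing[OF bump_sq(1)[OF u] sq_ind_qube])
  moreover have "(\<lambda>x. u x * ind (qube k y) x) = u"
    by (rule ext) (use u in \<open>auto simp: bump_def indicator_def\<close>)
  ultimately show ?thesis by simp
qed

lemma bump_ind: "bump k y (ind (qube k y))"
  by (auto simp: bump_def indicator_def)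

lemma bump_phi: "\<theta> \<in> bits \<Longrightarrow> bump k y (phi k y \<theta>)"
  by (auto simp: bump_def phi_outside phi_bound)

text \<open>In some coordinate the integer indices differ by more than
  \<open>2 ^ (hgt (i - j) - 2)\<close>, hence by at least that number plus 1, and the extra 1 pays
  for the width of the cubes.\<close>

lemma cube_sep:
  fixes i j :: "int^'n::finite" and x y X :: "real^'n"
  assumes x: "\<forall>c. (2 powi k * of_int (j $ c) + X $ c \<le> x $ c \<and> x $ c \<le> 2 powi k * of_int (j $ c) + X $ c + 2 powi k)"
    and y: "\<forall>c. (2 powi k * of_int (i $ c) + X $ c \<le> y $ c \<and> y $ c \<le> 2 powi k * of_int (i $ c) + X $ c + 2 powi k)"
    and h: "hgt (i - j) \<noteq> 1"
  shows "2 ^ (hgt (i - j) - 2) * 2 powi k \<le> norm (x - y)"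
proof -
  obtain c where c: "2 ^ (hgt (i - j) - 2) < \<bar>(i - j) $ c\<bar>" using hgt_lower[OF h] by blast
  define D where "D = \<bar>(i - j) $ c\<bar>"
  define p where "p = (2::real) powi k"
  have p: "p > 0" by (simp add: p_def)
  have "(2::int) ^ (hgt (i - j) - 2) + 1 \<le> D" using c unfolding D_def by linarith
  hence "real_of_int (2 ^ (hgt (i - j) - 2) + 1) \<le> real_of_int D" by (rule of_int_le_iff[THEN iffD2])
  hence "(2 ^ (hgt (i - j) - 2) + 1) * p \<le> real_of_int D * p" using p by (intro mult_right_mono) auto
  also have "real_of_int D * p = \<bar>p * of_int (i $ c) - p * of_int (j $ c)\<bar>"
    using p by (simp add: D_def right_diff_distrib[symmetric] abs_mult)
  also have "\<dots> \<le> \<bar>x $ c - y $ c\<bar> + p"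
  proof -
    have "p * of_int (j $ c) + X $ c \<le> x $ c" "x $ c \<le> p * of_int (j $ c) + X $ c + p"
         "p * of_int (i $ c) + X $ c \<le> y $ c" "y $ c \<le> p * of_int (i $ c) + X $ c + p"
      using x y by (auto simp: p_def)
    thus ?thesis by linarith
  qed
  also have "\<bar>x $ c - y $ c\<bar> \<le> norm (x - y)" using component_le_norm_cart[of "x - y" c] by simp
  finally show ?thesis unfolding p_def[symmetric] by (simp add: algebra_simps)
qed

lemma cube_diam:
  fixes x :: "real^'n::finite"
  assumes "x \<in> qube k y" shows "norm (x - y) \<le> real CARD('n) * 2 powi k"
proof -
  have "norm (x - y) \<le> (\<Sum>c\<in>UNIV. \<bar>(x - y) $ c\<bar>)" by (rule norm_le_l1_cart)
  also have "\<dots> \<le> (\<Sum>c\<in>(UNIV::'n set). 2 powi k)"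
    using assms by (intro sum_mono) (auto simp: qube_def abs_le_iff less_imp_le algebra_simps dest!: spec)
  finally show ?thesis by simp
qed

text \<open>The support is a closure, so on the upper faces only weak inequalities remain.\<close>

lemma supp_bump:
  fixes u :: "('n::finite) fn"
  assumes "bump k y u"
  shows "compact (supp u)" "x \<in> supp u \<Longrightarrow> y $ c \<le> x $ c \<and> x $ c \<le> y $ c + 2 powi k"
proof -
  let ?z = "y + (\<chi> c. 2 powi k)"
  have "{x. u x \<noteq> 0} \<subseteq> qube k y" using assms by (auto simp: bump_def)
  also have "qube k y \<subseteq> cbox y ?z" by (auto simp: qube_def mem_box_cart less_imp_le)
  finally have "{x. u x \<noteq> 0} \<subseteq> cbox y ?z" .
  hence sub: "supp u \<subseteq> cbox y ?z" unfolding supp_def by (rule closure_minimal[OF _ closed_cbox])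
  thus "compact (supp u)" unfolding supp_def
    by (meson bounded_cbox bounded_subset closed_closure compact_eq_bounded_closed)
  show "y $ c \<le> x $ c \<and> x $ c \<le> y $ c + 2 powi k" if "x \<in> supp u"
    using sub that by (auto simp: mem_box_cart)
qed

text \<open>Smoothness in the second variable makes \<open>K x\<close> continuous off
  \<open>x\<close>, which yields the measurability that the kernel bounds do not state. At the point
  \<open>x\<close> itself the factor \<open>u x = 0\<close> removes the arbitrary diagonal
  value.\<close>

lemma kernel_measurable:
  fixes K :: "real^'n::finite \<Rightarrow> real^'n \<Rightarrow> complex"
  assumes K: "cz_kernel Ccz \<alpha> K" and \<alpha>: "\<alpha> > 0" and [measurable]: "u \<in> borel_measurable borel" and x: "u x = 0"
  shows "(\<lambda>y. K x y * u y) \<in> borel_measurable borel"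
proof -
  have "continuous_on (- {x}) (K x)"
    unfolding continuous_on_def
  proof
    fix y assume "y \<in> - {x}"
    hence d: "norm (y - x) > 0" by simp
    define M where "M = Ccz * norm (y - x) powr (- real CARD('n) - \<alpha>)"
    have ev: "eventually (\<lambda>y'. norm (y - y') < norm (y - x) / 2) (at y within - {x})"
    proof -
      have "((\<lambda>y'. norm (y - y')) \<longlongrightarrow> norm (y - y)) (at y within - {x})" by (intro tendsto_intros)
      thus ?thesis by (rule order_tendstoD) (use d in simp)
    qed
    have "((\<lambda>y'. K x y' - K x y) \<longlongrightarrow> 0) (at y within - {x})"
    proof (rule Lim_null_comparison)
      show "eventually (\<lambda>y'. norm (K x y' - K x y) \<le> M * norm (y - y') powr \<alpha>) (at y within - {x})"
        using ev
      proof eventually_elim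
        case (elim y')
        have "cmod (K y x - K y' x) + cmod (K x y - K x y') \<le> Ccz * norm (y - y') powr \<alpha> * norm (y - x) powr (- real CARD('n) - \<alpha>)"
          using K elim unfolding cz_kernel_def by blast
        hence "cmod (K x y - K x y') \<le> Ccz * norm (y - y') powr \<alpha> * norm (y - x) powr (- real CARD('n) - \<alpha>)"
          using norm_ge_zero[of "K y x - K y' x"] by linarith
        thus ?case by (simp add: M_def norm_minus_commute[of "K x y'"] mult_ac)
      qed
      have "((\<lambda>y'. M * norm (y - y') powr \<alpha>) \<longlongrightarrow> M * norm (y - y) powr \<alpha>) (at y within - {x})"
        using \<alpha> by (intro tendsto_intros tendsto_powr2) auto
      thus "((\<lambda>y'. M * norm (y - y') powr \<alpha>) \<longlongrightarrow> 0) (at y within - {x})" by simp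
    qed
    thus "(K x \<longlongrightarrow> K x y) (at y within - {x})" by (rule LIM_zero_cancel)
  qed
  hence [measurable]: "(\<lambda>y. indicator (- {x}) y *\<^sub>R K x y) \<in> borel_measurable borel"
    by (intro borel_measurable_continuous_on_indicator) auto
  have "(\<lambda>y. K x y * u y) = (\<lambda>y. (indicator (- {x}) y *\<^sub>R K x y) * u y)"
    using x by (auto simp: indicator_def)
  also have "\<dots> \<in> borel_measurable borel" by measurable
  finally show ?thesis .
qed

lemma L2_norm_cong_AE:
  assumes "AE x in lborel. f x = g x" "f \<in> borel_measurable borel" "g \<in> borel_measurable borel"
  shows "L2_norm f = L2_norm g"
proof -
  note [measurable] = assms(2,3)
  have "(LINT x|lborel. (cmod (f x))\<^sup>2) = (LINT x|lborel. (cmod (g x))\<^sup>2)"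
    using assms(1) by (intro integral_cong_AE) auto
  thus ?thesis by (simp add: L2_norm_def)
qed

lemma pairing_cong_AE:
  assumes "AE x in lborel. f x = f' x" "f \<in> borel_measurable borel" "f' \<in> borel_measurable borel" "square_integrable g"
  shows "pairing f g = pairing f' g"
proof -
  note [measurable] = assms(2,3) square_integrableD(1)[OF assms(4)]
  show ?thesis unfolding pairing_def using assms(1) by (intro integral_cong_AE) auto
qed

text \<open>The operator is linear only up to null sets, and pairing with a function removes this
  ambiguity.\<close>

lemma operator_bform:
  assumes T: "L2_bounded_operator (T :: ('n::finite) oper)"
  shows "bform (L2_opnorm T) (\<lambda>f g. pairing (T f) g)" and "L2_opnorm T \<ge> 0"
proof -
  have Tsq: "square_integrable (T f)" if "square_integrable f" for f
    using T that unfolding L2_bounded_operator_def by blast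
  have Tadd: "AE x in lborel. T (\<lambda>y. f y + g y) x = T f x + T g x"
    if "square_integrable f" "square_integrable g" for f g
    using T that unfolding L2_bounded_operator_def by blast
  have Tsc: "AE x in lborel. T (\<lambda>y. c * f y) x = c * T f x" if "square_integrable f" for f c
    using T that unfolding L2_bounded_operator_def by blast
  obtain C where C: "\<And>f. square_integrable f \<Longrightarrow> L2_norm (T f) \<le> C * L2_norm f"
    using T unfolding L2_bounded_operator_def by blast
  let ?S = "{f :: 'n fn. square_integrable f \<and> L2_norm f \<le> 1}"
  have bdd: "bdd_above ((\<lambda>f. L2_norm (T f)) ` ?S)"
  proof (rule bdd_aboveI2)
    fix f assume "f \<in> ?S"
    hence "L2_norm (T f) \<le> C * L2_norm f" "L2_norm f \<le> 1" using C by auto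
    moreover have "C * L2_norm f \<le> \<bar>C\<bar> * L2_norm f" by (intro mult_right_mono) auto
    moreover have "\<bar>C\<bar> * L2_norm f \<le> \<bar>C\<bar> * 1" using \<open>L2_norm f \<le> 1\<close> by (intro mult_left_mono) auto
    ultimately show "L2_norm (T f) \<le> \<bar>C\<bar>" by linarith
  qed
  have up: "L2_norm (T f) \<le> L2_opnorm T" if "f \<in> ?S" for f
    unfolding L2_opnorm_def by (rule cSUP_upper[OF that bdd])
  show op0: "L2_opnorm T \<ge> 0"
    using order_trans[OF L2_norm_nonneg up[of "\<lambda>x. 0"]] by simp
  have nrm: "L2_norm (T f) \<le> L2_opnorm T * L2_norm f" if f: "square_integrable f" for f
  \<comment> \<open>A function of norm zero cannot be normalized; the unspecified bound
    \<open>C\<close> of the operator settles this case.\<close>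
  proof (cases "L2_norm f = 0")
    case True
    thus ?thesis using C[OF f] by simp
  next
    case False
    define c where "c = complex_of_real (1 / L2_norm f)"
    have "L2_norm (\<lambda>y. c * f y) = 1" unfolding L2_norm_scale c_def using False by (simp add: norm_divide)
    hence "L2_norm (T (\<lambda>y. c * f y)) \<le> L2_opnorm T"
      using square_integrable_scale[OF f] by (intro up) auto
    also have "L2_norm (T (\<lambda>y. c * f y)) = L2_norm (\<lambda>x. c * T f x)"
      by (rule L2_norm_cong_AE[OF Tsc[OF f]])
         (use Tsq[OF square_integrable_scale[OF f]] square_integrable_scale[OF Tsq[OF f]] square_integrableD(1) in blast)+
    also have "\<dots> = (1 / L2_norm f) * L2_norm (T f)"
      unfolding L2_norm_scale by (simp add: c_def norm_divide)
    finally show ?thesis using False L2_norm_nonneg[of f] by (simp add: field_simps)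
  qed
  show "bform (L2_opnorm T) (\<lambda>f g. pairing (T f) g)"
    unfolding bform_def
  proof (intro conjI allI impI op0)
    fix f f' g :: "'n fn" assume sq: "square_integrable f" "square_integrable f'" "square_integrable g"
    have "pairing (T (\<lambda>x. f x + f' x)) g = pairing (\<lambda>x. T f x + T f' x) g"
      by (rule pairing_cong_AE[OF Tadd[OF sq(1,2)] _ _ sq(3)])
         (use Tsq[OF square_integrable_add[OF sq(1,2)]] square_integrable_add[OF Tsq[OF sq(1)] Tsq[OF sq(2)]] square_integrableD(1) in blast)+
    thus "pairing (T (\<lambda>x. f x + f' x)) g = pairing (T f) g + pairing (T f') g"
      by (simp add: pairing_add_left Tsq sq)
    show "pairing (T g) (\<lambda>x. f x + f' x) = pairing (T g) f + pairing (T g) f'"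
      by (intro pairing_add_right Tsq sq)
  next
    fix c and f g :: "'n fn" assume sq: "square_integrable f" "square_integrable g"
    have "pairing (T (\<lambda>x. c * f x)) g = pairing (\<lambda>x. c * T f x) g"
      by (rule pairing_cong_AE[OF Tsc[OF sq(1)] _ _ sq(2)])
         (use Tsq[OF square_integrable_scale[OF sq(1)]] square_integrable_scale[OF Tsq[OF sq(1)]] square_integrableD(1) in blast)+
    thus "pairing (T (\<lambda>x. c * f x)) g = c * pairing (T f) g" by (simp add: pairing_scale_left)
    show "pairing (T g) (\<lambda>x. c * f x) = c * pairing (T g) f" by (rule pairing_scale_right)
  next
    fix f g :: "'n fn" assume sq: "square_integrable f" "square_integrable g"
    have "cmod (pairing (T f) g) \<le> L2_norm (T f) * L2_norm g" by (intro pairing_bound Tsq sq)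
    also have "\<dots> \<le> (L2_opnorm T * L2_norm f) * L2_norm g" by (intro mult_right_mono nrm sq) auto
    finally show "cmod (pairing (T f) g) \<le> L2_opnorm T * L2_norm f * L2_norm g" .
  qed
qed

text \<open>The first summand serves cubes of height \<open>H\<close> with \<open>2 ^ H\<close> at
  most \<open>8 * CARD('n)\<close>, where only boundedness on $L^2$ is used; the second serves
  distant cubes and comes from the smoothness of the kernel.\<close>

definition cz_const :: "'n::finite itself \<Rightarrow> real \<Rightarrow> real \<Rightarrow> real \<Rightarrow> real" where
  "cz_const _ N \<alpha> Ccz = N * (8 * real CARD('n)) powr (real CARD('n) + \<alpha>)
     + \<bar>Ccz\<bar> * real CARD('n) powr \<alpha> * 4 powr (real CARD('n) + \<alpha>)"

text \<open>Near cubes cost only the operator norm, because the decay factor is bounded below there.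
  For far cubes the mean zero of one bump allows the kernel to be replaced by its difference from
  the value at the corner \<open>yj\<close>.\<close>

lemma cz_operator_form:
  assumes T: "cz_operator Ccz \<alpha> (T :: ('n::finite) oper)"
  shows "cz_form (\<lambda>f g. pairing (T f) g) (L2_opnorm T) \<alpha> (cz_const TYPE('n) (L2_opnorm T) \<alpha> Ccz)"
proof -
  let ?N = "L2_opnorm T"
  let ?d = "real CARD('n)"
  obtain K where K: "cz_kernel Ccz \<alpha> K" and TK: "has_kernel T K" and \<alpha>: "\<alpha> > 0" and TB: "L2_bounded_operator T"
    using T unfolding cz_operator_def by blast
  have N0: "?N \<ge> 0" by (rule operator_bform(2)[OF TB])
  have Tsq: "square_integrable (T f)" if "square_integrable f" for f
    using TB that unfolding L2_bounded_operator_def by blast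
  have ker: "AE x in lborel. x \<notin> supp u \<longrightarrow> T u x = (LINT y|lborel. K x y * u y)"
    if "bump k y u" for k y u
    using TK bump_sq(1)[OF that] supp_bump(1)[OF that] unfolding has_kernel_def by blast
  have d1: "?d \<ge> 1" using zero_less_card_finite[where 'a = 'n] by linarith
  have C0: "cz_const TYPE('n) ?N \<alpha> Ccz \<ge> 0" using N0 by (simp add: cz_const_def)
  have decay: "cmod (pairing (T u) h) \<le> cz_const TYPE('n) ?N \<alpha> Ccz * vl TYPE('n) k * dec TYPE('n) \<alpha> (hgt (i - j)) \<and>
      cmod (pairing (T h) u) \<le> cz_const TYPE('n) ?N \<alpha> Ccz * vl TYPE('n) k * dec TYPE('n) \<alpha> (hgt (i - j))"
    if u: "bump k ((2 powi k) *\<^sub>R rv i + X) u" and h: "bump k ((2 powi k) *\<^sub>R rv j + X) h"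
      and h0: "(LINT x|lborel. h x) = 0" for k X i j u h
  proof -
    define H where "H = hgt (i - j)"
    define V where "V = vl TYPE('n) k"
    define yi where "yi = (2 powi k) *\<^sub>R rv i + X"
    define yj where "yj = (2 powi k) *\<^sub>R rv j + X"
    have V: "V > 0" by (simp add: V_def)
    note usq = bump_sq[OF u] and hsq = bump_sq[OF h]
    have dp: "dec TYPE('n) \<alpha> H = (2 ^ H) powr (- (?d + \<alpha>))"
      by (simp add: dec_def powr_realpow[symmetric] powr_powr algebra_simps)
    \<comment> \<open>Beyond the threshold the distance of the cubes is more than twice the bound
      \<open>?d * 2 powi k\<close> for their diameter, as the smoothness condition on the kernel
      requires.\<close>
    show ?thesis
    proof (cases "2 ^ H \<le> 8 * ?d")
      case True
      have "1 = (2 ^ H) powr (?d + \<alpha>) * (2 ^ H) powr (- (?d + \<alpha>))" by (simp add: powr_add[symmetric])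
      also have "\<dots> \<le> (8 * ?d) powr (?d + \<alpha>) * (2 ^ H) powr (- (?d + \<alpha>))"
        using True \<alpha> by (intro mult_right_mono powr_mono2) auto
      finally have one: "1 \<le> (8 * ?d) powr (?d + \<alpha>) * dec TYPE('n) \<alpha> H" by (simp add: dp)
      have nb: "?N * a * b \<le> cz_const TYPE('n) ?N \<alpha> Ccz * V * dec TYPE('n) \<alpha> H"
        if "a \<le> sqrt V" "b \<le> sqrt V" "0 \<le> a" "0 \<le> b" for a b
      proof -
        have "?N * a * b \<le> ?N * (sqrt V * sqrt V)"
          using that N0 V by (simp only: mult.assoc) (intro mult_left_mono mult_mono, auto)
        also have "\<dots> = ?N * V * 1" using V by simp
        also have "\<dots> \<le> ?N * V * ((8 * ?d) powr (?d + \<alpha>) * dec TYPE('n) \<alpha> H)"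
          using one N0 V by (intro mult_left_mono) auto
        also have "\<dots> = (?N * (8 * ?d) powr (?d + \<alpha>)) * (V * dec TYPE('n) \<alpha> H)" by (simp add: mult_ac)
        also have "\<dots> \<le> cz_const TYPE('n) ?N \<alpha> Ccz * (V * dec TYPE('n) \<alpha> H)"
          using V by (intro mult_right_mono) (auto simp: cz_const_def less_imp_le)
        finally show ?thesis by (simp add: mult.assoc)
      qed
      show ?thesis
        using order_trans[OF bformD(4)[OF operator_bform(1)[OF TB] usq(1) hsq(1)] nb]
              order_trans[OF bformD(4)[OF operator_bform(1)[OF TB] hsq(1) usq(1)] nb] usq(2) hsq(2)
        by (simp add: V_def H_def)
    next
      case False
      have H1: "H \<noteq> 1"
      proof
        assume "H = 1" with False d1 show False by simp
      qed
      have H2: "H \<ge> 2" using H1 hgt_pos[of "i - j"] by (simp add: H_def)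
      define \<rho> where "\<rho> = 2 ^ (H - 2) * (2::real) powi k"
      have \<rho>: "\<rho> > 0" by (simp add: \<rho>_def)
      have p4: "(2::real) ^ H = 4 * 2 ^ (H - 2)"
      proof -
        have "H = Suc (Suc (H - 2))" using H2 by simp
        hence "(2::real) ^ H = 2 ^ Suc (Suc (H - 2))" by (rule arg_cong)
        thus ?thesis by simp
      qed
      have big: "?d * 2 powi k < \<rho> / 2"
      proof -
        have "8 * ?d < 4 * 2 ^ (H - 2)" using False p4 by simp
        hence "?d < 2 ^ (H - 2) / 2" by simp
        hence "?d * 2 powi k < 2 ^ (H - 2) / 2 * 2 powi k" by (rule mult_strict_right_mono) simp
        thus ?thesis by (simp add: \<rho>_def)
      qed
      define \<kappa> where "\<kappa> = \<bar>Ccz\<bar> * (?d * 2 powi k) powr \<alpha> * \<rho> powr (- ?d - \<alpha>)"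
      have \<kappa>0: "\<kappa> \<ge> 0" by (simp add: \<kappa>_def)
      have sep: "\<rho> \<le> norm (x - y)" if "\<forall>c. yj $ c \<le> x $ c \<and> x $ c \<le> yj $ c + 2 powi k"
          "\<forall>c. yi $ c \<le> y $ c \<and> y $ c \<le> yi $ c + 2 powi k" for x y
        unfolding \<rho>_def H_def
        by (rule cube_sep[where X = X]) (use that H1 in \<open>auto simp: yi_def yj_def rv_def H_def\<close>)
      have inJ: "yj $ c \<le> x $ c \<and> x $ c \<le> yj $ c + 2 powi k" if "x \<in> qube k yj" for x c
        using that by (auto simp: qube_def less_imp_le)
      have inI: "yi $ c \<le> x $ c \<and> x $ c \<le> yi $ c + 2 powi k" if "x \<in> qube k yi" for x c
        using that by (auto simp: qube_def less_imp_le)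
      have kd: "cmod (K x y - K yj y) + cmod (K y x - K y yj) \<le> \<kappa>" if "x \<in> qube k yj" "y \<in> qube k yi" for x y
      proof -
        have s: "\<rho> \<le> norm (x - y)" using sep inJ inI that by blast
        have dx: "norm (x - yj) \<le> ?d * 2 powi k" by (rule cube_diam[OF that(1)])
        hence "norm (x - yj) < norm (x - y) / 2" using s big by linarith
        hence "cmod (K x y - K yj y) + cmod (K y x - K y yj) \<le> Ccz * norm (x - yj) powr \<alpha> * norm (x - y) powr (- ?d - \<alpha>)"
          using K unfolding cz_kernel_def by blast
        also have "\<dots> \<le> \<bar>Ccz\<bar> * norm (x - yj) powr \<alpha> * norm (x - y) powr (- ?d - \<alpha>)"
          by (intro mult_right_mono) auto
        also have "\<dots> \<le> \<kappa>"
          unfolding \<kappa>_def using dx s \<rho> \<alpha>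
          by (intro mult_mono powr_mono2 powr_mono2') auto
        finally show ?thesis .
      qed
      \<comment> \<open>The powers of the side length cancel: \<alpha> from the increment and
        \<open>?d\<close> from the volume against \<open>- ?d - \<alpha>\<close> from the
        distance.\<close>
      have \<kappa>V: "\<kappa> * V \<le> cz_const TYPE('n) ?N \<alpha> Ccz * dec TYPE('n) \<alpha> H"
      proof -
        define p where "p = (2::real) powi k"
        have p: "p > 0" by (simp add: p_def)
        have rho: "\<rho> = (2 ^ H / 4) * p" using p4 by (simp add: \<rho>_def p_def)
        have "\<rho> powr (- ?d - \<alpha>) = (2 ^ H / 4) powr (- ?d - \<alpha>) * p powr (- ?d - \<alpha>)"
        proof -
          have "(a * p) powr e = a powr e * p powr e" if "a \<ge> 0" for a e :: real
            using that p by (simp add: powr_mult)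
          thus ?thesis unfolding rho by (metis divide_nonneg_nonneg zero_le_numeral zero_le_power)
        qed
        also have "(2 ^ H / 4) powr (- ?d - \<alpha>) = (2 ^ H) powr (- (?d + \<alpha>)) * 4 powr (?d + \<alpha>)"
          using powr_divide[of "2 ^ H" 4 "- ?d - \<alpha>"] powr_minus_divide[of 4 "?d + \<alpha>"] by (simp add: powr_minus_divide)
        finally have e1: "\<rho> powr (- ?d - \<alpha>) = dec TYPE('n) \<alpha> H * 4 powr (?d + \<alpha>) * p powr (- ?d - \<alpha>)"
          by (simp add: dp)
        have e2: "(?d * p) powr \<alpha> = ?d powr \<alpha> * p powr \<alpha>" using p by (simp add: powr_mult)
        have e3: "p powr \<alpha> * p powr (- ?d - \<alpha>) * V = 1"
        proof -
          have "V = p powr ?d" using p by (simp add: V_def vl_def p_def powr_realpow)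
          thus ?thesis using p by (simp add: powr_add[symmetric])
        qed
        have "\<kappa> * V = \<bar>Ccz\<bar> * ?d powr \<alpha> * 4 powr (?d + \<alpha>) * dec TYPE('n) \<alpha> H * (p powr \<alpha> * p powr (- ?d - \<alpha>) * V)"
          unfolding \<kappa>_def p_def[symmetric] e1 e2 by (simp add: mult_ac)
        also have "\<dots> = \<bar>Ccz\<bar> * ?d powr \<alpha> * 4 powr (?d + \<alpha>) * dec TYPE('n) \<alpha> H" unfolding e3 by simp
        also have "\<dots> \<le> cz_const TYPE('n) ?N \<alpha> Ccz * dec TYPE('n) \<alpha> H"
          using N0 by (intro mult_right_mono) (auto simp: cz_const_def less_imp_le)
        finally show ?thesis .
      qed
      have ub: "u \<in> borel_measurable borel" "\<And>x. x \<notin> qube k yi \<Longrightarrow> u x = 0" "\<And>x. cmod (u x) \<le> 1"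
        using u by (auto simp: bump_def yi_def)
      have hb: "h \<in> borel_measurable borel" "\<And>x. x \<notin> qube k yj \<Longrightarrow> h x = 0" "\<And>x. cmod (h x) \<le> 1"
        using h by (auto simp: bump_def yj_def)
      have yjJ: "yj \<in> qube k yj" by (simp add: qube_def)
      have disj: "qube k yi \<inter> qube k yj = {}"
      proof (rule ccontr)
        assume "qube k yi \<inter> qube k yj \<noteq> {}"
        then obtain z where "z \<in> qube k yi" "z \<in> qube k yj" by blast
        hence "\<rho> \<le> norm (z - z)" using sep inI inJ by blast
        thus False using \<rho> by simp
      qed
      have iI: "integrable lborel (\<lambda>y. c * indicator (qube k y0) y :: real)" for c and y0 :: "real^'n"
        by (intro integrable_mult_right integrable_real_indicator) (auto simp: emeasure_qube)
      have intI: "(LINT y|lborel. c * indicator (qube k y0) y :: real) = c * V" for c and y0 :: "real^'n"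
        by (simp add: measure_qube V_def emeasure_qube)
      have k0: "integrable lborel (\<lambda>y. K x y * v y)"
        if "v \<in> borel_measurable borel" "\<And>y. y \<notin> qube k y0 \<Longrightarrow> v y = 0" "\<And>y. cmod (v y) \<le> 1" "x \<notin> qube k y0"
           "\<And>y. y \<in> qube k y0 \<Longrightarrow> \<rho> \<le> norm (x - y)" for x v y0
      proof (rule Bochner_Integration.integrable_bound[OF iI[of "\<bar>Ccz\<bar> * \<rho> powr (- ?d)" y0]])
        show "(\<lambda>y. K x y * v y) \<in> borel_measurable lborel"
          using kernel_measurable[OF K \<alpha> that(1), of x] that by simp
        show "AE y in lborel. norm (K x y * v y) \<le> norm (\<bar>Ccz\<bar> * \<rho> powr (- ?d) * indicator (qube k y0) y)"
        proof (rule AE_I2)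
          fix y
          show "norm (K x y * v y) \<le> norm (\<bar>Ccz\<bar> * \<rho> powr (- ?d) * indicator (qube k y0) y)"
          proof (cases "y \<in> qube k y0")
            case True
            have "cmod (K x y) \<le> Ccz * norm (x - y) powr (- ?d)"
            proof -
              have "x \<noteq> y" using True that(4) by blast
              thus ?thesis using K unfolding cz_kernel_def by blast
            qed
            also have "\<dots> \<le> \<bar>Ccz\<bar> * \<rho> powr (- ?d)"
              using that(5)[OF True] \<rho> by (intro mult_mono powr_mono2') auto
            finally have "cmod (K x y) * cmod (v y) \<le> (\<bar>Ccz\<bar> * \<rho> powr (- ?d)) * 1"
              using that(3) by (intro mult_mono) auto
            thus ?thesis using True by (simp add: norm_mult)
          qed (use that in simp)
        qed
      qed
      have fin: "\<kappa> * V * V \<le> cz_const TYPE('n) ?N \<alpha> Ccz * V * dec TYPE('n) \<alpha> H"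
        using mult_right_mono[OF \<kappa>V, of V] V by (simp add: mult_ac)
      have notsuppu: "x \<notin> supp u" if "x \<in> qube k yj" for x
      proof
        assume "x \<in> supp u"
        hence "\<forall>c. yi $ c \<le> x $ c \<and> x $ c \<le> yi $ c + 2 powi k" using supp_bump(2)[OF u] by (simp add: yi_def)
        hence "\<rho> \<le> norm (x - x)" using sep inJ[OF that] by blast
        thus False using \<rho> by simp
      qed
      have notsupph: "x \<notin> supp h" if "x \<in> qube k yi" for x
      proof
        assume "x \<in> supp h"
        hence "\<forall>c. yj $ c \<le> x $ c \<and> x $ c \<le> yj $ c + 2 powi k" using supp_bump(2)[OF h] by (simp add: yj_def)
        hence "\<rho> \<le> norm (x - x)" using sep inI[OF that] by blast
        thus False using \<rho> by simp
      qed
      have first: "cmod (pairing (T u) h) \<le> \<kappa> * V * V"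
      proof -
        \<comment> \<open>\<open>F\<close> is \<open>T u\<close> off the support of
          \<open>u\<close>; subtracting the constant \<open>F yj\<close> is free because
          \<open>h\<close> has mean zero.\<close>
        define F where "F x = (LINT y|lborel. K x y * u y)" for x
        have Fd: "cmod (F x - F yj) \<le> \<kappa> * V" if x: "x \<in> qube k yj" for x
        proof -
          have k1: "integrable lborel (\<lambda>y. K z y * u y)" if "z \<in> qube k yj" for z
            using that disj sep inI inJ by (intro k0[OF ub]) blast+
          have "F x - F yj = (LINT y|lborel. K x y * u y - K yj y * u y)"
            unfolding F_def by (intro Bochner_Integration.integral_diff[symmetric] k1 x yjJ)
          also have "cmod \<dots> \<le> (LINT y|lborel. \<kappa> * indicator (qube k yi) y)"
          proof (rule order_trans[OF integral_norm_bound integral_mono])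
            show "integrable lborel (\<lambda>y. cmod (K x y * u y - K yj y * u y))"
              by (intro integrable_norm Bochner_Integration.integrable_diff k1 x yjJ)
            fix y
            show "cmod (K x y * u y - K yj y * u y) \<le> \<kappa> * indicator (qube k yi) y"
            proof (cases "y \<in> qube k yi")
              case True
              have "cmod (K x y - K yj y) * cmod (u y) \<le> \<kappa> * 1"
                using order_trans[OF _ kd[OF x True]] ub(3) \<kappa>0 by (intro mult_mono) auto
              thus ?thesis using True by (simp add: left_diff_distrib[symmetric] norm_mult)
            qed (use ub(2) in simp)
          qed (rule iI)
          also have "\<dots> = \<kappa> * V" by (rule intI)
          finally show ?thesis .
        qed
        have ip: "integrable lborel (\<lambda>x. T u x * h x)" by (intro integrable_pairing Tsq usq hsq)
        have ic: "integrable lborel (\<lambda>x. F yj * h x)" by (intro integrable_mult_right bump_integrable[OF h])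
        have "pairing (T u) h = (LINT x|lborel. T u x * h x - F yj * h x)"
          unfolding pairing_def using ip ic h0 by simp
        also have "cmod \<dots> \<le> (LINT x|lborel. (\<kappa> * V) * indicator (qube k yj) x)"
        proof (rule order_trans[OF integral_norm_bound integral_mono_AE])
          show "integrable lborel (\<lambda>x. cmod (T u x * h x - F yj * h x))" using ip ic by simp
          show "AE x in lborel. cmod (T u x * h x - F yj * h x) \<le> \<kappa> * V * indicator (qube k yj) x"
            using ker[OF u]
          proof eventually_elim
            case (elim x)
            show ?case
            proof (cases "x \<in> qube k yj")
              case True
              hence "T u x = F x" using elim notsuppu by (simp add: F_def)
              hence "cmod (T u x - F yj) * cmod (h x) \<le> (\<kappa> * V) * 1"
                using Fd[OF True] hb(3) \<kappa>0 V by (intro mult_mono) auto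
              thus ?thesis using True by (simp add: left_diff_distrib[symmetric] norm_mult)
            qed (use hb(2) in simp)
          qed
        qed (rule iI)
        also have "\<dots> = \<kappa> * V * V" by (rule intI)
        finally show ?thesis .
      qed
      \<comment> \<open>Here the cancellation sits inside the kernel integral, so the second
        variable of the kernel is moved to \<open>yj\<close>.\<close>
      have second: "cmod (pairing (T h) u) \<le> \<kappa> * V * V"
      proof -
        have ip: "integrable lborel (\<lambda>x. T h x * u x)" by (intro integrable_pairing Tsq usq hsq)
        have "cmod (pairing (T h) u) \<le> (LINT x|lborel. (\<kappa> * V) * indicator (qube k yi) x)"
          unfolding pairing_def
        proof (rule order_trans[OF integral_norm_bound integral_mono_AE])
          show "integrable lborel (\<lambda>x. cmod (T h x * u x))" using ip by simp
          show "AE x in lborel. cmod (T h x * u x) \<le> \<kappa> * V * indicator (qube k yi) x"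
            using ker[OF h]
          proof eventually_elim
            case (elim x)
            show ?case
            proof (cases "x \<in> qube k yi")
              case True
              have k1: "integrable lborel (\<lambda>y. K x y * h y)"
                using True disj sep[of _ x] inI inJ by (intro k0[OF hb]) (auto simp: norm_minus_commute)
              have k2: "integrable lborel (\<lambda>y. K x yj * h y)" by (intro integrable_mult_right bump_integrable[OF h])
              have "T h x = (LINT y|lborel. K x y * h y - K x yj * h y)"
                using elim notsupph[OF True] k1 k2 h0 by simp
              also have "cmod \<dots> \<le> (LINT y|lborel. \<kappa> * indicator (qube k yj) y)"
              proof (rule order_trans[OF integral_norm_bound integral_mono])
                show "integrable lborel (\<lambda>y. cmod (K x y * h y - K x yj * h y))"
                  by (intro integrable_norm Bochner_Integration.integrable_diff k1 k2)
                fix y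
                show "cmod (K x y * h y - K x yj * h y) \<le> \<kappa> * indicator (qube k yj) y"
                proof (cases "y \<in> qube k yj")
                  case y: True
                  have "cmod (K x y - K x yj) * cmod (h y) \<le> \<kappa> * 1"
                    using order_trans[OF _ kd[OF y True]] hb(3) \<kappa>0 by (intro mult_mono) auto
                  thus ?thesis using y by (simp add: left_diff_distrib[symmetric] norm_mult)
                qed (use hb(2) in simp)
              qed (rule iI)
              also have "\<dots> = \<kappa> * V" by (rule intI)
              finally have "cmod (T h x) * cmod (u x) \<le> (\<kappa> * V) * 1"
                using ub(3) \<kappa>0 V by (intro mult_mono) auto
              thus ?thesis using True by (simp add: norm_mult)
            qed (use ub(2) in simp)
          qed
        qed (rule iI)
        also have "\<dots> = \<kappa> * V * V" by (rule intI)
        finally show ?thesis .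
      qed
      show ?thesis using order_trans[OF first fin] order_trans[OF second fin] by (simp add: V_def H_def)
    qed
  qed
  show ?thesis
    by unfold_locales (use operator_bform(1)[OF TB] \<alpha> C0 decay in blast)+
qed

subsection \<open>Sums over shells\<close>

text \<open>Shells are taken by height rather than by distance, because the height decides in which
  generation the weight merges two cubes.\<close>

definition shell :: "int^'n \<Rightarrow> nat \<Rightarrow> (int^'n::finite) set" where
  "shell j r = {i. hgt (i - j) = r}"

lemma card_box:
  "finite {v :: int^'n::finite. \<forall>c. \<bar>v $ c\<bar> \<le> M}"
  "M \<ge> 0 \<Longrightarrow> card {v :: int^'n::finite. \<forall>c. \<bar>v $ c\<bar> \<le> M} = nat (2 * M + 1) ^ CARD('n)"
proof -
  have b: "bij_betw (\<lambda>v::int^'n. \<lambda>c. v $ c) {v. \<forall>c. \<bar>v $ c\<bar> \<le> M} (Pi\<^sub>E UNIV (\<lambda>_. {-M..M}))"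
    by (rule bij_betwI[where g = "\<lambda>f. \<chi> c. f c"]) (auto simp: PiE_def Pi_def abs_le_iff minus_le_iff)
  show "finite {v :: int^'n::finite. \<forall>c. \<bar>v $ c\<bar> \<le> M}"
    using bij_betw_finite[OF b] by (simp add: finite_PiE)
  show "M \<ge> 0 \<Longrightarrow> card {v :: int^'n::finite. \<forall>c. \<bar>v $ c\<bar> \<le> M} = nat (2 * M + 1) ^ CARD('n)"
    using bij_betw_same_card[OF b] by (simp add: card_PiE)
qed

lemma finite_shell [simp]: "finite (shell j r)"
  and card_shell: "card (shell (j :: int^'n::finite) r) \<le> 2 ^ (CARD('n) * (r + 1))"
proof -
  let ?S = "{v :: int^'n. \<forall>c. \<bar>v $ c\<bar> \<le> 2 ^ (r - 1)}"
  have sub: "shell j r \<subseteq> (\<lambda>v. v + j) ` ?S"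
  proof
    fix i assume "i \<in> shell j r"
    hence "i - j \<in> ?S" using hgt_bound[of "i - j"] by (auto simp: shell_def)
    hence "(i - j) + j \<in> (\<lambda>v. v + j) ` ?S" by (rule imageI)
    thus "i \<in> (\<lambda>v. v + j) ` ?S" by simp
  qed
  show fin: "finite (shell j r)" by (rule finite_subset[OF sub]) (simp add: card_box)
  show "card (shell j r) \<le> 2 ^ (CARD('n) * (r + 1))"
  proof (cases "r = 0")
    case True
    hence "shell j r = {}" by (simp add: shell_def hgt_def)
    thus ?thesis by simp
  next
    case False
    have "card (shell j r) \<le> card ((\<lambda>v. v + j) ` ?S)" by (rule card_mono[OF _ sub]) (simp add: card_box)
    also have "\<dots> \<le> card ?S" by (rule card_image_le) (simp add: card_box)
    also have "\<dots> = nat (2 * 2 ^ (r - 1) + 1) ^ CARD('n)" by (rule card_box) simp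
    also have "\<dots> \<le> (2 ^ (r + 1)) ^ CARD('n)"
    proof (rule power_mono)
      have "(2::int) * 2 ^ (r - 1) = 2 ^ r" using False by (simp add: power_Suc[symmetric] del: power_Suc)
      moreover have "(1::int) \<le> 2 ^ r" by simp
      ultimately have "(2::int) * 2 ^ (r - 1) + 1 \<le> 2 ^ (r + 1)" by simp
      thus "nat (2 * 2 ^ (r - 1) + 1) \<le> 2 ^ (r + 1)" by (simp add: nat_le_iff)
    qed simp
    finally show ?thesis by (simp only: power_mult[symmetric] mult.commute)
  qed
qed

lemma geometric_tail:
  fixes a :: "nat \<Rightarrow> complex"
  assumes a: "\<And>r. cmod (a r) \<le> M * l ^ r" and l: "0 \<le> l" "l < 1"
  shows "summable (\<lambda>r. cmod (a r))"
    and "summable (\<lambda>r. if n \<le> r then a r else 0)"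
    and "cmod (\<Sum>r. if n \<le> r then a r else 0) \<le> M * l ^ n / (1 - l)"
    and "(\<Sum>r | n \<le> r \<and> r < R. cmod (a r)) \<le> M * l ^ n / (1 - l)"
proof -
  have M: "M \<ge> 0" using order_trans[OF norm_ge_zero a[of 0]] by simp
  have geo: "summable (\<lambda>r. M * l ^ r)" using l by (intro summable_mult summable_geometric) auto
  show sm: "summable (\<lambda>r. cmod (a r))"
    by (rule summable_comparison_test[OF _ geo]) (use a in auto)
  have bd: "(\<Sum>r | n \<le> r \<and> r < R. cmod (a r)) \<le> M * l ^ n / (1 - l)" for R
  proof -
    have "(\<Sum>r | n \<le> r \<and> r < R. cmod (a r)) \<le> (\<Sum>r | n \<le> r \<and> r < R. M * l ^ r)" by (intro sum_mono a)
    also have "\<dots> = (\<Sum>r\<in>(\<lambda>s. s + n) ` {..<R - n}. M * l ^ r)"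
    proof (rule sum.cong[OF _ refl])
      have "r \<in> (\<lambda>s. s + n) ` {..<R - n}" if "n \<le> r" "r < R" for r
        using that by (intro image_eqI[of _ _ "r - n"]) auto
      thus "{r. n \<le> r \<and> r < R} = (\<lambda>s. s + n) ` {..<R - n}" by auto
    qed
    also have "\<dots> = (\<Sum>s<R - n. M * l ^ n * l ^ s)" by (subst sum.reindex) (auto simp: power_add mult_ac)
    also have "\<dots> = M * l ^ n * (\<Sum>s<R - n. l ^ s)" by (simp add: sum_distrib_left)
    also have "\<dots> \<le> M * l ^ n * (1 / (1 - l))"
    proof (rule mult_left_mono)
      have "(\<Sum>s<R - n. l ^ s) \<le> (\<Sum>s. l ^ s)" using l by (intro sum_le_suminf summable_geometric) auto
      also have "\<dots> = 1 / (1 - l)" using l by (simp add: suminf_geometric)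
      finally show "(\<Sum>s<R - n. l ^ s) \<le> 1 / (1 - l)" .
    qed (use M l in simp)
    finally show ?thesis by simp
  qed
  show "(\<Sum>r | n \<le> r \<and> r < R. cmod (a r)) \<le> M * l ^ n / (1 - l)" by (rule bd)
  have sm': "summable (\<lambda>r. cmod (if n \<le> r then a r else 0))"
    by (rule summable_comparison_test[OF _ sm]) auto
  thus "summable (\<lambda>r. if n \<le> r then a r else 0)" by (rule summable_norm_cancel)
  have "cmod (\<Sum>r. if n \<le> r then a r else 0) \<le> (\<Sum>r. cmod (if n \<le> r then a r else 0))"
    by (rule summable_norm[OF sm'])
  also have "\<dots> \<le> M * l ^ n / (1 - l)"
  proof (rule suminf_le_const[OF sm'])
    fix R
    have "(\<Sum>r<R. cmod (if n \<le> r then a r else 0)) = (\<Sum>r | n \<le> r \<and> r < R. cmod (a r))"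
      by (rule sum.mono_neutral_cong_right) auto
    thus "(\<Sum>r<R. cmod (if n \<le> r then a r else 0)) \<le> M * l ^ n / (1 - l)" using bd[of R] by simp
  qed
  finally show "cmod (\<Sum>r. if n \<le> r then a r else 0) \<le> M * l ^ n / (1 - l)" .
qed

lemma Cauchy_Schwarz_sum:
  "(\<Sum>x\<in>F. a x * b x) \<le> sqrt (\<Sum>x\<in>F. (a x)\<^sup>2) * sqrt (\<Sum>x\<in>F. (b x :: real)\<^sup>2)"
  unfolding real_sqrt_mult[symmetric] by (rule real_le_rsqrt[OF Cauchy_Schwarz_ineq_sum])

lemma L2_norm_sum_le:
  assumes "\<And>t. t \<in> F \<Longrightarrow> square_integrable (X t)"
  shows "L2_norm (\<lambda>x. \<Sum>t\<in>F. X t x) \<le> (\<Sum>t\<in>F. L2_norm (X t))"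
  using assms
proof (induction F rule: infinite_finite_induct)
  case (insert t F)
  have "L2_norm (\<lambda>x. X t x + (\<Sum>t\<in>F. X t x)) \<le> L2_norm (X t) + L2_norm (\<lambda>x. \<Sum>t\<in>F. X t x)"
    using insert by (intro L2_norm_triangle square_integrable_sum) auto
  thus ?case using insert by fastforce
qed auto

text \<open>Identifies the recursive sum with a sum over a finite set of cubes, the form to which
  \<open>bessel_functional\<close> applies.\<close>

lemma tsum_eq_sum:
  "finite (desc \<omega> n k i) \<and> tsum \<omega> w n k i = (\<Sum>(k, i)\<in>desc \<omega> n k i. w k i)"
proof (induction n arbitrary: k i)
  case 0
  show ?case by (simp add: desc_def)
next
  case (Suc n)
  have lev: "l < k" if "(l, j) \<in> desc \<omega> n (k - 1) q" for l j q
    using that by (auto simp: desc_def)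
  have disj: "desc \<omega> n (k - 1) (chl \<omega> k i a) \<inter> desc \<omega> n (k - 1) (chl \<omega> k i b) = {}" if "a \<noteq> b" for a b
  proof (rule ccontr)
    assume "desc \<omega> n (k - 1) (chl \<omega> k i a) \<inter> desc \<omega> n (k - 1) (chl \<omega> k i b) \<noteq> {}"
    then obtain l j where "(l, j) \<in> desc \<omega> n (k - 1) (chl \<omega> k i a)" "(l, j) \<in> desc \<omega> n (k - 1) (chl \<omega> k i b)" by auto
    then obtain s s' where "l = k - 1 - int s" "anc \<omega> l s j = chl \<omega> k i a"
       "l = k - 1 - int s'" "anc \<omega> l s' j = chl \<omega> k i b" unfolding mem_desc by blast
    hence "chl \<omega> k i a = chl \<omega> k i b" by simp
    thus False using chl_inj that by blast
  qed
  have fin: "finite (\<Union>\<theta>\<in>bits. desc \<omega> n (k - 1) (chl \<omega> k i \<theta>))" using Suc by auto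
  have ni: "(k, i) \<notin> (\<Union>\<theta>\<in>bits. desc \<omega> n (k - 1) (chl \<omega> k i \<theta>))" using lev by fastforce
  have "(\<Sum>(k, i)\<in>(\<Union>\<theta>\<in>bits. desc \<omega> n (k - 1) (chl \<omega> k i \<theta>)). w k i)
      = (\<Sum>\<theta>\<in>bits. \<Sum>(k, i)\<in>desc \<omega> n (k - 1) (chl \<omega> k i \<theta>). w k i)"
    using Suc disj by (intro sum.UNION_disjoint) auto
  thus ?case using Suc fin ni by (simp add: desc_Suc)
qed

lemma tsum_mono_desc:
  assumes "\<And>l j. (l, j) \<in> desc \<omega> n k i \<Longrightarrow> w l j \<le> w' l j"
  shows "tsum \<omega> w n k i \<le> tsum \<omega> w' n k i"
  using tsum_eq_sum[of \<omega> n k i w] tsum_eq_sum[of \<omega> n k i w'] assms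
  by (auto intro!: sum_mono)

text \<open>The children together have the volume of their parent, so each further generation
  contributes the same up to one more factor \<open>l\<close>.\<close>

lemma tsum_geometric:
  fixes i :: "int^'n::finite"
  assumes l: "0 < l" "l < 1" and D: "D \<ge> 0"
  shows "tsum \<omega> (\<lambda>k (i::int^'n). D * vl TYPE('n) k * l powi (k0 - k)) n k i \<le> D * vl TYPE('n) k * l powi (k0 - k) / (1 - l)"
proof (induction n arbitrary: k i)
  case 0
  show ?case using l D by (simp add: divide_nonneg_pos)
next
  case (Suc n)
  define p where "p = D * vl TYPE('n) k * l powi (k0 - k)"
  have pw: "l powi (k0 - (k - 1)) = l powi (k0 - k) * l"
    using l power_int_add[of l "k0 - k" 1] by (simp add: algebra_simps)
  have "tsum \<omega> (\<lambda>k (i::int^'n). D * vl TYPE('n) k * l powi (k0 - k)) (Suc n) k i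
      \<le> p + (\<Sum>\<theta>\<in>(bits::(int^'n) set). D * vl TYPE('n) (k-1) * l powi (k0 - (k-1)) / (1 - l))"
    unfolding tsum.simps p_def by (intro add_mono order_refl sum_mono Suc)
  also have "\<dots> = p + p * l / (1 - l)"
    by (simp add: card_bits vl_diff_1 pw p_def)
  also have "\<dots> = p / (1 - l)" using l by (simp add: field_simps)
  finally show ?case by (simp add: p_def)
qed

section \<open>Shell sums of the form, and the Carleson condition for T1\<close>

context cz_form
begin

definition lam :: real where "lam = 2 powr (- \<alpha>)"

lemma lam: "0 < lam" "lam < 1" using \<alpha> by (auto simp: lam_def powr_less_one)

text \<open>The shell \<open>r\<close> has at most a constant times
  \<open>2 ^ (CARD('n) * r)\<close> cubes; the decay beats this count by
  \<open>2 powr (- \<alpha> * r)\<close>.\<close>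

lemma dec_lam: "dec TYPE('n) \<alpha> r * 2 ^ (CARD('n) * r) = lam ^ r"
proof -
  have "(2::real) ^ (CARD('n) * r) = 2 powr (real r * real CARD('n))"
    by (simp add: powr_realpow[symmetric] mult.commute)
  moreover have "lam ^ r = 2 powr (- (real r * \<alpha>))"
    using lam by (simp add: lam_def powr_realpow[symmetric] powr_powr mult.commute)
  ultimately show ?thesis
    by (simp add: dec_def powr_add[symmetric] algebra_simps)
qed

text \<open>One factor \<open>2 ^ CARD('n)\<close> bounds the weights, the other comes from the
  \<open>r + 1\<close> in \<open>card_shell\<close>.\<close>

definition EE :: real where "EE = 4 ^ CARD('n) * A"

lemma EE: "EE \<ge> 0" using A by (simp add: EE_def)

definition Bc :: "'n digits \<Rightarrow> int \<Rightarrow> int^'n \<Rightarrow> int^'n \<Rightarrow> int^'n \<Rightarrow> complex" where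
  "Bc \<omega> k i j \<theta> = B (ind (cub \<omega> k i)) (phc \<omega> k j \<theta>)"

lemma Bc_bound:
  assumes "\<theta> \<in> bits"
  shows "cmod (Bc \<omega> k i j \<theta>) \<le> A * vl TYPE('n) k * dec TYPE('n) \<alpha> (hgt (i - j))"
  unfolding Bc_def cub_def corner_def
  by (rule decay1[OF bump_ind bump_phi[OF assms]]) (rule phi_integral)

lemma Bphi_bound:
  assumes "\<eta> \<in> bits" "\<theta> \<in> bits"
  shows "cmod (B (phc \<omega> k i \<eta>) (phc \<omega> k j \<theta>)) \<le> A * vl TYPE('n) k * dec TYPE('n) \<alpha> (hgt (i - j))"
  unfolding cub_def corner_def
  by (rule decay1[OF bump_phi[OF assms(1)] bump_phi[OF assms(2)]]) (rule phi_integral)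

text \<open>The coefficients \<open>c\<close> are 1 for the true form and \<open>wt\<close> for the
  weighted one; the same bounds serve both.\<close>

definition esum :: "'n digits \<Rightarrow> (int^'n \<Rightarrow> real) \<Rightarrow> int \<Rightarrow> int^'n \<Rightarrow> int^'n \<Rightarrow> nat \<Rightarrow> complex" where
  "esum \<omega> c k j \<theta> r = (\<Sum>i\<in>shell j r. complex_of_real (c i) * Bc \<omega> k i j \<theta>)"

lemma esum_abs_bound:
  assumes \<theta>: "\<theta> \<in> bits" and c: "\<And>i. \<bar>c i\<bar> \<le> 2 ^ CARD('n)"
  shows "(\<Sum>i\<in>shell j r. cmod (complex_of_real (c i) * Bc \<omega> k i j \<theta>)) \<le> (EE * vl TYPE('n) k) * lam ^ r"
proof -
  have "(\<Sum>i\<in>shell j r. cmod (complex_of_real (c i) * Bc \<omega> k i j \<theta>)) \<le> (\<Sum>i\<in>shell j r. 2 ^ CARD('n) * (A * vl TYPE('n) k * dec TYPE('n) \<alpha> r))"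
  proof (rule sum_mono)
    fix i assume "i \<in> shell j r"
    hence "hgt (i - j) = r" by (simp add: shell_def)
    thus "cmod (complex_of_real (c i) * Bc \<omega> k i j \<theta>) \<le> 2 ^ CARD('n) * (A * vl TYPE('n) k * dec TYPE('n) \<alpha> r)"
      using Bc_bound[OF \<theta>, of \<omega> k i j] c[of i] by (auto simp: norm_mult intro!: mult_mono)
  qed
  also have "\<dots> = real (card (shell j r)) * (2 ^ CARD('n) * (A * vl TYPE('n) k * dec TYPE('n) \<alpha> r))" by simp
  also have "\<dots> \<le> real (2 ^ (CARD('n) * (r + 1))) * (2 ^ CARD('n) * (A * vl TYPE('n) k * dec TYPE('n) \<alpha> r))"
    using A card_shell[of j r] by (intro mult_right_mono) (auto simp del: of_nat_power intro!: mult_nonneg_nonneg less_imp_le[OF dec_pos])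
  also have "\<dots> = (2 ^ CARD('n) * 2 ^ CARD('n)) * A * vl TYPE('n) k * (dec TYPE('n) \<alpha> r * 2 ^ (CARD('n) * r))"
    by (simp add: power_add mult_ac)
  also have "\<dots> = (EE * vl TYPE('n) k) * lam ^ r"
    by (simp add: dec_lam EE_def power_mult_distrib[symmetric])
  finally show ?thesis .
qed

lemma esum_bound:
  assumes "\<theta> \<in> bits" and "\<And>i. \<bar>c i\<bar> \<le> 2 ^ CARD('n)"
  shows "cmod (esum \<omega> c k j \<theta> r) \<le> (EE * vl TYPE('n) k) * lam ^ r"
  unfolding esum_def by (rule order_trans[OF norm_sum esum_abs_bound[OF assms]])

definition tail :: "'n digits \<Rightarrow> (int^'n \<Rightarrow> real) \<Rightarrow> int \<Rightarrow> int^'n \<Rightarrow> int^'n \<Rightarrow> nat \<Rightarrow> complex" where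
  "tail \<omega> c k j \<theta> n = (\<Sum>r. if n \<le> r then esum \<omega> c k j \<theta> r else 0)"

lemma tail_bound:
  assumes "\<theta> \<in> bits" and "\<And>i. \<bar>c i\<bar> \<le> 2 ^ CARD('n)"
  shows "cmod (tail \<omega> c k j \<theta> n) \<le> (EE * vl TYPE('n) k) * lam ^ n / (1 - lam)"
  unfolding tail_def by (rule geometric_tail(3)[OF esum_bound[OF assms]]) (use lam in auto)

text \<open>
  The Haar coefficient of $T1$ on the cube \<open>j\<close>, as the sum over the shells around \<open>j\<close> of the pairings with
  the indicators of the cubes of the same generation.
\<close>

definition bmo :: "'n digits \<Rightarrow> int \<Rightarrow> int^'n \<Rightarrow> int^'n \<Rightarrow> complex" where
  "bmo \<omega> k j \<theta> = tail \<omega> (\<lambda>_. 1) k j \<theta> 0"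

text \<open>The indicator of a cube together with its neighbours; by \<open>near_eq\<close> it is a
  finite combination of indicators in every finer generation.\<close>

definition near :: "'n digits \<Rightarrow> int \<Rightarrow> int^'n \<Rightarrow> 'n fn" where
  "near \<omega> k j x = (if \<forall>c. \<bar>pidx \<omega> k x $ c - j $ c\<bar> \<le> 1 then 1 else 0)"

definition nearset :: "'n digits \<Rightarrow> int \<Rightarrow> nat \<Rightarrow> int^'n \<Rightarrow> (int^'n) set" where
  "nearset \<omega> k s j = {i. \<forall>c. \<bar>anc \<omega> (k - int s) s i $ c - j $ c\<bar> \<le> 1}"

lemma finite_nearset: "finite (nearset \<omega> k s j)"
proof -
  have "nearset \<omega> k s j \<subseteq> (\<Union>v\<in>{v :: int^'n. \<forall>c. \<bar>v $ c\<bar> \<le> 1}. {i. anc \<omega> (k - int s) s i = j + v})"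
  proof
    fix i assume "i \<in> nearset \<omega> k s j"
    thus "i \<in> (\<Union>v\<in>{v :: int^'n. \<forall>c. \<bar>v $ c\<bar> \<le> 1}. {i. anc \<omega> (k - int s) s i = j + v})"
      by (intro UN_I[of "anc \<omega> (k - int s) s i - j"]) (auto simp: nearset_def)
  qed
  moreover have "finite (\<Union>v\<in>{v :: int^'n. \<forall>c. \<bar>v $ c\<bar> \<le> 1}. {i. anc \<omega> (k - int s) s i = j + v})"
    using desc_finite_card by (intro finite_UN_I card_box) blast
  ultimately show ?thesis by (rule finite_subset)
qed

lemma near_eq:
  assumes "valid \<omega>"
  shows "near \<omega> k j = (\<lambda>x. \<Sum>i\<in>nearset \<omega> k s j. 1 * ind (cub \<omega> (k - int s) i) x)"
proof
  fix x
  have "pidx \<omega> k x = anc \<omega> (k - int s) s (pidx \<omega> (k - int s) x)"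
    using pidx_anc[OF assms, of "k - int s" s x] by simp
  hence "near \<omega> k j x = of_bool (pidx \<omega> (k - int s) x \<in> nearset \<omega> k s j)"
    by (simp add: near_def nearset_def)
  also have "\<dots> = (\<Sum>i\<in>nearset \<omega> k s j. of_bool (i = pidx \<omega> (k - int s) x))"
    using finite_nearset by (simp add: of_bool_def)
  also have "\<dots> = (\<Sum>i\<in>nearset \<omega> k s j. 1 * ind (cub \<omega> (k - int s) i) x)"
    by (intro sum.cong) (auto simp: indicator_def mem_cub_iff)
  finally show "near \<omega> k j x = (\<Sum>i\<in>nearset \<omega> k s j. 1 * ind (cub \<omega> (k - int s) i) x)" .
qed

lemma near_sq:
  assumes "valid \<omega>"
  shows "square_integrable (near \<omega> k j)" "L2_norm (near \<omega> k j) \<le> 3 ^ CARD('n) * sqrt (vl TYPE('n) k)"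
proof -
  show "square_integrable (near \<omega> k j)"
    unfolding near_eq[OF assms, of k j 0] by (intro square_integrable_sum square_integrable_scale) simp
  have "L2_norm (near \<omega> k j) \<le> (\<Sum>i\<in>nearset \<omega> k 0 j. L2_norm (ind (cub \<omega> k i)))"
    unfolding near_eq[OF assms, of k j 0] using L2_norm_sum_le[of "nearset \<omega> k 0 j" "\<lambda>i. ind (cub \<omega> k i)"] by simp
  also have "\<dots> = real (card (nearset \<omega> k 0 j)) * sqrt (vl TYPE('n) k)"
    by (simp add: cub_def L2_norm_qube)
  also have "\<dots> \<le> 3 ^ CARD('n) * sqrt (vl TYPE('n) k)"
  proof (rule mult_right_mono)
    have ns: "nearset \<omega> k 0 j = (\<lambda>v. v + j) ` {v :: int^'n. \<forall>c. \<bar>v $ c\<bar> \<le> 1}"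
    proof
      show "nearset \<omega> k 0 j \<subseteq> (\<lambda>v. v + j) ` {v :: int^'n. \<forall>c. \<bar>v $ c\<bar> \<le> 1}"
      proof
        fix i assume "i \<in> nearset \<omega> k 0 j"
        thus "i \<in> (\<lambda>v. v + j) ` {v :: int^'n. \<forall>c. \<bar>v $ c\<bar> \<le> 1}"
          by (intro image_eqI[of _ _ "i - j"]) (auto simp: nearset_def)
      qed
    qed (auto simp: nearset_def)
    have "card (nearset \<omega> k 0 j) \<le> card {v :: int^'n. \<forall>c. \<bar>v $ c\<bar> \<le> 1}"
      unfolding ns by (rule card_image_le[OF card_box(1)])
    also have "\<dots> = 3 ^ CARD('n)" using card_box(2)[of 1, where 'n = 'n] by simp
    finally show "real (card (nearset \<omega> k 0 j)) \<le> 3 ^ CARD('n)" 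
      using of_nat_mono[of _ "3 ^ CARD('n)", where 'a = real] by simp
  qed simp
  finally show "L2_norm (near \<omega> k j) \<le> 3 ^ CARD('n) * sqrt (vl TYPE('n) k)" .
qed

text \<open>The function \<open>1\<close> is split into the indicators of the three-fold dilate of the ancestor \<open>j0\<close> and of its
  complement.\<close>

lemma bmo_split:
  assumes v: "valid \<omega>" and \<theta>: "\<theta> \<in> bits" and anc: "anc \<omega> (k - int s) s j = j0"
  shows "cmod (bmo \<omega> (k - int s) j \<theta> - B (near \<omega> k j0) (phc \<omega> (k - int s) j \<theta>))
     \<le> 2 * ((EE * vl TYPE('n) (k - int s)) * lam ^ s / (1 - lam))"
proof -
  define l where "l = k - int s"
  define e where "e r = esum \<omega> (\<lambda>_. 1) l j \<theta> r" for r
  define G where "G = nearset \<omega> k s j0"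
  define T' where "T' = (EE * vl TYPE('n) l) * lam ^ (s + 1) / (1 - lam)"
  have one: "\<bar>1\<bar> \<le> (2::real) ^ CARD('n)" by simp
  have eb: "cmod (e r) \<le> (EE * vl TYPE('n) l) * lam ^ r" for r
    unfolding e_def by (rule esum_bound[OF \<theta> one])
  \<comment> \<open>Cubes of height at most \<open>s\<close> relative to \<open>j\<close> have
    ancestors next to \<open>j0\<close>, so the dilate contains the first shells completely.\<close>
  have Gsmall: "shell j r \<subseteq> G" if "r < s + 1" for r
  proof
    fix i assume "i \<in> shell j r"
    hence h: "hgt (i - j) = r" by (simp add: shell_def)
    have "\<forall>c. \<bar>i $ c - j $ c\<bar> \<le> 2 ^ s"
    proof
      fix c
      have "\<bar>(i - j) $ c\<bar> \<le> 2 ^ (r - 1)" using hgt_bound[of "i - j" c] h by simp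
      also have "(2::int) ^ (r - 1) \<le> 2 ^ s" using that by (intro power_increasing) auto
      finally show "\<bar>i $ c - j $ c\<bar> \<le> 2 ^ s" by simp
    qed
    hence "\<bar>anc \<omega> l s i $ c - anc \<omega> l s j $ c\<bar> \<le> 1" for c by (rule anc_close)
    thus "i \<in> G" by (simp add: G_def nearset_def l_def[symmetric] anc[folded l_def])
  qed
  \<comment> \<open>The dilate is finite and ends before shell \<open>R\<close>; beyond shell
    \<open>s\<close> it may contain only part of a shell.\<close>
  define R where "R = Suc (Max (insert (s + 1) ((\<lambda>i. hgt (i - j)) ` G)))"
  have fG: "finite G" unfolding G_def by (rule finite_nearset)
  have R: "s + 1 < R" "hgt (i - j) < R" if "i \<in> G" for i
    using fG that by (auto simp: R_def less_Suc_eq_le)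
  have Rs: "s + 1 < R" using fG by (auto simp: R_def less_Suc_eq_le)
  have "B (near \<omega> k j0) (phc \<omega> l j \<theta>) = (\<Sum>i\<in>G. 1 * Bc \<omega> l i j \<theta>)"
    unfolding near_eq[OF v, of k j0 s] Bc_def G_def l_def
    by (rule bform_sum[OF B]) auto
  also have "\<dots> = (\<Sum>r<R. \<Sum>i\<in>G \<inter> shell j r. Bc \<omega> l i j \<theta>)"
  proof -
    have "G = (\<Union>r<R. G \<inter> shell j r)" using R by (auto simp: shell_def)
    hence "(\<Sum>i\<in>G. Bc \<omega> l i j \<theta>) = (\<Sum>i\<in>(\<Union>r<R. G \<inter> shell j r). Bc \<omega> l i j \<theta>)" by simp
    also have "\<dots> = (\<Sum>r<R. \<Sum>i\<in>G \<inter> shell j r. Bc \<omega> l i j \<theta>)"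
      by (intro sum.UNION_disjoint) (auto simp: shell_def fG)
    finally show ?thesis by simp
  qed
  also have "\<dots> = (\<Sum>r<s+1. \<Sum>i\<in>G \<inter> shell j r. Bc \<omega> l i j \<theta>) + (\<Sum>r | s + 1 \<le> r \<and> r < R. \<Sum>i\<in>G \<inter> shell j r. Bc \<omega> l i j \<theta>)"
  proof -
    have R_split: "{..<R} = {..<s+1} \<union> {r. s + 1 \<le> r \<and> r < R}" using Rs by auto
    show ?thesis unfolding R_split by (rule sum.union_disjoint) auto
  qed
  also have "(\<Sum>r<s+1. \<Sum>i\<in>G \<inter> shell j r. Bc \<omega> l i j \<theta>) = (\<Sum>r<s+1. e r)"
    by (intro sum.cong refl) (use Gsmall in \<open>auto simp: e_def esum_def intro!: sum.cong\<close>)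
  finally have Beq: "B (near \<omega> k j0) (phc \<omega> l j \<theta>) = (\<Sum>r<s+1. e r) + (\<Sum>r | s + 1 \<le> r \<and> r < R. \<Sum>i\<in>G \<inter> shell j r. Bc \<omega> l i j \<theta>)" .
  have "bmo \<omega> l j \<theta> = (\<Sum>r<s+1. e r) + (\<Sum>r. if s + 1 \<le> r then e r else 0)"
  proof -
    have sm: "summable e" by (rule summable_norm_cancel[OF geometric_tail(1)[OF eb]]) (use lam in auto)
    have sm2: "summable (\<lambda>r. if s + 1 \<le> r then e r else 0)"
      by (rule geometric_tail(2)[OF eb]) (use lam in auto)
    have "(\<lambda>r. if r \<in> {..<s+1} then e r else 0) sums (\<Sum>r\<in>{..<s+1}. e r)"
      by (rule sums_If_finite_set) simp
    hence "(\<lambda>r. (if r \<in> {..<s+1} then e r else 0) + (if s + 1 \<le> r then e r else 0)) sums ((\<Sum>r<s+1. e r) + (\<Sum>r. if s + 1 \<le> r then e r else 0))"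
      by (intro sums_add summable_sums sm2)
    moreover have "(\<lambda>r. (if r \<in> {..<s+1} then e r else 0) + (if s + 1 \<le> r then e r else 0)) = e" by auto
    ultimately have "e sums ((\<Sum>r<s+1. e r) + (\<Sum>r. if s + 1 \<le> r then e r else 0))" by (simp only:)
    from sums_unique[OF this] show ?thesis by (simp add: bmo_def tail_def e_def[symmetric])
  qed
  hence "bmo \<omega> l j \<theta> - B (near \<omega> k j0) (phc \<omega> l j \<theta>)
     = (\<Sum>r. if s + 1 \<le> r then e r else 0) - (\<Sum>r | s + 1 \<le> r \<and> r < R. \<Sum>i\<in>G \<inter> shell j r. Bc \<omega> l i j \<theta>)"
    using Beq by simp
  \<comment> \<open>One tail is what \<open>bmo\<close> has beyond shell \<open>s\<close>, the other
    is what the dilate still has there.\<close>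
  also have "cmod \<dots> \<le> T' + T'"
  proof (rule order_trans[OF norm_triangle_ineq4 add_mono])
    show "cmod (\<Sum>r. if s + 1 \<le> r then e r else 0) \<le> T'"
      unfolding T'_def by (rule geometric_tail(3)[OF eb]) (use lam in auto)
    define a where "a r = complex_of_real (\<Sum>i\<in>shell j r. cmod (complex_of_real 1 * Bc \<omega> l i j \<theta>))" for r
    have an: "cmod (a r) = (\<Sum>i\<in>shell j r. cmod (Bc \<omega> l i j \<theta>))" for r
      unfolding a_def norm_of_real by (simp add: sum_nonneg)
    have ab: "cmod (a r) \<le> (EE * vl TYPE('n) l) * lam ^ r" for r
      using esum_abs_bound[OF \<theta>, of "\<lambda>_. 1"] by (simp add: an)
    have "cmod (\<Sum>r | s + 1 \<le> r \<and> r < R. \<Sum>i\<in>G \<inter> shell j r. Bc \<omega> l i j \<theta>) \<le> (\<Sum>r | s + 1 \<le> r \<and> r < R. cmod (a r))"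
    proof (rule order_trans[OF norm_sum sum_mono])
      fix r
      have "cmod (\<Sum>i\<in>G \<inter> shell j r. Bc \<omega> l i j \<theta>) \<le> (\<Sum>i\<in>G \<inter> shell j r. cmod (Bc \<omega> l i j \<theta>))" by (rule norm_sum)
      also have "\<dots> \<le> (\<Sum>i\<in>shell j r. cmod (Bc \<omega> l i j \<theta>))" by (rule sum_mono2) auto
      also have "\<dots> = cmod (a r)" by (simp only: an)
      finally show "cmod (\<Sum>i\<in>G \<inter> shell j r. Bc \<omega> l i j \<theta>) \<le> cmod (a r)" .
    qed
    also have "\<dots> \<le> T'" unfolding T'_def by (rule geometric_tail(4)[OF ab]) (use lam in auto)
    finally show "cmod (\<Sum>r | s + 1 \<le> r \<and> r < R. \<Sum>i\<in>G \<inter> shell j r. Bc \<omega> l i j \<theta>) \<le> T'" .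
  qed
  finally have "cmod (bmo \<omega> l j \<theta> - B (near \<omega> k j0) (phc \<omega> l j \<theta>)) \<le> 2 * ((EE * vl TYPE('n) l) * lam ^ (s + 1) / (1 - lam))" by (simp only: T'_def mult_2)
  also have "\<dots> \<le> 2 * ((EE * vl TYPE('n) l) * lam ^ s / (1 - lam))"
    using lam EE by (intro mult_left_mono divide_right_mono power_decreasing) auto
  finally show ?thesis by (simp add: l_def)
qed

text \<open>The squared norm of the Haar part of T1 on the cube \<open>j\<close>.\<close>

definition mu :: "'n digits \<Rightarrow> int \<Rightarrow> int^'n \<Rightarrow> real" where
  "mu \<omega> k j = (\<Sum>\<theta>\<in>bits. (cmod (bmo \<omega> k j \<theta>))\<^sup>2 / vl TYPE('n) (k - 1))"

lemma mu_nonneg: "mu \<omega> k j \<ge> 0"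
  unfolding mu_def by (intro sum_nonneg divide_nonneg_pos) auto

text \<open>The square of the error in \<open>bmo_split\<close>: a factor 4 from squaring its 2,
  another 2 from squaring a sum, and \<open>4 ^ CARD('n)\<close> from the number and the volume of
  the children.\<close>

definition DD :: real where "DD = 8 * 4 ^ CARD('n) * EE\<^sup>2 / (1 - lam)\<^sup>2"

text \<open>The first summand comes from the dilate by Bessel's inequality, the second from its
  complement by a geometric series over generations, and the third makes the constant at least
  1.\<close>

definition CC :: real where "CC = 2 * (N * 3 ^ CARD('n))\<^sup>2 + DD / (1 - lam\<^sup>2) + 1"

lemma DD: "DD \<ge> 0" by (simp add: DD_def)

lemma lam2: "0 < lam\<^sup>2" "lam\<^sup>2 < 1" using lam by (auto simp: power_less_one_iff abs_square_less_1)

lemma CC: "CC \<ge> 1" using DD lam2 by (simp add: CC_def)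

text \<open>T1 has bounded mean oscillation. For the tree below a cube, the dilate of this cube
  contributes a genuine $L^2$ function, and the rest of the function 1 an error that decays with the
  depth.\<close>

lemma mu_carleson:
  assumes v: "valid \<omega>"
  shows "tsum \<omega> (mu \<omega>) n k i \<le> CC * vl TYPE('n) k"
proof -
  define w1 where "w1 l j = 2 * (\<Sum>\<theta>\<in>bits. (cmod (B (near \<omega> k i) (phc \<omega> l j \<theta>)))\<^sup>2 / vl TYPE('n) (l - 1))" for l j
  define w2 where "w2 = (\<lambda>l (j::int^'n). DD * vl TYPE('n) l * (lam\<^sup>2) powi (k - l))"
  have "mu \<omega> l j \<le> w1 l j + w2 l j" if "(l, j) \<in> desc \<omega> n k i" for l j
  proof -
    from that obtain s where s: "l = k - int s" "anc \<omega> l s j = i" unfolding mem_desc by blast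
    define t where "t = 2 * ((EE * vl TYPE('n) l) * lam ^ s / (1 - lam))"
    have t0: "t \<ge> 0" using EE lam by (auto simp: t_def intro!: divide_nonneg_pos)
    have "(cmod (bmo \<omega> l j \<theta>))\<^sup>2 \<le> 2 * (cmod (B (near \<omega> k i) (phc \<omega> l j \<theta>)))\<^sup>2 + 2 * t\<^sup>2" if "\<theta> \<in> bits" for \<theta>
    proof -
      have "cmod (bmo \<omega> l j \<theta> - B (near \<omega> k i) (phc \<omega> l j \<theta>)) \<le> t"
        using bmo_split[OF v that, of k s j i] s by (simp add: t_def)
      hence "cmod (bmo \<omega> l j \<theta>) \<le> cmod (B (near \<omega> k i) (phc \<omega> l j \<theta>)) + t"
        using norm_triangle_sub[of "bmo \<omega> l j \<theta>" "B (near \<omega> k i) (phc \<omega> l j \<theta>)"] by linarith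
      hence "(cmod (bmo \<omega> l j \<theta>))\<^sup>2 \<le> (cmod (B (near \<omega> k i) (phc \<omega> l j \<theta>)) + t)\<^sup>2" by (intro power_mono) auto
      also have "\<dots> \<le> 2 * (cmod (B (near \<omega> k i) (phc \<omega> l j \<theta>)))\<^sup>2 + 2 * t\<^sup>2"
        using sum_squares_bound[of "cmod (B (near \<omega> k i) (phc \<omega> l j \<theta>))" t] by (simp add: power2_sum)
      finally show ?thesis .
    qed
    hence "mu \<omega> l j \<le> (\<Sum>\<theta>\<in>bits. (2 * (cmod (B (near \<omega> k i) (phc \<omega> l j \<theta>)))\<^sup>2 + 2 * t\<^sup>2) / vl TYPE('n) (l - 1))"
      unfolding mu_def by (intro sum_mono divide_right_mono) auto
    also have "\<dots> = w1 l j + 2 ^ CARD('n) * (2 * t\<^sup>2 / vl TYPE('n) (l - 1))"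
      by (simp add: w1_def add_divide_distrib sum.distrib sum_distrib_left card_bits)
    also have "2 ^ CARD('n) * (2 * t\<^sup>2 / vl TYPE('n) (l - 1)) = w2 l j"
    proof -
      have pw: "(lam\<^sup>2) powi (k - l) = (lam ^ s)\<^sup>2" using s by (simp add: power_mult[symmetric] mult.commute)
      have V: "vl TYPE('n) l \<noteq> 0" by simp
      have four: "(4::real) ^ CARD('n) = 2 ^ CARD('n) * 2 ^ CARD('n)" by (simp add: power_mult_distrib[symmetric])
      show ?thesis unfolding w2_def pw DD_def t_def vl_diff_1 four
        using V lam by (simp add: power_divide power_mult_distrib power2_eq_square)
    qed
    finally show ?thesis .
  qed
  hence "tsum \<omega> (mu \<omega>) n k i \<le> tsum \<omega> (\<lambda>l j. w1 l j + w2 l j) n k i" by (rule tsum_mono_desc)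
  also have "\<dots> = tsum \<omega> w1 n k i + tsum \<omega> w2 n k i" by (rule tsum_add)
  also have "tsum \<omega> w1 n k i \<le> 2 * (N * (3 ^ CARD('n) * sqrt (vl TYPE('n) k)))\<^sup>2"
  proof -
    have fin: "finite (desc \<omega> n k i)" using tsum_eq_sum by blast
    have "tsum \<omega> w1 n k i = 2 * (\<Sum>(l, j)\<in>desc \<omega> n k i. \<Sum>\<theta>\<in>bits. (cmod (B (near \<omega> k i) (phc \<omega> l j \<theta>)))\<^sup>2 / vl TYPE('n) (l - 1))"
      using tsum_eq_sum[of \<omega> n k i w1] by (simp add: w1_def sum_distrib_left case_prod_unfold)
    also have "\<dots> \<le> 2 * (N * L2_norm (near \<omega> k i))\<^sup>2"
      using bessel_functional[OF v B near_sq(1)[OF v] fin] by simp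
    also have "\<dots> \<le> 2 * (N * (3 ^ CARD('n) * sqrt (vl TYPE('n) k)))\<^sup>2"
      using near_sq(2)[OF v] bformD(1)[OF B] by (intro mult_left_mono power_mono) auto
    finally show ?thesis .
  qed
  also have "2 * (N * (3 ^ CARD('n) * sqrt (vl TYPE('n) k)))\<^sup>2 = 2 * (N * 3 ^ CARD('n))\<^sup>2 * vl TYPE('n) k"
    by (simp add: power_mult_distrib)
  also have "tsum \<omega> w2 n k i \<le> DD * vl TYPE('n) k * (lam\<^sup>2) powi (k - k) / (1 - lam\<^sup>2)"
    unfolding w2_def by (rule tsum_geometric[OF lam2 DD])
  also have "2 * (N * 3 ^ CARD('n))\<^sup>2 * vl TYPE('n) k + DD * vl TYPE('n) k * (lam\<^sup>2) powi (k - k) / (1 - lam\<^sup>2) \<le> CC * vl TYPE('n) k"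
    by (simp add: CC_def algebra_simps)
  finally show ?thesis by simp
qed

definition para :: "'n digits \<Rightarrow> 'n fn \<Rightarrow> 'n fn \<Rightarrow> int \<Rightarrow> int^'n \<Rightarrow> complex" where
  "para \<omega> f g k j = av \<omega> f k j * (\<Sum>\<theta>\<in>bits. bmo \<omega> k j \<theta> * pairing g (phc \<omega> k j \<theta>) / vl TYPE('n) (k - 1))"

text \<open>Cauchy-Schwarz, with the Carleson embedding for the averages of \<open>f\<close> and
  Bessel's inequality for the coefficients of \<open>g\<close>.\<close>

lemma para_bound:
  assumes v: "valid \<omega>" and f: "square_integrable f" and g: "square_integrable g" and F: "finite F"
  shows "(\<Sum>(k, j)\<in>F. cmod (para \<omega> f g k j)) \<le> 2 * CC * L2_norm f * L2_norm g"
proof -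
  have le: "cmod (para \<omega> f g k j) \<le> sqrt (mu \<omega> k j * (cmod (av \<omega> f k j))\<^sup>2) * sqrt (al2 \<omega> g k j)" for k j
  proof -
    define V where "V = vl TYPE('n) (k - 1)"
    have V: "V > 0" by (simp add: V_def)
    have "cmod (\<Sum>\<theta>\<in>bits. bmo \<omega> k j \<theta> * pairing g (phc \<omega> k j \<theta>) / complex_of_real V)
       \<le> (\<Sum>\<theta>\<in>bits. (cmod (bmo \<omega> k j \<theta>) / sqrt V) * (cmod (pairing g (phc \<omega> k j \<theta>)) / sqrt V))"
      using V by (intro order_trans[OF norm_sum] sum_mono) (simp add: norm_mult norm_divide)
    also have "\<dots> \<le> sqrt (\<Sum>\<theta>\<in>bits. (cmod (bmo \<omega> k j \<theta>) / sqrt V)\<^sup>2) * sqrt (\<Sum>\<theta>\<in>bits. (cmod (pairing g (phc \<omega> k j \<theta>)) / sqrt V)\<^sup>2)"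
      by (rule Cauchy_Schwarz_sum)
    also have "\<dots> = sqrt (mu \<omega> k j) * sqrt (al2 \<omega> g k j)"
      using V by (simp add: mu_def al2_def power_divide V_def)
    finally have "cmod (av \<omega> f k j) * cmod (\<Sum>\<theta>\<in>bits. bmo \<omega> k j \<theta> * pairing g (phc \<omega> k j \<theta>) / complex_of_real V)
       \<le> cmod (av \<omega> f k j) * (sqrt (mu \<omega> k j) * sqrt (al2 \<omega> g k j))" by (intro mult_left_mono) auto
    thus ?thesis by (simp add: para_def norm_mult V_def real_sqrt_mult mult_ac)
  qed
  have "(\<Sum>(k, j)\<in>F. cmod (para \<omega> f g k j)) \<le> (\<Sum>x\<in>F. sqrt (case x of (k, j) \<Rightarrow> mu \<omega> k j * (cmod (av \<omega> f k j))\<^sup>2) * sqrt (case x of (k, j) \<Rightarrow> al2 \<omega> g k j))"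
    by (intro sum_mono) (auto simp: le)
  also have "\<dots> \<le> sqrt (\<Sum>x\<in>F. (sqrt (case x of (k, j) \<Rightarrow> mu \<omega> k j * (cmod (av \<omega> f k j))\<^sup>2))\<^sup>2) * sqrt (\<Sum>x\<in>F. (sqrt (case x of (k, j) \<Rightarrow> al2 \<omega> g k j))\<^sup>2)"
    by (rule Cauchy_Schwarz_sum)
  also have "\<dots> = sqrt (\<Sum>(k, j)\<in>F. mu \<omega> k j * (cmod (av \<omega> f k j))\<^sup>2) * sqrt (\<Sum>(k, j)\<in>F. al2 \<omega> g k j)"
  proof -
    have "(sqrt (case x of (k, j) \<Rightarrow> mu \<omega> k j * (cmod (av \<omega> f k j))\<^sup>2))\<^sup>2 = (case x of (k, j) \<Rightarrow> mu \<omega> k j * (cmod (av \<omega> f k j))\<^sup>2)"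
         "(sqrt (case x of (k, j) \<Rightarrow> al2 \<omega> g k j))\<^sup>2 = (case x of (k, j) \<Rightarrow> al2 \<omega> g k j)" for x
      by (cases x, simp add: mu_nonneg al2_nonneg)+
    thus ?thesis by simp
  qed
  also have "\<dots> \<le> (2 * sqrt CC * L2_norm f) * L2_norm g"
  proof (rule mult_mono)
    have "sqrt (\<Sum>(k, j)\<in>F. mu \<omega> k j * (cmod (av \<omega> f k j))\<^sup>2) \<le> sqrt (4 * CC * (L2_norm f)\<^sup>2)"
      using CC by (intro real_sqrt_le_mono carleson_embedding[OF v f mu_nonneg _ mu_carleson[OF v] F]) auto
    thus "sqrt (\<Sum>(k, j)\<in>F. mu \<omega> k j * (cmod (av \<omega> f k j))\<^sup>2) \<le> 2 * sqrt CC * L2_norm f"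
      by (simp add: real_sqrt_mult)
    have "sqrt (\<Sum>(k, j)\<in>F. al2 \<omega> g k j) \<le> sqrt ((L2_norm g)\<^sup>2)"
      by (intro real_sqrt_le_mono bessel[OF v g F])
    thus "sqrt (\<Sum>(k, j)\<in>F. al2 \<omega> g k j) \<le> L2_norm g" by simp
  qed (use CC in \<open>auto intro!: sum_nonneg al2_nonneg\<close>)
  also have "\<dots> \<le> (2 * CC * L2_norm f) * L2_norm g"
  proof -
    have "sqrt CC \<le> CC" using CC by (intro real_le_lsqrt) (auto simp: power2_eq_square)
    thus ?thesis by (intro mult_right_mono) auto
  qed
  finally show ?thesis .
qed

end

subsection \<open>Existence of shifts\<close>

lemma has_sum_finite_sum':
  fixes f :: "'a \<Rightarrow> 'b \<Rightarrow> complex"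
  assumes "\<And>\<eta>. \<eta> \<in> I \<Longrightarrow> (f \<eta> has_sum s \<eta>) T"
  shows "((\<lambda>t. \<Sum>\<eta>\<in>I. f \<eta> t) has_sum (\<Sum>\<eta>\<in>I. s \<eta>)) T"
  using assms by (induction I rule: infinite_finite_induct) (auto intro: has_sum_add)

text \<open>A supremum of reals is informative only for a bounded family, so even nonnegativity
  rests on the assumed bound.\<close>

lemma sup_norm_le:
  assumes "\<And>x. cmod (h x) \<le> M"
  shows "0 \<le> sup_norm h" "sup_norm h \<le> M"
proof -
  have b: "bdd_above (range (\<lambda>x. cmod (h x)))" using assms by (auto intro!: bdd_aboveI)
  show "sup_norm h \<le> M" unfolding sup_norm_def by (rule cSUP_least) (use assms in auto)
  show "0 \<le> sup_norm h" unfolding sup_norm_def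
    by (rule order_trans[OF norm_ge_zero cSUP_upper[OF UNIV_I b]])
qed

definition hr :: "bool \<Rightarrow> ('n::finite) lattice \<Rightarrow> (real^'n) set \<Rightarrow> 'n fn \<Rightarrow> bool" where
  "hr gen D Q h \<longleftrightarrow> (if gen then generalized_haar D Q h else haar D Q h)"

lemma children_cub:
  assumes v: "valid \<omega>" and R: "R \<in> children (shifted_lattice \<omega>) (cub \<omega> k i)"
  shows "\<exists>\<theta>\<in>bits. R = cub \<omega> (k - 1) (chl \<omega> k i \<theta>)"
proof -
  obtain k' where k': "cub \<omega> k i \<in> shifted_lattice \<omega> k'" "R \<in> shifted_lattice \<omega> (k' - 1)" "R \<subseteq> cub \<omega> k i"
    using R unfolding children_def by blast
  obtain i' where "cub \<omega> k i = cub \<omega> k' i'" using k'(1) unfolding range_cub[OF v] by blast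
  hence kk: "k' = k" using cub_level_inj by metis
  obtain j where j: "R = cub \<omega> (k - 1) j" using k'(2) unfolding range_cub[OF v] kk by blast
  have "par \<omega> (k - 1) j = i"
    using k'(3) cub_subset_iff[OF v, of "k - 1" j 1 i] unfolding j by simp
  then obtain \<theta> where "\<theta> \<in> bits" "j = chl \<omega> k i \<theta>" using par_eq_iff[of \<omega> k j i] by blast
  thus ?thesis unfolding j by (intro bexI[of _ \<theta>]) auto
qed

lemma hr_zero: "hr gen D Q (\<lambda>x. 0)"
  by (simp add: hr_def haar_def generalized_haar_def constant_on_def)

lemma haar_phc_comb:
  fixes \<omega> :: "('n::finite) digits"
  assumes v: "valid \<omega>"
  shows "haar (shifted_lattice \<omega>) (cub \<omega> k i) (\<lambda>x. \<Sum>\<theta>\<in>bits. c \<theta> * phc \<omega> k i \<theta> x)"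
  unfolding haar_def generalized_haar_def
proof (intro conjI allI impI ballI)
  fix x assume "x \<notin> cub \<omega> k i"
  thus "(\<Sum>\<theta>\<in>bits. c \<theta> * phc \<omega> k i \<theta> x) = 0"
    unfolding cub_def by (intro sum.neutral) (auto simp: phi_outside)
next
  fix R assume "R \<in> children (shifted_lattice \<omega>) (cub \<omega> k i)"
  then obtain t where t: "t \<in> bits" "R = cub \<omega> (k - 1) (chl \<omega> k i t)" using children_cub[OF v] by blast
  have "phc \<omega> k i \<theta> x = of_bool (\<theta> = t) - 1 / 2 ^ CARD('n)" if "x \<in> R" "\<theta> \<in> bits" for \<theta> x
  proof -
    have 1: "x \<in> cub \<omega> k i" using that t mem_cub_chl_iff[OF v] by blast
    have "x \<in> cub \<omega> (k - 1) (chl \<omega> k i \<theta>) \<longleftrightarrow> \<theta> = t"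
      using that(1) t(2) chl_inj[of \<omega> k i \<theta> i t] by (auto simp: mem_cub_iff)
    thus ?thesis using 1 by (simp add: phc_eq[OF v] indicator_def)
  qed
  thus "(\<lambda>x. \<Sum>\<theta>\<in>bits. c \<theta> * phc \<omega> k i \<theta> x) constant_on R"
    unfolding constant_on_def by (intro exI[of _ "\<Sum>\<theta>\<in>bits. c \<theta> * (of_bool (\<theta> = t) - 1 / 2 ^ CARD('n))"]) (auto intro!: sum.cong)
next
  have "(LINT x|lborel. (\<Sum>\<theta>\<in>bits. c \<theta> * phc \<omega> k i \<theta> x)) = (\<Sum>\<theta>\<in>bits. LINT x|lborel. c \<theta> * phc \<omega> k i \<theta> x)"
    by (rule Bochner_Integration.integral_sum) (intro integrable_mult_right bump_integrable[OF bump_phi])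
  thus "(LINT x|lborel. (\<Sum>\<theta>\<in>bits. c \<theta> * phc \<omega> k i \<theta> x)) = 0" by (simp add: phi_integral)
qed

lemma haar_phc:
  assumes "valid \<omega>" "\<eta> \<in> bits"
  shows "haar (shifted_lattice \<omega>) (cub \<omega> k i) (phc \<omega> k i \<eta>)"
proof -
  have "(\<lambda>x. \<Sum>\<theta>\<in>bits. of_bool (\<theta> = \<eta>) * phc \<omega> k i \<theta> x) = phc \<omega> k i \<eta>"
    using assms(2) by (intro ext) (simp add: of_bool_def if_distrib[of "\<lambda>z. z * _"] cong: if_cong)
  thus ?thesis using haar_phc_comb[OF assms(1), of k i "\<lambda>\<theta>. of_bool (\<theta> = \<eta>)"] by simp
qed

lemma hr_haar: "haar D Q h \<Longrightarrow> hr gen D Q h"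
  by (simp add: hr_def haar_def)

text \<open>The average over a cube in the paraproduct is a pairing with a generalized Haar function
  of the parent. Hence the paraproduct fits a shift with \<open>Q' = Q\<close> the parent and
  \<open>Q''\<close> the child, that is complexity (0,1).\<close>

lemma gen_haar_ind:
  assumes v: "valid \<omega>"
  shows "generalized_haar (shifted_lattice \<omega>) (cub \<omega> (k + 1) (par \<omega> k j)) (ind (cub \<omega> k j))"
  unfolding generalized_haar_def
proof (intro conjI allI impI ballI)
  fix x assume "x \<notin> cub \<omega> (k + 1) (par \<omega> k j)"
  thus "ind (cub \<omega> k j) x = 0" using pidx_par[OF v] by (auto simp: mem_cub_iff indicator_def)
next
  fix R assume "R \<in> children (shifted_lattice \<omega>) (cub \<omega> (k + 1) (par \<omega> k j))"
  then obtain t where t: "R = cub \<omega> k (chl \<omega> (k + 1) (par \<omega> k j) t)" using children_cub[OF v] by force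
  show "ind (cub \<omega> k j) constant_on R"
    unfolding constant_on_def t by (intro exI[of _ "of_bool (chl \<omega> (k + 1) (par \<omega> k j) t = j)"]) (auto simp: mem_cub_iff indicator_def)
qed

text \<open>Recovers generation and index from the set; the value is arbitrary for sets that are not
  cubes of the lattice.\<close>

definition cidx :: "'n digits \<Rightarrow> (real^'n) set \<Rightarrow> int \<times> (int^'n::finite)" where
  "cidx \<omega> Q = (SOME p. Q = cub \<omega> (fst p) (snd p))"

lemma cidx_cub [simp]: "cidx \<omega> (cub \<omega> k i) = (k, i)"
  unfolding cidx_def by (rule some_equality) (auto dest: cub_level_inj simp: prod_eq_iff)

definition tri_sets :: "'n digits \<Rightarrow> nat \<Rightarrow> nat \<Rightarrow> int \<times> (int^'n) \<times> (int^'n::finite)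
    \<Rightarrow> (real^'n) set \<times> (real^'n) set \<times> (real^'n) set" where
  "tri_sets \<omega> m n = (\<lambda>(k, i, j). (cub \<omega> k (anc \<omega> (k - int m) m i), cub \<omega> (k - int m) i, cub \<omega> (k - int n) j))"

lemma bij_tri_sets:
  fixes \<omega> :: "('n::finite) digits"
  assumes v: "valid \<omega>"
  shows "bij_betw (tri_sets \<omega> m n) (tri \<omega> m n) (shift_triples (shifted_lattice \<omega>) m n)"
  unfolding bij_betw_def
proof
  show "inj_on (tri_sets \<omega> m n) (tri \<omega> m n)"
    by (rule inj_onI) (auto simp: tri_sets_def dest!: cub_level_inj)
  show "tri_sets \<omega> m n ` tri \<omega> m n = shift_triples (shifted_lattice \<omega>) m n"
  proof (intro equalityI subsetI)
    fix t assume "t \<in> tri_sets \<omega> m n ` tri \<omega> m n"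
    then obtain k i j where t: "t = tri_sets \<omega> m n (k, i, j)" "anc \<omega> (k - int m) m i = anc \<omega> (k - int n) n j"
      by (auto simp: tri_def)
    have "cub \<omega> (k - int m) i \<subseteq> cub \<omega> k (anc \<omega> (k - int m) m i)"
         "cub \<omega> (k - int n) j \<subseteq> cub \<omega> k (anc \<omega> (k - int m) m i)"
      using cub_subset_iff[OF v, of "k - int m" i m] cub_subset_iff[OF v, of "k - int n" j n] t(2) by auto
    thus "t \<in> shift_triples (shifted_lattice \<omega>) m n"
      unfolding t(1) tri_sets_def shift_triples_def range_cub[OF v] by auto
  next
    fix t assume "t \<in> shift_triples (shifted_lattice \<omega>) m n"
    then obtain k q i j where t: "t = (cub \<omega> k q, cub \<omega> (k - int m) i, cub \<omega> (k - int n) j)"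
      "cub \<omega> (k - int m) i \<subseteq> cub \<omega> k q" "cub \<omega> (k - int n) j \<subseteq> cub \<omega> k q"
      unfolding shift_triples_def range_cub[OF v] by auto
    have "anc \<omega> (k - int m) m i = q" "anc \<omega> (k - int n) n j = q"
      using cub_subset_iff[OF v, of "k - int m" i m q] cub_subset_iff[OF v, of "k - int n" j n q] t(2,3) by auto
    hence "t = tri_sets \<omega> m n (k, i, j)" "(k, i, j) \<in> tri \<omega> m n" using t(1) by (auto simp: tri_sets_def tri_def)
    thus "t \<in> tri_sets \<omega> m n ` tri \<omega> m n" by blast
  qed
qed

text \<open>The absolute bound on the pairings with every \<open>g\<close> is the criterion of
  \<open>L2_unconditional_convergence\<close>, so the series converges for Haar and generalized Haar
  functions alike; \<open>E\<close> is a choice of its sum.\<close>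

lemma elementary_shift_exists:
  fixes \<omega> :: "('n::finite) digits" and u v :: "int \<Rightarrow> int^'n \<Rightarrow> int^'n \<Rightarrow> 'n fn"
  assumes val: "valid \<omega>"
    and h: "\<And>k i j. (k, i, j) \<in> tri \<omega> m n \<Longrightarrow> hr gen (shifted_lattice \<omega>) (cub \<omega> (k - int m) i) (u k i j) \<and>
        hr gen (shifted_lattice \<omega>) (cub \<omega> (k - int n) j) (v k i j) \<and> sup_norm (u k i j) * sup_norm (v k i j) \<le> 1"
    and sq: "\<And>k i j. square_integrable (u k i j)" "\<And>k i j. square_integrable (v k i j)"
    and bd: "\<And>f g F. square_integrable f \<Longrightarrow> square_integrable g \<Longrightarrow> finite F \<Longrightarrow> F \<subseteq> tri \<omega> m n \<Longrightarrow>
       (\<Sum>(k, i, j)\<in>F. cmod (pairing f (u k i j)) * cmod (pairing (v k i j) g) / vl TYPE('n) k) \<le> K * L2_norm f * L2_norm g"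
  obtains E where "elementary_shift gen (shifted_lattice \<omega>) m n E"
    "\<And>f. square_integrable f \<Longrightarrow> square_integrable (E f)"
    "\<And>f g. square_integrable f \<Longrightarrow> square_integrable g \<Longrightarrow>
       ((\<lambda>(k, i, j). pairing f (u k i j) * pairing (v k i j) g / vl TYPE('n) k) has_sum pairing (E f) g) (tri \<omega> m n)"
proof -
  let ?I = "shift_triples (shifted_lattice \<omega>) m n"
  let ?\<tau> = "tri_sets \<omega> m n"
  note bij = bij_tri_sets[OF val, of m n]
  \<comment> \<open>The families in the definition of a shift are indexed by \<open>Q'\<close> and
    \<open>Q''\<close> only; the generation of \<open>Q\<close> is recovered as \<open>m\<close>
    above that of \<open>Q'\<close>.\<close>
  define U where "U Q' Q'' = u (fst (cidx \<omega> Q') + int m) (snd (cidx \<omega> Q')) (snd (cidx \<omega> Q''))" for Q' Q''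
  define V where "V Q' Q'' = v (fst (cidx \<omega> Q') + int m) (snd (cidx \<omega> Q')) (snd (cidx \<omega> Q''))" for Q' Q''
  define X where "X f = (\<lambda>(Q :: (real^'n) set, Q', Q'') x. complex_of_real (1 / measure lborel Q) * pairing f (U Q' Q'') * V Q' Q'' x)" for f
  have Xt: "X f (?\<tau> (k, i, j)) = (\<lambda>x. complex_of_real (1 / vl TYPE('n) k) * pairing f (u k i j) * v k i j x)" for f k i j
    by (simp add: X_def tri_sets_def U_def V_def measure_cub)
  have Xsq: "square_integrable (X f t)" for f t
  proof -
    obtain Q Q' Q'' where t: "t = (Q, Q', Q'')" by (cases t)
    show ?thesis unfolding t X_def V_def prod.case by (intro square_integrable_scale sq)
  qed
  have Xp: "pairing (X f (?\<tau> (k, i, j))) g = pairing f (u k i j) * pairing (v k i j) g / vl TYPE('n) k" for f g k i j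
    unfolding Xt pairing_scale_left by (simp add: divide_simps)
  have Xb: "(\<Sum>t\<in>F. cmod (pairing (X f t) g)) \<le> (K * L2_norm f) * L2_norm g"
    if f: "square_integrable f" and F: "finite F" "F \<subseteq> ?I" and g: "square_integrable g" for f F g
  proof -
    define G where "G = {t \<in> tri \<omega> m n. ?\<tau> t \<in> F}"
    have "F \<subseteq> ?\<tau> ` tri \<omega> m n" using F(2) bij by (simp add: bij_betw_def)
    hence G: "F = ?\<tau> ` G" unfolding G_def by blast
    have inj: "inj_on ?\<tau> G" using bij unfolding bij_betw_def by (rule inj_on_subset[OF conjunct1]) (auto simp: G_def)
    have fG: "finite G" using F(1) inj unfolding G by (rule finite_imageD)
    have "(\<Sum>t\<in>F. cmod (pairing (X f t) g)) = (\<Sum>t\<in>G. cmod (pairing (X f (?\<tau> t)) g))"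
      unfolding G by (rule sum.reindex[OF inj, unfolded o_def])
    also have "\<dots> = (\<Sum>(k, i, j)\<in>G. cmod (pairing f (u k i j)) * cmod (pairing (v k i j) g) / vl TYPE('n) k)"
      by (intro sum.cong) (auto simp: Xp norm_mult norm_divide)
    also have "\<dots> \<le> K * L2_norm f * L2_norm g" by (rule bd[OF f g fG]) (auto simp: G_def)
    finally show ?thesis .
  qed
  have ex: "\<exists>s. square_integrable s \<and> ((\<lambda>F. L2_norm (\<lambda>x. s x - (\<Sum>t\<in>F. X f t x))) \<longlongrightarrow> 0) (finite_subsets_at_top ?I)"
    if "square_integrable f" for f
    by (rule L2_unconditional_convergence[of ?I "X f" "K * L2_norm f"]) (use Xsq Xb[OF that] in blast)+
  define E where "E f = (SOME s. square_integrable s \<and> ((\<lambda>F. L2_norm (\<lambda>x. s x - (\<Sum>t\<in>F. X f t x))) \<longlongrightarrow> 0) (finite_subsets_at_top ?I))" for f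
  have E: "square_integrable (E f)" "((\<lambda>F. L2_norm (\<lambda>x. E f x - (\<Sum>t\<in>F. X f t x))) \<longlongrightarrow> 0) (finite_subsets_at_top ?I)"
    if "square_integrable f" for f
    using someI_ex[OF ex[OF that]] unfolding E_def by blast+
  have "\<forall>(Q, Q', Q'')\<in>?I.
       (if gen then generalized_haar (shifted_lattice \<omega>) Q' (U Q' Q'') \<and> generalized_haar (shifted_lattice \<omega>) Q'' (V Q' Q'')
        else haar (shifted_lattice \<omega>) Q' (U Q' Q'') \<and> haar (shifted_lattice \<omega>) Q'' (V Q' Q'')) \<and>
        sup_norm (U Q' Q'') * sup_norm (V Q' Q'') \<le> 1"
  proof
    fix t assume "t \<in> ?I"
    hence "t \<in> ?\<tau> ` tri \<omega> m n" using bij by (simp add: bij_betw_def)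
    then obtain k i j where t: "t = ?\<tau> (k, i, j)" "(k, i, j) \<in> tri \<omega> m n" by auto
    show "case t of (Q, Q', Q'') \<Rightarrow>
       (if gen then generalized_haar (shifted_lattice \<omega>) Q' (U Q' Q'') \<and> generalized_haar (shifted_lattice \<omega>) Q'' (V Q' Q'')
        else haar (shifted_lattice \<omega>) Q' (U Q' Q'') \<and> haar (shifted_lattice \<omega>) Q'' (V Q' Q'')) \<and>
        sup_norm (U Q' Q'') * sup_norm (V Q' Q'') \<le> 1"
      using h[OF t(2)] unfolding t(1) by (auto simp: tri_sets_def U_def V_def hr_def)
  qed
  moreover have "\<forall>f. square_integrable f \<longrightarrow> square_integrable (E f) \<and>
     ((\<lambda>F. L2_norm (\<lambda>x. E f x - (\<Sum>(Q, Q', Q'')\<in>F. complex_of_real (1 / measure lborel Q) * pairing f (U Q' Q'') * V Q' Q'' x))) \<longlongrightarrow> 0) (finite_subsets_at_top ?I)"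
  proof (intro allI impI conjI)
    fix f :: "'n fn" assume f: "square_integrable f"
    show "square_integrable (E f)" by (rule E[OF f])
    have "(\<lambda>t. X f t x) = (\<lambda>(Q, Q', Q''). complex_of_real (1 / measure lborel Q) * pairing f (U Q' Q'') * V Q' Q'' x)" for x
      by (rule ext) (simp only: X_def case_prod_unfold)
    thus "((\<lambda>F. L2_norm (\<lambda>x. E f x - (\<Sum>(Q, Q', Q'')\<in>F. complex_of_real (1 / measure lborel Q) * pairing f (U Q' Q'') * V Q' Q'' x))) \<longlongrightarrow> 0) (finite_subsets_at_top ?I)"
      using E(2)[OF f] by (simp only:)
  qed
  ultimately have "elementary_shift gen (shifted_lattice \<omega>) m n E"
    unfolding elementary_shift_def by blast
  moreover have "((\<lambda>(k, i, j). pairing f (u k i j) * pairing (v k i j) g / vl TYPE('n) k) has_sum pairing (E f) g) (tri \<omega> m n)"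
    if f: "square_integrable f" and g: "square_integrable g" for f g
  proof -
    have "((\<lambda>t. pairing (X f t) g) has_sum pairing (E f) g) ?I"
      by (rule L2_limit_pairing_has_sum[OF Xsq E[OF f] g])
    hence "((\<lambda>t. pairing (X f (?\<tau> t)) g) has_sum pairing (E f) g) (tri \<omega> m n)"
      using has_sum_reindex_bij_betw[OF bij, of "\<lambda>t. pairing (X f t) g"] by simp
    moreover have "(\<lambda>t. pairing (X f (?\<tau> t)) g) = (\<lambda>(k, i, j). pairing f (u k i j) * pairing (v k i j) g / vl TYPE('n) k)"
      by (rule ext) (auto simp: Xp)
    ultimately show ?thesis by simp
  qed
  ultimately show ?thesis using E(1) that by blast
qed

text \<open>The contribution of one triple to the bilinear form; \<eta> and \<theta> run over the
  children of the two small cubes.\<close>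

definition frm :: "'n digits \<Rightarrow> nat \<Rightarrow> nat \<Rightarrow> ('n coeffs) \<Rightarrow>
    'n fn \<Rightarrow> 'n fn \<Rightarrow> int \<Rightarrow> int^'n \<Rightarrow> int^'n::finite \<Rightarrow> complex" where
  "frm \<omega> m n a f g k i j = (\<Sum>\<eta>\<in>bits. \<Sum>\<theta>\<in>bits. a k i j \<eta> \<theta> * pairing f (phc \<omega> (k - int m) i \<eta>) * pairing g (phc \<omega> (k - int n) j \<theta>))
     / vl TYPE('n) k"

lemma pairing_comb:
  "pairing (\<lambda>x. \<Sum>\<theta>\<in>bits. c \<theta> * phc \<omega> k j \<theta> x) g = (\<Sum>\<theta>\<in>bits. c \<theta> * pairing g (phc \<omega> k j \<theta>))" if "square_integrable g"
  using bform_sum[OF bform_pairing, of bits "\<lambda>\<theta>. phc \<omega> k j \<theta>" g c] that by (simp add: pairing_commute)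

lemma comb_sq: "square_integrable (\<lambda>x. \<Sum>\<theta>\<in>bits. c \<theta> * phc \<omega> k j \<theta> x)"
  by (intro square_integrable_sum square_integrable_scale phi_sq)

lemma comb_bound:
  fixes \<omega> :: "('n::finite) digits"
  assumes "\<And>\<theta>. \<theta> \<in> bits \<Longrightarrow> cmod (c \<theta>) \<le> M"
  shows "cmod (\<Sum>\<theta>\<in>bits. c \<theta> * phc \<omega> k j \<theta> x) \<le> 2 ^ CARD('n) * M"
proof -
  have M0: "M \<ge> 0" using bits_nonempty assms norm_ge_zero order_trans by blast
  have "cmod (\<Sum>\<theta>\<in>bits. c \<theta> * phc \<omega> k j \<theta> x) \<le> (\<Sum>\<theta>\<in>(bits :: (int^'n) set). M * 1)"
  proof (rule order_trans[OF norm_sum sum_mono])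
    fix \<theta> :: "int^'n" assume "\<theta> \<in> bits"
    thus "cmod (c \<theta> * phc \<omega> k j \<theta> x) \<le> M * 1"
      unfolding norm_mult by (intro mult_mono assms phi_bound M0) auto
  qed
  thus ?thesis by (simp add: card_bits)
qed

lemma frm_elem_bound:
  fixes \<omega> :: "('n::finite) digits"
  assumes a: "\<And>k i j \<theta>. (k, i, j) \<in> tri \<omega> m n \<Longrightarrow> \<theta> \<in> bits \<Longrightarrow> cmod (a k i j \<theta>) \<le> M" and \<eta>: "\<eta> \<in> bits" and M: "M \<ge> 0"
    and v: "valid \<omega>" and f: "square_integrable f" and g: "square_integrable g" and F: "finite F" "F \<subseteq> tri \<omega> m n"
  shows "(\<Sum>(k, i, j)\<in>F. cmod (pairing f (phc \<omega> (k - int m) i \<eta>)) * (\<Sum>\<theta>\<in>bits. cmod (a k i j \<theta>) * cmod (pairing g (phc \<omega> (k - int n) j \<theta>))) / vl TYPE('n) k)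
     \<le> (2 ^ CARD('n) * M) * L2_norm f * L2_norm g"
proof -
  have "(\<Sum>(k, i, j)\<in>F. cmod (pairing f (phc \<omega> (k - int m) i \<eta>)) * (\<Sum>\<theta>\<in>bits. cmod (a k i j \<theta>) * cmod (pairing g (phc \<omega> (k - int n) j \<theta>))) / vl TYPE('n) k)
    \<le> (\<Sum>(k, i, j)\<in>F. (2 ^ CARD('n) * M) * (sqrt (vl TYPE('n) (k - int m) * al2 \<omega> f (k - int m) i) * sqrt (vl TYPE('n) (k - int n) * al2 \<omega> g (k - int n) j) / vl TYPE('n) k))"
  proof (rule sum_mono, clarify)
    fix k i j assume "(k, i, j) \<in> F"
    hence t: "(k, i, j) \<in> tri \<omega> m n" using F(2) by blast
    have s: "0 \<le> sqrt (vl TYPE('n) (k - int n) * al2 \<omega> g (k - int n) j)" by (simp add: al2_nonneg)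
    have "(\<Sum>\<theta>\<in>bits. cmod (a k i j \<theta>) * cmod (pairing g (phc \<omega> (k - int n) j \<theta>)))
      \<le> (\<Sum>\<theta>\<in>(bits::(int^'n) set). M * sqrt (vl TYPE('n) (k - int n) * al2 \<omega> g (k - int n) j))"
      by (intro sum_mono mult_mono a[OF t] pairing_phc_le) (use M in auto)
    also have "\<dots> = 2 ^ CARD('n) * M * sqrt (vl TYPE('n) (k - int n) * al2 \<omega> g (k - int n) j)" by (simp add: card_bits)
    finally have "cmod (pairing f (phc \<omega> (k - int m) i \<eta>)) * (\<Sum>\<theta>\<in>bits. cmod (a k i j \<theta>) * cmod (pairing g (phc \<omega> (k - int n) j \<theta>)))
       \<le> sqrt (vl TYPE('n) (k - int m) * al2 \<omega> f (k - int m) i) * (2 ^ CARD('n) * M * sqrt (vl TYPE('n) (k - int n) * al2 \<omega> g (k - int n) j))"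
      using pairing_phc_le[OF \<eta>] by (intro mult_mono) (auto intro!: sum_nonneg simp: al2_nonneg)
    hence "cmod (pairing f (phc \<omega> (k - int m) i \<eta>)) * (\<Sum>\<theta>\<in>bits. cmod (a k i j \<theta>) * cmod (pairing g (phc \<omega> (k - int n) j \<theta>))) / vl TYPE('n) k
       \<le> sqrt (vl TYPE('n) (k - int m) * al2 \<omega> f (k - int m) i) * (2 ^ CARD('n) * M * sqrt (vl TYPE('n) (k - int n) * al2 \<omega> g (k - int n) j)) / vl TYPE('n) k"
      by (rule divide_right_mono) simp
    thus "cmod (pairing f (phc \<omega> (k - int m) i \<eta>)) * (\<Sum>\<theta>\<in>bits. cmod (a k i j \<theta>) * cmod (pairing g (phc \<omega> (k - int n) j \<theta>))) / vl TYPE('n) k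
       \<le> 2 ^ CARD('n) * M * (sqrt (vl TYPE('n) (k - int m) * al2 \<omega> f (k - int m) i) * sqrt (vl TYPE('n) (k - int n) * al2 \<omega> g (k - int n) j) / vl TYPE('n) k)"
      by (simp only: mult_ac times_divide_eq_right)
  qed
  also have "\<dots> = (2 ^ CARD('n) * M) * (\<Sum>(k, i, j)\<in>F. sqrt (vl TYPE('n) (k - int m) * al2 \<omega> f (k - int m) i) * sqrt (vl TYPE('n) (k - int n) * al2 \<omega> g (k - int n) j) / vl TYPE('n) k)"
    by (simp add: sum_distrib_left case_prod_unfold)
  also have "\<dots> \<le> (2 ^ CARD('n) * M) * (L2_norm f * L2_norm g)"
    by (intro mult_left_mono tri_bound[OF F al2_nonneg al2_nonneg bessel[OF v f] _ bessel[OF v g]]) (use M in auto)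
  finally show ?thesis by (simp add: mult.assoc)
qed

lemma frm_abs_bound:
  fixes \<omega> :: "('n::finite) digits"
  assumes a: "\<And>k i j \<eta> \<theta>. (k, i, j) \<in> tri \<omega> m n \<Longrightarrow> \<eta> \<in> bits \<Longrightarrow> \<theta> \<in> bits \<Longrightarrow> cmod (a k i j \<eta> \<theta>) \<le> M" and M: "M \<ge> 0"
    and v: "valid \<omega>" and f: "square_integrable f" and g: "square_integrable g" and F: "finite F" "F \<subseteq> tri \<omega> m n"
  shows "(\<Sum>(k, i, j)\<in>F. cmod (frm \<omega> m n a f g k i j)) \<le> (4 ^ CARD('n) * M) * L2_norm f * L2_norm g"
proof -
  let ?t = "\<lambda>\<eta> k i j. cmod (pairing f (phc \<omega> (k - int m) i \<eta>)) * (\<Sum>\<theta>\<in>bits. cmod (a k i j \<eta> \<theta>) * cmod (pairing g (phc \<omega> (k - int n) j \<theta>))) / vl TYPE('n) k"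
  have "(\<Sum>(k, i, j)\<in>F. cmod (frm \<omega> m n a f g k i j)) \<le> (\<Sum>(k, i, j)\<in>F. \<Sum>\<eta>\<in>bits. ?t \<eta> k i j)"
  proof (rule sum_mono, clarify)
    fix k i j
    have "cmod (frm \<omega> m n a f g k i j) \<le> (\<Sum>\<eta>\<in>bits. \<Sum>\<theta>\<in>bits. cmod (a k i j \<eta> \<theta>) * cmod (pairing f (phc \<omega> (k - int m) i \<eta>)) * cmod (pairing g (phc \<omega> (k - int n) j \<theta>))) / vl TYPE('n) k"
      unfolding frm_def norm_divide norm_of_real abs_of_pos[OF vl_pos]
      by (intro divide_right_mono order_trans[OF norm_sum sum_mono] order_trans[OF norm_sum sum_mono]) (auto simp: norm_mult)
    also have "\<dots> = (\<Sum>\<eta>\<in>bits. ?t \<eta> k i j)"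
      by (simp add: sum_divide_distrib sum_distrib_left mult_ac)
    finally show "cmod (frm \<omega> m n a f g k i j) \<le> (\<Sum>\<eta>\<in>bits. ?t \<eta> k i j)" .
  qed
  also have "\<dots> = (\<Sum>\<eta>\<in>bits. \<Sum>(k, i, j)\<in>F. ?t \<eta> k i j)"
    unfolding case_prod_unfold by (rule sum.swap)
  also have "\<dots> \<le> (\<Sum>\<eta>\<in>(bits::(int^'n) set). (2 ^ CARD('n) * M) * L2_norm f * L2_norm g)"
    by (intro sum_mono frm_elem_bound[OF _ _ M v f g F] a)
  also have "\<dots> = (4 ^ CARD('n) * M) * L2_norm f * L2_norm g"
    by (simp add: card_bits power_mult_distrib[symmetric])
  finally show ?thesis .
qed

text \<open>One elementary shift for each child \<eta> of the first cube, with the sum over \<theta>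
  absorbed into the second Haar function, and one more for \<open>u0\<close> and \<open>v0\<close>.
  The bound \<open>1 / 2 ^ CARD('n)\<close> keeps that sum at most 1 in the supremum norm.\<close>

lemma dyadic_shift_exists:
  fixes \<omega> :: "('n::finite) digits" and u0 v0 :: "int \<Rightarrow> int^'n \<Rightarrow> int^'n \<Rightarrow> 'n fn"
  assumes val: "valid \<omega>"
    and a: "\<And>k i j \<eta> \<theta>. (k, i, j) \<in> tri \<omega> m n \<Longrightarrow> \<eta> \<in> bits \<Longrightarrow> \<theta> \<in> bits \<Longrightarrow> cmod (a k i j \<eta> \<theta>) \<le> 1 / 2 ^ CARD('n)"
    and h0: "\<And>k i j. (k, i, j) \<in> tri \<omega> m n \<Longrightarrow> hr gen (shifted_lattice \<omega>) (cub \<omega> (k - int m) i) (u0 k i j) \<and>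
        hr gen (shifted_lattice \<omega>) (cub \<omega> (k - int n) j) (v0 k i j) \<and> sup_norm (u0 k i j) * sup_norm (v0 k i j) \<le> 1"
    and sq0: "\<And>k i j. square_integrable (u0 k i j)" "\<And>k i j. square_integrable (v0 k i j)"
    and bd0: "\<And>f g F. square_integrable f \<Longrightarrow> square_integrable g \<Longrightarrow> finite F \<Longrightarrow> F \<subseteq> tri \<omega> m n \<Longrightarrow>
       (\<Sum>(k, i, j)\<in>F. cmod (pairing f (u0 k i j)) * cmod (pairing (v0 k i j) g) / vl TYPE('n) k) \<le> K * L2_norm f * L2_norm g"
  shows "\<exists>S. dyadic_shift gen (shifted_lattice \<omega>) m n S \<and>
    (\<forall>f g. square_integrable f \<longrightarrow> square_integrable g \<longrightarrow>
       ((\<lambda>(k, i, j). frm \<omega> m n a f g k i j + pairing f (u0 k i j) * pairing (v0 k i j) g / vl TYPE('n) k)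
         has_sum pairing (S f) g) (tri \<omega> m n))"
proof -
  let ?D = "shifted_lattice \<omega>"
  let ?w = "\<lambda>\<eta> k i j x. \<Sum>\<theta>\<in>bits. a k i j \<eta> \<theta> * phc \<omega> (k - int n) j \<theta> x"
  let ?h = "\<lambda>f g \<eta> t. case t of (k, i, j) \<Rightarrow> pairing f (phc \<omega> (k - int m) i \<eta>) * (\<Sum>\<theta>\<in>bits. a k i j \<eta> \<theta> * pairing g (phc \<omega> (k - int n) j \<theta>)) / vl TYPE('n) k"
  let ?u = "\<lambda>f g t. case t of (k, i, j) \<Rightarrow> pairing f (u0 k i j) * pairing (v0 k i j) g / vl TYPE('n) k"
  define EP where "EP \<eta> E \<longleftrightarrow> elementary_shift gen ?D m n E \<and> (\<forall>f. square_integrable f \<longrightarrow> square_integrable (E f)) \<and>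
     (\<forall>f g. square_integrable f \<longrightarrow> square_integrable g \<longrightarrow>
       (?h f g \<eta> has_sum pairing (E f) g) (tri \<omega> m n))" for \<eta> and E :: "'n oper"
  have ex: "\<exists>E. EP \<eta> E"
    if \<eta>: "\<eta> \<in> bits" for \<eta>
  proof (rule elementary_shift_exists[OF val, of m n gen "\<lambda>k i j. phc \<omega> (k - int m) i \<eta>" "?w \<eta>" 1])
    fix k i j assume t: "(k, i, j) \<in> tri \<omega> m n"
    have s1: "0 \<le> sup_norm (phc \<omega> (k - int m) i \<eta>)" "sup_norm (phc \<omega> (k - int m) i \<eta>) \<le> 1"
      using sup_norm_le[of "phc \<omega> (k - int m) i \<eta>" 1] phi_bound[OF \<eta>] by auto
    have "cmod (\<Sum>\<theta>\<in>bits. a k i j \<eta> \<theta> * phc \<omega> (k - int n) j \<theta> x) \<le> 1" for x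
      using comb_bound[of "a k i j \<eta>" "1 / 2 ^ CARD('n)"] a[OF t \<eta>] by simp
    note s2 = sup_norm_le[OF this]
    show "hr gen ?D (cub \<omega> (k - int m) i) (phc \<omega> (k - int m) i \<eta>) \<and>
       hr gen ?D (cub \<omega> (k - int n) j) (?w \<eta> k i j) \<and>
       sup_norm (phc \<omega> (k - int m) i \<eta>) * sup_norm (?w \<eta> k i j) \<le> 1"
      using s1 s2 by (intro conjI hr_haar haar_phc haar_phc_comb val \<eta> mult_le_one)
  next
    fix f g :: "'n fn" and F assume fg: "square_integrable f" "square_integrable g" and F: "finite F" "F \<subseteq> tri \<omega> m n"
    have "(\<Sum>(k, i, j)\<in>F. cmod (pairing f (phc \<omega> (k - int m) i \<eta>)) * cmod (pairing (?w \<eta> k i j) g) / vl TYPE('n) k)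
      \<le> (\<Sum>(k, i, j)\<in>F. cmod (pairing f (phc \<omega> (k - int m) i \<eta>)) * (\<Sum>\<theta>\<in>bits. cmod (a k i j \<eta> \<theta>) * cmod (pairing g (phc \<omega> (k - int n) j \<theta>))) / vl TYPE('n) k)"
      unfolding pairing_comb[OF fg(2)] norm_mult[symmetric]
      by (rule sum_mono, clarify, intro divide_right_mono) (auto simp: norm_mult intro!: mult_left_mono order_trans[OF norm_sum sum_mono])
    also have "\<dots> \<le> (2 ^ CARD('n) * (1 / 2 ^ CARD('n))) * L2_norm f * L2_norm g"
      by (rule frm_elem_bound[OF _ \<eta> _ val fg F]) (use a \<eta> in auto)
    finally show "(\<Sum>(k, i, j)\<in>F. cmod (pairing f (phc \<omega> (k - int m) i \<eta>)) * cmod (pairing (?w \<eta> k i j) g) / vl TYPE('n) k) \<le> 1 * L2_norm f * L2_norm g"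
      by simp
  next
    fix E assume E: "elementary_shift gen ?D m n E" "\<And>f. square_integrable f \<Longrightarrow> square_integrable (E f)"
     "\<And>f g. square_integrable f \<Longrightarrow> square_integrable g \<Longrightarrow>
       ((\<lambda>(k, i, j). pairing f (phc \<omega> (k - int m) i \<eta>) * pairing (?w \<eta> k i j) g / vl TYPE('n) k) has_sum pairing (E f) g) (tri \<omega> m n)"
    show ?thesis unfolding EP_def
    proof (intro exI[of _ E] conjI allI impI E(1,2))
      fix f g :: "'n fn" assume fg: "square_integrable f" "square_integrable g"
      show "(?h f g \<eta> has_sum pairing (E f) g) (tri \<omega> m n)"
        using E(3)[OF fg] unfolding pairing_comb[OF fg(2)] .
    qed
  qed (simp_all add: comb_sq)
  define E where "E \<eta> = (SOME E. EP \<eta> E)" for \<eta>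
  have EP: "EP \<eta> (E \<eta>)" if "\<eta> \<in> bits" for \<eta>
    unfolding E_def by (rule someI_ex[OF ex[OF that]])
  have E: "\<And>\<eta>. \<eta> \<in> bits \<Longrightarrow> elementary_shift gen ?D m n (E \<eta>)"
     "\<And>\<eta> f. \<eta> \<in> bits \<Longrightarrow> square_integrable f \<Longrightarrow> square_integrable (E \<eta> f)"
     "\<And>\<eta> f g. \<eta> \<in> bits \<Longrightarrow> square_integrable f \<Longrightarrow> square_integrable g \<Longrightarrow>
       (?h f g \<eta> has_sum pairing (E \<eta> f) g) (tri \<omega> m n)"
    using EP unfolding EP_def by blast+
  obtain E0 where E0: "elementary_shift gen ?D m n E0" "\<And>f. square_integrable f \<Longrightarrow> square_integrable (E0 f)"
    "\<And>f g. square_integrable f \<Longrightarrow> square_integrable g \<Longrightarrow>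
       ((\<lambda>(k, i, j). pairing f (u0 k i j) * pairing (v0 k i j) g / vl TYPE('n) k) has_sum pairing (E0 f) g) (tri \<omega> m n)"
    by (rule elementary_shift_exists[OF val h0 sq0 bd0]) blast+
  obtain e :: "nat \<Rightarrow> int^'n" where e: "bij_betw e {0..<2 ^ CARD('n)} bits"
    using ex_bij_betw_nat_finite[of "bits :: (int^'n) set"] by (auto simp: card_bits)
  define S where "S f = (\<lambda>x. (\<Sum>\<eta>\<in>bits. E \<eta> f x) + E0 f x)" for f
  define EE where "EE l = (if l < 2 ^ CARD('n) then E (e l) else E0)" for l
  have Ssq: "square_integrable (S f)" if "square_integrable f" for f
    unfolding S_def using that by (intro square_integrable_add square_integrable_sum E E0)
  have "dyadic_shift gen ?D m n S"
    unfolding dyadic_shift_def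
  proof (intro exI[of _ "Suc (2 ^ CARD('n))"] exI[of _ EE] conjI allI impI)
    \<comment> \<open>The number \<open>2 ^ CARD('n) + 1\<close> of elementary shifts is within the
      allowance because the dimension is at least 1.\<close>
    have "(2::nat) \<le> 2 ^ CARD('n)" using self_le_power[of "2::nat" "CARD('n)"] by simp
    hence "Suc (2 ^ CARD('n)) \<le> 2 ^ CARD('n) * (2::nat)" "2 ^ CARD('n) * (2::nat) \<le> 2 ^ CARD('n) * 2 ^ CARD('n)" by simp_all
    thus "Suc (2 ^ CARD('n)) \<le> (2 ^ CARD('n))\<^sup>2" unfolding power2_eq_square by (rule order_trans)
    show "elementary_shift gen ?D m n (EE l)" for l
      using bij_betwE[OF e] E(1) E0(1) by (simp add: EE_def)
    show "square_integrable (S f)" if "square_integrable f" for f by (rule Ssq[OF that])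
    have "S f x = (\<Sum>l<Suc (2 ^ CARD('n)). EE l f x)" for f x
    proof -
      have "(\<Sum>l<Suc (2 ^ CARD('n)). EE l f x) = (\<Sum>l\<in>{0..<2 ^ CARD('n)}. E (e l) f x) + E0 f x"
        by (simp add: EE_def atLeast0LessThan)
      also have "(\<Sum>l\<in>{0..<2 ^ CARD('n)}. E (e l) f x) = (\<Sum>\<eta>\<in>bits. E \<eta> f x)"
        by (rule sum.reindex_bij_betw[OF e])
      finally show ?thesis by (simp add: S_def)
    qed
    thus "AE x in lborel. S f x = (\<Sum>l<Suc (2 ^ CARD('n)). EE l f x)" for f by simp
  qed
  moreover have "((\<lambda>(k, i, j). frm \<omega> m n a f g k i j + pairing f (u0 k i j) * pairing (v0 k i j) g / vl TYPE('n) k) has_sum pairing (S f) g) (tri \<omega> m n)"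
    if f: "square_integrable f" and g: "square_integrable g" for f g
  proof -
    have "pairing (S f) g = (\<Sum>\<eta>\<in>bits. pairing (E \<eta> f) g) + pairing (E0 f) g"
      unfolding S_def using f g E(2) E0(2)
      by (subst pairing_add_left) (auto intro!: square_integrable_sum simp: pairing_sum_left)
    moreover have "((\<lambda>t. \<Sum>\<eta>\<in>bits. ?h f g \<eta> t)
       has_sum (\<Sum>\<eta>\<in>bits. pairing (E \<eta> f) g)) (tri \<omega> m n)"
      by (rule has_sum_finite_sum') (use E(3) f g in auto)
    from has_sum_add[OF this E0(3)[OF f g]]
    have "((\<lambda>t. (\<Sum>\<eta>\<in>bits. ?h f g \<eta> t)
        + ?u f g t)
       has_sum ((\<Sum>\<eta>\<in>bits. pairing (E \<eta> f) g) + pairing (E0 f) g)) (tri \<omega> m n)" .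
    moreover have "(\<lambda>t. (\<Sum>\<eta>\<in>bits. ?h f g \<eta> t)
        + ?u f g t)
       = (\<lambda>(k, i, j). frm \<omega> m n a f g k i j + pairing f (u0 k i j) * pairing (v0 k i j) g / vl TYPE('n) k)"
      by (rule ext) (auto simp: frm_def sum_divide_distrib sum_distrib_left mult_ac)
    ultimately show ?thesis by simp
  qed
  ultimately show ?thesis by blast
qed

subsection \<open>Coefficients of the shifts\<close>

text \<open>Volumes grow with \<open>s\<close>, so the bound at the bottom serves the whole chain of
  ancestors.\<close>

lemma av_bound:
  fixes f :: "('n::finite) fn"
  assumes f: "square_integrable f"
  shows "cmod (av \<omega> f (l + int s) i) \<le> L2_norm f / sqrt (vl TYPE('n) l)"
proof -
  define V where "V = vl TYPE('n) (l + int s)"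
  have V: "V > 0" by (simp add: V_def)
  have le: "vl TYPE('n) l \<le> V" by (simp add: V_def vl_add_nat)
  have n: "L2_norm (ind (cub \<omega> (l + int s) i)) = sqrt V" by (simp add: cub_def L2_norm_qube V_def)
  have "cmod (av \<omega> f (l + int s) i) \<le> (L2_norm f * sqrt V) / V"
    using pairing_bound[OF f sq_ind_cub, of \<omega> "l + int s" i] V unfolding n
    by (simp add: av_def V_def[symmetric] norm_divide divide_right_mono)
  also have "\<dots> = L2_norm f / sqrt V"
    using V by (simp add: field_simps)
  also have "\<dots> \<le> L2_norm f / sqrt (vl TYPE('n) l)"
    using le V by (intro divide_left_mono) auto
  finally show ?thesis .
qed

text \<open>Summation by parts: \<open>t n\<close> collects the \<open>y\<close> from
  \<open>n\<close> on, so that each \<open>y n\<close> ends up multiplied by \<open>a 0\<close>. For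
  \<open>n = 0\<close> the natural number \<open>n - 1\<close> is 0 and the increment
  vanishes.\<close>

lemma abel_telescope:
  fixes a y t :: "nat \<Rightarrow> complex"
  assumes t: "\<And>n. t n = y n + t (Suc n)"
  shows "(\<Sum>n\<le>M. y n * a n + (a (n - 1) - a n) * t n) = (\<Sum>n\<le>M. y n * a 0) + (a 0 - a M) * t (Suc M)"
proof (induction M)
  case (Suc M)
  have e: "t (Suc (Suc M)) = t (Suc M) - y (Suc M)" using t[of "Suc M"] by simp
  show ?case unfolding sum.atMost_Suc Suc e by (simp add: algebra_simps)
qed simp

lemma sum_swap3: "(\<Sum>i\<in>I. \<Sum>e\<in>J. \<Sum>x\<in>S. h i e x) = (\<Sum>x\<in>S. \<Sum>i\<in>I. \<Sum>e\<in>J. h i e x)"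
proof -
  have "(\<Sum>i\<in>I. \<Sum>e\<in>J. \<Sum>x\<in>S. h i e x) = (\<Sum>i\<in>I. \<Sum>x\<in>S. \<Sum>e\<in>J. h i e x)"
    by (intro sum.cong refl sum.swap)
  also have "\<dots> = (\<Sum>x\<in>S. \<Sum>i\<in>I. \<Sum>e\<in>J. h i e x)" by (rule sum.swap)
  finally show ?thesis .
qed

context cz_form
begin

text \<open>The form between the indicator of the cube \<open>i\<close> and the martingale
  difference of \<open>g\<close> on the cube \<open>j\<close>.\<close>

definition bt :: "'n digits \<Rightarrow> 'n fn \<Rightarrow> int \<Rightarrow> int^'n \<Rightarrow> int^'n \<Rightarrow> complex" where
  "bt \<omega> g l i j = (\<Sum>\<theta>\<in>bits. pairing g (phc \<omega> l j \<theta>) / vl TYPE('n) (l - 1) * Bc \<omega> l i j \<theta>)"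

text \<open>
  With \<open>k = l + n\<close>: \<open>raw2\<close> collects the increments of the averages along the ancestors of \<open>i'\<close> for the
  pairs \<open>(i', j)\<close> of generation \<open>l\<close> in the shell \<open>n\<close>, and \<open>raw3\<close> those along the ancestors of \<open>j\<close>. The latter
  involve only \<open>j\<close>, so that all shells \<open>r \<ge> n\<close> contribute to the complexity \<open>(0, n)\<close>.
\<close>

definition raw2 :: "'n digits \<Rightarrow> nat \<Rightarrow> nat \<Rightarrow> 'n coeffs" where
  "raw2 \<omega> m n k i j \<eta> \<theta> = (\<Sum>i'\<in>shell j n. of_bool (anc \<omega> (k - int n) (n - m - 1) i' = chl \<omega> (k - int m) i \<eta>) *
     (wt \<omega> (k - int n) i' j * Bc \<omega> (k - int n) i' j \<theta>))"

definition raw3 :: "'n digits \<Rightarrow> nat \<Rightarrow> 'n coeffs" where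
  "raw3 \<omega> n k i j \<eta> \<theta> = - of_bool (chl \<omega> k i \<eta> = anc \<omega> (k - int n) (n - 1) j) *
     tail \<omega> (\<lambda>i'. wt \<omega> (k - int n) i' j) (k - int n) j \<theta> n"

text \<open>The factor undoes the volumes in \<open>frm\<close> and in \<open>pairing_phc\<close>,
  so that plain increments of averages remain (\<open>frm_crs\<close>).\<close>

definition crs :: "'n digits \<Rightarrow> nat \<Rightarrow> nat \<Rightarrow> 'n coeffs" where
  "crs \<omega> m n k i j \<eta> \<theta> = (if m < n then
     (raw2 \<omega> m n k i j \<eta> \<theta> + (if m = 0 then raw3 \<omega> n k i j \<eta> \<theta> else 0)) *
       complex_of_real (vl TYPE('n) k / (vl TYPE('n) (k - int m - 1) * vl TYPE('n) (k - int n - 1))) else 0)"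

text \<open>A pair of cubes of one generation is filed under the complexity given by its height,
  where the weight guarantees a common ancestor.\<close>

definition dia :: "'n digits \<Rightarrow> nat \<Rightarrow> nat \<Rightarrow> 'n coeffs" where
  "dia \<omega> m n k i j \<eta> \<theta> = (if m = n \<and> hgt (i - j) = m then
     wt \<omega> (k - int m) i j * B (phc \<omega> (k - int m) i \<eta>) (phc \<omega> (k - int m) j \<theta>) *
       complex_of_real (vl TYPE('n) k / (vl TYPE('n) (k - int m - 1) * vl TYPE('n) (k - int m - 1))) else 0)"

lemma wt_abs: "\<bar>wt \<omega> k i j\<bar> \<le> 2 ^ CARD('n)" for i j :: "int^'n"
  using wt_bounds[of \<omega> k i j] by simp

text \<open>A common bound for all coefficients; the power \<open>8 ^ CARD('n)\<close> is dictated
  by \<open>pw_haar\<close>, where the coefficients of all children are added.\<close>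

definition KK :: real where "KK = 8 ^ CARD('n) * EE / (1 - lam)"

lemma KK_ge: "EE + 4 ^ CARD('n) * EE / (1 - lam) \<le> KK" "2 ^ CARD('n) * EE \<le> KK" "KK \<ge> 0"
proof -
  define q where "q = EE / (1 - lam)"
  define d4 where "d4 = (4::real) ^ CARD('n)"
  define d2 where "d2 = (2::real) ^ CARD('n)"
  have l: "1 - lam > 0" "1 - lam \<le> 1" using lam by auto
  have d: "d4 \<ge> 1" "d2 \<ge> 2" using self_le_power[of "2::real" "CARD('n)"] by (auto simp: d4_def d2_def)
  have K: "KK = d2 * (d4 * q)"
    by (simp add: KK_def d4_def d2_def q_def power_mult_distrib[symmetric] mult.assoc[symmetric])
  have q: "EE \<le> q" using EE l by (simp add: q_def le_divide_eq mult_left_le)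
  have q0: "0 \<le> q" using EE l by (simp add: q_def)
  have q4: "q \<le> d4 * q" using mult_right_mono[OF d(1) q0] by simp
  have q5: "0 \<le> d4 * q" using q0 q4 by linarith
  have q6: "2 * (d4 * q) \<le> KK" unfolding K using d(2) q5 by (rule mult_right_mono)
  have "4 ^ CARD('n) * EE / (1 - lam) = d4 * q" by (simp add: d4_def q_def)
  thus "EE + 4 ^ CARD('n) * EE / (1 - lam) \<le> KK" using q q4 q6 by linarith
  have "d2 * EE \<le> d2 * (d4 * q)" using q q4 d(2) by (intro mult_left_mono) auto
  thus "2 ^ CARD('n) * EE \<le> KK" by (simp add: K d2_def)
  show "KK \<ge> 0" using q5 q6 by linarith
qed

text \<open>Only cubes below one prescribed cube enter, at most
  \<open>2 ^ (CARD('n) * (n - m - 1))\<close> of them; counting the whole shell would lose a factor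
  that grows with \<open>m\<close>.\<close>

lemma raw2_bound:
  assumes "m < n" "\<theta> \<in> bits"
  shows "cmod (raw2 \<omega> m n k i j \<eta> \<theta>) \<le> 2 ^ (CARD('n) * (n - m - 1)) * (2 ^ CARD('n) * (A * vl TYPE('n) (k - int n) * dec TYPE('n) \<alpha> n))"
proof -
  let ?S = "{i' \<in> shell j n. anc \<omega> (k - int n) (n - m - 1) i' = chl \<omega> (k - int m) i \<eta>}"
  define M where "M = 2 ^ CARD('n) * (A * vl TYPE('n) (k - int n) * dec TYPE('n) \<alpha> n)"
  have M0: "M \<ge> 0" using A by (auto simp: M_def intro!: mult_nonneg_nonneg less_imp_le[OF dec_pos])
  have "cmod (raw2 \<omega> m n k i j \<eta> \<theta>) \<le> (\<Sum>i'\<in>shell j n. of_bool (anc \<omega> (k - int n) (n - m - 1) i' = chl \<omega> (k - int m) i \<eta>) * M)"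
    unfolding raw2_def
  proof (rule order_trans[OF norm_sum sum_mono])
    fix i' assume "i' \<in> shell j n"
    hence h: "hgt (i' - j) = n" by (simp add: shell_def)
    have "\<bar>wt \<omega> (k - int n) i' j\<bar> * cmod (Bc \<omega> (k - int n) i' j \<theta>) \<le> M"
      unfolding M_def using Bc_bound[OF assms(2), of \<omega> "k - int n" i' j] wt_abs unfolding h
      by (intro mult_mono) auto
    thus "cmod (of_bool (anc \<omega> (k - int n) (n - m - 1) i' = chl \<omega> (k - int m) i \<eta>) *
       (wt \<omega> (k - int n) i' j * Bc \<omega> (k - int n) i' j \<theta>)) \<le> of_bool (anc \<omega> (k - int n) (n - m - 1) i' = chl \<omega> (k - int m) i \<eta>) * M"
      by (simp add: norm_mult)
  qed
  also have "\<dots> = (\<Sum>i'\<in>?S. M)"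
    by (rule sum.mono_neutral_cong_right) auto
  also have "\<dots> = real (card ?S) * M" by simp
  also have "\<dots> \<le> real (2 ^ (CARD('n) * (n - m - 1))) * M"
  proof (rule mult_right_mono[OF _ M0])
    have "card ?S \<le> card {i'. anc \<omega> (k - int n) (n - m - 1) i' = chl \<omega> (k - int m) i \<eta>}"
      using desc_finite_card by (intro card_mono) auto
    also have "\<dots> \<le> 2 ^ (CARD('n) * (n - m - 1))" using desc_finite_card by blast
    finally show "real (card ?S) \<le> real (2 ^ (CARD('n) * (n - m - 1)))" by (rule of_nat_mono)
  qed
  finally show ?thesis by (simp add: M_def)
qed

text \<open>
  The exponential loss \<open>2 ^ (CARD('n) * n)\<close> from the ratio of the volumes is compensated by the
  decay of the kernel, leaving \<open>lam ^ n = 2 powr (- \<alpha> * n)\<close>.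
\<close>

lemma crs_bound:
  assumes "\<theta> \<in> bits"
  shows "cmod (crs \<omega> m n k i j \<eta> \<theta>) \<le> KK * lam ^ max m n"
proof (cases "m < n")
  case False
  thus ?thesis using KK_ge(3) lam by (simp add: crs_def)
next
  case True
  define V where "V = vl TYPE('n) (k - int n)"
  have V: "V > 0" by (simp add: V_def)
  have v1: "vl TYPE('n) k = V * 2 ^ (CARD('n) * n)"
    using vl_add_nat[where 'n = 'n, of "k - int n" n] by (simp add: V_def)
  have v2: "vl TYPE('n) (k - int m - 1) = V * 2 ^ (CARD('n) * (n - m - 1))"
  proof -
    have "k - int m - 1 = (k - int n) + int (n - m - 1)" using True by simp
    thus ?thesis unfolding V_def by (simp only: vl_add_nat)
  qed
  have v3: "vl TYPE('n) (k - int n - 1) = V / 2 ^ CARD('n)" by (simp add: V_def vl_diff_1)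
  define R where "R = vl TYPE('n) k / (vl TYPE('n) (k - int m - 1) * vl TYPE('n) (k - int n - 1))"
  have R0: "R > 0" by (simp add: R_def)
  have b2: "cmod (raw2 \<omega> m n k i j \<eta> \<theta>) * R \<le> EE * lam ^ n"
  proof -
    have "cmod (raw2 \<omega> m n k i j \<eta> \<theta>) * R \<le> 2 ^ (CARD('n) * (n - m - 1)) * (2 ^ CARD('n) * (A * V * dec TYPE('n) \<alpha> n)) * R"
      using raw2_bound[OF True assms, of \<omega> k i j \<eta>] R0 by (intro mult_right_mono) (auto simp: V_def)
    also have "\<dots> = (2 ^ CARD('n) * 2 ^ CARD('n)) * A * (dec TYPE('n) \<alpha> n * 2 ^ (CARD('n) * n))"
      unfolding R_def v1 v2 v3 using V by (simp add: field_simps)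
    also have "\<dots> = EE * lam ^ n" by (simp add: dec_lam EE_def power_mult_distrib[symmetric])
    finally show ?thesis .
  qed
  have b3: "cmod (if m = 0 then raw3 \<omega> n k i j \<eta> \<theta> else 0) * R \<le> (4 ^ CARD('n) * EE / (1 - lam)) * lam ^ n"
  proof (cases "m = 0")
    case m0: True
    have "cmod (raw3 \<omega> n k i j \<eta> \<theta>) \<le> cmod (tail \<omega> (\<lambda>i'. wt \<omega> (k - int n) i' j) (k - int n) j \<theta> n)"
      by (simp add: raw3_def norm_mult)
    also have "\<dots> \<le> (EE * V) * lam ^ n / (1 - lam)"
      unfolding V_def by (rule tail_bound[OF assms wt_abs])
    finally have "cmod (raw3 \<omega> n k i j \<eta> \<theta>) * R \<le> (EE * V) * lam ^ n / (1 - lam) * R"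
      using R0 by (intro mult_right_mono) auto
    also have "(EE * V) * lam ^ n / (1 - lam) * R = (EE * V) * lam ^ n / (1 - lam) * (4 ^ CARD('n) / V)"
    proof -
      have "(2::real) ^ (CARD('n) * n) = 2 ^ (CARD('n) * (n - m - 1)) * 2 ^ CARD('n)"
        using True m0 by (simp add: power_add[symmetric] right_diff_distrib')
      moreover have "(4::real) ^ CARD('n) = 2 ^ CARD('n) * 2 ^ CARD('n)" by (simp add: power_mult_distrib[symmetric])
      ultimately have "R = 4 ^ CARD('n) / V" unfolding R_def v1 v2 v3 using V by simp
      thus ?thesis by simp
    qed
    also have "(EE * V) * lam ^ n / (1 - lam) * (4 ^ CARD('n) / V) = (4 ^ CARD('n) * EE / (1 - lam)) * lam ^ n"
      using V by simp
    finally show ?thesis using m0 by simp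
  qed (use EE lam in simp)
  have "cmod (crs \<omega> m n k i j \<eta> \<theta>) = cmod (raw2 \<omega> m n k i j \<eta> \<theta> + (if m = 0 then raw3 \<omega> n k i j \<eta> \<theta> else 0)) * R"
    using True R0 unfolding crs_def R_def[symmetric] by (simp only: norm_mult norm_of_real if_True abs_of_pos)
  also have "\<dots> \<le> (cmod (raw2 \<omega> m n k i j \<eta> \<theta>) + cmod (if m = 0 then raw3 \<omega> n k i j \<eta> \<theta> else 0)) * R"
    using R0 by (intro mult_right_mono norm_triangle_ineq) auto
  also have "\<dots> \<le> EE * lam ^ n + (4 ^ CARD('n) * EE / (1 - lam)) * lam ^ n"
    using b2 b3 by (simp add: distrib_right)
  also have "\<dots> = (EE + 4 ^ CARD('n) * EE / (1 - lam)) * lam ^ n" by (simp add: distrib_right)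
  also have "\<dots> \<le> KK * lam ^ n" using KK_ge(1) lam by (intro mult_right_mono) auto
  finally show ?thesis using True by (simp add: max_def)
qed

lemma dia_bound:
  assumes "\<eta> \<in> bits" "\<theta> \<in> bits"
  shows "cmod (dia \<omega> m n k i j \<eta> \<theta>) \<le> KK * lam ^ max m n"
proof (cases "m = n \<and> hgt (i - j) = m")
  case False
  thus ?thesis using KK_ge(3) lam by (auto simp: dia_def)
next
  case True
  define V where "V = vl TYPE('n) (k - int m)"
  have V: "V > 0" by (simp add: V_def)
  have v1: "vl TYPE('n) k = V * 2 ^ (CARD('n) * m)"
    using vl_add_nat[where 'n = 'n, of "k - int m" m] by (simp add: V_def)
  have v3: "vl TYPE('n) (k - int m - 1) = V / 2 ^ CARD('n)" by (simp add: V_def vl_diff_1)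
  define R where "R = vl TYPE('n) k / (vl TYPE('n) (k - int m - 1) * vl TYPE('n) (k - int m - 1))"
  have R0: "R > 0" by (simp add: R_def)
  have "cmod (dia \<omega> m n k i j \<eta> \<theta>) = \<bar>wt \<omega> (k - int m) i j\<bar> * cmod (B (phc \<omega> (k - int m) i \<eta>) (phc \<omega> (k - int m) j \<theta>)) * R"
    unfolding dia_def R_def[symmetric] if_P[OF True] norm_mult norm_of_real using R0 by simp
  also have "\<dots> \<le> 2 ^ CARD('n) * (A * V * dec TYPE('n) \<alpha> m) * R"
    using Bphi_bound[OF assms, where \<omega> = \<omega> and k = "k - int m" and i = i and j = j] wt_abs True R0 unfolding V_def
    by (intro mult_right_mono mult_mono) auto
  also have "\<dots> = 2 ^ CARD('n) * ((2 ^ CARD('n) * 2 ^ CARD('n)) * A * (dec TYPE('n) \<alpha> m * 2 ^ (CARD('n) * m)))"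
    unfolding R_def v1 v3 using V by (simp add: field_simps)
  also have "\<dots> = 2 ^ CARD('n) * EE * lam ^ m" by (simp add: dec_lam EE_def power_mult_distrib[symmetric])
  also have "\<dots> \<le> KK * lam ^ m" using KK_ge(2) lam by (intro mult_right_mono) auto
  finally show ?thesis using True by simp
qed

subsection \<open>The cross terms at a fixed scale\<close>

text \<open>The differences of averages for one cube \<open>j\<close>, shell by shell;
  \<open>c = wt\<close> gives the weighted version and \<open>c = 1\<close> the true one.\<close>

definition wsum :: "'n digits \<Rightarrow> (int^'n \<Rightarrow> real) \<Rightarrow> 'n fn \<Rightarrow> 'n fn \<Rightarrow> int \<Rightarrow> int^'n \<Rightarrow> nat \<Rightarrow> complex" where
  "wsum \<omega> c f g l j r = (\<Sum>i\<in>shell j r. complex_of_real (c i) * bt \<omega> g l i j * (av \<omega> f l i - av \<omega> f l j))"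

definition GG :: "'n digits \<Rightarrow> 'n fn \<Rightarrow> int \<Rightarrow> int^'n \<Rightarrow> real" where
  "GG \<omega> g l j = (\<Sum>\<theta>\<in>bits. cmod (pairing g (phc \<omega> l j \<theta>)) / vl TYPE('n) (l - 1))"

lemma GG_nonneg: "GG \<omega> g l j \<ge> 0"
  unfolding GG_def by (intro sum_nonneg divide_nonneg_pos) auto

lemma bt_shell_bound:
  assumes c: "\<And>i. \<bar>c i\<bar> \<le> 2 ^ CARD('n)"
  shows "(\<Sum>i\<in>shell j r. cmod (complex_of_real (c i) * bt \<omega> g l i j)) \<le> (EE * vl TYPE('n) l * GG \<omega> g l j) * lam ^ r"
proof -
  have "(\<Sum>i\<in>shell j r. cmod (complex_of_real (c i) * bt \<omega> g l i j))
     \<le> (\<Sum>i\<in>shell j r. \<Sum>\<theta>\<in>bits. cmod (pairing g (phc \<omega> l j \<theta>)) / vl TYPE('n) (l - 1) * cmod (complex_of_real (c i) * Bc \<omega> l i j \<theta>))"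
  proof (rule sum_mono)
    fix i
    have "complex_of_real (c i) * bt \<omega> g l i j = (\<Sum>\<theta>\<in>bits. pairing g (phc \<omega> l j \<theta>) / vl TYPE('n) (l - 1) * (complex_of_real (c i) * Bc \<omega> l i j \<theta>))"
      by (simp add: bt_def sum_distrib_left mult_ac)
    thus "cmod (complex_of_real (c i) * bt \<omega> g l i j) \<le> (\<Sum>\<theta>\<in>bits. cmod (pairing g (phc \<omega> l j \<theta>)) / vl TYPE('n) (l - 1) * cmod (complex_of_real (c i) * Bc \<omega> l i j \<theta>))"
      using norm_sum[of "\<lambda>\<theta>. pairing g (phc \<omega> l j \<theta>) / vl TYPE('n) (l - 1) * (complex_of_real (c i) * Bc \<omega> l i j \<theta>)" bits]
      by (simp add: norm_mult norm_divide)
  qed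
  also have "\<dots> = (\<Sum>\<theta>\<in>bits. cmod (pairing g (phc \<omega> l j \<theta>)) / vl TYPE('n) (l - 1) * (\<Sum>i\<in>shell j r. cmod (complex_of_real (c i) * Bc \<omega> l i j \<theta>)))"
    unfolding sum_distrib_left by (rule sum.swap)
  also have "\<dots> \<le> (\<Sum>\<theta>\<in>bits. cmod (pairing g (phc \<omega> l j \<theta>)) / vl TYPE('n) (l - 1) * ((EE * vl TYPE('n) l) * lam ^ r))"
    by (intro sum_mono mult_left_mono esum_abs_bound c) auto
  also have "\<dots> = (EE * vl TYPE('n) l * GG \<omega> g l j) * lam ^ r"
    unfolding GG_def sum_distrib_right[symmetric] by (simp add: mult_ac)
  finally show ?thesis .
qed

lemma wsum_bound:
  assumes c: "\<And>i. \<bar>c i\<bar> \<le> 2 ^ CARD('n)" and f: "square_integrable f"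
  shows "cmod (wsum \<omega> c f g l j r) \<le> (2 * (L2_norm f / sqrt (vl TYPE('n) l)) * (EE * vl TYPE('n) l * GG \<omega> g l j)) * lam ^ r"
proof -
  let ?a = "L2_norm f / sqrt (vl TYPE('n) l)"
  have a: "cmod (av \<omega> f l i) \<le> ?a" for i using av_bound[OF f, of \<omega> l 0 i] by simp
  have a2: "cmod (av \<omega> f l i - av \<omega> f l j) \<le> 2 * ?a" for i
    using norm_triangle_ineq4[of "av \<omega> f l i" "av \<omega> f l j"] a[of i] a[of j] by linarith
  have "cmod (wsum \<omega> c f g l j r) \<le> (\<Sum>i\<in>shell j r. cmod (complex_of_real (c i) * bt \<omega> g l i j) * (2 * ?a))"
    unfolding wsum_def
  proof (rule order_trans[OF norm_sum sum_mono])
    fix i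
    show "cmod (complex_of_real (c i) * bt \<omega> g l i j * (av \<omega> f l i - av \<omega> f l j)) \<le> cmod (complex_of_real (c i) * bt \<omega> g l i j) * (2 * ?a)"
      by (subst norm_mult) (rule mult_left_mono[OF a2], simp)
  qed
  also have "\<dots> = 2 * ?a * (\<Sum>i\<in>shell j r. cmod (complex_of_real (c i) * bt \<omega> g l i j))"
    by (simp add: sum_distrib_left mult_ac)
  also have "\<dots> \<le> 2 * ?a * ((EE * vl TYPE('n) l * GG \<omega> g l j) * lam ^ r)"
    by (intro mult_left_mono bt_shell_bound c) auto
  finally show ?thesis by (simp only: mult.assoc)
qed

lemma frm_crs:
  assumes v: "valid \<omega>" and f: "square_integrable f" and mn: "m < n" and k: "k = l + int n"
  shows "frm \<omega> m n (crs \<omega> m n) f g k i j =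
    (\<Sum>\<eta>\<in>bits. (av \<omega> f (k - int m - 1) (chl \<omega> (k - int m) i \<eta>) - av \<omega> f (k - int m) i) *
      (\<Sum>\<theta>\<in>bits. (raw2 \<omega> m n k i j \<eta> \<theta> + (if m = 0 then raw3 \<omega> n k i j \<eta> \<theta> else 0)) *
         (pairing g (phc \<omega> l j \<theta>) / vl TYPE('n) (l - 1))))"
proof -
  have kn: "k - int n = l" using k by simp
  define r where "r \<eta> \<theta> = raw2 \<omega> m n k i j \<eta> \<theta> + (if m = 0 then raw3 \<omega> n k i j \<eta> \<theta> else 0)" for \<eta> \<theta>
  have "crs \<omega> m n k i j \<eta> \<theta> * pairing f (phc \<omega> (k - int m) i \<eta>) * pairing g (phc \<omega> (k - int n) j \<theta>) / vl TYPE('n) k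
     = (av \<omega> f (k - int m - 1) (chl \<omega> (k - int m) i \<eta>) - av \<omega> f (k - int m) i) * (r \<eta> \<theta> * (pairing g (phc \<omega> l j \<theta>) / vl TYPE('n) (l - 1)))" for \<eta> \<theta>
    unfolding pairing_phc[OF v f] crs_def r_def[symmetric] kn using mn by simp
  thus ?thesis unfolding frm_def sum_divide_distrib sum_distrib_left r_def[symmetric] by (simp cong: sum.cong)
qed

lemma raw2_sum:
  "(\<Sum>\<theta>\<in>bits. raw2 \<omega> m n k i j \<eta> \<theta> * (pairing g (phc \<omega> l j \<theta>) / vl TYPE('n) (l - 1)))
    = (\<Sum>i'\<in>shell j n. of_bool (anc \<omega> l (n - m - 1) i' = chl \<omega> (k - int m) i \<eta>) * (wt \<omega> l i' j * bt \<omega> g l i' j))"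
  if "k = l + int n"
proof -
  have kn: "k - int n = l" using that by simp
  show ?thesis unfolding raw2_def bt_def kn sum_distrib_right sum_distrib_left
    by (subst sum.swap) (simp add: mult_ac)
qed

text \<open>For each \<open>i'\<close> of nonzero weight exactly one pair \<open>(i, \<eta>)\<close>
  matches: the link of the ancestor chain of \<open>i'\<close> between the generations
  \<open>k - m - 1\<close> and \<open>k - m\<close>. It lies below the ancestor of \<open>j\<close>
  because the weight forces the two chains to merge.\<close>

lemma fam2_sum:
  assumes v: "valid \<omega>" and mn: "m < n" and k: "k = l + int n"
  shows "(\<Sum>i | anc \<omega> (k - int m) m i = anc \<omega> l n j. \<Sum>\<eta>\<in>bits. (av \<omega> f (k - int m - 1) (chl \<omega> (k - int m) i \<eta>) - av \<omega> f (k - int m) i) *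
      (\<Sum>i'\<in>shell j n. of_bool (anc \<omega> l (n - m - 1) i' = chl \<omega> (k - int m) i \<eta>) * (wt \<omega> l i' j * bt \<omega> g l i' j)))
    = (\<Sum>i'\<in>shell j n. wt \<omega> l i' j * bt \<omega> g l i' j *
         (av \<omega> f (l + int (n - m - 1)) (anc \<omega> l (n - m - 1) i') - av \<omega> f (l + int (n - m)) (anc \<omega> l (n - m) i')))"
proof -
  let ?I = "{i. anc \<omega> (k - int m) m i = anc \<omega> l n j}"
  have fI: "finite ?I" using desc_finite_card by blast
  have km: "k - int m = l + int (n - m)" using k mn by simp
  have km1: "k - int m - 1 = l + int (n - m - 1)" using k mn by simp
  have Suc: "n - m = Suc (n - m - 1)" using mn by simp
  define d where "d i \<eta> = av \<omega> f (k - int m - 1) (chl \<omega> (k - int m) i \<eta>) - av \<omega> f (k - int m) i" for i \<eta>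
  define w where "w i' = wt \<omega> l i' j * bt \<omega> g l i' j" for i'
  have "(\<Sum>i\<in>?I. \<Sum>\<eta>\<in>bits. d i \<eta> * (\<Sum>i'\<in>shell j n. of_bool (anc \<omega> l (n - m - 1) i' = chl \<omega> (k - int m) i \<eta>) * w i'))
    = (\<Sum>i'\<in>shell j n. w i' * (\<Sum>i\<in>?I. \<Sum>\<eta>\<in>bits. of_bool (anc \<omega> l (n - m - 1) i' = chl \<omega> (k - int m) i \<eta>) * d i \<eta>))"
    unfolding sum_distrib_left
    unfolding sum_swap3[where S = "shell j n"] by (simp add: mult_ac)
  also have "\<dots> = (\<Sum>i'\<in>shell j n. w i' * (av \<omega> f (l + int (n - m - 1)) (anc \<omega> l (n - m - 1) i') - av \<omega> f (l + int (n - m)) (anc \<omega> l (n - m) i')))"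
  proof (rule sum.cong[OF refl])
    fix i' assume i': "i' \<in> shell j n"
    show "w i' * (\<Sum>i\<in>?I. \<Sum>\<eta>\<in>bits. of_bool (anc \<omega> l (n - m - 1) i' = chl \<omega> (k - int m) i \<eta>) * d i \<eta>)
       = w i' * (av \<omega> f (l + int (n - m - 1)) (anc \<omega> l (n - m - 1) i') - av \<omega> f (l + int (n - m)) (anc \<omega> l (n - m) i'))"
    proof (cases "wt \<omega> l i' j = 0")
      case True
      thus ?thesis by (simp add: w_def)
    next
      case False
      define p where "p = anc \<omega> l (n - m - 1) i'"
      define q where "q = anc \<omega> l (n - m) i'"
      have qp: "q = par \<omega> (k - int m - 1) p"
        unfolding q_def p_def km1 by (subst Suc) simp
      then obtain e where e: "e \<in> bits" "p = chl \<omega> (k - int m) q e"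
        using par_eq_iff[of \<omega> "k - int m" p q] by auto
      have "anc \<omega> l n i' = anc \<omega> l n j" using wt_merge[OF False] i' by (simp add: shell_def)
      moreover have "anc \<omega> (k - int m) m q = anc \<omega> l n i'"
        unfolding q_def km using anc_add[of \<omega> l "n - m" m i'] mn by simp
      ultimately have qI: "q \<in> ?I" by simp
      have "of_bool (p = chl \<omega> (k - int m) i \<eta>) * d i \<eta> = (if i = q then of_bool (\<eta> = e) * d q e else 0)" if "\<eta> \<in> bits" for i \<eta>
      proof (cases "p = chl \<omega> (k - int m) i \<eta>")
        case pt: True
        have "i = q" using qp pt par_chl[OF that, of \<omega> "k - int m" i] by simp
        moreover hence "\<eta> = e" using pt e(2) chl_inj by metis
        ultimately show ?thesis using pt by simp
      next
        case False
        thus ?thesis using e(2) by auto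
      qed
      hence "(\<Sum>i\<in>?I. \<Sum>\<eta>\<in>bits. of_bool (p = chl \<omega> (k - int m) i \<eta>) * d i \<eta>)
         = (\<Sum>i\<in>?I. \<Sum>\<eta>\<in>bits. if i = q then of_bool (\<eta> = e) * d q e else 0)"
        by (intro sum.cong refl) auto
      also have "\<dots> = (\<Sum>i\<in>?I. if i = q then d q e else 0)"
        by (rule sum.cong[OF refl]) (use e(1) in \<open>simp add: of_bool_def if_distrib[of "\<lambda>x. x * _"] cong: if_cong\<close>)
      also have "\<dots> = d q e" using fI qI by simp
      finally have inner: "(\<Sum>i\<in>?I. \<Sum>\<eta>\<in>bits. of_bool (p = chl \<omega> (k - int m) i \<eta>) * d i \<eta>) = d q e" .
      have "d q e = av \<omega> f (k - int m - 1) p - av \<omega> f (k - int m) q"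
        by (simp only: d_def e(2)[symmetric])
      hence dq: "d q e = av \<omega> f (l + int (n - m - 1)) p - av \<omega> f (l + int (n - m)) q"
        by (simp only: km1) (simp only: km)
      show ?thesis unfolding p_def[symmetric] q_def[symmetric] inner dq ..
    qed
  qed
  finally show ?thesis by (simp only: d_def w_def)
qed

lemma tail_step:
  assumes "\<theta> \<in> bits" "\<And>i. \<bar>c i\<bar> \<le> 2 ^ CARD('n)"
  shows "tail \<omega> c k j \<theta> n = esum \<omega> c k j \<theta> n + tail \<omega> c k j \<theta> (Suc n)"
proof -
  have sm: "summable (\<lambda>r. if Suc n \<le> r then esum \<omega> c k j \<theta> r else 0)"
    by (rule geometric_tail(2)[OF esum_bound[OF assms]]) (use lam in auto)
  have "(\<lambda>r. if r \<in> {n} then esum \<omega> c k j \<theta> r else 0) sums (\<Sum>r\<in>{n}. esum \<omega> c k j \<theta> r)"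
    by (rule sums_If_finite_set) simp
  from sums_add[OF this summable_sums[OF sm]]
  have "(\<lambda>r. (if r \<in> {n} then esum \<omega> c k j \<theta> r else 0) + (if Suc n \<le> r then esum \<omega> c k j \<theta> r else 0)) sums
     (esum \<omega> c k j \<theta> n + tail \<omega> c k j \<theta> (Suc n))" by (simp add: tail_def)
  moreover have "(\<lambda>r. (if r \<in> {n} then esum \<omega> c k j \<theta> r else 0) + (if Suc n \<le> r then esum \<omega> c k j \<theta> r else 0))
     = (\<lambda>r. if n \<le> r then esum \<omega> c k j \<theta> r else 0)" by (auto simp: fun_eq_iff)
  ultimately show ?thesis unfolding tail_def[of _ _ _ _ _ n] by (simp add: sums_iff)
qed

text \<open>Grouped by \<open>n\<close>, the links of the chain of \<open>i'\<close> telescope from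
  its own average to that of the common ancestor. The links of the chain of \<open>j\<close> are
  stored in the tails \<open>t\<close>, and summation by parts leads from the common ancestor down
  to \<open>j\<close>.\<close>

lemma cross_sums:
  assumes v: "valid \<omega>" and f: "square_integrable f"
  shows "(\<lambda>n. \<Sum>m<n. \<Sum>i | anc \<omega> (l + int n - int m) m i = anc \<omega> l n j. frm \<omega> m n (crs \<omega> m n) f g (l + int n) i j)
     sums (\<Sum>r. wsum \<omega> (\<lambda>i. wt \<omega> l i j) f g l j r)"
proof -
  define c where "c i = wt \<omega> l i j" for i
  have cb: "\<bar>c i\<bar> \<le> 2 ^ CARD('n)" for i unfolding c_def by (rule wt_abs)
  define a where "a s = av \<omega> f (l + int s) (anc \<omega> l s j)" for s
  define pg where "pg \<theta> = pairing g (phc \<omega> l j \<theta>) / vl TYPE('n) (l - 1)" for \<theta>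
  define y where "y r = (\<Sum>i\<in>shell j r. complex_of_real (c i) * bt \<omega> g l i j)" for r
  define t where "t n = (\<Sum>\<theta>\<in>bits. tail \<omega> c l j \<theta> n * pg \<theta>)" for n
  have y_alt: "y r = (\<Sum>\<theta>\<in>bits. esum \<omega> c l j \<theta> r * pg \<theta>)" for r
    unfolding y_def bt_def esum_def pg_def sum_distrib_left sum_distrib_right
    by (subst sum.swap) (simp add: mult_ac)
  have t_step: "t n = y n + t (Suc n)" for n
    unfolding t_def y_alt sum.distrib[symmetric]
    by (intro sum.cong refl) (subst tail_step[OF _ cb], assumption, rule distrib_right)
  \<comment> \<open>The chain of \<open>i'\<close> produces the difference from \<open>a n\<close>,
    the average on the ancestor of \<open>j\<close>; the correction with \<open>t n\<close> prepares
    the passage to \<open>a 0\<close>.\<close>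
  have trm: "(\<Sum>m<n. \<Sum>i | anc \<omega> (l + int n - int m) m i = anc \<omega> l n j. frm \<omega> m n (crs \<omega> m n) f g (l + int n) i j)
     = (\<Sum>i'\<in>shell j n. complex_of_real (c i') * bt \<omega> g l i' j * av \<omega> f l i') - (y n * a n + (a (n - 1) - a n) * t n)" for n
  proof (cases "n = 0")
    case True
    have "shell j 0 = {}" by (simp add: shell_def hgt_def)
    thus ?thesis using True by (simp add: y_def)
  next
    case n0: False
    define F2 where "F2 m = (\<Sum>i'\<in>shell j n. complex_of_real (c i') * bt \<omega> g l i' j *
         (av \<omega> f (l + int (n - m - 1)) (anc \<omega> l (n - m - 1) i') - av \<omega> f (l + int (n - m)) (anc \<omega> l (n - m) i')))" for m
    have one: "(\<Sum>i | anc \<omega> (l + int n - int m) m i = anc \<omega> l n j. frm \<omega> m n (crs \<omega> m n) f g (l + int n) i j)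
       = F2 m + (if m = 0 then - ((a (n - 1) - a n) * t n) else 0)" if mn: "m < n" for m
    proof -
      let ?I = "{i. anc \<omega> (l + int n - int m) m i = anc \<omega> l n j}"
      define d where "d i \<eta> = av \<omega> f (l + int n - int m - 1) (chl \<omega> (l + int n - int m) i \<eta>) - av \<omega> f (l + int n - int m) i" for i \<eta>
      have "(\<Sum>i\<in>?I. frm \<omega> m n (crs \<omega> m n) f g (l + int n) i j)
         = (\<Sum>i\<in>?I. \<Sum>\<eta>\<in>bits. d i \<eta> * (\<Sum>\<theta>\<in>bits. raw2 \<omega> m n (l + int n) i j \<eta> \<theta> * pg \<theta>))
          + (\<Sum>i\<in>?I. \<Sum>\<eta>\<in>bits. d i \<eta> * (\<Sum>\<theta>\<in>bits. (if m = 0 then raw3 \<omega> n (l + int n) i j \<eta> \<theta> else 0) * pg \<theta>))"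
        unfolding frm_crs[OF v f mn refl] d_def pg_def
        by (simp only: distrib_left distrib_right sum.distrib)
      also have "(\<Sum>i\<in>?I. \<Sum>\<eta>\<in>bits. d i \<eta> * (\<Sum>\<theta>\<in>bits. raw2 \<omega> m n (l + int n) i j \<eta> \<theta> * pg \<theta>)) = F2 m"
        unfolding F2_def pg_def raw2_sum[OF refl] d_def c_def by (rule fam2_sum[OF v mn refl])
      also have "(\<Sum>i\<in>?I. \<Sum>\<eta>\<in>bits. d i \<eta> * (\<Sum>\<theta>\<in>bits. (if m = 0 then raw3 \<omega> n (l + int n) i j \<eta> \<theta> else 0) * pg \<theta>))
         = (if m = 0 then - ((a (n - 1) - a n) * t n) else 0)"
      proof (cases "m = 0")
        case m0: True
        define q where "q = anc \<omega> l n j"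
        define p where "p = anc \<omega> l (n - 1) j"
        have nS: "n = Suc (n - 1)" using n0 by simp
        have ln: "l + int n - 1 = l + int (n - 1)" using n0 by simp
        have "q = par \<omega> (l + int n - 1) p" unfolding q_def p_def ln by (subst nS) simp
        then obtain e where e: "e \<in> bits" "p = chl \<omega> (l + int n) q e"
          using par_eq_iff[of \<omega> "l + int n" p q] by auto
        have I: "?I = {q}" using m0 by (auto simp: q_def)
        have "(\<Sum>\<theta>\<in>bits. raw3 \<omega> n (l + int n) q j \<eta> \<theta> * pg \<theta>) = of_bool (\<eta> = e) * (- t n)" if "\<eta> \<in> bits" for \<eta>
        proof -
          have "chl \<omega> (l + int n) q \<eta> = p \<longleftrightarrow> \<eta> = e" using e(2) chl_inj by metis
          thus ?thesis unfolding raw3_def t_def p_def[symmetric] c_def by (simp add: sum_negf p_def)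
        qed
        hence "(\<Sum>\<eta>\<in>bits. d q \<eta> * (\<Sum>\<theta>\<in>bits. raw3 \<omega> n (l + int n) q j \<eta> \<theta> * pg \<theta>)) = (\<Sum>\<eta>\<in>bits. of_bool (\<eta> = e) * (- (d q e * t n)))"
          by (intro sum.cong refl) auto
        also have "\<dots> = - (d q e * t n)"
          using e(1) by (simp add: of_bool_def if_distrib[of "\<lambda>x. x * _"] sum_negf cong: if_cong)
        also have "d q e = a (n - 1) - a n"
          using m0 by (simp add: d_def a_def e(2)[symmetric] ln) (simp add: p_def q_def)
        finally show ?thesis using m0 unfolding I by simp
      qed simp
      finally show ?thesis .
    qed
    have "(\<Sum>m<n. \<Sum>i | anc \<omega> (l + int n - int m) m i = anc \<omega> l n j. frm \<omega> m n (crs \<omega> m n) f g (l + int n) i j)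
       = (\<Sum>m<n. F2 m) + (\<Sum>m<n. if m = 0 then - ((a (n - 1) - a n) * t n) else 0)"
      unfolding sum.distrib[symmetric] by (intro sum.cong refl one) simp
    also have "(\<Sum>m<n. if m = 0 then - ((a (n - 1) - a n) * t n) else 0) = - ((a (n - 1) - a n) * t n)"
      using n0 by simp
    also have "(\<Sum>m<n. F2 m) = (\<Sum>i'\<in>shell j n. complex_of_real (c i') * bt \<omega> g l i' j * (av \<omega> f l i' - a n))"
    proof -
      have "(\<Sum>m<n. F2 m) = (\<Sum>i'\<in>shell j n. complex_of_real (c i') * bt \<omega> g l i' j * (\<Sum>m<n.
         (av \<omega> f (l + int (n - m - 1)) (anc \<omega> l (n - m - 1) i') - av \<omega> f (l + int (n - m)) (anc \<omega> l (n - m) i'))))"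
        unfolding F2_def sum_distrib_left by (rule sum.swap)
      also have "\<dots> = (\<Sum>i'\<in>shell j n. complex_of_real (c i') * bt \<omega> g l i' j * (av \<omega> f l i' - a n))"
      proof (rule sum.cong[OF refl])
        fix i' assume i': "i' \<in> shell j n"
        define x where "x s = av \<omega> f (l + int s) (anc \<omega> l s i')" for s
        have "(\<Sum>m<n. x (n - m - 1) - x (n - m)) = (\<Sum>m<n. x (n - Suc m) - x (Suc (n - Suc m)))"
          by (intro sum.cong refl) (simp add: Suc_diff_Suc)
        also have "\<dots> = (\<Sum>m<n. x m - x (Suc m))" by (rule sum.nat_diff_reindex[of "\<lambda>m. x m - x (Suc m)"])
        also have "\<dots> = x 0 - x n" by (rule sum_lessThan_telescope')
        finally have tele: "(\<Sum>m<n. x (n - m - 1) - x (n - m)) = x 0 - x n" .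
        show "complex_of_real (c i') * bt \<omega> g l i' j * (\<Sum>m<n. (av \<omega> f (l + int (n - m - 1)) (anc \<omega> l (n - m - 1) i') - av \<omega> f (l + int (n - m)) (anc \<omega> l (n - m) i')))
          = complex_of_real (c i') * bt \<omega> g l i' j * (av \<omega> f l i' - a n)"
        proof (cases "c i' = 0")
          case False
          hence "anc \<omega> l n i' = anc \<omega> l n j" using wt_merge[of \<omega> l i' j] i' by (simp add: c_def shell_def)
          hence "x n = a n" by (simp add: x_def a_def)
          thus ?thesis using tele by (simp add: x_def)
        qed simp
      qed
      finally show ?thesis .
    qed
    also have "\<dots> = (\<Sum>i'\<in>shell j n. complex_of_real (c i') * bt \<omega> g l i' j * av \<omega> f l i') - y n * a n"
      by (simp add: y_def right_diff_distrib sum_subtractf sum_distrib_right)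
    finally show ?thesis by simp
  qed
  have ws: "(\<Sum>i'\<in>shell j n. complex_of_real (c i') * bt \<omega> g l i' j * av \<omega> f l i') - y n * a 0 = wsum \<omega> c f g l j n" for n
    by (simp add: wsum_def y_def a_def right_diff_distrib sum_subtractf sum_distrib_right)
  have part: "(\<Sum>n\<le>M. \<Sum>m<n. \<Sum>i | anc \<omega> (l + int n - int m) m i = anc \<omega> l n j. frm \<omega> m n (crs \<omega> m n) f g (l + int n) i j)
     = (\<Sum>n\<le>M. wsum \<omega> c f g l j n) - (a 0 - a M) * t (Suc M)" for M
    unfolding trm sum_subtractf abel_telescope[of t y, OF t_step] ws[symmetric] by simp
  have sw: "summable (wsum \<omega> c f g l j)"
    by (rule summable_norm_cancel[OF geometric_tail(1)[OF wsum_bound[OF cb f]]]) (use lam in auto)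
  have "(\<lambda>M. \<Sum>n\<le>M. wsum \<omega> c f g l j n) \<longlonglongrightarrow> (\<Sum>r. wsum \<omega> c f g l j r)"
    by (rule summable_LIMSEQ'[OF sw])
  \<comment> \<open>The boundary term of the summation by parts: the averages are bounded along the
    chain, and the tails decay geometrically.\<close>
  moreover have "(\<lambda>M. (a 0 - a M) * t (Suc M)) \<longlonglongrightarrow> 0"
  proof (rule Lim_null_comparison)
    let ?a = "L2_norm f / sqrt (vl TYPE('n) l)"
    define P where "P = (\<Sum>\<theta>\<in>bits. (EE * vl TYPE('n) l) / (1 - lam) * cmod (pg \<theta>))"
    have tb: "cmod (t n) \<le> P * lam ^ n" for n
    proof -
      have "cmod (t n) \<le> (\<Sum>\<theta>\<in>bits. ((EE * vl TYPE('n) l) * lam ^ n / (1 - lam)) * cmod (pg \<theta>))"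
        unfolding t_def
      proof (rule order_trans[OF norm_sum sum_mono])
        fix \<theta> :: "int^'n" assume "\<theta> \<in> bits"
        from tail_bound[OF this cb] show "cmod (tail \<omega> c l j \<theta> n * pg \<theta>) \<le> ((EE * vl TYPE('n) l) * lam ^ n / (1 - lam)) * cmod (pg \<theta>)"
          unfolding norm_mult by (rule mult_right_mono) simp
      qed
      also have "\<dots> = P * lam ^ n" unfolding P_def sum_distrib_right by (intro sum.cong refl) simp
      finally show ?thesis .
    qed
    show "eventually (\<lambda>M. norm ((a 0 - a M) * t (Suc M)) \<le> (2 * ?a) * (P * lam ^ Suc M)) sequentially"
    proof (intro always_eventually allI)
      fix M
      have ab: "cmod (a s) \<le> ?a" for s unfolding a_def by (rule av_bound[OF f])
      have "cmod (a 0 - a M) \<le> 2 * ?a"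
        using norm_triangle_ineq4[of "a 0" "a M"] ab[of 0] ab[of M] by linarith
      thus "norm ((a 0 - a M) * t (Suc M)) \<le> (2 * ?a) * (P * lam ^ Suc M)"
        unfolding norm_mult using tb[of "Suc M"] by (intro mult_mono) auto
    qed
    have "(\<lambda>M. lam ^ M) \<longlonglongrightarrow> 0" using lam by (intro LIMSEQ_realpow_zero) auto
    from tendsto_mult_right[OF LIMSEQ_Suc[OF this], of "(2 * ?a) * P"]
    show "(\<lambda>M. (2 * ?a) * (P * lam ^ Suc M)) \<longlonglongrightarrow> 0" by (simp add: mult_ac)
  qed
  ultimately have "(\<lambda>M. (\<Sum>n\<le>M. wsum \<omega> c f g l j n) - (a 0 - a M) * t (Suc M)) \<longlonglongrightarrow> (\<Sum>r. wsum \<omega> c f g l j r) - 0"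
    by (rule tendsto_diff)
  thus ?thesis unfolding part[symmetric] sums_def_le c_def by simp
qed

end

subsection \<open>Compactly supported functions\<close>

definition fsupp :: "real \<Rightarrow> ('n::finite) fn \<Rightarrow> bool" where
  "fsupp \<rho> f \<longleftrightarrow> (\<forall>x. f x \<noteq> 0 \<longrightarrow> (\<forall>c. \<bar>x $ c\<bar> \<le> \<rho>))"

text \<open>A finite index set that contains every cube of generation \<open>k\<close> meeting the
  support, for all lattices at once, so that sums over it commute with the expectation. The added 2
  absorbs the offset, which is at most one side length, and the rounding.\<close>

definition ix :: "real \<Rightarrow> int \<Rightarrow> (int^'n::finite) set" where
  "ix \<rho> k = {i. \<forall>c. \<bar>i $ c\<bar> \<le> \<lceil>\<rho> / 2 powi k\<rceil> + 2}"

lemma finite_ix [simp]: "finite (ix \<rho> k)"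
  unfolding ix_def by (rule card_box)

lemma ix_out:
  fixes f :: "('n::finite) fn"
  assumes v: "valid \<omega>" and f: "fsupp \<rho> f" and i: "i \<notin> ix \<rho> k" and x: "x \<in> cub \<omega> k i"
  shows "f x = 0"
proof (rule ccontr)
  assume "f x \<noteq> 0"
  hence b: "\<bar>x $ c\<bar> \<le> \<rho>" for c using f by (auto simp: fsupp_def)
  have "\<bar>i $ c\<bar> \<le> \<lceil>\<rho> / 2 powi k\<rceil> + 2" for c
  proof -
    define p where "p = (2::real) powi k"
    have p: "p > 0" by (simp add: p_def)
    have o: "0 \<le> off \<omega> k $ c" "off \<omega> k $ c \<le> p" using off_bounds[OF v] by (auto simp: p_def)
    define t where "t = (x $ c - off \<omega> k $ c) / p"
    have "i $ c = \<lfloor>t\<rfloor>" using x by (auto simp: mem_cub_iff pidx_def t_def p_def)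
    moreover have "t \<le> \<rho> / p" unfolding t_def using b[of c] o p by (intro divide_right_mono) auto
    moreover have "- (\<rho> / p) - 1 \<le> t"
    proof -
      have "- \<rho> - p \<le> x $ c - off \<omega> k $ c" using b[of c] o by linarith
      hence "(- \<rho> - p) / p \<le> t" unfolding t_def using p by (intro divide_right_mono) auto
      thus ?thesis using p by (simp add: diff_divide_distrib)
    qed
    ultimately show ?thesis unfolding p_def[symmetric] by linarith
  qed
  thus False using i by (auto simp: ix_def)
qed

lemma pairing_out:
  assumes "\<And>x. x \<in> Q \<Longrightarrow> f x = 0" "\<And>x. x \<notin> Q \<Longrightarrow> h x = 0"
  shows "pairing f h = 0"
proof -
  have "(\<lambda>x. f x * h x) = (\<lambda>x. 0)" using assms by (intro ext) (metis mult_eq_0_iff)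
  thus ?thesis by (simp add: pairing_def)
qed

lemma ix_pairing:
  assumes "valid \<omega>" "fsupp \<rho> f" "i \<notin> ix \<rho> k"
  shows "pairing f (ind (cub \<omega> k i)) = 0" "av \<omega> f k i = 0"
    "\<theta> \<in> bits \<Longrightarrow> pairing f (phc \<omega> k i \<theta>) = 0"
proof -
  show "pairing f (ind (cub \<omega> k i)) = 0"
    by (rule pairing_out[OF ix_out[OF assms]]) (auto simp: indicator_def)
  thus "av \<omega> f k i = 0" by (simp add: av_def)
  show "pairing f (phc \<omega> k i \<theta>) = 0" if "\<theta> \<in> bits"
    by (rule pairing_out[OF ix_out[OF assms]]) (use that in \<open>auto simp: cub_def phi_outside\<close>)
qed

subsection \<open>Martingale averages and differences\<close>

text \<open>A finite sum, so that bilinearity applies directly; under \<open>fsupp \<rho> f\<close>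
  it is the averaging operator (\<open>Ef_eval\<close>).\<close>

definition Ef :: "real \<Rightarrow> 'n digits \<Rightarrow> ('n::finite) fn \<Rightarrow> int \<Rightarrow> 'n fn" where
  "Ef \<rho> \<omega> f k = (\<lambda>x. \<Sum>i\<in>ix \<rho> k. av \<omega> f k i * ind (cub \<omega> k i) x)"

definition Df :: "real \<Rightarrow> 'n digits \<Rightarrow> ('n::finite) fn \<Rightarrow> int \<Rightarrow> 'n fn" where
  "Df \<rho> \<omega> f k = (\<lambda>x. \<Sum>p\<in>ix \<rho> k \<times> bits. pairing f (phc \<omega> k (fst p) (snd p)) / vl TYPE('n) (k - 1) * phc \<omega> k (fst p) (snd p) x)"

lemma Ef_sq [simp]: "square_integrable (Ef \<rho> \<omega> f k)"
  unfolding Ef_def by (intro square_integrable_sum square_integrable_scale sq_ind_cub)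

lemma Df_sq [simp]: "square_integrable (Df \<rho> \<omega> f k)"
  unfolding Df_def by (intro square_integrable_sum square_integrable_scale phi_sq)

lemma Ef_eval:
  assumes "valid \<omega>" "fsupp \<rho> f"
  shows "Ef \<rho> \<omega> f k x = av \<omega> f k (pidx \<omega> k x)"
proof -
  have "Ef \<rho> \<omega> f k x = (\<Sum>i\<in>ix \<rho> k. of_bool (i = pidx \<omega> k x) * av \<omega> f k (pidx \<omega> k x))"
    unfolding Ef_def by (intro sum.cong refl) (auto simp: indicator_def mem_cub_iff)
  also have "\<dots> = av \<omega> f k (pidx \<omega> k x)"
    using ix_pairing(2)[OF assms, of "pidx \<omega> k x" k]
    by (cases "pidx \<omega> k x \<in> ix \<rho> k") (simp_all add: of_bool_def if_distrib[of "\<lambda>z. z * _"] cong: if_cong)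
  finally show ?thesis .
qed

text \<open>At a point of the child \<open>t\<close> the frame expansion equals
  \<open>b t - a\<close>, because the deviations of the children from the mean add up to
  zero.\<close>

lemma Df_eval:
  fixes f :: "('n::finite) fn"
  assumes v: "valid \<omega>" and s: "fsupp \<rho> f" and f: "square_integrable f"
  shows "Ef \<rho> \<omega> f (k - 1) x = Ef \<rho> \<omega> f k x + Df \<rho> \<omega> f k x"
proof -
  define i where "i = pidx \<omega> k x"
  define a where "a = av \<omega> f k i"
  define b where "b \<theta> = av \<omega> f (k-1) (chl \<omega> k i \<theta>)" for \<theta>
  have "par \<omega> (k - 1) (pidx \<omega> (k - 1) x) = i" using pidx_par[OF v, of "k - 1" x] by (simp add: i_def)
  then obtain t where t: "t \<in> bits" "pidx \<omega> (k - 1) x = chl \<omega> k i t" using par_eq_iff by blast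
  have phx: "phc \<omega> k i \<theta> x = of_bool (\<theta> = t) - 1 / 2 ^ CARD('n)" for \<theta>
  proof -
    have "x \<in> cub \<omega> (k - 1) (chl \<omega> k i \<theta>) \<longleftrightarrow> \<theta> = t"
      using t(2) chl_inj[of \<omega> k i \<theta> i t] by (auto simp: mem_cub_iff)
    moreover have "x \<in> cub \<omega> k i" by (simp add: mem_cub_iff i_def)
    ultimately show ?thesis by (simp add: phc_eq[OF v] indicator_def)
  qed
  have off0: "phc \<omega> k i' \<theta> x = 0" if "i' \<noteq> i" "\<theta> \<in> bits" for i' \<theta>
  proof -
    have "x \<notin> cub \<omega> k i'" using that(1) by (auto simp: mem_cub_iff i_def)
    thus ?thesis using phi_outside[OF that(2)] by (simp add: cub_def)
  qed
  have "Df \<rho> \<omega> f k x = (\<Sum>i'\<in>ix \<rho> k. \<Sum>\<theta>\<in>bits. pairing f (phc \<omega> k i' \<theta>) / vl TYPE('n) (k - 1) * phc \<omega> k i' \<theta> x)"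
    unfolding Df_def by (simp add: sum.cartesian_product')
  also have "\<dots> = (\<Sum>i'\<in>ix \<rho> k. of_bool (i' = i) * (\<Sum>\<theta>\<in>bits. pairing f (phc \<omega> k i \<theta>) / vl TYPE('n) (k - 1) * phc \<omega> k i \<theta> x))"
    by (intro sum.cong refl) (auto simp: off0 intro!: sum.neutral)
  also have "\<dots> = (\<Sum>\<theta>\<in>bits. pairing f (phc \<omega> k i \<theta>) / vl TYPE('n) (k - 1) * phc \<omega> k i \<theta> x)"
    using ix_pairing(3)[OF v s, of i k]
    by (cases "i \<in> ix \<rho> k") (simp_all add: of_bool_def if_distrib[of "\<lambda>z. z * _"] cong: if_cong)
  also have "\<dots> = (\<Sum>\<theta>\<in>bits. (b \<theta> - a) * (of_bool (\<theta> = t) - 1 / 2 ^ CARD('n)))"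
    unfolding pairing_phc[OF v f] phx by (simp add: a_def b_def)
  also have "\<dots> = (\<Sum>\<theta>\<in>bits. of_bool (\<theta> = t) * (b t - a)) - (\<Sum>\<theta>\<in>bits. b \<theta> - a) / 2 ^ CARD('n)"
  proof -
    have "(\<Sum>\<theta>\<in>bits. (b \<theta> - a) * (of_bool (\<theta> = t) - 1 / 2 ^ CARD('n)))
       = (\<Sum>\<theta>\<in>bits. of_bool (\<theta> = t) * (b t - a) - (b \<theta> - a) / 2 ^ CARD('n))"
      by (intro sum.cong refl) (auto simp: field_simps)
    thus ?thesis by (simp add: sum_subtractf sum_divide_distrib diff_divide_distrib)
  qed
  also have "(\<Sum>\<theta>\<in>bits. b \<theta> - a) = 0"
    using av_children[OF v f, of k i] by (simp add: sum_subtractf b_def a_def card_bits)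
  also have "(\<Sum>\<theta>\<in>bits. of_bool (\<theta> = t) * (b t - a)) = b t - a"
    using t(1) by (simp add: of_bool_def if_distrib[of "\<lambda>z. z * _"] cong: if_cong)
  finally have D: "Df \<rho> \<omega> f k x = b t - a" by simp
  show ?thesis unfolding D Ef_eval[OF v s] t(2) by (simp add: a_def b_def i_def)
qed

lemma Df_eq:
  assumes "valid \<omega>" "fsupp \<rho> f" "square_integrable f"
  shows "Ef \<rho> \<omega> f (k - 1) = (\<lambda>x. Ef \<rho> \<omega> f k x + Df \<rho> \<omega> f k x)"
  by (rule ext) (rule Df_eval[OF assms])

subsection \<open>Measurability in the lattice parameter\<close>

lemma measurable_pairing_ind [measurable]:
  fixes f :: "('n::finite) fn"
  assumes "square_integrable f"
  shows "(\<lambda>\<omega>. pairing f (ind (cub \<omega> k i))) \<in> borel_measurable omega_measure"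
  unfolding cub_def by (rule bform_qube_measurable_right[OF bform_pairing assms measurable_corner])

lemma measurable_av [measurable]:
  fixes f :: "('n::finite) fn"
  assumes [measurable]: "square_integrable f"
  shows "(\<lambda>\<omega>. av \<omega> f k i) \<in> borel_measurable omega_measure"
  unfolding av_def by measurable

lemma phi_expand:
  fixes y :: "real^'n::finite"
  shows "phi k y \<theta> = (\<lambda>x. ind (qube (k - 1) (y + (2 powi (k - 1)) *\<^sub>R rv \<theta>)) x - (1 / 2 ^ CARD('n)) * ind (qube k y) x)"
  by (rule ext) (simp add: phi_def)

lemma bform_phi_right:
  fixes y :: "real^'n::finite"
  assumes B: "bform N B" and u: "square_integrable u"
  shows "B u (phi k y \<theta>) = B u (ind (qube (k - 1) (y + (2 powi (k - 1)) *\<^sub>R rv \<theta>))) - (1 / 2 ^ CARD('n)) * B u (ind (qube k y))"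
  unfolding phi_expand
  by (subst bform_right(4)[OF B]) (simp_all add: u square_integrable_scale bform_right(2)[OF B] del: times_divide_eq_left)

lemma measurable_pairing_phc [measurable]:
  fixes f :: "('n::finite) fn"
  assumes f [measurable]: "square_integrable f"
  shows "(\<lambda>\<omega>. pairing f (phc \<omega> k i \<theta>)) \<in> borel_measurable omega_measure"
proof -
  have [measurable]: "(\<lambda>\<omega>. pairing f (ind (qube (k - 1) (corner \<omega> k i + (2 powi (k - 1)) *\<^sub>R rv \<theta>)))) \<in> borel_measurable omega_measure"
       "(\<lambda>\<omega>. pairing f (ind (qube k (corner \<omega> k i)))) \<in> borel_measurable omega_measure"
    by (rule bform_qube_measurable_right[OF bform_pairing f]; measurable)+
  show ?thesis unfolding bform_phi_right[OF bform_pairing f] by measurable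
qed

lemma measurable_form_ind_phc:
  fixes B :: "('n::finite) fn \<Rightarrow> 'n fn \<Rightarrow> complex"
  assumes B: "bform N B" and [measurable]: "u \<in> borel_measurable omega_measure"
  shows "(\<lambda>\<omega>. B (ind (qube l (u \<omega>))) (phc \<omega> k j \<theta>)) \<in> borel_measurable omega_measure"
proof -
  have [measurable]: "(\<lambda>\<omega>. B (ind (qube l (u \<omega>))) (ind (qube (k - 1) (corner \<omega> k j + (2 powi (k - 1)) *\<^sub>R rv \<theta>)))) \<in> borel_measurable omega_measure"
     "(\<lambda>\<omega>. B (ind (qube l (u \<omega>))) (ind (qube k (corner \<omega> k j)))) \<in> borel_measurable omega_measure"
    by (rule bform_qube_measurable[OF B]; measurable)+
  show ?thesis unfolding bform_phi_right[OF B sq_ind_qube] by measurable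
qed

lemma bounded_integrable_omega:
  fixes h :: "('n::finite) digits \<Rightarrow> complex"
  assumes "h \<in> borel_measurable omega_measure" "\<And>\<omega>. valid \<omega> \<Longrightarrow> cmod (h \<omega>) \<le> M"
  shows "integrable omega_measure h"
proof -
  interpret prob_space "omega_measure :: 'n digits measure" by (rule prob_omega)
  show ?thesis
    by (rule integrable_const_bound[where B = M]) (use assms in \<open>auto simp: space_omega intro!: AE_I2\<close>)
qed

lemma sums_infsum:
  fixes f :: "nat \<Rightarrow> complex"
  assumes "summable (\<lambda>n. norm (f n))"
  shows "(\<Sum>\<^sub>\<infinity>n. f n) = (\<Sum>n. f n)"
  using has_sum_imp_sums[OF has_sum_infsum[OF norm_summable_imp_summable_on[OF assms]]] by (rule sums_unique)

section \<open>The terms of a single scale and their expectations\<close>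

context cz_form
begin

lemma measurable_Bc [measurable]:
  "(\<lambda>\<omega>. Bc \<omega> k i j \<theta>) \<in> borel_measurable omega_measure"
  unfolding Bc_def cub_def by (rule measurable_form_ind_phc[OF B measurable_corner])

lemma measurable_Bphi [measurable]:
  "(\<lambda>\<omega>. B (phc \<omega> k i \<eta>) (phc \<omega> k j \<theta>)) \<in> borel_measurable omega_measure"
proof -
  have [measurable]: "(\<lambda>\<omega>. B (ind (qube (k - 1) (corner \<omega> k i + (2 powi (k - 1)) *\<^sub>R rv \<eta>))) (phc \<omega> k j \<theta>)) \<in> borel_measurable omega_measure"
     "(\<lambda>\<omega>. B (ind (qube k (corner \<omega> k i))) (phc \<omega> k j \<theta>)) \<in> borel_measurable omega_measure"
    by (rule measurable_form_ind_phc[OF B]; measurable)+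
  show ?thesis unfolding bform_phi_right[OF bform_swap[OF B] phi_sq] by measurable
qed

lemma measurable_bt [measurable]:
  assumes [measurable]: "square_integrable g"
  shows "(\<lambda>\<omega>. bt \<omega> g l i j) \<in> borel_measurable omega_measure"
  unfolding bt_def by measurable

lemma measurable_wsum:
  assumes [measurable]: "square_integrable f" "square_integrable g" "\<And>i. (\<lambda>\<omega>. c \<omega> i) \<in> borel_measurable omega_measure"
  shows "(\<lambda>\<omega>. wsum \<omega> (c \<omega>) f g l j r) \<in> borel_measurable omega_measure"
  unfolding wsum_def by measurable

lemma measurable_bmo [measurable]: "(\<lambda>\<omega>. bmo \<omega> k j \<theta>) \<in> borel_measurable omega_measure"
  unfolding bmo_def tail_def esum_def by measurable

lemma measurable_para [measurable]:
  assumes [measurable]: "square_integrable f" "square_integrable g"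
  shows "(\<lambda>\<omega>. para \<omega> f g k j) \<in> borel_measurable omega_measure"
  unfolding para_def by measurable

definition lowc :: "real \<Rightarrow> 'n digits \<Rightarrow> 'n fn \<Rightarrow> 'n fn \<Rightarrow> int \<Rightarrow> complex" where
  "lowc \<rho> \<omega> f g l = (\<Sum>j\<in>ix \<rho> l. \<Sum>i\<in>ix \<rho> l. av \<omega> f l i * bt \<omega> g l i j)"

definition dd :: "'n digits \<Rightarrow> 'n fn \<Rightarrow> 'n fn \<Rightarrow> int \<Rightarrow> int^'n \<Rightarrow> int^'n \<Rightarrow> complex" where
  "dd \<omega> f g l i j = (\<Sum>\<eta>\<in>bits. \<Sum>\<theta>\<in>bits. pairing f (phc \<omega> l i \<eta>) / vl TYPE('n) (l - 1) *
      (pairing g (phc \<omega> l j \<theta>) / vl TYPE('n) (l - 1)) * B (phc \<omega> l i \<eta>) (phc \<omega> l j \<theta>))"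

text \<open>With \<open>Zp\<close> and \<open>Zd\<close>, the weighted cross term, the unweighted
  paraproduct and the weighted diagonal term of level \<open>l\<close>. They match the terms of the
  telescoping sum in expectation, not lattice by lattice.\<close>

definition Zc :: "real \<Rightarrow> 'n digits \<Rightarrow> 'n fn \<Rightarrow> 'n fn \<Rightarrow> int \<Rightarrow> complex" where
  "Zc \<rho> \<omega> f g l = (\<Sum>j\<in>ix \<rho> l. \<Sum>r. wsum \<omega> (\<lambda>i. wt \<omega> l i j) f g l j r)"

definition Zp :: "real \<Rightarrow> 'n digits \<Rightarrow> 'n fn \<Rightarrow> 'n fn \<Rightarrow> int \<Rightarrow> complex" where
  "Zp \<rho> \<omega> f g l = (\<Sum>j\<in>ix \<rho> l. para \<omega> f g l j)"

definition Zd :: "real \<Rightarrow> 'n digits \<Rightarrow> 'n fn \<Rightarrow> 'n fn \<Rightarrow> int \<Rightarrow> complex" where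
  "Zd \<rho> \<omega> f g l = (\<Sum>j\<in>ix \<rho> l. \<Sum>i\<in>ix \<rho> l. wt \<omega> l i j * dd \<omega> f g l i j)"

lemma B_Df:
  assumes "square_integrable u"
  shows "B u (Df \<rho> \<omega> g l) = (\<Sum>j\<in>ix \<rho> l. \<Sum>\<theta>\<in>bits. pairing g (phc \<omega> l j \<theta>) / vl TYPE('n) (l - 1) * B u (phc \<omega> l j \<theta>))"
  unfolding Df_def
  by (subst bform_right(5)[OF B]) (simp_all add: sum.cartesian_product' assms)

lemma lowc_eq:
  "lowc \<rho> \<omega> f g l = B (Ef \<rho> \<omega> f l) (Df \<rho> \<omega> g l)"
proof -
  have "B (Ef \<rho> \<omega> f l) (Df \<rho> \<omega> g l) = (\<Sum>i\<in>ix \<rho> l. av \<omega> f l i * B (ind (cub \<omega> l i)) (Df \<rho> \<omega> g l))"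
    unfolding Ef_def by (rule bform_sum[OF B]) simp_all
  also have "\<dots> = (\<Sum>i\<in>ix \<rho> l. \<Sum>j\<in>ix \<rho> l. av \<omega> f l i * bt \<omega> g l i j)"
    unfolding B_Df[OF sq_ind_cub] bt_def Bc_def by (simp add: sum_distrib_left)
  finally show ?thesis unfolding lowc_def by (subst sum.swap) simp
qed

lemma lowd_eq:
  "(\<Sum>j\<in>ix \<rho> l. \<Sum>i\<in>ix \<rho> l. dd \<omega> f g l i j) = B (Df \<rho> \<omega> f l) (Df \<rho> \<omega> g l)"
proof -
  have "B (Df \<rho> \<omega> f l) (Df \<rho> \<omega> g l) = (\<Sum>p\<in>ix \<rho> l \<times> bits. pairing f (phc \<omega> l (fst p) (snd p)) / vl TYPE('n) (l - 1) * B (phc \<omega> l (fst p) (snd p)) (Df \<rho> \<omega> g l))"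
    unfolding Df_def[of \<rho> \<omega> f] by (rule bform_sum[OF B]) simp_all
  also have "\<dots> = (\<Sum>i\<in>ix \<rho> l. \<Sum>\<eta>\<in>bits. \<Sum>j\<in>ix \<rho> l. \<Sum>\<theta>\<in>bits. pairing f (phc \<omega> l i \<eta>) / vl TYPE('n) (l - 1) *
        (pairing g (phc \<omega> l j \<theta>) / vl TYPE('n) (l - 1)) * B (phc \<omega> l i \<eta>) (phc \<omega> l j \<theta>))"
    unfolding B_Df[OF phi_sq] sum.cartesian_product' sum_distrib_left by (simp add: mult.assoc)
  also have "\<dots> = (\<Sum>i\<in>ix \<rho> l. \<Sum>j\<in>ix \<rho> l. dd \<omega> f g l i j)"
    unfolding dd_def by (rule sum.cong[OF refl], rule sum.swap)
  also have "\<dots> = (\<Sum>j\<in>ix \<rho> l. \<Sum>i\<in>ix \<rho> l. dd \<omega> f g l i j)" by (rule sum.swap)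
  finally show ?thesis ..
qed

definition GM :: "'n fn \<Rightarrow> int \<Rightarrow> real" where
  "GM g l = 2 ^ CARD('n) * (L2_norm g * sqrt (vl TYPE('n) l)) / vl TYPE('n) (l - 1)"

lemma phc_norm:
  fixes \<theta> :: "int^'n"
  shows "\<theta> \<in> bits \<Longrightarrow> L2_norm (phc \<omega> l j \<theta>) \<le> sqrt (vl TYPE('n) l)"
  using bump_sq(2)[OF bump_phi[of \<theta> l "corner \<omega> l j"]] by simp

lemma pairing_phc_bound:
  fixes \<theta> :: "int^'n"
  assumes "square_integrable g" "\<theta> \<in> bits"
  shows "cmod (pairing g (phc \<omega> l j \<theta>)) \<le> L2_norm g * sqrt (vl TYPE('n) l)"
  by (rule order_trans[OF pairing_bound[OF assms(1) phi_sq] mult_left_mono[OF phc_norm[OF assms(2)]]]) simp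

lemma GG_le: "square_integrable g \<Longrightarrow> GG \<omega> g l j \<le> GM g l"
proof -
  assume g: "square_integrable g"
  have "GG \<omega> g l j \<le> (\<Sum>\<theta>\<in>(bits::(int^'n) set). (L2_norm g * sqrt (vl TYPE('n) l)) / vl TYPE('n) (l - 1))"
    unfolding GG_def by (intro sum_mono divide_right_mono pairing_phc_bound g) auto
  thus ?thesis by (simp add: GM_def card_bits)
qed

lemma wsum_bound':
  assumes "\<And>i. \<bar>c i\<bar> \<le> 2 ^ CARD('n)" and f: "square_integrable f" and g: "square_integrable g"
  shows "cmod (wsum \<omega> c f g l j r) \<le> (2 * (L2_norm f / sqrt (vl TYPE('n) l)) * (EE * vl TYPE('n) l * GM g l)) * lam ^ r"
  using EE lam by (intro order_trans[OF wsum_bound[OF assms(1,2)]] mult_right_mono mult_left_mono GG_le g) auto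

lemma bt_bound:
  assumes g: "square_integrable g"
  shows "cmod (bt \<omega> g l i j) \<le> EE * vl TYPE('n) l * GM g l"
proof -
  have "cmod (complex_of_real 1 * bt \<omega> g l i j) \<le> (\<Sum>i\<in>shell j (hgt (i - j)). cmod (complex_of_real 1 * bt \<omega> g l i j))"
    by (rule member_le_sum[OF _ _ finite_shell]) (simp_all add: shell_def)
  also have "\<dots> \<le> (EE * vl TYPE('n) l * GG \<omega> g l j) * lam ^ hgt (i - j)"
    by (rule bt_shell_bound) simp
  also have "\<dots> \<le> (EE * vl TYPE('n) l * GM g l) * 1"
    using lam EE GG_nonneg[of \<omega> g l j] GG_le[OF g, of \<omega> l j] by (intro mult_mono power_le_one mult_left_mono) auto
  finally show ?thesis by simp
qed

lemma dd_bound: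
  assumes f: "square_integrable f" and g: "square_integrable g"
  shows "cmod (dd \<omega> f g l i j) \<le> (\<Sum>\<eta>\<in>(bits::(int^'n) set). \<Sum>\<theta>\<in>(bits::(int^'n) set). (L2_norm f * sqrt (vl TYPE('n) l)) / vl TYPE('n) (l - 1) *
      ((L2_norm g * sqrt (vl TYPE('n) l)) / vl TYPE('n) (l - 1)) * (N * vl TYPE('n) l))"
  unfolding dd_def
proof (rule order_trans[OF norm_sum sum_mono], rule order_trans[OF norm_sum sum_mono])
  fix \<eta> \<theta> :: "int^'n" assume e: "\<eta> \<in> bits" "\<theta> \<in> bits"
  have "cmod (B (phc \<omega> l i \<eta>) (phc \<omega> l j \<theta>)) \<le> N * (L2_norm (phc \<omega> l i \<eta>) * L2_norm (phc \<omega> l j \<theta>))"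
    using bformD(4)[OF B phi_sq phi_sq] by (simp add: mult.assoc)
  also have "\<dots> \<le> N * (sqrt (vl TYPE('n) l) * sqrt (vl TYPE('n) l))"
    by (intro mult_left_mono mult_mono phc_norm e) (use bformD(1)[OF B] in auto)
  finally have b: "cmod (B (phc \<omega> l i \<eta>) (phc \<omega> l j \<theta>)) \<le> N * vl TYPE('n) l" by simp
  show "cmod (pairing f (phc \<omega> l i \<eta>) / vl TYPE('n) (l - 1) *
      (pairing g (phc \<omega> l j \<theta>) / vl TYPE('n) (l - 1)) * B (phc \<omega> l i \<eta>) (phc \<omega> l j \<theta>))
     \<le> (L2_norm f * sqrt (vl TYPE('n) l)) / vl TYPE('n) (l - 1) *
      ((L2_norm g * sqrt (vl TYPE('n) l)) / vl TYPE('n) (l - 1)) * (N * vl TYPE('n) l)"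
    unfolding norm_mult norm_divide norm_of_real abs_of_pos[OF vl_pos]
    by (intro mult_mono divide_right_mono pairing_phc_bound f g e b) auto
qed

text \<open>Level \<open>l\<close> sees the lattice only through the offsets of the generations
  \<open>l\<close> and \<open>l - 1\<close>, as \<open>expect_wt\<close> requires of the function
  next to the weight.\<close>

lemma level_upd:
  assumes "l' \<ge> l"
  shows "bt (fun_upd \<omega> l' v) g l i j = bt \<omega> g l i j" "av (fun_upd \<omega> l' v) f l i = av \<omega> f l i"
    "dd (fun_upd \<omega> l' v) f g l i j = dd \<omega> f g l i j"
  unfolding bt_def Bc_def av_def dd_def cub_def corner_def off_upd[OF assms] by (rule refl)+

text \<open>Compact support makes the sum with the averages on \<open>i\<close> finite. The sum with
  the average on \<open>j\<close> runs over all shells and is that average times the shell sums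
  which define T1.\<close>

lemma wsum_one_sum:
  assumes v: "valid \<omega>" and f: "square_integrable f" "fsupp \<rho> f" and g: "square_integrable g"
  shows "(\<Sum>r. wsum \<omega> (\<lambda>_. 1) f g l j r) = (\<Sum>i\<in>ix \<rho> l. av \<omega> f l i * bt \<omega> g l i j) - para \<omega> f g l j"
proof -
  have "(\<lambda>r. \<Sum>i\<in>shell j r. bt \<omega> g l i j * av \<omega> f l i) sums (\<Sum>i\<in>ix \<rho> l. av \<omega> f l i * bt \<omega> g l i j)"
  proof -
    have "(\<lambda>r. \<Sum>i\<in>ix \<rho> l. if r = hgt (i - j) then av \<omega> f l i * bt \<omega> g l i j else 0) sums (\<Sum>i\<in>ix \<rho> l. av \<omega> f l i * bt \<omega> g l i j)"
      by (intro sums_sum sums_single)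
    moreover have "(\<Sum>i\<in>ix \<rho> l. if r = hgt (i - j) then av \<omega> f l i * bt \<omega> g l i j else 0) = (\<Sum>i\<in>shell j r. bt \<omega> g l i j * av \<omega> f l i)" for r
    proof -
      have "(\<Sum>i\<in>ix \<rho> l. if r = hgt (i - j) then av \<omega> f l i * bt \<omega> g l i j else 0) = (\<Sum>i\<in>ix \<rho> l \<inter> shell j r. bt \<omega> g l i j * av \<omega> f l i)"
        by (rule sum.mono_neutral_cong_right) (auto simp: shell_def mult.commute)
      also have "\<dots> = (\<Sum>i\<in>shell j r. bt \<omega> g l i j * av \<omega> f l i)"
        by (rule sum.mono_neutral_left) (use ix_pairing(2)[OF v f(2)] in auto)
      finally show ?thesis .
    qed
    ultimately show ?thesis by simp
  qed
  moreover have "(\<lambda>r. av \<omega> f l j * (\<Sum>i\<in>shell j r. bt \<omega> g l i j)) sums para \<omega> f g l j"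
    unfolding para_def
  proof (rule sums_mult)
    have "(\<lambda>r. \<Sum>\<theta>\<in>bits. esum \<omega> (\<lambda>_. 1) l j \<theta> r * (pairing g (phc \<omega> l j \<theta>) / vl TYPE('n) (l - 1)))
       sums (\<Sum>\<theta>\<in>bits. bmo \<omega> l j \<theta> * (pairing g (phc \<omega> l j \<theta>) / vl TYPE('n) (l - 1)))"
    proof (intro sums_sum sums_mult2)
      fix \<theta> :: "int^'n" assume "\<theta> \<in> bits"
      hence "cmod (esum \<omega> (\<lambda>_. 1) l j \<theta> r) \<le> (EE * vl TYPE('n) l) * lam ^ r" for r
        by (rule esum_bound) simp
      from summable_norm_cancel[OF geometric_tail(1)[OF this]] lam
      have "summable (esum \<omega> (\<lambda>_. 1) l j \<theta>)" by simp
      thus "esum \<omega> (\<lambda>_. 1) l j \<theta> sums bmo \<omega> l j \<theta>" by (simp add: bmo_def tail_def summable_sums)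
    qed
    moreover have "(\<Sum>\<theta>\<in>bits. esum \<omega> (\<lambda>_. 1) l j \<theta> r * (pairing g (phc \<omega> l j \<theta>) / vl TYPE('n) (l - 1))) = (\<Sum>i\<in>shell j r. bt \<omega> g l i j)" for r
      unfolding bt_def esum_def sum_distrib_right by (subst sum.swap) (simp add: mult_ac)
    ultimately show "(\<lambda>r. \<Sum>i\<in>shell j r. bt \<omega> g l i j) sums (\<Sum>\<theta>\<in>bits. bmo \<omega> l j \<theta> * pairing g (phc \<omega> l j \<theta>) / vl TYPE('n) (l - 1))"
      by simp
  qed
  ultimately have "(\<lambda>r. (\<Sum>i\<in>shell j r. bt \<omega> g l i j * av \<omega> f l i) - av \<omega> f l j * (\<Sum>i\<in>shell j r. bt \<omega> g l i j))
     sums ((\<Sum>i\<in>ix \<rho> l. av \<omega> f l i * bt \<omega> g l i j) - para \<omega> f g l j)" by (rule sums_diff)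
  moreover have "(\<lambda>r. (\<Sum>i\<in>shell j r. bt \<omega> g l i j * av \<omega> f l i) - av \<omega> f l j * (\<Sum>i\<in>shell j r. bt \<omega> g l i j)) = wsum \<omega> (\<lambda>_. 1) f g l j"
    by (rule ext) (simp add: wsum_def right_diff_distrib sum_subtractf sum_distrib_left mult_ac)
  ultimately show ?thesis by (simp add: sums_iff)
qed

text \<open>Inside a shell the weights are removed term by term; the shells are then summed with a
  geometric bound that is uniform in the lattice.\<close>

lemma expect_wsum:
  assumes f: "square_integrable f" and g: "square_integrable g"
  shows "integrable omega_measure (\<lambda>\<omega>. \<Sum>r. wsum \<omega> (\<lambda>i. wt \<omega> l i j) f g l j r)" (is ?I1)
    and "integrable omega_measure (\<lambda>\<omega>. \<Sum>r. wsum \<omega> (\<lambda>_. 1) f g l j r)" (is ?I2)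
    and "(LINT \<omega>|omega_measure. (\<Sum>r. wsum \<omega> (\<lambda>i. wt \<omega> l i j) f g l j r)) = (LINT \<omega>|omega_measure. (\<Sum>r. wsum \<omega> (\<lambda>_. 1) f g l j r))" (is ?E)
proof -
  note [measurable] = f g
  define M where "M = 2 * (L2_norm f / sqrt (vl TYPE('n) l)) * (EE * vl TYPE('n) l * GM g l)"
  \<comment> \<open>The boolean selects the weighted or the true version, since all bounds are the
    same.\<close>
  define c where "c b \<omega> i = (if b then wt \<omega> l i j else 1)" for b \<omega> i
  have ct: "c True \<omega> = (\<lambda>i. wt \<omega> l i j)" "c False \<omega> = (\<lambda>_. 1)" for \<omega>
    by (auto simp: c_def)
  have cb: "\<bar>c b \<omega> i\<bar> \<le> 2 ^ CARD('n)" for b \<omega> i using wt_abs by (simp add: c_def)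
  have wb: "cmod (wsum \<omega> (c b \<omega>) f g l j r) \<le> M * lam ^ r" for b \<omega> r
    unfolding M_def by (rule wsum_bound'[OF cb f g])
  have meas: "(\<lambda>\<omega>. wsum \<omega> (c b \<omega>) f g l j r) \<in> borel_measurable omega_measure" for b r
    by (rule measurable_wsum[OF f g]) (simp add: c_def)
  have fb: "(\<Sum>r\<in>F. cmod (wsum \<omega> (c b \<omega>) f g l j r)) \<le> M / (1 - lam)" if "finite F" for b \<omega> F
  proof -
    have "(\<Sum>r\<in>F. cmod (wsum \<omega> (c b \<omega>) f g l j r)) \<le> (\<Sum>r | 0 \<le> r \<and> r < Suc (Max (insert 0 F)). cmod (wsum \<omega> (c b \<omega>) f g l j r))"
      using that by (intro sum_mono2) (auto simp: less_Suc_eq_le)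
    also have "\<dots> \<le> M * lam ^ 0 / (1 - lam)"
      by (rule geometric_tail(4)[OF wb]) (use lam in auto)
    finally show ?thesis by simp
  qed
  have eq: "(\<Sum>\<^sub>\<infinity>r. wsum \<omega> (c b \<omega>) f g l j r) = (\<Sum>r. wsum \<omega> (c b \<omega>) f g l j r)" for b \<omega>
    by (rule sums_infsum[OF geometric_tail(1)[OF wb]]) (use lam in auto)
  note X = expect_infsum[OF prob_omega meas fb, unfolded eq]
  have "integrable omega_measure (\<lambda>\<omega>. \<Sum>r. wsum \<omega> (c b \<omega>) f g l j r)" for b by (rule X(1))
  from this[of True] this[of False] show ?I1 ?I2 by (simp_all only: ct)
  have "(LINT \<omega>|omega_measure. wsum \<omega> (c True \<omega>) f g l j r) = (LINT \<omega>|omega_measure. wsum \<omega> (c False \<omega>) f g l j r)" for r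
  proof -
    define h where "h i = (\<lambda>\<omega>. bt \<omega> g l i j * (av \<omega> f l i - av \<omega> f l j))" for i
    define K where "K = (EE * vl TYPE('n) l * GM g l) * (2 * (L2_norm f / sqrt (vl TYPE('n) l)))"
    have hm [measurable]: "h i \<in> borel_measurable omega_measure" for i unfolding h_def by measurable
    have hb: "cmod (h i \<omega>) \<le> K" for i \<omega>
    proof -
      have a: "cmod (av \<omega> f l i) \<le> L2_norm f / sqrt (vl TYPE('n) l)" for i using av_bound[OF f, of \<omega> l 0 i] by simp
      have "cmod (av \<omega> f l i - av \<omega> f l j) \<le> 2 * (L2_norm f / sqrt (vl TYPE('n) l))"
        using norm_triangle_ineq4[of "av \<omega> f l i" "av \<omega> f l j"] a[of i] a[of j] by linarith
      thus ?thesis unfolding h_def K_def norm_mult using bt_bound[OF g, of \<omega> l i j]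
        by (intro mult_mono) (auto intro: order_trans[OF norm_ge_zero])
    qed
    have hu: "h i (fun_upd \<omega> l' v) = h i \<omega>" if "l' \<ge> l" for i \<omega> l' v
      by (simp add: h_def level_upd[OF that])
    have int: "integrable omega_measure (\<lambda>\<omega>. complex_of_real (c b \<omega> i) * h i \<omega>)" for b i
    proof (rule bounded_integrable_omega)
      show "(\<lambda>\<omega>. complex_of_real (c b \<omega> i) * h i \<omega>) \<in> borel_measurable omega_measure" unfolding c_def by measurable
      show "cmod (complex_of_real (c b \<omega> i) * h i \<omega>) \<le> 2 ^ CARD('n) * K" for \<omega>
        unfolding norm_mult norm_of_real by (intro mult_mono cb hb) auto
    qed
    have "(LINT \<omega>|omega_measure. wsum \<omega> (c b \<omega>) f g l j r) = (\<Sum>i\<in>shell j r. LINT \<omega>|omega_measure. complex_of_real (c b \<omega> i) * h i \<omega>)" for b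
    proof -
      have "wsum \<omega> (c b \<omega>) f g l j r = (\<Sum>i\<in>shell j r. complex_of_real (c b \<omega> i) * h i \<omega>)" for \<omega>
        by (simp add: wsum_def h_def mult.assoc)
      thus ?thesis by (simp only: Bochner_Integration.integral_sum[OF int])
    qed
    moreover have "(LINT \<omega>|omega_measure. complex_of_real (c True \<omega> i) * h i \<omega>) = (LINT \<omega>|omega_measure. complex_of_real (c False \<omega> i) * h i \<omega>)" for i
      using expect_wt[OF hm hb hu, of l i j] by (simp add: c_def)
    ultimately show ?thesis by simp
  qed
  hence fe: "(\<lambda>r. LINT \<omega>|omega_measure. wsum \<omega> (c True \<omega>) f g l j r) = (\<lambda>r. LINT \<omega>|omega_measure. wsum \<omega> (c False \<omega>) f g l j r)" by (rule ext)
  have "(LINT \<omega>|omega_measure. (\<Sum>r. wsum \<omega> (c True \<omega>) f g l j r)) = (LINT \<omega>|omega_measure. (\<Sum>r. wsum \<omega> (c False \<omega>) f g l j r))"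
    using X(2)[of True] X(2)[of False] unfolding fe by (rule has_sum_unique)
  thus ?E by (simp only: ct)
qed

lemma para_single_bound:
  assumes v: "valid \<omega>" and f: "square_integrable f" and g: "square_integrable g"
  shows "cmod (para \<omega> f g l j) \<le> 2 * CC * L2_norm f * L2_norm g"
  using para_bound[OF v f g, of "{(l, j)}"] by simp

text \<open>The paraproduct carries no weight and appears unchanged on both sides, so only the sums
  of differences have to be compared.\<close>

lemma expect_cross:
  assumes f: "square_integrable f" "fsupp \<rho> f" and g: "square_integrable g"
  shows "integrable omega_measure (\<lambda>\<omega>. Zc \<rho> \<omega> f g l + Zp \<rho> \<omega> f g l)" (is ?I1)
    and "integrable omega_measure (\<lambda>\<omega>. lowc \<rho> \<omega> f g l)" (is ?I2)
    and "(LINT \<omega>|omega_measure. Zc \<rho> \<omega> f g l + Zp \<rho> \<omega> f g l) = (LINT \<omega>|omega_measure. lowc \<rho> \<omega> f g l)" (is ?E)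
proof -
  note [measurable] = f(1) g
  have ip: "integrable omega_measure (\<lambda>\<omega>. para \<omega> f g l j)" for j
    by (rule bounded_integrable_omega[OF _ para_single_bound[OF _ f(1) g]]) measurable
  have iZc: "integrable omega_measure (\<lambda>\<omega>. Zc \<rho> \<omega> f g l)"
    unfolding Zc_def by (intro Bochner_Integration.integrable_sum expect_wsum f g)
  have iZp: "integrable omega_measure (\<lambda>\<omega>. Zp \<rho> \<omega> f g l)"
    unfolding Zp_def by (intro Bochner_Integration.integrable_sum ip)
  show ?I1 by (rule Bochner_Integration.integrable_add[OF iZc iZp])
  have low: "lowc \<rho> \<omega> f g l = (\<Sum>j\<in>ix \<rho> l. \<Sum>r. wsum \<omega> (\<lambda>_. 1) f g l j r) + Zp \<rho> \<omega> f g l"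
    if "\<omega> \<in> space omega_measure" for \<omega>
    using that by (simp add: lowc_def Zp_def wsum_one_sum[OF _ f g] space_omega sum_subtractf)
  have i1: "integrable omega_measure (\<lambda>\<omega>. \<Sum>j\<in>ix \<rho> l. \<Sum>r. wsum \<omega> (\<lambda>_. 1) f g l j r)"
    by (intro Bochner_Integration.integrable_sum expect_wsum f g)
  show ?I2
    by (rule Bochner_Integration.integrable_cong[THEN iffD2, OF refl low Bochner_Integration.integrable_add[OF i1 iZp]])
  have "(LINT \<omega>|omega_measure. lowc \<rho> \<omega> f g l) = (LINT \<omega>|omega_measure. (\<Sum>j\<in>ix \<rho> l. \<Sum>r. wsum \<omega> (\<lambda>_. 1) f g l j r) + Zp \<rho> \<omega> f g l)"
    by (rule Bochner_Integration.integral_cong[OF refl low])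
  also have "\<dots> = (\<Sum>j\<in>ix \<rho> l. LINT \<omega>|omega_measure. (\<Sum>r. wsum \<omega> (\<lambda>_. 1) f g l j r)) + (LINT \<omega>|omega_measure. Zp \<rho> \<omega> f g l)"
    using i1 iZp expect_wsum(2)[OF f(1) g] by (simp add: Bochner_Integration.integral_sum)
  also have "(\<Sum>j\<in>ix \<rho> l. LINT \<omega>|omega_measure. (\<Sum>r. wsum \<omega> (\<lambda>_. 1) f g l j r)) = (LINT \<omega>|omega_measure. Zc \<rho> \<omega> f g l)"
    unfolding Zc_def expect_wsum(3)[OF f(1) g, symmetric]
    by (rule Bochner_Integration.integral_sum[symmetric]) (rule expect_wsum(1)[OF f(1) g])
  also have "(LINT \<omega>|omega_measure. Zc \<rho> \<omega> f g l) + (LINT \<omega>|omega_measure. Zp \<rho> \<omega> f g l) = (LINT \<omega>|omega_measure. Zc \<rho> \<omega> f g l + Zp \<rho> \<omega> f g l)"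
    by (rule Bochner_Integration.integral_add[OF iZc iZp, symmetric])
  finally show ?E ..
qed

lemma expect_diag:
  assumes f: "square_integrable f" and g: "square_integrable g"
  shows "integrable omega_measure (\<lambda>\<omega>. Zd \<rho> \<omega> f g l)" (is ?I1)
    and "integrable omega_measure (\<lambda>\<omega>. B (Df \<rho> \<omega> f l) (Df \<rho> \<omega> g l))" (is ?I2)
    and "(LINT \<omega>|omega_measure. Zd \<rho> \<omega> f g l) = (LINT \<omega>|omega_measure. B (Df \<rho> \<omega> f l) (Df \<rho> \<omega> g l))" (is ?E)
proof -
  note [measurable] = f g
  have m: "(\<lambda>\<omega>. dd \<omega> f g l i j) \<in> borel_measurable omega_measure" for i j
    unfolding dd_def by measurable
  note [measurable] = m
  have i0: "integrable omega_measure (\<lambda>\<omega>. dd \<omega> f g l i j)" for i j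
    by (rule bounded_integrable_omega[OF m dd_bound[OF f g]])
  have i1: "integrable omega_measure (\<lambda>\<omega>. wt \<omega> l i j * dd \<omega> f g l i j)" for i j
  proof (rule bounded_integrable_omega)
    show "(\<lambda>\<omega>. wt \<omega> l i j * dd \<omega> f g l i j) \<in> borel_measurable omega_measure" by measurable
    show "cmod (wt \<omega> l i j * dd \<omega> f g l i j) \<le> 2 ^ CARD('n) * (\<Sum>\<eta>\<in>(bits::(int^'n) set). \<Sum>\<theta>\<in>(bits::(int^'n) set). (L2_norm f * sqrt (vl TYPE('n) l)) / vl TYPE('n) (l - 1) *
      ((L2_norm g * sqrt (vl TYPE('n) l)) / vl TYPE('n) (l - 1)) * (N * vl TYPE('n) l))" for \<omega>
      unfolding norm_mult norm_of_real by (intro mult_mono wt_abs dd_bound f g) auto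
  qed
  have e: "(LINT \<omega>|omega_measure. wt \<omega> l i j * dd \<omega> f g l i j) = (LINT \<omega>|omega_measure. dd \<omega> f g l i j)" for i j
    by (rule expect_wt[OF m dd_bound[OF f g] level_upd(3)])
  show ?I1 unfolding Zd_def by (intro Bochner_Integration.integrable_sum i1)
  show ?I2 unfolding lowd_eq[symmetric] by (intro Bochner_Integration.integrable_sum i0)
  show ?E unfolding Zd_def lowd_eq[symmetric]
    by (simp add: Bochner_Integration.integral_sum i0 i1 Bochner_Integration.integrable_sum e)
qed

end

subsection \<open>Convergence of the averages\<close>

lemma ind_box_sq: "square_integrable (ind (cbox a b))"
  using emeasure_lborel_cbox_finite[of a b] by (intro square_integrable_ind(1)) auto

lemma fsupp_integrable:
  fixes f :: "('n::finite) fn"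
  assumes f: "square_integrable f" and s: "fsupp \<rho> f"
  shows "integrable lborel f"
proof -
  let ?z = "(\<chi> c. \<rho>) :: real^'n"
  have "(\<lambda>x. f x * ind (cbox (-?z) ?z) x) = f"
  proof
    fix x
    show "f x * ind (cbox (-?z) ?z) x = f x"
    proof (cases "f x = 0")
      case False
      hence "x \<in> cbox (-?z) ?z" using s by (auto simp: fsupp_def mem_box_cart abs_le_iff minus_le_iff)
      thus ?thesis by simp
    qed simp
  qed
  thus ?thesis using integrable_pairing(1)[OF f ind_box_sq[of "-?z" ?z]] by simp
qed

lemma fsupp_zero:
  assumes "fsupp \<rho> f" "\<bar>x $ c\<bar> > \<rho>"
  shows "f x = 0"
proof (rule ccontr)
  assume "f x \<noteq> 0"
  hence "\<bar>x $ c\<bar> \<le> \<rho>" using assms(1) by (auto simp: fsupp_def)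
  thus False using assms(2) by simp
qed

lemma mem_sym_box:
  "x \<in> cbox (- (\<chi> c. r)) (\<chi> c. r) \<longleftrightarrow> (\<forall>c. \<bar>x $ c\<bar> \<le> r)" for x :: "real^'n::finite"
  by (auto simp: mem_box_cart abs_le_iff minus_le_iff)

text \<open>Uniform continuity. The threshold does not depend on the lattice, as the limit is taken
  under the expectation.\<close>

lemma Ef_small_scale:
  fixes f :: "('n::finite) fn"
  assumes f: "square_integrable f" "fsupp \<rho> f" "continuous_on UNIV f" and e: "e > 0" and \<rho>: "\<rho> \<ge> 0"
  shows "\<exists>K. \<forall>k\<le>K. \<forall>\<omega>. valid \<omega> \<longrightarrow> L2_norm (\<lambda>x. Ef \<rho> \<omega> f k x - f x) \<le> e"
proof -
  let ?z = "\<lambda>r. (\<chi> c. r) :: real^'n"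
  let ?Q = "\<lambda>r. cbox (- ?z r) (?z r)"
  define V where "V = measure lborel (?Q (\<rho> + 1))"
  \<comment> \<open>A pointwise error \<open>e'\<close> on a box of volume \<open>V\<close> costs
    \<open>e' * sqrt V\<close> in norm; the added 1 keeps the denominator positive.\<close>
  define e' where "e' = e / (sqrt V + 1)"
  have V0: "V \<ge> 0" by (simp add: V_def)
  have sV: "sqrt V + 1 > 0" using V0 by (simp add: add_nonneg_pos)
  have e': "e' > 0" using e sV by (simp add: e'_def)
  have "uniformly_continuous_on (?Q (\<rho> + 2)) f"
    by (rule compact_uniformly_continuous[OF continuous_on_subset[OF f(3)]]) auto
  then obtain \<delta> where \<delta>: "\<delta> > 0" "\<And>x y. x \<in> ?Q (\<rho> + 2) \<Longrightarrow> y \<in> ?Q (\<rho> + 2) \<Longrightarrow> dist y x < \<delta> \<Longrightarrow> dist (f y) (f x) < e'"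
    unfolding uniformly_continuous_on_def using e' by meson
  define \<tau> where "\<tau> = min 1 (\<delta> / (2 * real CARD('n) + 1))"
  have \<tau>: "\<tau> > 0" using \<delta> by (simp add: \<tau>_def)
  obtain n :: nat where n: "(1/2) ^ n < \<tau>" using real_arch_pow_inv[OF \<tau>, of "1/2"] by auto
  have "L2_norm (\<lambda>x. Ef \<rho> \<omega> f k x - f x) \<le> e" if k: "k \<le> - int n" and v: "valid \<omega>" for k \<omega>
  proof -
    have "(2::real) powi k \<le> 2 powi (- int n)" using k by (intro power_int_increasing) auto
    also have "\<dots> = (1/2) ^ n" by (simp add: power_int_minus power_one_over inverse_eq_divide)
    finally have pk: "(2::real) powi k < \<tau>" using n by linarith
    hence pk1: "(2::real) powi k < 1" and pk2: "(2 * real CARD('n) + 1) * 2 powi k < \<delta>"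
      by (auto simp: \<tau>_def less_divide_eq mult.commute)
    have close: "\<bar>x $ c - y $ c\<bar> \<le> 2 powi k" if "x \<in> cub \<omega> k i" "y \<in> cub \<omega> k i" for x y i c
      using that by (auto simp: cub_def qube_def abs_le_iff dest!: spec[of _ c])
    have dclose: "dist y x < \<delta>" if "x \<in> cub \<omega> k i" "y \<in> cub \<omega> k i" for x y i
    proof -
      have "dist y x \<le> (\<Sum>c\<in>UNIV. \<bar>(y - x) $ c\<bar>)" unfolding dist_norm by (rule norm_le_l1_cart)
      also have "\<dots> \<le> (\<Sum>c\<in>(UNIV::'n set). 2 powi k)" using close[OF that(2,1)] by (intro sum_mono) auto
      also have "\<dots> \<le> (2 * real CARD('n) + 1) * 2 powi k" by simp
      finally show ?thesis using pk2 by linarith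
    qed
    have pt: "cmod (Ef \<rho> \<omega> f k x - f x) \<le> e'" and pz: "x \<notin> ?Q (\<rho> + 1) \<Longrightarrow> Ef \<rho> \<omega> f k x - f x = 0" for x
    proof -
      define i where "i = pidx \<omega> k x"
      have xi: "x \<in> cub \<omega> k i" by (simp add: i_def mem_cub_iff)
      have fd: "cmod (f y - f x) \<le> e'" if y: "y \<in> cub \<omega> k i" for y
      proof (cases "x \<in> ?Q (\<rho> + 1)")
        case True
        have "y \<in> ?Q (\<rho> + 2)" "x \<in> ?Q (\<rho> + 2)"
        proof -
          have x: "\<bar>x $ c\<bar> \<le> \<rho> + 1" for c using True unfolding mem_sym_box by blast
          have y: "\<bar>y $ c\<bar> \<le> \<rho> + 2" for c using x[of c] close[OF xi y, of c] pk1 by linarith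
          show "y \<in> ?Q (\<rho> + 2)" unfolding mem_sym_box using y by blast
          have "\<bar>x $ c\<bar> \<le> \<rho> + 2" for c using x[of c] by linarith
          thus "x \<in> ?Q (\<rho> + 2)" unfolding mem_sym_box by blast
        qed
        thus ?thesis using \<delta>(2)[of x y] dclose[OF xi y] by (simp add: dist_norm less_imp_le)
      next
        case False
        then obtain c where c: "\<bar>x $ c\<bar> > \<rho> + 1" unfolding mem_sym_box not_all not_le by blast
        have "f y = 0" "f x = 0"
        proof -
          have "\<bar>y $ c\<bar> > \<rho>" using c close[OF xi y, of c] pk1 by linarith
          thus "f y = 0" by (rule fsupp_zero[OF f(2)])
          show "f x = 0" using c by (intro fsupp_zero[OF f(2), of x c]) simp
        qed
        thus ?thesis using e' by simp
      qed
      have int: "integrable lborel (\<lambda>y. f y * ind (cub \<omega> k i) y)" by (rule integrable_pairing(1)[OF f(1) sq_ind_cub])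
      have inti: "integrable lborel (\<lambda>y. f x * ind (cub \<omega> k i) y)"
        by (intro integrable_mult_right integrable_ind) (simp_all add: emeasure_cub)
      have "pairing f (ind (cub \<omega> k i)) - f x * complex_of_real (vl TYPE('n) k) = (LINT y|lborel. f y * ind (cub \<omega> k i) y - f x * ind (cub \<omega> k i) y)"
        using int inti by (simp add: pairing_def integral_ind measure_cub)
      also have "cmod \<dots> \<le> (LINT y|lborel. e' * indicator (cub \<omega> k i) y)"
      proof (rule order_trans[OF integral_norm_bound integral_mono])
        show "integrable lborel (\<lambda>y. cmod (f y * ind (cub \<omega> k i) y - f x * ind (cub \<omega> k i) y))" using int inti by simp
        show "integrable lborel (\<lambda>y. e' * indicator (cub \<omega> k i) y)"
          by (intro integrable_mult_right integrable_real_indicator) (simp_all add: emeasure_cub)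
        show "cmod (f y * ind (cub \<omega> k i) y - f x * ind (cub \<omega> k i) y) \<le> e' * indicator (cub \<omega> k i) y" for y
          using fd[of y] by (cases "y \<in> cub \<omega> k i") auto
      qed
      also have "\<dots> = e' * vl TYPE('n) k" by (simp add: measure_cub emeasure_cub)
      finally have "cmod (pairing f (ind (cub \<omega> k i)) - f x * complex_of_real (vl TYPE('n) k)) / vl TYPE('n) k \<le> e'"
        by (simp add: pos_divide_le_eq)
      moreover have "Ef \<rho> \<omega> f k x - f x = (pairing f (ind (cub \<omega> k i)) - f x * complex_of_real (vl TYPE('n) k)) / vl TYPE('n) k"
        unfolding Ef_eval[OF v f(2)] by (simp add: av_def i_def diff_divide_distrib)
      ultimately show "cmod (Ef \<rho> \<omega> f k x - f x) \<le> e'" by (simp add: norm_divide)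
      show "Ef \<rho> \<omega> f k x - f x = 0" if out: "x \<notin> ?Q (\<rho> + 1)"
      proof -
        obtain c where c: "\<bar>x $ c\<bar> > \<rho> + 1" using out unfolding mem_sym_box not_all not_le by blast
        have "f y = 0" if y: "y \<in> cub \<omega> k i" for y
        proof -
          have "\<bar>y $ c\<bar> > \<rho>" using c close[OF xi y, of c] pk1 by linarith
          thus "f y = 0" by (rule fsupp_zero[OF f(2)])
        qed
        hence "pairing f (ind (cub \<omega> k i)) = 0" by (intro pairing_out[where Q = "cub \<omega> k i"]) (auto simp: indicator_def)
        moreover have "f x = 0" using c by (intro fsupp_zero[OF f(2), of x c]) simp
        ultimately show ?thesis unfolding Ef_eval[OF v f(2)] by (simp add: av_def i_def)
      qed
    qed
    have "(L2_norm (\<lambda>x. Ef \<rho> \<omega> f k x - f x))\<^sup>2 \<le> e'\<^sup>2 * measure lborel (?Q (\<rho> + 1))"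
      using square_integrableD(1)[OF square_integrable_diff[OF Ef_sq f(1)]] pt pz
      by (intro square_integrable_bounded(2)) (auto simp: emeasure_lborel_cbox_finite[unfolded infinity_ennreal_def])
    hence "L2_norm (\<lambda>x. Ef \<rho> \<omega> f k x - f x) \<le> sqrt (e'\<^sup>2 * V)" unfolding V_def by (rule real_le_rsqrt)
    also have "\<dots> = e' * sqrt V" using e' by (simp add: real_sqrt_mult)
    also have "\<dots> \<le> e' * (sqrt V + 1)" using e' by (intro mult_left_mono) auto
    also have "\<dots> = e" using sV by (simp add: e'_def)
    finally show ?thesis .
  qed
  thus ?thesis by blast
qed

text \<open>On coarse cubes the averages are at most the $L^1$ norm divided by the volume, and a
  bounded number of cubes is involved, so the norm decays like the inverse square root of the
  volume.\<close>

lemma Ef_large_scale: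
  fixes f :: "('n::finite) fn"
  assumes f: "square_integrable f" "fsupp \<rho> f" and e: "e > 0"
  shows "\<exists>K. \<forall>k\<ge>K. \<forall>\<omega>. valid \<omega> \<longrightarrow> L2_norm (Ef \<rho> \<omega> f k) \<le> e"
proof -
  define M where "M = (LINT x|lborel. cmod (f x))"
  \<comment> \<open>Seven indices per coordinate, from -3 to 3, remain in \<open>ix\<close> once
    \<open>2 powi k\<close> exceeds \<rho>.\<close>
  define Q where "Q = 7 ^ CARD('n) * (M + 1) / e"
  have M0: "M \<ge> 0" by (simp add: M_def)
  have Q0: "Q > 0" using M0 e by (simp add: Q_def)
  obtain n :: nat where n: "max \<rho> (Q\<^sup>2) < 2 ^ n" using real_arch_pow[of 2 "max \<rho> (Q\<^sup>2)"] by auto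
  have "L2_norm (Ef \<rho> \<omega> f k) \<le> e" if k: "k \<ge> int n" and v: "valid \<omega>" for k \<omega>
  proof -
    have "(2::real) powi int n \<le> 2 powi k" using k by (intro power_int_increasing) auto
    hence pk: "max \<rho> (Q\<^sup>2) < 2 powi k" using n by simp
    have V: "vl TYPE('n) k \<ge> 2 powi k"
    proof -
      have "1 \<le> (2::real) powi k"
      proof -
        have "(2::real) powi 0 \<le> 2 powi k" using k by (intro power_int_increasing) auto
        thus ?thesis by simp
      qed
      from self_le_power[OF this, of "CARD('n)"] show ?thesis by (simp add: vl_def)
    qed
    have cix: "real (card (ix \<rho> k :: (int^'n) set)) \<le> 7 ^ CARD('n)"
    proof -
      have z: "\<lceil>\<rho> / 2 powi k\<rceil> \<le> 1" using pk by (simp add: ceiling_le_iff pos_divide_le_eq)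
      have "ix \<rho> k \<subseteq> {i :: int^'n. \<forall>c. \<bar>i $ c\<bar> \<le> 3}"
      proof safe
        fix i :: "int^'n" and c assume "i \<in> ix \<rho> k"
        hence "\<bar>i $ c\<bar> \<le> \<lceil>\<rho> / 2 powi k\<rceil> + 2" unfolding ix_def by blast
        thus "\<bar>i $ c\<bar> \<le> 3" using z by linarith
      qed
      hence "card (ix \<rho> k :: (int^'n) set) \<le> card {i :: int^'n. \<forall>c. \<bar>i $ c\<bar> \<le> 3}" by (intro card_mono card_box)
      also have "\<dots> = 7 ^ CARD('n)" using card_box(2)[of 3, where 'n = 'n] by simp
      finally show ?thesis using of_nat_mono[of _ "7 ^ CARD('n)", where 'a = real] by simp
    qed
    have "L2_norm (Ef \<rho> \<omega> f k) \<le> (\<Sum>i\<in>ix \<rho> k. L2_norm (\<lambda>x. av \<omega> f k i * ind (cub \<omega> k i) x))"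
      unfolding Ef_def by (rule L2_norm_sum_le) (intro square_integrable_scale sq_ind_cub)
    also have "\<dots> \<le> (\<Sum>i\<in>(ix \<rho> k :: (int^'n) set). M / sqrt (vl TYPE('n) k))"
    proof (rule sum_mono)
      fix i :: "int^'n"
      have c: "cmod (pairing f (ind (cub \<omega> k i))) \<le> M"
      proof -
        have "mass \<omega> (\<lambda>x. cmod (f x)) k i \<le> M"
          using mass_sum_le[of "\<lambda>x. cmod (f x)" "{i}" \<omega> k] fsupp_integrable[OF f] by (simp add: M_def)
        thus ?thesis using abs_av_le(1)[OF f(1), of \<omega> k i] by linarith
      qed
      have "L2_norm (\<lambda>x. av \<omega> f k i * ind (cub \<omega> k i) x) = cmod (pairing f (ind (cub \<omega> k i))) / vl TYPE('n) k * sqrt (vl TYPE('n) k)"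
        unfolding L2_norm_scale by (simp add: av_def norm_divide cub_def L2_norm_qube)
      also have "\<dots> = cmod (pairing f (ind (cub \<omega> k i))) / sqrt (vl TYPE('n) k)"
        by (simp add: field_simps)
      also have "\<dots> \<le> M / sqrt (vl TYPE('n) k)" using c by (intro divide_right_mono) auto
      finally show "L2_norm (\<lambda>x. av \<omega> f k i * ind (cub \<omega> k i) x) \<le> M / sqrt (vl TYPE('n) k)" .
    qed
    also have "\<dots> = real (card (ix \<rho> k :: (int^'n) set)) * (M / sqrt (vl TYPE('n) k))" by simp
    also have "\<dots> \<le> 7 ^ CARD('n) * ((M + 1) / sqrt (vl TYPE('n) k))"
      using cix M0 by (intro mult_mono divide_right_mono) auto
    also have "\<dots> = Q * e / sqrt (vl TYPE('n) k)" using e by (simp add: Q_def)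
    also have "\<dots> \<le> e"
    proof -
      have "Q\<^sup>2 \<le> vl TYPE('n) k" using pk V by linarith
      hence "Q \<le> sqrt (vl TYPE('n) k)" by (rule real_le_rsqrt)
      hence "Q * e \<le> sqrt (vl TYPE('n) k) * e" using e by (intro mult_right_mono) auto
      thus ?thesis by (simp add: pos_divide_le_eq mult.commute)
    qed
    finally show ?thesis .
  qed
  thus ?thesis by blast
qed

text \<open>A non-integrable function has integral 0 by convention, and the bound covers this case
  too.\<close>

lemma expect_bound:
  fixes h :: "('n::finite) digits \<Rightarrow> complex"
  assumes "\<And>\<omega>. valid \<omega> \<Longrightarrow> cmod (h \<omega>) \<le> M"
  shows "cmod (LINT \<omega>|omega_measure. h \<omega>) \<le> M"
proof -
  interpret prob_space "omega_measure :: 'n digits measure" by (rule prob_omega)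
  obtain \<omega>0 where "\<omega>0 \<in> space (omega_measure :: 'n digits measure)" using not_empty by blast
  hence M0: "0 \<le> M" using assms order_trans[OF norm_ge_zero] by (auto simp: space_omega)
  show ?thesis
  proof (cases "integrable omega_measure h")
    case True
    have "cmod (LINT \<omega>|omega_measure. h \<omega>) \<le> (LINT \<omega>|omega_measure. cmod (h \<omega>))" by (rule integral_norm_bound)
    also have "\<dots> \<le> (LINT \<omega>|(omega_measure :: 'n digits measure). M)"
      using True assms by (intro integral_mono) (auto simp: space_omega)
    finally show ?thesis by (simp add: prob_space)
  qed (simp add: not_integrable_integral_eq M0)
qed

context cz_form
begin

text \<open>The two ends of the telescoping sum: the fine one gives the form itself, and the coarse
  one vanishes because averages over huge cubes have small norm.\<close>

lemma expect_limits:
  assumes f: "square_integrable f" "fsupp \<rho> f" "continuous_on UNIV f"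
    and g: "square_integrable g" "fsupp \<rho> g" "continuous_on UNIV g" and \<rho>: "\<rho> \<ge> 0"
    and int: "\<And>k. integrable omega_measure (\<lambda>\<omega>. B (Ef \<rho> \<omega> f k) (Ef \<rho> \<omega> g k))"
  shows "(\<lambda>n. (LINT \<omega>|omega_measure. B (Ef \<rho> \<omega> f (- int n)) (Ef \<rho> \<omega> g (- int n))) - (LINT \<omega>|omega_measure. B (Ef \<rho> \<omega> f (int n)) (Ef \<rho> \<omega> g (int n)))) \<longlonglongrightarrow> B f g"
proof -
  interpret prob_space "omega_measure :: 'n digits measure" by (rule prob_omega)
  have N0: "N \<ge> 0" using bformD(1)[OF B] .
  have lim1: "(\<lambda>n. (LINT \<omega>|omega_measure. B (Ef \<rho> \<omega> f (- int n)) (Ef \<rho> \<omega> g (- int n)))) \<longlonglongrightarrow> B f g"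
  proof (rule LIMSEQ_I)
    fix r :: real assume r: "r > 0"
    define D where "D = N * (L2_norm f + L2_norm g + 1) + 1"
    have D: "D > 0" using N0 by (simp add: D_def add_nonneg_pos)
    define e where "e = min 1 (r / (2 * D))"
    have e: "e > 0" using r D by (simp add: e_def)
    obtain K1 where K1: "\<And>k \<omega>. k \<le> K1 \<Longrightarrow> valid \<omega> \<Longrightarrow> L2_norm (\<lambda>x. Ef \<rho> \<omega> f k x - f x) \<le> e"
      using Ef_small_scale[OF f e \<rho>] by blast
    obtain K2 where K2: "\<And>k \<omega>. k \<le> K2 \<Longrightarrow> valid \<omega> \<Longrightarrow> L2_norm (\<lambda>x. Ef \<rho> \<omega> g k x - g x) \<le> e"
      using Ef_small_scale[OF g e \<rho>] by blast
    have "norm ((LINT \<omega>|omega_measure. B (Ef \<rho> \<omega> f (- int n)) (Ef \<rho> \<omega> g (- int n))) - B f g) < r"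
      if n: "n \<ge> nat (max (- K1) (- K2))" for n
    proof -
      define k where "k = - int n"
      have k: "k \<le> K1" "k \<le> K2" using n by (auto simp: k_def)
      have "cmod (B (Ef \<rho> \<omega> f k) (Ef \<rho> \<omega> g k) - B f g) \<le> e * D" if v: "valid \<omega>" for \<omega>
      proof -
        let ?f = "Ef \<rho> \<omega> f k" and ?g = "Ef \<rho> \<omega> g k"
        have "L2_norm (\<lambda>x. (?f x - f x) + f x) \<le> L2_norm (\<lambda>x. ?f x - f x) + L2_norm f"
          by (intro L2_norm_triangle square_integrable_diff Ef_sq f)
        hence nf: "L2_norm ?f \<le> e + L2_norm f" using K1[OF k(1) v] by simp
        have "B ?f ?g - B f g = B ?f (\<lambda>x. ?g x - g x) + B (\<lambda>x. ?f x - f x) g"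
          using bform_diff[OF B Ef_sq f(1) g(1)] bform_right(4)[OF B Ef_sq g(1) Ef_sq] by simp
        hence "cmod (B ?f ?g - B f g) \<le> cmod (B ?f (\<lambda>x. ?g x - g x)) + cmod (B (\<lambda>x. ?f x - f x) g)"
          by (simp add: norm_triangle_ineq)
        also have "\<dots> \<le> N * L2_norm ?f * L2_norm (\<lambda>x. ?g x - g x) + N * L2_norm (\<lambda>x. ?f x - f x) * L2_norm g"
          by (intro add_mono bformD(4)[OF B] square_integrable_diff Ef_sq f g)
        also have "\<dots> \<le> N * (1 + L2_norm f) * e + N * e * L2_norm g"
          using K1[OF k(1) v] K2[OF k(2) v] nf N0 e
          by (intro add_mono mult_mono mult_left_mono) (auto simp: e_def)
        also have "\<dots> \<le> e * D" using e by (simp add: D_def algebra_simps)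
        finally show ?thesis .
      qed
      hence "cmod (LINT \<omega>|omega_measure. B (Ef \<rho> \<omega> f k) (Ef \<rho> \<omega> g k) - B f g) \<le> e * D" by (rule expect_bound)
      also have "(LINT \<omega>|omega_measure. B (Ef \<rho> \<omega> f k) (Ef \<rho> \<omega> g k) - B f g) = (LINT \<omega>|omega_measure. B (Ef \<rho> \<omega> f k) (Ef \<rho> \<omega> g k)) - B f g"
        using int[of k] by (simp add: prob_space)
      finally have "cmod ((LINT \<omega>|omega_measure. B (Ef \<rho> \<omega> f k) (Ef \<rho> \<omega> g k)) - B f g) \<le> e * D" .
      also have "e * D \<le> r / (2 * D) * D" using D by (intro mult_right_mono) (auto simp: e_def)
      also have "\<dots> < r" using D r by simp
      finally show ?thesis by (simp add: k_def)
    qed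
    thus "\<exists>n0. \<forall>n\<ge>n0. norm ((LINT \<omega>|omega_measure. B (Ef \<rho> \<omega> f (- int n)) (Ef \<rho> \<omega> g (- int n))) - B f g) < r" by blast
  qed
  have lim2: "(\<lambda>n. (LINT \<omega>|omega_measure. B (Ef \<rho> \<omega> f (int n)) (Ef \<rho> \<omega> g (int n)))) \<longlonglongrightarrow> 0"
  proof (rule LIMSEQ_I)
    fix r :: real assume r: "r > 0"
    define e where "e = min 1 (r / (2 * (N + 1)))"
    have e: "e > 0" using r N0 by (simp add: e_def)
    obtain K1 where K1: "\<And>k \<omega>. k \<ge> K1 \<Longrightarrow> valid \<omega> \<Longrightarrow> L2_norm (Ef \<rho> \<omega> f k) \<le> e"
      using Ef_large_scale[OF f(1,2) e] by blast
    obtain K2 where K2: "\<And>k \<omega>. k \<ge> K2 \<Longrightarrow> valid \<omega> \<Longrightarrow> L2_norm (Ef \<rho> \<omega> g k) \<le> e"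
      using Ef_large_scale[OF g(1,2) e] by blast
    have "norm ((LINT \<omega>|omega_measure. B (Ef \<rho> \<omega> f (int n)) (Ef \<rho> \<omega> g (int n))) - 0) < r"
      if n: "n \<ge> nat (max K1 K2)" for n
    proof -
      have k: "int n \<ge> K1" "int n \<ge> K2" using n by auto
      have "cmod (B (Ef \<rho> \<omega> f (int n)) (Ef \<rho> \<omega> g (int n))) \<le> N * e * 1" if v: "valid \<omega>" for \<omega>
      proof -
        have "cmod (B (Ef \<rho> \<omega> f (int n)) (Ef \<rho> \<omega> g (int n))) \<le> N * L2_norm (Ef \<rho> \<omega> f (int n)) * L2_norm (Ef \<rho> \<omega> g (int n))"
          by (rule bformD(4)[OF B Ef_sq Ef_sq])
        also have "\<dots> \<le> N * e * 1"
          using K1[OF k(1) v] K2[OF k(2) v] N0 e by (intro mult_mono mult_left_mono) (auto simp: e_def)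
        finally show ?thesis .
      qed
      hence "cmod (LINT \<omega>|omega_measure. B (Ef \<rho> \<omega> f (int n)) (Ef \<rho> \<omega> g (int n))) \<le> N * e * 1" by (rule expect_bound)
      also have "N * e * 1 \<le> (N + 1) * (r / (2 * (N + 1)))"
        unfolding mult_1_right by (intro mult_mono) (use N0 r e in \<open>auto simp: e_def\<close>)
      also have "\<dots> = r / 2" using N0 by (simp add: field_simps)
      also have "\<dots> < r" using r by simp
      finally show ?thesis by simp
    qed
    thus "\<exists>n0. \<forall>n\<ge>n0. norm ((LINT \<omega>|omega_measure. B (Ef \<rho> \<omega> f (int n)) (Ef \<rho> \<omega> g (int n))) - 0) < r" by blast
  qed
  show ?thesis using tendsto_diff[OF lim1 lim2] by simp
qed

end

subsection \<open>The shifts of a lattice\<close>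

lemma frm_add:
  "frm \<omega> m n (\<lambda>k i j \<eta> \<theta>. a k i j \<eta> \<theta> + b k i j \<eta> \<theta>) f g k i j = frm \<omega> m n a f g k i j + frm \<omega> m n b f g k i j"
  by (simp add: frm_def distrib_right sum.distrib add_divide_distrib)

lemma frm_scale:
  "frm \<omega> m n (\<lambda>k i j \<eta> \<theta>. c * a k i j \<eta> \<theta>) f g k i j = c * frm \<omega> m n a f g k i j"
  by (simp add: frm_def sum_distrib_left mult.assoc)

lemma frm_transpose:
  "frm \<omega> m n (\<lambda>k i j \<eta> \<theta>. a k j i \<theta> \<eta>) f g k i j = frm \<omega> n m a g f k j i"
  unfolding frm_def by (subst sum.swap) (simp add: mult_ac)

lemma frm_out:
  fixes i :: "int^'n::finite"
  assumes "valid \<omega>" "fsupp \<rho> f" "fsupp \<rho> g" "i \<notin> ix \<rho> (k - int m) \<or> j \<notin> ix \<rho> (k - int n)"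
  shows "frm \<omega> m n a f g k i j = 0"
  using assms(4)
proof
  assume "i \<notin> ix \<rho> (k - int m)"
  from ix_pairing(3)[OF assms(1,2) this] show ?thesis by (simp add: frm_def)
next
  assume "j \<notin> ix \<rho> (k - int n)"
  from ix_pairing(3)[OF assms(1,3) this] show ?thesis by (simp add: frm_def)
qed

lemma tri_parent:
  "(k, i, j) \<in> tri \<omega> 0 1 \<longleftrightarrow> i = par \<omega> (k - 1) j" "(k, i, j) \<in> tri \<omega> 1 0 \<longleftrightarrow> j = par \<omega> (k - 1) i"
  by (auto simp: tri_def)

context cz_form
begin

text \<open>The Haar part of T1 as the second function of the paraproduct. The factor
  \<open>2 ^ CARD('n)\<close> compensates for the normalization by the volume of the parent instead
  of that of the cube itself.\<close>

definition pw :: "'n digits \<Rightarrow> real \<Rightarrow> int \<Rightarrow> int^'n \<Rightarrow> 'n fn" where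
  "pw \<omega> z k j = (\<lambda>x. \<Sum>\<theta>\<in>bits. (complex_of_real (z * 2 ^ CARD('n) / vl TYPE('n) (k - 2)) * bmo \<omega> (k - 1) j \<theta>) * phc \<omega> (k - 1) j \<theta> x)"

lemma pw_haar:
  assumes v: "valid \<omega>" and z: "z \<ge> 0" "z * KK \<le> 1"
  shows "haar (shifted_lattice \<omega>) (cub \<omega> (k - 1) j) (pw \<omega> z k j)"
    and "sup_norm (ind (cub \<omega> (k - 1) j)) * sup_norm (pw \<omega> z k j) \<le> 1"
    and "square_integrable (pw \<omega> z k j)"
    and "square_integrable g \<Longrightarrow> pairing f (ind (cub \<omega> (k - 1) j)) * pairing (pw \<omega> z k j) g / vl TYPE('n) k = z * para \<omega> f g (k - 1) j"
proof -
  show "haar (shifted_lattice \<omega>) (cub \<omega> (k - 1) j) (pw \<omega> z k j)" unfolding pw_def by (rule haar_phc_comb[OF v])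
  show "square_integrable (pw \<omega> z k j)" unfolding pw_def by (rule comb_sq)
  have v2: "vl TYPE('n) (k - 1) = 2 ^ CARD('n) * vl TYPE('n) (k - 2)"
    using vl_diff_1[where 'n = 'n, of "k - 1"] by simp
  have v1: "vl TYPE('n) k = 2 ^ CARD('n) * vl TYPE('n) (k - 1)"
    using vl_diff_1[where 'n = 'n, of k] by simp
  have l: "1 - lam > 0" using lam by simp
  have "cmod (complex_of_real (z * 2 ^ CARD('n) / vl TYPE('n) (k - 2)) * bmo \<omega> (k - 1) j \<theta>) \<le> z * (4 ^ CARD('n) * EE / (1 - lam))"
    if "\<theta> \<in> bits" for \<theta>
  proof -
    have "cmod (bmo \<omega> (k - 1) j \<theta>) \<le> (EE * vl TYPE('n) (k - 1)) * lam ^ 0 / (1 - lam)"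
      unfolding bmo_def by (rule tail_bound[OF that]) simp
    hence "cmod (complex_of_real (z * 2 ^ CARD('n) / vl TYPE('n) (k - 2)) * bmo \<omega> (k - 1) j \<theta>) \<le>
       (z * 2 ^ CARD('n) / vl TYPE('n) (k - 2)) * ((EE * vl TYPE('n) (k - 1)) * lam ^ 0 / (1 - lam))"
      unfolding norm_mult norm_of_real using z by (intro mult_mono) auto
    also have "\<dots> = z * ((2 ^ CARD('n) * 2 ^ CARD('n)) * EE / (1 - lam))" unfolding v2 by simp
    also have "\<dots> = z * (4 ^ CARD('n) * EE / (1 - lam))" by (simp add: power_mult_distrib[symmetric])
    finally show ?thesis .
  qed
  hence "cmod (pw \<omega> z k j x) \<le> 2 ^ CARD('n) * (z * (4 ^ CARD('n) * EE / (1 - lam)))" for x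
    unfolding pw_def by (rule comb_bound)
  also have "2 ^ CARD('n) * (z * (4 ^ CARD('n) * EE / (1 - lam))) = z * ((2 ^ CARD('n) * 4 ^ CARD('n)) * EE / (1 - lam))" by simp
  also have "\<dots> = z * KK" by (simp add: KK_def power_mult_distrib[symmetric])
  also have "\<dots> \<le> 1" by (rule z(2))
  finally have p: "cmod (pw \<omega> z k j x) \<le> 1" for x .
  have i: "cmod (ind (cub \<omega> (k - 1) j) x) \<le> 1" for x by (simp add: indicator_def)
  show "sup_norm (ind (cub \<omega> (k - 1) j)) * sup_norm (pw \<omega> z k j) \<le> 1"
    using mult_mono[OF sup_norm_le(2)[of "ind (cub \<omega> (k - 1) j)" 1, OF i] sup_norm_le(2)[OF p] _ sup_norm_le(1)[OF p]] by simp
  show "pairing f (ind (cub \<omega> (k - 1) j)) * pairing (pw \<omega> z k j) g / vl TYPE('n) k = z * para \<omega> f g (k - 1) j"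
    if g: "square_integrable g"
  proof -
    have "pairing (pw \<omega> z k j) g = complex_of_real (z * 2 ^ CARD('n)) * (\<Sum>\<theta>\<in>bits. bmo \<omega> (k - 1) j \<theta> * pairing g (phc \<omega> (k - 1) j \<theta>) / vl TYPE('n) (k - 1 - 1))"
      unfolding pw_def pairing_comb[OF g] sum_distrib_left by (intro sum.cong refl) simp
    moreover have "pairing f (ind (cub \<omega> (k - 1) j)) = complex_of_real (vl TYPE('n) (k - 1)) * av \<omega> f (k - 1) j"
      by (simp add: av_def)
    ultimately show ?thesis unfolding para_def v1 by simp
  qed
qed

text \<open>In these triples the larger cube is determined by the smaller one, so that the sums are
  over single cubes and \<open>para_bound\<close> applies.\<close>

lemma para_tri_bound:
  assumes v: "valid \<omega>" and f: "square_integrable f" and g: "square_integrable g" and F: "finite F"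
  shows "F \<subseteq> tri \<omega> 0 1 \<Longrightarrow> (\<Sum>(k, i, j)\<in>F. cmod (para \<omega> f g (k - 1) j)) \<le> 2 * CC * L2_norm f * L2_norm g"
    and "F \<subseteq> tri \<omega> 1 0 \<Longrightarrow> (\<Sum>(k, i, j)\<in>F. cmod (para \<omega> f g (k - 1) i)) \<le> 2 * CC * L2_norm f * L2_norm g"
proof -
  have le: "(\<Sum>x\<in>F. cmod (para \<omega> f g (fst (h x)) (snd (h x)))) \<le> 2 * CC * L2_norm f * L2_norm g" if "inj_on h F" for h
    using para_bound[OF v f g finite_imageI[OF F], of h] unfolding sum.reindex[OF that] by (simp add: case_prod_unfold)
  show "(\<Sum>(k, i, j)\<in>F. cmod (para \<omega> f g (k - 1) j)) \<le> 2 * CC * L2_norm f * L2_norm g" if F1: "F \<subseteq> tri \<omega> 0 1"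
  proof -
    have "inj_on (\<lambda>(k, i, j). (k - 1, j)) F"
    proof (rule inj_onI)
      fix t t' assume t: "t \<in> F" "t' \<in> F" and e: "(\<lambda>(k, i, j). (k - 1, j)) t = (\<lambda>(k, i, j). (k - 1, j)) t'"
      obtain k i j k' i' j' where tt: "t = (k, i, j)" "t' = (k', i', j')" by (metis prod_cases3)
      have "i = par \<omega> (k - 1) j" "i' = par \<omega> (k' - 1) j'" using t F1 tri_parent(1) unfolding tt by blast+
      thus "t = t'" using e by (simp add: tt)
    qed
    from le[OF this] show ?thesis by (simp add: case_prod_unfold)
  qed
  show "(\<Sum>(k, i, j)\<in>F. cmod (para \<omega> f g (k - 1) i)) \<le> 2 * CC * L2_norm f * L2_norm g" if F1: "F \<subseteq> tri \<omega> 1 0"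
  proof -
    have "inj_on (\<lambda>(k, i, j). (k - 1, i)) F"
    proof (rule inj_onI)
      fix t t' assume t: "t \<in> F" "t' \<in> F" and e: "(\<lambda>(k, i, j). (k - 1, i)) t = (\<lambda>(k, i, j). (k - 1, i)) t'"
      obtain k i j k' i' j' where tt: "t = (k, i, j)" "t' = (k', i', j')" by (metis prod_cases3)
      have "j = par \<omega> (k - 1) i" "j' = par \<omega> (k' - 1) i'" using t F1 tri_parent(2) unfolding tt by blast+
      thus "t = t'" using e by (simp add: tt)
    qed
    from le[OF this] show ?thesis by (simp add: case_prod_unfold)
  qed
qed

end

section \<open>Total coefficients and the shift of each complexity\<close>

context cz_form
begin

text \<open>The transposed form: what is proved for the cross term with the cancellation on
  \<open>g\<close> holds under the prefix \<open>S\<close> for the cross term with the cancellation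
  on \<open>f\<close>.\<close>

interpretation S: cz_form "\<lambda>f g. B g f" N \<alpha> A
  by (rule cz_form_swap[OF cz_form_axioms])

definition totc :: "'n digits \<Rightarrow> nat \<Rightarrow> nat \<Rightarrow> 'n coeffs" where
  "totc \<omega> m n k i j \<eta> \<theta> = crs \<omega> m n k i j \<eta> \<theta> + S.crs \<omega> n m k j i \<theta> \<eta> + dia \<omega> m n k i j \<eta> \<theta>"

lemma totc_bound:
  assumes "\<eta> \<in> bits" "\<theta> \<in> bits"
  shows "cmod (totc \<omega> m n k i j \<eta> \<theta>) \<le> 3 * KK * lam ^ max m n"
  unfolding totc_def
  by (rule order_trans[OF norm_triangle_ineq], rule order_trans[OF add_right_mono[OF norm_triangle_ineq]])
     (use crs_bound[OF assms(2), of \<omega> m n k i j \<eta>] S.crs_bound[OF assms(1), of \<omega> n m k j i \<theta>] dia_bound[OF assms, of \<omega> m n k i j] in \<open>simp add: max.commute\<close>)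

definition pt :: "'n digits \<Rightarrow> nat \<Rightarrow> nat \<Rightarrow> 'n fn \<Rightarrow> 'n fn \<Rightarrow> int \<Rightarrow> int^'n \<Rightarrow> int^'n \<Rightarrow> complex" where
  "pt \<omega> m n f g k i j = (if (m, n) = (0, 1) then para \<omega> f g (k - 1) j
     else if (m, n) = (1, 0) then S.para \<omega> g f (k - 1) i else 0)"

text \<open>The paraproducts occur only for \<open>max m n = 1\<close>, where
  \<open>lam ^ max m n / lam\<close> is 1; written in this way, the bound is geometric in all
  complexities alike.\<close>

lemma pt_abs_bound:
  assumes v: "valid \<omega>" and f: "square_integrable f" and g: "square_integrable g" and F: "finite F" "F \<subseteq> tri \<omega> m n"
  shows "(\<Sum>(k, i, j)\<in>F. cmod (pt \<omega> m n f g k i j)) \<le> 2 * CC / lam * lam ^ max m n * L2_norm f * L2_norm g"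
proof -
  consider "(m, n) = (0, 1)" | "(m, n) = (1, 0)" | "(m, n) \<noteq> (0, 1)" "(m, n) \<noteq> (1, 0)" by blast
  thus ?thesis
  proof cases
    case 1
    thus ?thesis using para_tri_bound(1)[OF v f g F(1)] F(2) lam by (simp add: pt_def)
  next
    case 2
    thus ?thesis using S.para_tri_bound(2)[OF v g f F(1)] F(2) lam by (simp add: pt_def mult_ac)
  next
    case 3
    have "(\<Sum>(k, i, j)\<in>F. cmod (pt \<omega> m n f g k i j)) = 0" using 3 by (intro sum.neutral) (auto simp: pt_def)
    thus ?thesis using CC lam by (simp add: L2_norm_nonneg)
  qed
qed

text \<open>
  \<open>1 / sc\<close> is the constant of the theorem; \<open>sc\<close> makes all coefficients small enough for the
  normalization of elementary shifts.
\<close>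

definition sc :: real where "sc = 1 / (1 + 3 * 2 ^ CARD('n) * KK + 2 powr (\<alpha> / 2) * KK)"

lemma sc: "sc > 0" "3 * KK * sc \<le> 1 / 2 ^ CARD('n)" "sc * 2 powr (\<alpha> / 2) * KK \<le> 1"
proof -
  define d where "d = 1 + 3 * 2 ^ CARD('n) * KK + 2 powr (\<alpha> / 2) * KK"
  have t: "2 powr (\<alpha> / 2) * KK \<ge> 0" "3 * 2 ^ CARD('n) * KK \<ge> 0" using KK_ge(3) by auto
  hence d: "d \<ge> 1" unfolding d_def by linarith
  have s: "sc = 1 / d" by (simp add: sc_def d_def)
  show "sc > 0" using d by (simp add: s)
  have "3 * 2 ^ CARD('n) * KK \<le> d" using t unfolding d_def by linarith
  thus "3 * KK * sc \<le> 1 / 2 ^ CARD('n)" using d by (simp add: s field_simps)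
  have "2 powr (\<alpha> / 2) * KK \<le> d" using t unfolding d_def by linarith
  thus "sc * 2 powr (\<alpha> / 2) * KK \<le> 1" using d by (simp add: s)
qed

text \<open>The maximum is at least the mean of \<open>m\<close> and \<open>n\<close>. This is the
  origin of the exponent \<alpha>/2.\<close>

lemma lam_max_powr: "lam ^ max m n * 2 powr (real (m + n) * \<alpha> / 2) \<le> 1"
proof -
  have l: "lam ^ max m n = 2 powr (- \<alpha> * real (max m n))" by (simp add: lam_def powr_realpow[symmetric] powr_powr del: of_nat_max)
  have "lam ^ max m n * 2 powr (real (m + n) * \<alpha> / 2) = 2 powr (- \<alpha> * real (max m n) + real (m + n) * \<alpha> / 2)"
    unfolding l powr_add ..
  also have "\<dots> \<le> 2 powr 0"
  proof (intro powr_mono)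
    have "real (m + n) / 2 \<le> real (max m n)" by simp
    hence "real (m + n) / 2 * \<alpha> \<le> real (max m n) * \<alpha>" using \<alpha> by (intro mult_right_mono) auto
    thus "- \<alpha> * real (max m n) + real (m + n) * \<alpha> / 2 \<le> 0" by (simp add: mult.commute)
  qed simp
  finally show ?thesis by simp
qed

definition ttm :: "'n digits \<Rightarrow> nat \<Rightarrow> nat \<Rightarrow> 'n fn \<Rightarrow> 'n fn \<Rightarrow> int \<Rightarrow> int^'n \<Rightarrow> int^'n \<Rightarrow> complex" where
  "ttm \<omega> m n f g k i j = frm \<omega> m n (totc \<omega> m n) f g k i j + pt \<omega> m n f g k i j"

text \<open>The reciprocal of the weight in the series of the statement, times \<open>sc\<close>:
  the shifts are scaled up by it as far as their normalization permits, and the series scales them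
  back.\<close>

definition ww :: "nat \<Rightarrow> nat \<Rightarrow> real" where
  "ww m n = sc * 2 powr (real (m + n) * \<alpha> / 2)"

lemma ww_pos: "ww m n > 0" using sc(1) by (simp add: ww_def)

lemma scaled_coefficient_bound:
  assumes "\<eta> \<in> bits" "\<theta> \<in> bits"
  shows "cmod (ww m n * totc \<omega> m n k i j \<eta> \<theta>) \<le> 1 / 2 ^ CARD('n)"
proof -
  have "cmod (ww m n * totc \<omega> m n k i j \<eta> \<theta>) \<le> ww m n * (3 * KK * lam ^ max m n)"
    unfolding norm_mult norm_of_real abs_of_pos[OF ww_pos]
    using ww_pos[of m n] by (intro mult_left_mono totc_bound assms) auto
  also have "\<dots> = (3 * KK * sc) * (lam ^ max m n * 2 powr (real (m + n) * \<alpha> / 2))" by (simp add: ww_def)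
  also have "\<dots> \<le> (3 * KK * sc) * 1" using KK_ge(3) sc(1) by (intro mult_left_mono lam_max_powr) auto
  finally show ?thesis using sc(2) by linarith
qed

text \<open>The pair \<open>u0\<close>, \<open>v0\<close> carries the paraproducts. For (0,1) the
  generalized Haar function is the first one, for (1,0) the second; for all other complexities both
  are zero and the shift is regular.\<close>

lemma shift_of_lattice:
  assumes v: "valid \<omega>"
  shows "\<exists>S. dyadic_shift ((m, n) \<in> {(0, 1), (1, 0)}) (shifted_lattice \<omega>) m n S \<and>
    (\<forall>f g. square_integrable f \<longrightarrow> square_integrable g \<longrightarrow>
       ((\<lambda>(k, i, j). ww m n * ttm \<omega> m n f g k i j) has_sum pairing (S f) g) (tri \<omega> m n))"
proof -
  define a where "a k i j \<eta> \<theta> = ww m n * totc \<omega> m n k i j \<eta> \<theta>" for k i j \<eta> \<theta>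
  define u0 where "u0 k i j = (if (m, n) = (0, 1) then ind (cub \<omega> (k - 1) j)
     else if (m, n) = (1, 0) then S.pw \<omega> (ww m n) k i else (\<lambda>x. 0))" for k and i j :: "int^'n"
  define v0 where "v0 k i j = (if (m, n) = (0, 1) then pw \<omega> (ww m n) k j
     else if (m, n) = (1, 0) then ind (cub \<omega> (k - 1) i) else (\<lambda>x. 0))" for k and i j :: "int^'n"
  let ?gen = "(m, n) \<in> {(0, 1), (1, 0)}"
  have z: "ww m n \<ge> 0" "(m, n) = (0, 1) \<or> (m, n) = (1, 0) \<Longrightarrow> ww m n * KK \<le> 1"
    using ww_pos[of m n] sc(3) by (auto simp: ww_def)
  have pr: "pairing f (u0 k i j) * pairing (v0 k i j) g / vl TYPE('n) k = ww m n * pt \<omega> m n f g k i j"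
    if f: "square_integrable f" and g: "square_integrable g" for f g k i j
  proof -
    consider "(m, n) = (0, 1)" | "(m, n) = (1, 0)" | "(m, n) \<noteq> (0, 1)" "(m, n) \<noteq> (1, 0)" by blast
    thus ?thesis
    proof cases
      case 1
      thus ?thesis using pw_haar(4)[OF v z(1) z(2)[OF disjI1[OF 1]] g, of f k j] by (simp add: u0_def v0_def pt_def)
    next
      case 2
      thus ?thesis using S.pw_haar(4)[OF v z(1) z(2)[OF disjI2[OF 2]] f, of g k i]
        by (simp add: u0_def v0_def pt_def pairing_commute[of f] pairing_commute[of _ g] mult.commute)
    qed (auto simp: u0_def v0_def pt_def pairing_def)
  qed
  have "\<exists>S. dyadic_shift ?gen (shifted_lattice \<omega>) m n S \<and>
    (\<forall>f g. square_integrable f \<longrightarrow> square_integrable g \<longrightarrow>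
       ((\<lambda>(k, i, j). frm \<omega> m n a f g k i j + pairing f (u0 k i j) * pairing (v0 k i j) g / vl TYPE('n) k)
         has_sum pairing (S f) g) (tri \<omega> m n))"
  proof (rule dyadic_shift_exists[OF v, where K = "ww m n * (2 * CC / lam * lam ^ max m n)"])
    show "cmod (a k i j \<eta> \<theta>) \<le> 1 / 2 ^ CARD('n)" if "(k, i, j) \<in> tri \<omega> m n" "\<eta> \<in> bits" "\<theta> \<in> bits" for k i j \<eta> \<theta>
      unfolding a_def by (rule scaled_coefficient_bound[OF that(2,3)])
    show "square_integrable (u0 k i j)" "square_integrable (v0 k i j)" for k i j
    proof -
      have z0: "square_integrable ((\<lambda>x. 0) :: 'n fn)" using square_integrable_scale[OF sq_ind_cub, of 0 \<omega> 0 i] by simp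
      show "square_integrable (u0 k i j)" "square_integrable (v0 k i j)"
        using z0 pw_haar(3)[OF v z(1) z(2)] S.pw_haar(3)[OF v z(1) z(2)] by (auto simp: u0_def v0_def)
    qed
    show "hr ?gen (shifted_lattice \<omega>) (cub \<omega> (k - int m) i) (u0 k i j) \<and>
        hr ?gen (shifted_lattice \<omega>) (cub \<omega> (k - int n) j) (v0 k i j) \<and> sup_norm (u0 k i j) * sup_norm (v0 k i j) \<le> 1"
      if t: "(k, i, j) \<in> tri \<omega> m n" for k i j
    proof -
      consider "(m, n) = (0, 1)" | "(m, n) = (1, 0)" | "(m, n) \<noteq> (0, 1)" "(m, n) \<noteq> (1, 0)" by blast
      thus ?thesis
      proof cases
        case 1
        note P = pw_haar(1,2)[OF v z(1) z(2)[OF disjI1[OF 1]], of k j]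
        have i: "i = par \<omega> (k - 1) j" using t 1 by (simp add: tri_parent(1)[symmetric])
        show ?thesis using P(1,2) 1 gen_haar_ind[OF v, of "k - 1" j]
          by (auto simp: u0_def v0_def i hr_def haar_def)
      next
        case 2
        note P = S.pw_haar(1,2)[OF v z(1) z(2)[OF disjI2[OF 2]], of k i]
        have j: "j = par \<omega> (k - 1) i" using t 2 by (simp add: tri_parent(2)[symmetric])
        show ?thesis using P(1,2) 2 gen_haar_ind[OF v, of "k - 1" i]
          by (auto simp: u0_def v0_def j hr_def haar_def mult.commute)
      next
        case 3
        have "sup_norm ((\<lambda>x. 0) :: 'n fn) \<le> 0" "sup_norm ((\<lambda>x. 0) :: 'n fn) \<ge> 0" using sup_norm_le[of "(\<lambda>x. 0) :: 'n fn" 0] by auto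
        thus ?thesis using 3 by (auto simp: u0_def v0_def hr_zero)
      qed
    qed
    show "(\<Sum>(k, i, j)\<in>F. cmod (pairing f (u0 k i j)) * cmod (pairing (v0 k i j) g) / vl TYPE('n) k) \<le> ww m n * (2 * CC / lam * lam ^ max m n) * L2_norm f * L2_norm g"
      if f: "square_integrable f" and g: "square_integrable g" and F: "finite F" "F \<subseteq> tri \<omega> m n" for f g F
    proof -
      have "cmod (pairing f (u0 k i j)) * cmod (pairing (v0 k i j) g) / vl TYPE('n) k = ww m n * cmod (pt \<omega> m n f g k i j)" for k i j
        using arg_cong[OF pr[OF f g, of k i j], of cmod] ww_pos[of m n] by (simp add: norm_mult norm_divide)
      hence "(\<Sum>(k, i, j)\<in>F. cmod (pairing f (u0 k i j)) * cmod (pairing (v0 k i j) g) / vl TYPE('n) k) = ww m n * (\<Sum>(k, i, j)\<in>F. cmod (pt \<omega> m n f g k i j))"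
        by (simp add: sum_distrib_left case_prod_unfold)
      also have "\<dots> \<le> ww m n * (2 * CC / lam * lam ^ max m n * L2_norm f * L2_norm g)"
        using ww_pos[of m n] by (intro mult_left_mono pt_abs_bound[OF v f g F]) auto
      finally show ?thesis by (simp only: mult.assoc)
    qed
  qed
  then obtain S where S: "dyadic_shift ?gen (shifted_lattice \<omega>) m n S"
     "\<And>f g. square_integrable f \<Longrightarrow> square_integrable g \<Longrightarrow>
       ((\<lambda>(k, i, j). frm \<omega> m n a f g k i j + pairing f (u0 k i j) * pairing (v0 k i j) g / vl TYPE('n) k)
         has_sum pairing (S f) g) (tri \<omega> m n)" by blast
  have "((\<lambda>(k, i, j). ww m n * ttm \<omega> m n f g k i j) has_sum pairing (S f) g) (tri \<omega> m n)"
    if f: "square_integrable f" and g: "square_integrable g" for f g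
  proof -
    have "frm \<omega> m n a f g k i j + pairing f (u0 k i j) * pairing (v0 k i j) g / vl TYPE('n) k = ww m n * ttm \<omega> m n f g k i j" for k i j
      unfolding pr[OF f g] ttm_def distrib_left frm_scale[symmetric] a_def ..
    thus ?thesis using S(2)[OF f g] by simp
  qed
  thus ?thesis using S(1) by blast
qed

definition HH :: real where "HH = 4 ^ CARD('n) * (3 * KK) + 2 * CC / lam"

lemma ttm_abs_bound:
  assumes v: "valid \<omega>" and f: "square_integrable f" and g: "square_integrable g" and F: "finite F" "F \<subseteq> tri \<omega> m n"
  shows "(\<Sum>(k, i, j)\<in>F. cmod (ttm \<omega> m n f g k i j)) \<le> HH * lam ^ max m n * L2_norm f * L2_norm g"
proof -
  have "(\<Sum>(k, i, j)\<in>F. cmod (ttm \<omega> m n f g k i j)) \<le> (\<Sum>(k, i, j)\<in>F. cmod (frm \<omega> m n (totc \<omega> m n) f g k i j)) + (\<Sum>(k, i, j)\<in>F. cmod (pt \<omega> m n f g k i j))"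
    unfolding sum.distrib[symmetric] ttm_def by (intro sum_mono) (auto intro: norm_triangle_ineq)
  also have "\<dots> \<le> (4 ^ CARD('n) * (3 * KK * lam ^ max m n)) * L2_norm f * L2_norm g + 2 * CC / lam * lam ^ max m n * L2_norm f * L2_norm g"
    using KK_ge(3) lam
    by (intro add_mono frm_abs_bound[OF totc_bound _ v f g F] pt_abs_bound[OF v f g F]) auto
  also have "\<dots> = HH * lam ^ max m n * L2_norm f * L2_norm g" by (simp add: HH_def algebra_simps)
  finally show ?thesis .
qed

end

subsection \<open>Summation over scales and complexities\<close>

text \<open>Fubini for an array indexed by scale \<open>l\<close> and complexity \<open>p\<close>:
  the summable majorant \<open>M\<close> makes it absolutely summable, so both orders agree. The
  third claim is the uniform bound that \<open>expect_infsum\<close> asks for.\<close>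

lemma double_has_sum:
  fixes \<Psi> :: "'i \<Rightarrow> 'p \<Rightarrow> complex" and M :: "'p \<Rightarrow> real"
  assumes bd: "\<And>p F. finite F \<Longrightarrow> (\<Sum>l\<in>F. cmod (\<Psi> l p)) \<le> M p" and M: "M summable_on UNIV"
    and X: "\<And>l. (\<Psi> l has_sum X l) UNIV" and Y: "\<And>p. ((\<lambda>l. \<Psi> l p) has_sum Y p) UNIV"
  shows "Y summable_on UNIV" "(X has_sum infsum Y UNIV) UNIV"
    "finite F \<Longrightarrow> (\<Sum>l\<in>F. cmod (X l)) \<le> infsum M UNIV"
proof -
  have M0: "0 \<le> M p" for p using bd[of "{}" p] by simp
  have fin: "(\<Sum>(p, l)\<in>G. cmod (\<Psi> l p)) \<le> infsum M UNIV" if G: "finite G" for G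
  proof -
    have "(\<Sum>(p, l)\<in>G. cmod (\<Psi> l p)) \<le> (\<Sum>(p, l)\<in>fst ` G \<times> snd ` G. cmod (\<Psi> l p))"
      using G by (intro sum_mono2) force+
    also have "\<dots> = (\<Sum>p\<in>fst ` G. \<Sum>l\<in>snd ` G. cmod (\<Psi> l p))" by (simp add: sum.cartesian_product)
    also have "\<dots> \<le> (\<Sum>p\<in>fst ` G. M p)" using G by (intro sum_mono bd) auto
    also have "\<dots> \<le> infsum M UNIV" using G M M0 by (intro finite_sum_le_infsum) auto
    finally show ?thesis .
  qed
  have "(\<lambda>x. norm ((\<lambda>(p, l). \<Psi> l p) x)) summable_on (UNIV \<times> UNIV)"
  proof (rule nonneg_bdd_above_summable_on)
    show "bdd_above (sum (\<lambda>x. norm ((\<lambda>(p, l). \<Psi> l p) x)) ` {F. F \<subseteq> UNIV \<times> UNIV \<and> finite F})"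
      using fin by (intro bdd_aboveI[where M = "infsum M UNIV"]) (auto simp: case_prod_unfold)
  qed simp
  then obtain s where s: "((\<lambda>(p, l). \<Psi> l p) has_sum s) (UNIV \<times> UNIV)"
    using abs_summable_summable unfolding summable_on_def by blast
  have Ys: "(Y has_sum s) UNIV"
    by (rule has_sum_SigmaD[OF s]) (use Y in simp)
  have "((\<lambda>(l, p). \<Psi> l p) has_sum s) (UNIV \<times> UNIV)"
    using s has_sum_swap[where f = "\<lambda>(p, l). \<Psi> l p" and S = s and A = UNIV and B = UNIV] by (simp add: case_prod_unfold)
  hence Xs: "(X has_sum s) UNIV"
    by (rule has_sum_SigmaD) (use X in simp)
  show "Y summable_on UNIV" using Ys by (auto simp: summable_on_def)
  show "(X has_sum infsum Y UNIV) UNIV" using Xs infsumI[OF Ys] by simp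
  assume F: "finite F"
  have abs: "(\<lambda>p. cmod (\<Psi> l p)) summable_on UNIV" for l
    by (rule summable_on_comparison_test[OF M]) (use bd[of "{l}"] in auto)
  have Xl: "cmod (X l) \<le> (\<Sum>\<^sub>\<infinity>p. cmod (\<Psi> l p))" for l
    by (rule norm_infsum_le[OF X has_sum_infsum[OF abs]]) simp
  have "((\<lambda>p. \<Sum>l\<in>F. cmod (\<Psi> l p)) has_sum (\<Sum>l\<in>F. \<Sum>\<^sub>\<infinity>p. cmod (\<Psi> l p))) UNIV"
    using F by (induction F rule: finite_induct) (auto intro!: has_sum_add has_sum_infsum abs)
  hence "(\<Sum>l\<in>F. \<Sum>\<^sub>\<infinity>p. cmod (\<Psi> l p)) \<le> infsum M UNIV"
    by (rule has_sum_mono[OF _ has_sum_infsum[OF M]]) (use bd[OF F] in simp)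
  moreover have "(\<Sum>l\<in>F. cmod (X l)) \<le> (\<Sum>l\<in>F. \<Sum>\<^sub>\<infinity>p. cmod (\<Psi> l p))" by (intro sum_mono Xl)
  ultimately show "(\<Sum>l\<in>F. cmod (X l)) \<le> infsum M UNIV" by linarith
qed

text \<open>The triples with top generation \<open>k\<close>, cut down to the finitely many indices
  near the support.\<close>

definition fsm :: "real \<Rightarrow> ('n::finite) digits \<Rightarrow> nat \<Rightarrow> nat \<Rightarrow> (int \<Rightarrow> int^'n \<Rightarrow> int^'n \<Rightarrow> complex) \<Rightarrow> int \<Rightarrow> complex" where
  "fsm \<rho> \<omega> m n t k = (\<Sum>i\<in>ix \<rho> (k - int m). \<Sum>j\<in>ix \<rho> (k - int n). if (k, i, j) \<in> tri \<omega> m n then t k i j else 0)"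

lemma fsm_add: "fsm \<rho> \<omega> m n (\<lambda>k i j. s k i j + t k i j) k = fsm \<rho> \<omega> m n s k + fsm \<rho> \<omega> m n t k"
  unfolding fsm_def sum.distrib[symmetric] by (intro sum.cong refl) simp

lemma fsm_transpose: "fsm \<rho> \<omega> m n (\<lambda>k i j. t k j i) k = fsm \<rho> \<omega> n m t k"
  unfolding fsm_def by (subst sum.swap) (intro sum.cong refl if_cong, auto simp: tri_swap)

lemma fsm_eq_sum:
  "fsm \<rho> \<omega> m n t k = (\<Sum>(i, j)\<in>(ix \<rho> (k - int m) \<times> ix \<rho> (k - int n)) \<inter> {(i, j). (k, i, j) \<in> tri \<omega> m n}. t k i j)"
  unfolding fsm_def sum.cartesian_product
  by (subst sum.inter_restrict) (auto intro!: sum.cong)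

lemma fsm_abs_bound:
  fixes \<omega> :: "('n::finite) digits"
  assumes bd: "\<And>F. finite F \<Longrightarrow> F \<subseteq> tri \<omega> m n \<Longrightarrow> (\<Sum>(k, i, j)\<in>F. cmod (t k i j)) \<le> M" and K: "finite K"
  shows "(\<Sum>k\<in>K. cmod (fsm \<rho> \<omega> m n t k)) \<le> M"
proof -
  define P where "P k = (ix \<rho> (k - int m) \<times> ix \<rho> (k - int n)) \<inter> {(i, j). (k, i, j) \<in> tri \<omega> m n}" for k
  have fP: "finite (P k)" for k unfolding P_def by (intro finite_Int disjI1) simp
  have "(\<Sum>k\<in>K. cmod (fsm \<rho> \<omega> m n t k)) \<le> (\<Sum>k\<in>K. \<Sum>p\<in>P k. cmod (t k (fst p) (snd p)))"
    unfolding fsm_eq_sum P_def[symmetric] by (intro sum_mono order_trans[OF norm_sum]) (simp add: case_prod_unfold)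
  also have "\<dots> = (\<Sum>x\<in>Sigma K P. cmod (t (fst x) (fst (snd x)) (snd (snd x))))"
    using K fP by (simp add: sum.Sigma case_prod_unfold)
  also have "\<dots> = (\<Sum>(k, i, j)\<in>Sigma K P. cmod (t k i j))" by (simp add: case_prod_unfold)
  also have "\<dots> \<le> M"
  proof (rule bd)
    show "finite (Sigma K P)" using K fP by blast
    show "Sigma K P \<subseteq> tri \<omega> m n" by (auto simp: P_def)
  qed
  finally show ?thesis .
qed

lemma fsm_has_sum:
  fixes \<omega> :: "('n::finite) digits"
  assumes s: "((\<lambda>(k, i, j). t k i j) has_sum s) (tri \<omega> m n)"
    and out: "\<And>k i j. (k, i, j) \<in> tri \<omega> m n \<Longrightarrow> i \<notin> ix \<rho> (k - int m) \<or> j \<notin> ix \<rho> (k - int n) \<Longrightarrow> t k i j = 0"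
  shows "(fsm \<rho> \<omega> m n t has_sum s) UNIV"
proof -
  have e: "tri \<omega> m n = Sigma UNIV (\<lambda>k. {(i, j). (k, i, j) \<in> tri \<omega> m n})" by auto
  have "((\<lambda>(k, i, j). t k i j) has_sum s) (Sigma UNIV (\<lambda>k. {(i, j). (k, i, j) \<in> tri \<omega> m n}))"
    using s e by simp
  thus ?thesis
  proof (rule has_sum_SigmaD)
    fix k :: int
    show "((\<lambda>y. (\<lambda>(k, i, j). t k i j) (k, y)) has_sum fsm \<rho> \<omega> m n t k) {(i, j). (k, i, j) \<in> tri \<omega> m n}"
      by (rule has_sum_finite_neutralI[where B = "(ix \<rho> (k - int m) \<times> ix \<rho> (k - int n)) \<inter> {(i, j). (k, i, j) \<in> tri \<omega> m n}"])
         (auto simp: fsm_eq_sum case_prod_unfold intro!: out)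
  qed
qed

text \<open>The cube lies in its parent, and the parent misses the support. This is needed because
  \<open>ix\<close> of one generation says nothing about the parents of its indices.\<close>

lemma fsupp_parent_out:
  assumes v: "valid \<omega>" and f: "fsupp \<rho> f" and j: "par \<omega> l j \<notin> ix \<rho> (l + 1)"
  shows "av \<omega> f l j = 0"
proof -
  have "pairing f (ind (cub \<omega> l j)) = 0"
  proof (rule pairing_out[where Q = "cub \<omega> l j"])
    fix x assume "x \<in> cub \<omega> l j"
    hence "x \<in> cub \<omega> (l + 1) (par \<omega> l j)" using pidx_par[OF v, of l x] by (simp add: mem_cub_iff)
    thus "f x = 0" by (rule ix_out[OF v f j])
  qed (simp add: indicator_def)
  thus ?thesis by (simp add: av_def)
qed

lemma geometric_pairs_summable:
  fixes q :: real
  assumes q: "0 \<le> q" "q < 1"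
  shows "(\<lambda>(m, n). q ^ m * q ^ n) summable_on (UNIV :: (nat \<times> nat) set)"
proof (rule nonneg_bdd_above_summable_on)
  show "bdd_above (sum (\<lambda>(m, n). q ^ m * q ^ n) ` {F. F \<subseteq> (UNIV :: (nat \<times> nat) set) \<and> finite F})"
  proof (rule bdd_aboveI2[where M = "(1 / (1 - q)) * (1 / (1 - q))"])
    fix F :: "(nat \<times> nat) set" assume "F \<in> {F. F \<subseteq> UNIV \<and> finite F}"
    hence F: "finite F" by simp
    have g: "(\<Sum>m\<in>G. q ^ m) \<le> 1 / (1 - q)" if "finite G" for G :: "nat set"
      using sum_le_suminf[OF summable_geometric that, of q] q by (simp add: suminf_geometric)
    have "(\<Sum>(m, n)\<in>F. q ^ m * q ^ n) \<le> (\<Sum>(m, n)\<in>fst ` F \<times> snd ` F. q ^ m * q ^ n)"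
      using F q by (intro sum_mono2) force+
    also have "\<dots> = (\<Sum>m\<in>fst ` F. q ^ m) * (\<Sum>n\<in>snd ` F. q ^ n)"
      by (simp add: sum_product sum.cartesian_product)
    also have "\<dots> \<le> (1 / (1 - q)) * (1 / (1 - q))"
      using F q by (intro mult_mono g sum_nonneg) auto
    finally show "(\<Sum>(m, n)\<in>F. q ^ m * q ^ n) \<le> (1 / (1 - q)) * (1 / (1 - q))" .
  qed
qed (use q in auto)

context cz_form
begin

text \<open>The maximum is at least the mean, so a product of two geometric series with ratio
  \<open>sqrt lam\<close> dominates.\<close>

lemma lam_max_summable: "(\<lambda>(m, n). lam ^ max m n) summable_on (UNIV :: (nat \<times> nat) set)"
proof (rule summable_on_comparison_test)
  define q where "q = sqrt lam"
  have q: "0 \<le> q" "q < 1" "q * q = lam" using lam by (auto simp: q_def)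
  show "(\<lambda>(m, n). q ^ m * q ^ n) summable_on (UNIV :: (nat \<times> nat) set)"
    by (rule geometric_pairs_summable[OF q(1,2)])
  show "(case p of (m, n) \<Rightarrow> lam ^ max m n) \<le> (case p of (m, n) \<Rightarrow> q ^ m * q ^ n)" for p :: "nat \<times> nat"
  proof (cases p)
    case (Pair m n)
    have "lam ^ max m n = q ^ (2 * max m n)" by (simp add: q(3)[symmetric] power_mult power2_eq_square)
    also have "\<dots> \<le> q ^ (m + n)" using q by (intro power_decreasing) auto
    finally show ?thesis by (simp add: Pair power_add)
  qed
  show "0 \<le> (case p of (m, n) \<Rightarrow> lam ^ max m n)" for p :: "nat \<times> nat" using lam by (auto split: prod.split)
qed

lemma level_summable:
  assumes "\<And>m n. cmod (t m n) \<le> M * lam ^ max m n"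
  shows "(\<lambda>(m, n). t m n) summable_on (UNIV :: (nat \<times> nat) set)"
proof (rule abs_summable_summable, rule summable_on_comparison_test)
  show "(\<lambda>x. M * (\<lambda>(m, n). lam ^ max m n) x) summable_on (UNIV :: (nat \<times> nat) set)"
    by (rule summable_on_cmult_right[OF lam_max_summable])
qed (use assms in \<open>auto split: prod.split\<close>)

text \<open>Here \<open>l\<close> is the generation of the finer cube \<open>j\<close>, and the
  triples of all complexities at that level make up the cross term. Absolute summability allows them
  to be grouped by \<open>n\<close>, where \<open>cross_sums\<close> applies.\<close>

lemma crs_level_sum:
  assumes v: "valid \<omega>" and f: "square_integrable f" "fsupp \<rho> f" and g: "square_integrable g" "fsupp \<rho> g"
  shows "((\<lambda>(m, n). fsm \<rho> \<omega> m n (frm \<omega> m n (crs \<omega> m n) f g) (l + int (max m n))) has_sum Zc \<rho> \<omega> f g l) UNIV"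
proof -
  define t where "t m n = fsm \<rho> \<omega> m n (frm \<omega> m n (crs \<omega> m n) f g) (l + int (max m n))" for m n
  have "cmod (t m n) \<le> (4 ^ CARD('n) * KK * L2_norm f * L2_norm g) * lam ^ max m n" for m n
  proof -
    have "(\<Sum>k\<in>{l + int (max m n)}. cmod (fsm \<rho> \<omega> m n (frm \<omega> m n (crs \<omega> m n) f g) k)) \<le> (4 ^ CARD('n) * (KK * lam ^ max m n)) * L2_norm f * L2_norm g"
      using KK_ge(3) lam
      by (intro fsm_abs_bound frm_abs_bound[OF crs_bound _ v f(1) g(1)]) auto
    thus ?thesis by (simp add: t_def mult_ac)
  qed
  hence "(\<lambda>(m, n). t m n) summable_on (UNIV \<times> UNIV)" unfolding UNIV_Times_UNIV by (rule level_summable)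
  then obtain s where s: "((\<lambda>(m, n). t m n) has_sum s) (UNIV \<times> UNIV)" unfolding summable_on_def by blast
  have "((\<lambda>(n, m). t m n) has_sum s) (UNIV \<times> UNIV)"
    using s has_sum_swap[where f = "\<lambda>(m, n). t m n" and S = s and A = UNIV and B = UNIV] by (simp add: case_prod_unfold)
  hence "((\<lambda>n. \<Sum>m<n. t m n) has_sum s) UNIV"
  proof (rule has_sum_SigmaD)
    fix n :: nat
    have "t m n = 0" if "\<not> m < n" for m using that by (simp add: t_def fsm_def frm_def crs_def cong: if_cong)
    thus "((\<lambda>m. (\<lambda>(n, m). t m n) (n, m)) has_sum (\<Sum>m<n. t m n)) UNIV"
      by (intro has_sum_finite_neutralI[where B = "{..<n}"]) auto
  qed
  hence s1: "(\<lambda>n. \<Sum>m<n. t m n) sums s" by (rule has_sum_imp_sums)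
  have tm: "t m n = (\<Sum>j\<in>ix \<rho> l. \<Sum>i | anc \<omega> (l + int n - int m) m i = anc \<omega> l n j. frm \<omega> m n (crs \<omega> m n) f g (l + int n) i j)"
    if mn: "m < n" for m n
  proof -
    have k: "l + int (max m n) = l + int n" "l + int n - int n = l" using mn by auto
    have "t m n = (\<Sum>j\<in>ix \<rho> l. \<Sum>i\<in>ix \<rho> (l + int n - int m). if anc \<omega> (l + int n - int m) m i = anc \<omega> l n j then frm \<omega> m n (crs \<omega> m n) f g (l + int n) i j else 0)"
      unfolding t_def fsm_def k tri_def by (subst sum.swap) (simp add: k)
    also have "\<dots> = (\<Sum>j\<in>ix \<rho> l. \<Sum>i | anc \<omega> (l + int n - int m) m i = anc \<omega> l n j. frm \<omega> m n (crs \<omega> m n) f g (l + int n) i j)"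
    proof (rule sum.cong[OF refl])
      fix j
      have fin: "finite {i. anc \<omega> (l + int n - int m) m i = anc \<omega> l n j}" using desc_finite_card by blast
      have "(\<Sum>i\<in>ix \<rho> (l + int n - int m). if anc \<omega> (l + int n - int m) m i = anc \<omega> l n j then frm \<omega> m n (crs \<omega> m n) f g (l + int n) i j else 0)
         = (\<Sum>i\<in>ix \<rho> (l + int n - int m) \<inter> {i. anc \<omega> (l + int n - int m) m i = anc \<omega> l n j}. frm \<omega> m n (crs \<omega> m n) f g (l + int n) i j)"
        by (subst sum.inter_restrict) auto
      also have "\<dots> = (\<Sum>i | anc \<omega> (l + int n - int m) m i = anc \<omega> l n j. frm \<omega> m n (crs \<omega> m n) f g (l + int n) i j)"
        by (rule sum.mono_neutral_left[OF fin]) (auto intro!: frm_out[OF v f(2) g(2)])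
      finally show "(\<Sum>i\<in>ix \<rho> (l + int n - int m). if anc \<omega> (l + int n - int m) m i = anc \<omega> l n j then frm \<omega> m n (crs \<omega> m n) f g (l + int n) i j else 0)
         = (\<Sum>i | anc \<omega> (l + int n - int m) m i = anc \<omega> l n j. frm \<omega> m n (crs \<omega> m n) f g (l + int n) i j)" .
    qed
    finally show ?thesis .
  qed
  have "(\<lambda>n. \<Sum>j\<in>ix \<rho> l. \<Sum>m<n. \<Sum>i | anc \<omega> (l + int n - int m) m i = anc \<omega> l n j. frm \<omega> m n (crs \<omega> m n) f g (l + int n) i j) sums Zc \<rho> \<omega> f g l"
    unfolding Zc_def by (intro sums_sum cross_sums v f(1))
  moreover have "(\<Sum>j\<in>ix \<rho> l. \<Sum>m<n. \<Sum>i | anc \<omega> (l + int n - int m) m i = anc \<omega> l n j. frm \<omega> m n (crs \<omega> m n) f g (l + int n) i j) = (\<Sum>m<n. t m n)" for n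
    by (subst sum.swap) (simp add: tm)
  ultimately have "s = Zc \<rho> \<omega> f g l" using s1 sums_unique2 by simp
  thus ?thesis using s by (simp add: t_def)
qed

text \<open>Compact support leaves finitely many heights and hence finitely many complexities; the
  common ancestor required by \<open>tri\<close> exists wherever the weight is not zero.\<close>

lemma dia_level_sum:
  assumes v: "valid \<omega>"
  shows "((\<lambda>(m, n). fsm \<rho> \<omega> m n (frm \<omega> m n (dia \<omega> m n) f g) (l + int (max m n))) has_sum Zd \<rho> \<omega> f g l) UNIV"
proof -
  define I where "I = (ix \<rho> l :: (int^'n) set)"
  define M0 where "M0 = (\<lambda>p. hgt (fst p - snd p)) ` (I \<times> I)"
  have fM: "finite M0" by (simp add: M0_def I_def)
  define t where "t = (\<lambda>(m, n). fsm \<rho> \<omega> m n (frm \<omega> m n (dia \<omega> m n) f g) (l + int (max m n)))"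
  define w where "w i j = wt \<omega> l i j * dd \<omega> f g l i j" for i j
  have fd: "frm \<omega> m m (dia \<omega> m m) f g (l + int m) i j = (if hgt (i - j) = m then w i j else 0)" for m i j
  proof (cases "hgt (i - j) = m")
    case True
    have "dia \<omega> m m (l + int m) i j \<eta> \<theta> * pairing f (phc \<omega> l i \<eta>) * pairing g (phc \<omega> l j \<theta>) / vl TYPE('n) (l + int m)
       = wt \<omega> l i j * (pairing f (phc \<omega> l i \<eta>) / vl TYPE('n) (l - 1) *
      (pairing g (phc \<omega> l j \<theta>) / vl TYPE('n) (l - 1)) * B (phc \<omega> l i \<eta>) (phc \<omega> l j \<theta>))" for \<eta> \<theta>
      using True by (simp add: dia_def)
    thus ?thesis using True by (simp add: frm_def w_def dd_def sum_divide_distrib sum_distrib_left)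
  qed (simp add: frm_def dia_def)
  have tmm: "t (m, m) = (\<Sum>i\<in>I. \<Sum>j\<in>I. if hgt (i - j) = m then w i j else 0)" for m
  proof -
    have "t (m, m) = (\<Sum>i\<in>I. \<Sum>j\<in>I. if (l + int m, i, j) \<in> tri \<omega> m m then (if hgt (i - j) = m then w i j else 0) else 0)"
      by (simp add: t_def fsm_def fd I_def cong: if_cong)
    also have "\<dots> = (\<Sum>i\<in>I. \<Sum>j\<in>I. if hgt (i - j) = m then w i j else 0)"
      by (intro sum.cong refl) (use wt_merge[of \<omega> l] in \<open>auto simp: tri_def w_def\<close>)
    finally show ?thesis .
  qed
  have "(t has_sum (\<Sum>p\<in>(\<lambda>m. (m, m)) ` M0. t p)) UNIV"
  proof (rule has_sum_finite_neutralI[where B = "(\<lambda>m. (m, m)) ` M0"])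
    fix p assume p: "p \<in> UNIV - (\<lambda>m. (m, m)) ` M0"
    obtain m n where mn: "p = (m, n)" by (cases p)
    show "t p = 0"
    proof (cases "m = n")
      case True
      hence "m \<notin> M0" using p mn by auto
      hence "hgt (i - j) \<noteq> m" if "i \<in> I" "j \<in> I" for i j using that unfolding M0_def by force
      thus ?thesis unfolding mn True[symmetric] tmm by (intro sum.neutral ballI) auto
    qed (simp add: mn t_def fsm_def frm_def dia_def cong: if_cong)
  qed (use fM in auto)
  also have "(\<Sum>p\<in>(\<lambda>m. (m, m)) ` M0. t p) = (\<Sum>m\<in>M0. t (m, m))" by (subst sum.reindex) (auto simp: inj_on_def)
  also have "\<dots> = (\<Sum>i\<in>I. \<Sum>m\<in>M0. \<Sum>j\<in>I. if hgt (i - j) = m then w i j else 0)" unfolding tmm by (rule sum.swap)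
  also have "\<dots> = (\<Sum>i\<in>I. \<Sum>j\<in>I. \<Sum>m\<in>M0. if hgt (i - j) = m then w i j else 0)" by (intro sum.cong refl sum.swap)
  also have "\<dots> = (\<Sum>i\<in>I. \<Sum>j\<in>I. w i j)"
  proof (intro sum.cong refl)
    fix i j assume "i \<in> I" "j \<in> I"
    hence "hgt (i - j) \<in> M0" unfolding M0_def by force
    thus "(\<Sum>m\<in>M0. if hgt (i - j) = m then w i j else 0) = w i j" using fM by simp
  qed
  also have "\<dots> = Zd \<rho> \<omega> f g l" unfolding Zd_def w_def I_def by (rule sum.swap)
  finally show ?thesis by (simp add: t_def)
qed

text \<open>The paraproduct of one form alone; \<open>pt\<close> is its sum with the transposed one
  (\<open>ttm_split\<close>).\<close>

definition pa :: "'n digits \<Rightarrow> nat \<Rightarrow> nat \<Rightarrow> 'n fn \<Rightarrow> 'n fn \<Rightarrow> int \<Rightarrow> int^'n \<Rightarrow> int^'n \<Rightarrow> complex" where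
  "pa \<omega> m n f g k i j = (if (m, n) = (0, 1) then para \<omega> f g (k - 1) j else 0)"

lemma pa_out:
  assumes v: "valid \<omega>" and f: "fsupp \<rho> f" and g: "fsupp \<rho> g"
    and t: "(k, i, j) \<in> tri \<omega> m n" "i \<notin> ix \<rho> (k - int m) \<or> j \<notin> ix \<rho> (k - int n)"
  shows "pa \<omega> m n f g k i j = 0"
proof (cases "(m, n) = (0, 1)")
  case True
  hence i: "i = par \<omega> (k - 1) j" using t(1) tri_parent(1) by blast
  have "av \<omega> f (k - 1) j = 0"
  proof (cases "j \<in> ix \<rho> (k - 1)")
    case False
    thus ?thesis by (rule ix_pairing(2)[OF v f])
  next
    case j: True
    hence "par \<omega> (k - 1) j \<notin> ix \<rho> ((k - 1) + 1)" using t(2) True i by simp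
    thus ?thesis by (rule fsupp_parent_out[OF v f])
  qed
  thus ?thesis by (simp add: pa_def para_def)
qed (auto simp: pa_def)

lemma pa_level_sum:
  assumes v: "valid \<omega>" and f: "fsupp \<rho> f"
  shows "((\<lambda>(m, n). fsm \<rho> \<omega> m n (pa \<omega> m n f g) (l + int (max m n))) has_sum Zp \<rho> \<omega> f g l) UNIV"
proof (rule has_sum_finite_neutralI[where B = "{(0, 1)}"])
  show "(case p of (m, n) \<Rightarrow> fsm \<rho> \<omega> m n (pa \<omega> m n f g) (l + int (max m n))) = 0" if "p \<in> UNIV - {(0, 1)}" for p
    using that by (cases p) (auto simp: fsm_def pa_def cong: if_cong)
  have "fsm \<rho> \<omega> 0 1 (pa \<omega> 0 1 f g) (l + 1) = (\<Sum>j\<in>ix \<rho> l. \<Sum>i\<in>ix \<rho> (l + 1). if i = par \<omega> l j then para \<omega> f g l j else 0)"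
    unfolding fsm_def tri_parent(1) by (subst sum.swap) (simp add: pa_def cong: if_cong)
  also have "\<dots> = (\<Sum>j\<in>ix \<rho> l. para \<omega> f g l j)"
  proof (rule sum.cong[OF refl])
    fix j
    show "(\<Sum>i\<in>ix \<rho> (l + 1). if i = par \<omega> l j then para \<omega> f g l j else 0) = para \<omega> f g l j"
      using fsupp_parent_out[OF v f, of l j] by (cases "par \<omega> l j \<in> ix \<rho> (l + 1)") (auto simp: para_def)
  qed
  finally show "Zp \<rho> \<omega> f g l = (\<Sum>p\<in>{(0, 1)}. case p of (m, n) \<Rightarrow> fsm \<rho> \<omega> m n (pa \<omega> m n f g) (l + int (max m n)))"
    by (simp add: Zp_def)
qed auto

lemma has_sum_pairs_swap:
  fixes t :: "nat \<Rightarrow> nat \<Rightarrow> complex"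
  shows "((\<lambda>(m, n). t m n) has_sum s) UNIV \<Longrightarrow> ((\<lambda>(m, n). t n m) has_sum s) UNIV"
  using has_sum_swap[where f = "\<lambda>(m, n). t m n" and S = s and A = UNIV and B = UNIV] by (simp add: case_prod_unfold)

end

context cz_form
begin

interpretation S: cz_form "\<lambda>f g. B g f" N \<alpha> A
  by (rule cz_form_swap[OF cz_form_axioms])

lemma ttm_split:
  "ttm \<omega> m n f g = (\<lambda>k i j. ((frm \<omega> m n (crs \<omega> m n) f g k i j + pa \<omega> m n f g k i j) +
     (frm \<omega> n m (S.crs \<omega> n m) g f k j i + S.pa \<omega> n m g f k j i)) + frm \<omega> m n (dia \<omega> m n) f g k i j)"
proof (intro ext)
  fix k i j
  have p: "pt \<omega> m n f g k i j = pa \<omega> m n f g k i j + S.pa \<omega> n m g f k j i"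
    by (auto simp: pt_def pa_def S.pa_def)
  show "ttm \<omega> m n f g k i j = ((frm \<omega> m n (crs \<omega> m n) f g k i j + pa \<omega> m n f g k i j) +
     (frm \<omega> n m (S.crs \<omega> n m) g f k j i + S.pa \<omega> n m g f k j i)) + frm \<omega> m n (dia \<omega> m n) f g k i j"
    unfolding ttm_def totc_def frm_add p frm_transpose[of \<omega> m n "S.crs \<omega> n m"] by simp
qed

lemma ttm_out:
  assumes v: "valid \<omega>" and f: "fsupp \<rho> f" and g: "fsupp \<rho> g"
    and t: "(k, i, j) \<in> tri \<omega> m n" "i \<notin> ix \<rho> (k - int m) \<or> j \<notin> ix \<rho> (k - int n)"
  shows "ttm \<omega> m n f g k i j = 0"
  unfolding ttm_split
  using frm_out[OF v f g t(2)] pa_out[OF v f g t] frm_out[OF v g f, of j k n i m]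
    S.pa_out[OF v g f tri_swap[THEN iffD1, OF t(1)]] t(2) by auto

definition lev :: "real \<Rightarrow> 'n digits \<Rightarrow> 'n fn \<Rightarrow> 'n fn \<Rightarrow> int \<Rightarrow> complex" where
  "lev \<rho> \<omega> f g l = (Zc \<rho> \<omega> f g l + Zp \<rho> \<omega> f g l) + (S.Zc \<rho> \<omega> g f l + S.Zp \<rho> \<omega> g f l) + Zd \<rho> \<omega> f g l"

lemma ttm_level_sum:
  assumes v: "valid \<omega>" and f: "square_integrable f" "fsupp \<rho> f" and g: "square_integrable g" "fsupp \<rho> g"
  shows "((\<lambda>(m, n). fsm \<rho> \<omega> m n (ttm \<omega> m n f g) (l + int (max m n))) has_sum lev \<rho> \<omega> f g l) UNIV"
proof -
  have e1: "fsm \<rho> \<omega> m n (\<lambda>k i j. frm \<omega> n m (S.crs \<omega> n m) g f k j i) (l + int (max m n)) = fsm \<rho> \<omega> n m (frm \<omega> n m (S.crs \<omega> n m) g f) (l + int (max n m))" for m n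
    using fsm_transpose[of \<rho> \<omega> m n "frm \<omega> n m (S.crs \<omega> n m) g f"] by (simp only: max.commute)
  have e2: "fsm \<rho> \<omega> m n (\<lambda>k i j. S.pa \<omega> n m g f k j i) (l + int (max m n)) = fsm \<rho> \<omega> n m (S.pa \<omega> n m g f) (l + int (max n m))" for m n
    using fsm_transpose[of \<rho> \<omega> m n "S.pa \<omega> n m g f"] by (simp only: max.commute)
  have c1: "((\<lambda>(m, n). fsm \<rho> \<omega> m n (\<lambda>k i j. frm \<omega> n m (S.crs \<omega> n m) g f k j i) (l + int (max m n))) has_sum S.Zc \<rho> \<omega> g f l) UNIV"
    unfolding e1 by (rule has_sum_pairs_swap[OF S.crs_level_sum[OF v g f]])
  have c2: "((\<lambda>(m, n). fsm \<rho> \<omega> m n (\<lambda>k i j. S.pa \<omega> n m g f k j i) (l + int (max m n))) has_sum S.Zp \<rho> \<omega> g f l) UNIV"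
    unfolding e2 by (rule has_sum_pairs_swap[OF S.pa_level_sum[OF v g(2)]])
  show ?thesis
    using has_sum_add[OF has_sum_add[OF has_sum_add[OF crs_level_sum[OF v f g, of l] pa_level_sum[OF v f(2), of g l]] has_sum_add[OF c1 c2]] dia_level_sum[OF v, of \<rho> f g l]]
    unfolding lev_def ttm_split fsm_add case_prod_unfold .
qed

end

subsection \<open>Averaging over the lattices\<close>

text \<open>Symmetric intervals eventually contain every finite set of integers, so the unordered
  sum can be evaluated along them.\<close>

lemma has_sum_telescope:
  fixes e :: "int \<Rightarrow> complex"
  assumes s: "((\<lambda>l. e (l - 1) - e l) has_sum S) UNIV" and lim: "(\<lambda>n. e (- int n) - e (int n)) \<longlonglongrightarrow> b"
  shows "S = b"
proof -
  have "(\<Sum>l\<in>{- int n<..int n}. e (l - 1) - e l) = e (- int n) - e (int n)" for n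
  proof (induction n)
    case (Suc n)
    have "{- int (Suc n)<..int (Suc n)} = insert (- int n) (insert (int (Suc n)) {- int n<..int n})" by auto
    moreover have "- int n \<notin> insert (int (Suc n)) {- int n<..int n}" "int (Suc n) \<notin> {- int n<..int n}" by auto
    ultimately have "(\<Sum>l\<in>{- int (Suc n)<..int (Suc n)}. e (l - 1) - e l) =
       (e (- int n - 1) - e (- int n)) + ((e (int (Suc n) - 1) - e (int (Suc n))) + (\<Sum>l\<in>{- int n<..int n}. e (l - 1) - e l))"
      by (simp del: of_nat_Suc)
    moreover have "- int n - 1 = - int (Suc n)" "int (Suc n) - 1 = int n" by simp_all
    ultimately show ?case unfolding Suc by simp
  qed simp
  moreover have "filterlim (\<lambda>n. {- int n<..int n}) (finite_subsets_at_top UNIV) sequentially"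
    unfolding filterlim_finite_subsets_at_top
  proof (intro allI impI)
    fix X :: "int set" assume "finite X \<and> X \<subseteq> UNIV"
    hence X: "finite X" by simp
    define M where "M = nat (Max (insert 0 (abs ` X))) + 1"
    have "X \<subseteq> {- int n<..int n}" if "n \<ge> M" for n
    proof
      fix x assume "x \<in> X"
      hence "\<bar>x\<bar> \<le> Max (insert 0 (abs ` X))" using X by (intro Max_ge) auto
      thus "x \<in> {- int n<..int n}" using that by (auto simp: M_def)
    qed
    thus "eventually (\<lambda>n. finite {- int n<..int n} \<and> X \<subseteq> {- int n<..int n} \<and> {- int n<..int n} \<subseteq> UNIV) sequentially"
      unfolding eventually_sequentially by blast
  qed
  from filterlim_compose[OF s[unfolded has_sum_def] this]
  have "(\<lambda>n. \<Sum>l\<in>{- int n<..int n}. e (l - 1) - e l) \<longlonglongrightarrow> S" by (simp add: o_def)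
  ultimately have "(\<lambda>n. e (- int n) - e (int n)) \<longlonglongrightarrow> S" by simp
  thus ?thesis using lim LIMSEQ_unique by blast
qed

abbreviation shift_average :: "real \<Rightarrow> ('n digits \<Rightarrow> nat \<Rightarrow> nat \<Rightarrow> ('n::finite) oper) \<Rightarrow> 'n fn \<Rightarrow> 'n fn \<Rightarrow> complex" where
  "shift_average \<alpha> S f g \<equiv> LINT \<omega>|omega_measure. (\<Sum>\<^sub>\<infinity>mn. shift_series_term \<alpha> (S \<omega>) f g mn)"

abbreviation shift_series_ok :: "real \<Rightarrow> ('n digits \<Rightarrow> nat \<Rightarrow> nat \<Rightarrow> ('n::finite) oper) \<Rightarrow> 'n fn \<Rightarrow> 'n fn \<Rightarrow> bool" where
  "shift_series_ok \<alpha> S f g \<equiv> (\<forall>\<omega>\<in>space omega_measure. shift_series_term \<alpha> (S \<omega>) f g summable_on UNIV) \<and>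
     integrable omega_measure (\<lambda>\<omega>. \<Sum>\<^sub>\<infinity>mn. shift_series_term \<alpha> (S \<omega>) f g mn)"

context cz_form
begin

interpretation S: cz_form "\<lambda>f g. B g f" N \<alpha> A
  by (rule cz_form_swap[OF cz_form_axioms])

lemma integrable_form_Ef:
  assumes f: "square_integrable f" and g: "square_integrable g"
  shows "integrable omega_measure (\<lambda>\<omega>. B (Ef \<rho> \<omega> f k) (Ef \<rho> \<omega> g k))"
proof -
  note [measurable] = f g
  have e: "B (Ef \<rho> \<omega> f k) (Ef \<rho> \<omega> g k) = (\<Sum>i\<in>ix \<rho> k. \<Sum>j\<in>ix \<rho> k. av \<omega> f k i * (av \<omega> g k j * B (ind (cub \<omega> k i)) (ind (cub \<omega> k j))))" for \<omega>
  proof -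
    have "B (Ef \<rho> \<omega> f k) (Ef \<rho> \<omega> g k) = (\<Sum>i\<in>ix \<rho> k. av \<omega> f k i * B (ind (cub \<omega> k i)) (Ef \<rho> \<omega> g k))"
      unfolding Ef_def[of \<rho> \<omega> f] by (rule bform_sum[OF B sq_ind_cub Ef_sq])
    moreover have "B (ind (cub \<omega> k i)) (Ef \<rho> \<omega> g k) = (\<Sum>j\<in>ix \<rho> k. av \<omega> g k j * B (ind (cub \<omega> k i)) (ind (cub \<omega> k j)))" for i
      unfolding Ef_def by (rule bform_right(5)[OF B sq_ind_cub sq_ind_cub])
    ultimately show ?thesis by (simp add: sum_distrib_left)
  qed
  have "integrable omega_measure (\<lambda>\<omega>. av \<omega> f k i * (av \<omega> g k j * B (ind (cub \<omega> k i)) (ind (cub \<omega> k j))))" for i j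
  proof (rule bounded_integrable_omega)
    have [measurable]: "(\<lambda>\<omega>. B (ind (cub \<omega> k i)) (ind (cub \<omega> k j))) \<in> borel_measurable omega_measure"
      unfolding cub_def by (rule bform_qube_measurable[OF B]) measurable
    show "(\<lambda>\<omega>. av \<omega> f k i * (av \<omega> g k j * B (ind (cub \<omega> k i)) (ind (cub \<omega> k j)))) \<in> borel_measurable omega_measure"
      by measurable
    have a: "cmod (av \<omega> h k i) \<le> L2_norm h / sqrt (vl TYPE('n) k)" if "square_integrable h" for \<omega> i and h :: "'n fn"
      using av_bound[OF that, of \<omega> k 0 i] by simp
    have b: "cmod (B (ind (cub \<omega> k i)) (ind (cub \<omega> k j))) \<le> N * sqrt (vl TYPE('n) k) * sqrt (vl TYPE('n) k)" for \<omega>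
      using bformD(4)[OF B sq_ind_cub sq_ind_cub, of \<omega> k i \<omega> k j] by (simp add: cub_def L2_norm_qube)
    show "cmod (av \<omega> f k i * (av \<omega> g k j * B (ind (cub \<omega> k i)) (ind (cub \<omega> k j)))) \<le>
       (L2_norm f / sqrt (vl TYPE('n) k)) * ((L2_norm g / sqrt (vl TYPE('n) k)) * (N * sqrt (vl TYPE('n) k) * sqrt (vl TYPE('n) k)))" for \<omega>
      unfolding norm_mult by (intro mult_mono a b f g mult_nonneg_nonneg norm_ge_zero divide_nonneg_nonneg L2_norm_nonneg) auto
  qed
  thus ?thesis unfolding e by (intro Bochner_Integration.integrable_sum)
qed

text \<open>Expanding \<open>B\<close> on the sum of \<open>Ef\<close> and \<open>Df\<close> in both
  arguments leaves three terms besides the coarser one, and their expectations are those of the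
  three parts of \<open>lev\<close>.\<close>

lemma expect_level:
  assumes f: "square_integrable f" "fsupp \<rho> f" and g: "square_integrable g" "fsupp \<rho> g"
  shows "integrable omega_measure (\<lambda>\<omega>. lev \<rho> \<omega> f g l)"
    and "(LINT \<omega>|omega_measure. lev \<rho> \<omega> f g l)
      = (LINT \<omega>|omega_measure. B (Ef \<rho> \<omega> f (l - 1)) (Ef \<rho> \<omega> g (l - 1))) - (LINT \<omega>|omega_measure. B (Ef \<rho> \<omega> f l) (Ef \<rho> \<omega> g l))"
proof -
  note C1 = expect_cross[OF f g(1), of l] and C2 = S.expect_cross[OF g f(1), of l] and C3 = expect_diag[OF f(1) g(1), of \<rho> l]
  show "integrable omega_measure (\<lambda>\<omega>. lev \<rho> \<omega> f g l)"
    unfolding lev_def by (intro Bochner_Integration.integrable_add[OF Bochner_Integration.integrable_add] C1(1) C2(1) C3(1))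
  have "(LINT \<omega>|omega_measure. lev \<rho> \<omega> f g l)
     = (LINT \<omega>|omega_measure. Zc \<rho> \<omega> f g l + Zp \<rho> \<omega> f g l) + (LINT \<omega>|omega_measure. S.Zc \<rho> \<omega> g f l + S.Zp \<rho> \<omega> g f l) + (LINT \<omega>|omega_measure. Zd \<rho> \<omega> f g l)"
    unfolding lev_def Bochner_Integration.integral_add[OF Bochner_Integration.integrable_add[OF C1(1) C2(1)] C3(1)]
      Bochner_Integration.integral_add[OF C1(1) C2(1)] ..
  also have "\<dots> = (LINT \<omega>|omega_measure. lowc \<rho> \<omega> f g l) + (LINT \<omega>|omega_measure. S.lowc \<rho> \<omega> g f l) + (LINT \<omega>|omega_measure. B (Df \<rho> \<omega> f l) (Df \<rho> \<omega> g l))"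
    unfolding C1(3) C2(3) C3(3) ..
  also have "\<dots> = (LINT \<omega>|omega_measure. lowc \<rho> \<omega> f g l + S.lowc \<rho> \<omega> g f l + B (Df \<rho> \<omega> f l) (Df \<rho> \<omega> g l))"
    unfolding Bochner_Integration.integral_add[OF Bochner_Integration.integrable_add[OF C1(2) C2(2)] C3(2)]
      Bochner_Integration.integral_add[OF C1(2) C2(2)] ..
  also have "\<dots> = (LINT \<omega>|omega_measure. B (Ef \<rho> \<omega> f (l - 1)) (Ef \<rho> \<omega> g (l - 1)) - B (Ef \<rho> \<omega> f l) (Ef \<rho> \<omega> g l))"
  proof (rule Bochner_Integration.integral_cong[OF refl])
    fix \<omega> :: "int \<Rightarrow> real^'n" assume "\<omega> \<in> space omega_measure"
    hence v: "valid \<omega>" by (simp add: space_omega)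
    show "lowc \<rho> \<omega> f g l + S.lowc \<rho> \<omega> g f l + B (Df \<rho> \<omega> f l) (Df \<rho> \<omega> g l) = B (Ef \<rho> \<omega> f (l - 1)) (Ef \<rho> \<omega> g (l - 1)) - B (Ef \<rho> \<omega> f l) (Ef \<rho> \<omega> g l)"
      unfolding lowc_eq S.lowc_eq Df_eq[OF v f(2,1)] Df_eq[OF v g(2,1)]
      by (simp add: bformD(2)[OF B] bform_right(1)[OF B] square_integrable_add)
  qed
  also have "\<dots> = (LINT \<omega>|omega_measure. B (Ef \<rho> \<omega> f (l - 1)) (Ef \<rho> \<omega> g (l - 1))) - (LINT \<omega>|omega_measure. B (Ef \<rho> \<omega> f l) (Ef \<rho> \<omega> g l))"
    by (rule Bochner_Integration.integral_diff) (intro integrable_form_Ef f g)+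
  finally show "(LINT \<omega>|omega_measure. lev \<rho> \<omega> f g l)
      = (LINT \<omega>|omega_measure. B (Ef \<rho> \<omega> f (l - 1)) (Ef \<rho> \<omega> g (l - 1))) - (LINT \<omega>|omega_measure. B (Ef \<rho> \<omega> f l) (Ef \<rho> \<omega> g l))" .
qed

text \<open>Summed over scales first, the array \<Psi> gives the series of shifts; summed over
  complexities first, it gives the level sums, whose expectations telescope.\<close>

lemma form_representation:
  fixes Sh :: "'n digits \<Rightarrow> nat \<Rightarrow> nat \<Rightarrow> 'n oper"
  assumes f: "square_integrable f" "fsupp \<rho> f" "continuous_on UNIV f"
    and g: "square_integrable g" "fsupp \<rho> g" "continuous_on UNIV g" and \<rho>: "\<rho> \<ge> 0"
    and Sh: "\<And>\<omega> m n. valid \<omega> \<Longrightarrow>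
      ((\<lambda>(k, i, j). ww m n * ttm \<omega> m n f g k i j) has_sum pairing (Sh \<omega> m n f) g) (tri \<omega> m n)"
  shows "\<omega> \<in> space omega_measure \<Longrightarrow> shift_series_term \<alpha> (Sh \<omega>) f g summable_on UNIV"
    and "integrable omega_measure (\<lambda>\<omega>. \<Sum>\<^sub>\<infinity>mn. shift_series_term \<alpha> (Sh \<omega>) f g mn)"
    and "sc * B f g = shift_average \<alpha> Sh f g"
proof -
  define X where "X l \<omega> = lev \<rho> \<omega> f g l" for l \<omega>
  define e where "e l = sc * (LINT \<omega>|omega_measure. B (Ef \<rho> \<omega> f l) (Ef \<rho> \<omega> g l))" for l
  \<comment> \<open>Scales are counted by the generation \<open>l\<close> of the finer cubes and not
    by that of their common ancestor, since the telescoping takes place in \<open>l\<close>.\<close>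
  define \<Psi> where "\<Psi> \<omega> l = (\<lambda>(m, n). sc * fsm \<rho> \<omega> m n (ttm \<omega> m n f g) (l + int (max m n)))" for \<omega> l
  define M where "M = (\<lambda>p. (sc * HH * L2_norm f * L2_norm g) * (\<lambda>(m, n). lam ^ max m n) p)"
  have M: "M summable_on (UNIV :: (nat \<times> nat) set)"
    unfolding M_def by (rule summable_on_cmult_right[OF lam_max_summable])
  have shifted: "bij_betw (\<lambda>l. l + int q) UNIV UNIV" for q
    by (rule bij_betwI[where g = "\<lambda>l. l - int q"]) auto
  have bd: "(\<Sum>l\<in>F. cmod (\<Psi> \<omega> l p)) \<le> M p" if v: "valid \<omega>" and F: "finite F" for \<omega> F p
  proof (cases p)
    case (Pair m n)
    have "(\<Sum>l\<in>F. cmod (\<Psi> \<omega> l p)) = sc * (\<Sum>k\<in>(\<lambda>l. l + int (max m n)) ` F. cmod (fsm \<rho> \<omega> m n (ttm \<omega> m n f g) k))"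
      using sc(1) by (subst sum.reindex) (auto simp: inj_on_def Pair \<Psi>_def norm_mult sum_distrib_left)
    also have "\<dots> \<le> sc * (HH * lam ^ max m n * L2_norm f * L2_norm g)"
      using sc(1) F by (intro mult_left_mono fsm_abs_bound ttm_abs_bound v f(1) g(1)) auto
    finally show ?thesis by (simp add: M_def Pair mult_ac)
  qed
  have X: "(\<Psi> \<omega> l has_sum sc * X l \<omega>) UNIV" if v: "valid \<omega>" for \<omega> l
    using has_sum_cmult_right[OF ttm_level_sum[OF v f(1,2) g(1,2), of l], of "complex_of_real sc"]
    by (simp add: \<Psi>_def X_def case_prod_unfold)
  have Y: "((\<lambda>l. \<Psi> \<omega> l p) has_sum shift_series_term \<alpha> (Sh \<omega>) f g p) UNIV" if v: "valid \<omega>" for \<omega> p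
  proof (cases p)
    case (Pair m n)
    define z where "z = 2 powr (- (real (m + n) * \<alpha> / 2))"
    have "(fsm \<rho> \<omega> m n (\<lambda>k i j. ww m n * ttm \<omega> m n f g k i j) has_sum pairing (Sh \<omega> m n f) g) UNIV"
      by (rule fsm_has_sum[OF Sh[OF v]]) (simp add: ttm_out[OF v f(2) g(2)])
    moreover have "fsm \<rho> \<omega> m n (\<lambda>k i j. ww m n * ttm \<omega> m n f g k i j) = (\<lambda>k. ww m n * fsm \<rho> \<omega> m n (ttm \<omega> m n f g) k)"
      unfolding fsm_def sum_distrib_left by (intro ext sum.cong refl) simp
    ultimately have "((\<lambda>k. ww m n * fsm \<rho> \<omega> m n (ttm \<omega> m n f g) k) has_sum pairing (Sh \<omega> m n f) g) UNIV"
      by simp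
    hence "((\<lambda>l. ww m n * fsm \<rho> \<omega> m n (ttm \<omega> m n f g) (l + int (max m n))) has_sum pairing (Sh \<omega> m n f) g) UNIV"
      by (subst has_sum_reindex_bij_betw[OF shifted])
    from has_sum_cmult_right[OF this, of "complex_of_real z"]
    have "((\<lambda>l. (z * ww m n) * fsm \<rho> \<omega> m n (ttm \<omega> m n f g) (l + int (max m n))) has_sum z * pairing (Sh \<omega> m n f) g) UNIV"
      by (simp add: mult.assoc)
    moreover have "z * ww m n = sc" by (simp add: z_def ww_def powr_minus)
    ultimately show ?thesis by (simp only: Pair \<Psi>_def shift_series_term_def z_def prod.case)
  qed
  have D: "shift_series_term \<alpha> (Sh \<omega>) f g summable_on UNIV"
     "((\<lambda>l. sc * X l \<omega>) has_sum infsum (shift_series_term \<alpha> (Sh \<omega>) f g) UNIV) UNIV"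
     "finite F \<Longrightarrow> (\<Sum>l\<in>F. cmod (sc * X l \<omega>)) \<le> infsum M UNIV" if "\<omega> \<in> space omega_measure" for \<omega> F
  proof -
    have v: "valid \<omega>" using that by (simp add: space_omega)
    note D = double_has_sum[OF bd[OF v] M X[OF v] Y[OF v]]
    show "shift_series_term \<alpha> (Sh \<omega>) f g summable_on UNIV"
     "((\<lambda>l. sc * X l \<omega>) has_sum infsum (shift_series_term \<alpha> (Sh \<omega>) f g) UNIV) UNIV"
     "finite F \<Longrightarrow> (\<Sum>l\<in>F. cmod (sc * X l \<omega>)) \<le> infsum M UNIV" by (rule D; assumption)+
  qed
  show "shift_series_term \<alpha> (Sh \<omega>) f g summable_on UNIV" if "\<omega> \<in> space omega_measure" for \<omega>
    by (rule D(1)[OF that])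
  have inf: "(\<Sum>\<^sub>\<infinity>l. sc * X l \<omega>) = (\<Sum>\<^sub>\<infinity>mn. shift_series_term \<alpha> (Sh \<omega>) f g mn)" if "\<omega> \<in> space omega_measure" for \<omega>
    by (rule infsumI[OF D(2)[OF that]])
  have iX: "integrable omega_measure (X l)" for l
    unfolding X_def by (rule expect_level(1)[OF f(1,2) g(1,2)])
  have mX: "(\<lambda>\<omega>. sc * X l \<omega>) \<in> borel_measurable omega_measure" for l
    using borel_measurable_integrable[OF iX[of l]] by measurable
  have bX: "(\<Sum>l\<in>F. cmod (sc * X l \<omega>)) \<le> infsum M UNIV" if "\<omega> \<in> space omega_measure" "finite F" for \<omega> F
    by (rule D(3)[OF that])
  note E = expect_infsum[OF prob_omega mX bX]
  show "integrable omega_measure (\<lambda>\<omega>. \<Sum>\<^sub>\<infinity>mn. shift_series_term \<alpha> (Sh \<omega>) f g mn)"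
    by (rule Bochner_Integration.integrable_cong[THEN iffD1, OF refl inf E(1)])
  have "(LINT \<omega>|omega_measure. sc * X l \<omega>) = e (l - 1) - e l" for l
    unfolding X_def e_def by (simp add: expect_level(2)[OF f(1,2) g(1,2)] right_diff_distrib)
  with E(2) have "((\<lambda>l. e (l - 1) - e l) has_sum (LINT \<omega>|omega_measure. (\<Sum>\<^sub>\<infinity>l. sc * X l \<omega>))) UNIV" by simp
  moreover have "(\<lambda>n. e (- int n) - e (int n)) \<longlonglongrightarrow> sc * B f g"
    unfolding e_def right_diff_distrib[symmetric]
    by (intro tendsto_mult_left expect_limits f g \<rho> integrable_form_Ef)
  ultimately have "(LINT \<omega>|omega_measure. (\<Sum>\<^sub>\<infinity>l. sc * X l \<omega>)) = sc * B f g"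
    by (rule has_sum_telescope)
  moreover have "(LINT \<omega>|omega_measure. (\<Sum>\<^sub>\<infinity>l. sc * X l \<omega>)) = shift_average \<alpha> Sh f g"
    by (rule Bochner_Integration.integral_cong[OF refl inf])
  ultimately show "sc * B f g = shift_average \<alpha> Sh f g" by simp
qed

text \<open>The shifts are chosen before \<open>f\<close> and \<open>g\<close>, with their pairings
  prescribed for all square-integrable functions, so that one family serves all pairs of
  functions.\<close>

theorem form_shift_representation:
  "\<exists>Sh :: 'n digits \<Rightarrow> nat \<Rightarrow> nat \<Rightarrow> 'n oper.
     (\<forall>\<omega>\<in>space omega_measure. \<forall>m n. dyadic_shift ((m, n) \<in> {(0, 1), (1, 0)}) (shifted_lattice \<omega>) m n (Sh \<omega> m n)) \<and>
     (\<forall>f g \<rho>. square_integrable f \<longrightarrow> fsupp \<rho> f \<longrightarrow> continuous_on UNIV f \<longrightarrow>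
        square_integrable g \<longrightarrow> fsupp \<rho> g \<longrightarrow> continuous_on UNIV g \<longrightarrow> \<rho> \<ge> 0 \<longrightarrow>
        shift_series_ok \<alpha> Sh f g \<and>
        sc * B f g = shift_average \<alpha> Sh f g)"
proof -
  define P where "P \<omega> m n S \<longleftrightarrow> dyadic_shift ((m, n) \<in> {(0, 1), (1, 0)}) (shifted_lattice \<omega>) m n S \<and>
    (\<forall>f g. square_integrable f \<longrightarrow> square_integrable g \<longrightarrow>
       ((\<lambda>(k, i, j). ww m n * ttm \<omega> m n f g k i j) has_sum pairing (S f) g) (tri \<omega> m n))" for \<omega> m n S
  define Sh where "Sh \<omega> m n = (SOME S. P \<omega> m n S)" for \<omega> m n
  have Sh: "P \<omega> m n (Sh \<omega> m n)" if "valid \<omega>" for \<omega> m n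
  proof -
    have "\<exists>S. P \<omega> m n S" using shift_of_lattice[OF that, of m n] unfolding P_def .
    thus ?thesis unfolding Sh_def by (rule someI_ex)
  qed
  note R = form_representation[where Sh = Sh, OF _ _ _ _ _ _ _ Sh[unfolded P_def, THEN conjunct2, rule_format]]
  show ?thesis
  proof (rule exI[of _ Sh], intro conjI ballI allI impI)
    show "dyadic_shift ((m, n) \<in> {(0, 1), (1, 0)}) (shifted_lattice \<omega>) m n (Sh \<omega> m n)" if "\<omega> \<in> space omega_measure" for \<omega> m n
      using Sh[of \<omega> m n] that unfolding P_def by (simp add: space_omega)
  qed (rule R; assumption)+
qed

end

subsection \<open>The representation theorem\<close>

lemma test_function_properties:
  assumes "test_function (f :: ('n::finite) fn)"
  shows "continuous_on UNIV f" "square_integrable f" "\<exists>r\<ge>0. fsupp r f"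
proof -
  have t: "times_cont_diff 0 f" and c: "compact (supp f)" using assms unfolding test_function_def by blast+
  show ct: "continuous_on UNIV f" using t by simp
  obtain r where r: "\<And>x. x \<in> supp f \<Longrightarrow> norm x \<le> r" using compact_imp_bounded[OF c] unfolding bounded_iff by blast
  have sup: "x \<in> supp f" if "f x \<noteq> 0" for x unfolding supp_def by (rule subsetD[OF closure_subset]) (simp add: that)
  have fs: "fsupp (max 0 r) f" unfolding fsupp_def
  proof (intro allI impI)
    fix x c assume "f x \<noteq> 0"
    hence "norm x \<le> r" by (rule r[OF sup])
    thus "\<bar>x $ c\<bar> \<le> max 0 r" using component_le_norm_cart[of x c] by linarith
  qed
  thus "\<exists>r\<ge>0. fsupp r f" by (intro exI[of _ "max 0 r"]) simp
  have "bounded (f ` supp f)" by (rule compact_imp_bounded[OF compact_continuous_image[OF continuous_on_subset[OF ct] c]]) simp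
  then obtain M where M: "\<And>x. x \<in> supp f \<Longrightarrow> cmod (f x) \<le> M" unfolding bounded_iff by blast
  show "square_integrable f"
  proof (rule square_integrable_bounded(1)[where A = "supp f" and M = "max 0 M"])
    show "f \<in> borel_measurable borel" by (rule borel_measurable_continuous_onI[OF ct])
    show "supp f \<in> sets borel" by (rule borel_compact[OF c])
    show "emeasure lborel (supp f) < \<infinity>" by (rule emeasure_compact_finite[OF c])
    show "f x = 0" if "x \<notin> supp f" for x using sup that by blast
    show "cmod (f x) \<le> max 0 M" for x using M[of x] sup[of x] by (cases "f x = 0") auto
  qed
qed

lemma fsupp_mono: "fsupp r f \<Longrightarrow> r \<le> s \<Longrightarrow> fsupp s f"
  unfolding fsupp_def using order_trans by blast

theorem theorem4p1:
  "\<exists>C :: real \<Rightarrow> real \<Rightarrow> real \<Rightarrow> real.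
     \<forall>Ccz \<alpha>. \<forall>T :: ('n::finite) oper. cz_operator Ccz \<alpha> T \<longrightarrow>
       (\<exists>S :: (int \<Rightarrow> real^'n) \<Rightarrow> nat \<Rightarrow> nat \<Rightarrow> 'n oper.
          (\<forall>\<omega>\<in>space omega_measure. \<forall>m n.
             dyadic_shift ((m, n) \<in> {(0, 1), (1, 0)}) (shifted_lattice \<omega>) m n (S \<omega> m n)) \<and>
          (\<forall>f g. test_function f \<longrightarrow> test_function g \<longrightarrow>
             (\<forall>\<omega>\<in>space omega_measure. shift_series_term \<alpha> (S \<omega>) f g summable_on UNIV) \<and>
             integrable omega_measure (\<lambda>\<omega>. \<Sum>\<^sub>\<infinity>mn. shift_series_term \<alpha> (S \<omega>) f g mn) \<and>
             pairing (T f) g =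
               complex_of_real (C (L2_opnorm T) \<alpha> Ccz) *
               (LINT \<omega>|omega_measure. (\<Sum>\<^sub>\<infinity>mn. shift_series_term \<alpha> (S \<omega>) f g mn))))"
proof -
  \<comment> \<open>The constant \<open>sc\<close> depends on the dimension through the type, on
    \<alpha> and on the constant \<open>A\<close> of the locale, into which the operator norm and
    \<open>Ccz\<close> enter through \<open>cz_const\<close>. So the function \<open>C\<close> is
    fixed before \<open>T\<close>.\<close>
  define s where "s N \<alpha> Ccz = cz_form.sc TYPE('n) \<alpha> (cz_const TYPE('n) N \<alpha> Ccz)" for N \<alpha> Ccz
  show ?thesis
  proof (rule exI[of _ "\<lambda>N \<alpha> Ccz. 1 / s N \<alpha> Ccz"], intro allI impI)
    fix Ccz \<alpha> and T :: "'n oper"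
    assume T: "cz_operator Ccz \<alpha> T"
    interpret cz_form "\<lambda>f g. pairing (T f) g" "L2_opnorm T" \<alpha> "cz_const TYPE('n) (L2_opnorm T) \<alpha> Ccz"
      by (rule cz_operator_form[OF T])
    have s: "s (L2_opnorm T) \<alpha> Ccz > 0" unfolding s_def by (rule sc(1))
    obtain S :: "'n digits \<Rightarrow> nat \<Rightarrow> nat \<Rightarrow> 'n oper" where
      S1: "\<forall>\<omega>\<in>space omega_measure. \<forall>m n. dyadic_shift ((m, n) \<in> {(0, 1), (1, 0)}) (shifted_lattice \<omega>) m n (S \<omega> m n)"
      and S2: "\<And>f g \<rho>. square_integrable f \<Longrightarrow> fsupp \<rho> f \<Longrightarrow> continuous_on UNIV f \<Longrightarrow>
        square_integrable g \<Longrightarrow> fsupp \<rho> g \<Longrightarrow> continuous_on UNIV g \<Longrightarrow> \<rho> \<ge> 0 \<Longrightarrow>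
        shift_series_ok \<alpha> S f g \<and>
        s (L2_opnorm T) \<alpha> Ccz * pairing (T f) g = shift_average \<alpha> S f g"
      using form_shift_representation unfolding s_def by blast
    have S3: "shift_series_ok \<alpha> S f g \<and>
             pairing (T f) g = complex_of_real (1 / s (L2_opnorm T) \<alpha> Ccz) *
               shift_average \<alpha> S f g"
      if f: "test_function f" and g: "test_function g" for f g
    proof -
      note F = test_function_properties[OF f] and G = test_function_properties[OF g]
      obtain r1 r2 where r: "r1 \<ge> 0" "fsupp r1 f" "r2 \<ge> 0" "fsupp r2 g" using F(3) G(3) by blast
      have "fsupp (max r1 r2) f" "fsupp (max r1 r2) g" "max r1 r2 \<ge> 0"
        using r fsupp_mono[OF r(2), of "max r1 r2"] fsupp_mono[OF r(4), of "max r1 r2"] by auto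
      note X = S2[OF F(2) this(1) F(1) G(2) this(2) G(1) this(3)]
      show ?thesis
      proof (intro conjI)
        show "pairing (T f) g = complex_of_real (1 / s (L2_opnorm T) \<alpha> Ccz) *
               shift_average \<alpha> S f g"
          unfolding X[THEN conjunct2, symmetric] using s by simp
      qed (rule X[THEN conjunct1, THEN conjunct1] X[THEN conjunct1, THEN conjunct2])+
    qed
    show "\<exists>S. (\<forall>\<omega>\<in>space omega_measure. \<forall>m n.
             dyadic_shift ((m, n) \<in> {(0, 1), (1, 0)}) (shifted_lattice \<omega>) m n (S \<omega> m n)) \<and>
          (\<forall>f g. test_function f \<longrightarrow> test_function g \<longrightarrow>
             (\<forall>\<omega>\<in>space omega_measure. shift_series_term \<alpha> (S \<omega>) f g summable_on UNIV) \<and>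
             integrable omega_measure (\<lambda>\<omega>. \<Sum>\<^sub>\<infinity>mn. shift_series_term \<alpha> (S \<omega>) f g mn) \<and>
             pairing (T f) g = complex_of_real (1 / s (L2_opnorm T) \<alpha> Ccz) *
               shift_average \<alpha> S f g)"
      by (rule exI[of _ S], rule conjI[OF S1], intro allI impI, rule conj_assoc[THEN iffD1], rule S3)
  qed
qed

end
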